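(* Let $d\ge 2$, $\delta\in(0,1]$, $\rho_0\in(0,\infty)$, $p_0\in(2,2+d]$. Let $n\in\{1\}\cup\{2i: i=2,3,\dots\}$ and $\lambda\ge 0$. Then there are constants $\hat{\mathsf a},\hat b\in(0,1)$, depending only on $d,\delta,p_0,n$, such that the following holds. Let $a:\mathbb R^{d+1}\to\mathbb S_\delta$, $\mathsf a:\mathbb R^{d+1}\to\mathbb R^d$, $b:\mathbb R^{d+1}\to\mathbb R^d$ be of class $B^{0,\infty}$, let $f\in C_0^\infty(\mathbb R^d)$, $T>0$, and let $u(t,x)$ be the classical solution of $$\partial_t u+\tfrac12 D_i\big(a^{ij}D_ju+\mathsf a^iu\big)+b^iD_iu=0\quad\text{in }[0,T]\times\mathbb R^d$$ with boundary condition $u(T,x)=f(x)$. If $$\hat{\mathsf a}_{p_0,\rho_0}\le e^{-\lambda\rho_0}\hat{\mathsf a},\qquad \hat b_{p_0,\rho_0}\le e^{-\lambda\rho_0}\hat b,$$ then $$\int_{\mathbb R^d}|u(0,x)|^{2n}e^{-\lambda|x|}\,dx\le Ne^{\alpha T}\int_{\mathbb R^d}|f(x)|^{2n}e^{-\lambda|x|}\,dx,$$ $$\int_{[0,T]\times\mathbb R^d}u^{2n-2}|Du|^2e^{-\lambda|x|}\,dxdt\le Ne^{\lambda\rho_0+\alpha T}\int_{\mathbb R^d}|f(x)|^{2n}e^{-\lambda|x|}\,dx,$$ where $\alpha=N\rho_0^{-2}e^{\lambda\rho_0}$ and the constants called $N$ (possibly different in different places) depend only on $d,\delta,p_0,n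$.
   Context: Points of $\mathbb R^{d+1}$ are written $(t,x)$, $t\in\mathbb R$, $x\in\mathbb R^d$. $\mathbb S_\delta$ is the set of symmetric $d\times d$ matrices whose eigenvalues are in $[\delta,\delta^{-1}]$. $B^{0,\infty}$ is the set of bounded functions $f(t,x)$ on $\mathbb R^{d+1}$ that are Borel in $t$ and, for each $t$, infinitely differentiable with respect to $x$, with each derivative being a bounded function on $\mathbb R^{d+1}$ (for vector- or matrix-valued functions: componentwise). $D_iu=\partial u/\partial x^i$, $Du=(D_iu)$, $\partial_tu=\partial u/\partial t$; summation over repeated indices is understood. $B_r(x)=\{y\in\mathbb R^d:|y-x|<r\}$, $C_r(t,x)=[t,t+r^2)\times B_r(x)$, and $\mathbb C_r$ is the collection of all $C_r(t,x)$, $(t,x)\in\mathbb R^{d+1}$. With $|C|$ the Lebesgue measure of $C$, for a function $g$ ($\mathbb R^d$-valued, with Euclidean norm) and $\rho>0$, $$\hat g_{p_0,\rho}=\sup_{r\le\rho}\,r\sup_{C\in\mathbb C_r}\Big(\frac1{|C|}\int_C|g|^{p_0}\,dxdt\Big)^{1/p_0};$$ $\hat{\mathsf a}_{p_0,\rho}$ and $\hat b_{p_0,\rho}$ are these quantities for $g=\mathsf a$ and $g=b$. (The symbols $\hat{\mathsf a},\hat b$ without subscripts denote numerical constants.) Classical solution: the unique function $u$ on $[0,T]\times\mathbb R^d$ that is bounded, infinitely differentiable in $x$ with each $x$-derivative bounded on $[0,T]\times\mathbb R^d$, Lipschitz continuous in $t$, satisfies the equation for almost every $t$ (the coefficients being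 only Borel in $t$), and equals $f$ at $t=T$. Its existence is classical. *)

theory Defs
  imports "HOL-Analysis.Analysis"
begin

text \<open>
  A point $(t,x)$ of $\mathbb R^{d+1}$ is a pair of type \<open>real \<times> (real ^ 'd)\<close>, so that
  \<open>d = CARD('d)\<close> and Lebesgue measure on $\mathbb R^{d+1}$ is \<open>lborel\<close> on the product type.
\<close>

definition partial_deriv :: "'d::finite \<Rightarrow> (real ^ 'd \<Rightarrow> real) \<Rightarrow> real ^ 'd \<Rightarrow> real" where
  "partial_deriv i g x = deriv (\<lambda>s. g (x + s *\<^sub>R axis i 1)) 0"

text \<open>The iterated partial derivative along a list of coordinate indices; the empty list gives
  the function itself.\<close>

definition partial_derivs :: "'d::finite list \<Rightarrow> (real ^ 'd \<Rightarrow> real) \<Rightarrow> real ^ 'd \<Rightarrow> real" where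
  "partial_derivs is g = foldr partial_deriv is g"

definition gradient :: "(real ^ 'd::finite \<Rightarrow> real) \<Rightarrow> real ^ 'd \<Rightarrow> real ^ 'd" where
  "gradient g x = (\<chi> i. partial_deriv i g x)"

definition infinitely_differentiable :: "(real ^ 'd::finite \<Rightarrow> real) \<Rightarrow> bool" where
  "infinitely_differentiable g \<longleftrightarrow> (\<forall>is x. partial_derivs is g differentiable (at x))"

definition C0_infinity :: "(real ^ 'd::finite \<Rightarrow> real) set" where
  "C0_infinity = {f. infinitely_differentiable f \<and> compact (closure {x. f x \<noteq> 0})}"

text \<open>Smoothness in \<open>x\<close> for each time in \<open>I\<close>, each \<open>x\<close>-derivative (including the one of order
  zero) being bounded on \<open>I \<times> UNIV\<close>, i.e. uniformly in time.\<close>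

definition smooth_bounded_in_x ::
    "real set \<Rightarrow> (real \<times> (real ^ 'd::finite) \<Rightarrow> real) \<Rightarrow> bool" where
  "smooth_bounded_in_x I g \<longleftrightarrow>
     (\<forall>t\<in>I. infinitely_differentiable (\<lambda>x. g (t, x))) \<and>
     (\<forall>is. bounded ((\<lambda>(t, x). partial_derivs is (\<lambda>y. g (t, y)) x) ` (I \<times> UNIV)))"

definition B0_infinity :: "(real \<times> (real ^ 'd::finite) \<Rightarrow> real) set" where
  "B0_infinity = {g. (\<forall>x. (\<lambda>t. g (t, x)) \<in> borel_measurable borel) \<and> smooth_bounded_in_x UNIV g}"

definition B0_infinity_vec :: "(real \<times> (real ^ 'd::finite) \<Rightarrow> real ^ 'd) set" where
  "B0_infinity_vec = {g. \<forall>i. (\<lambda>z. g z $ i) \<in> B0_infinity}"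

definition B0_infinity_mat :: "(real \<times> (real ^ 'd::finite) \<Rightarrow> real ^ 'd ^ 'd) set" where
  "B0_infinity_mat = {g. \<forall>i j. (\<lambda>z. g z $ i $ j) \<in> B0_infinity}"

definition eigenvalue :: "real ^ 'd ^ 'd::finite \<Rightarrow> real \<Rightarrow> bool" where
  "eigenvalue A c \<longleftrightarrow> (\<exists>v. v \<noteq> 0 \<and> A *v v = c *\<^sub>R v)"

definition S_delta :: "real \<Rightarrow> (real ^ 'd ^ 'd::finite) set" where
  "S_delta \<delta> = {A. transpose A = A \<and> (\<forall>c. eigenvalue A c \<longrightarrow> c \<in> {\<delta>..inverse \<delta>})}"

definition parabolic_cylinder ::
    "real \<Rightarrow> real \<times> (real ^ 'd::finite) \<Rightarrow> (real \<times> (real ^ 'd)) set" where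
  "parabolic_cylinder r z = {fst z..<fst z + r\<^sup>2} \<times> ball (snd z) r"

definition parabolic_cylinders :: "real \<Rightarrow> (real \<times> (real ^ 'd::finite)) set set" where
  "parabolic_cylinders r = range (parabolic_cylinder r)"

text \<open>The quantity $\hat g_{p,\rho}$. The suprema are taken in \<open>ennreal\<close>, so that they are
  meaningful without a boundedness side condition. For \<open>g\<close> of class $B^{0,\infty}$ the integrand
  is bounded and measurable, hence integrable over each cylinder.\<close>

definition morrey_hat ::
    "real \<Rightarrow> real \<Rightarrow> (real \<times> (real ^ 'd::finite) \<Rightarrow> real ^ 'd) \<Rightarrow> ennreal" where
  "morrey_hat p \<rho> g =
     (SUP r\<in>{0<..\<rho>}. ennreal r *
        (SUP C\<in>parabolic_cylinders r.
           ennreal ((1 / measure lborel C * (LINT z:C|lborel. norm (g z) powr p)) powr (1 / p))))"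

text \<open>$\frac12 D_i(a^{ij}D_ju+\mathsf a^iu)+b^iD_iu$ at \<open>(t, x)\<close>, with \<open>c\<close> for $\mathsf a$.\<close>

definition elliptic_part ::
    "(real \<times> (real ^ 'd::finite) \<Rightarrow> real ^ 'd ^ 'd) \<Rightarrow> (real \<times> (real ^ 'd) \<Rightarrow> real ^ 'd) \<Rightarrow>
     (real \<times> (real ^ 'd) \<Rightarrow> real ^ 'd) \<Rightarrow> (real \<times> (real ^ 'd) \<Rightarrow> real) \<Rightarrow> real \<Rightarrow> real ^ 'd \<Rightarrow> real" where
  "elliptic_part a c b u t x =
     1 / 2 * (\<Sum>i\<in>UNIV. partial_deriv i
                (\<lambda>y. (\<Sum>j\<in>UNIV. a (t, y) $ i $ j * partial_deriv j (\<lambda>y'. u (t, y')) y)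
                     + c (t, y) $ i * u (t, y)) x)
     + (\<Sum>i\<in>UNIV. b (t, x) $ i * partial_deriv i (\<lambda>y. u (t, y)) x)"

text \<open>Only the values of \<open>u\<close> on \<open>{0..T} \<times> UNIV\<close> matter. The Lipschitz constant in \<open>t\<close> is
  uniform in \<open>x\<close>, and the exceptional null set of times does not depend on \<open>x\<close>. For functions with
  the stated bounds that solve the equation, this is no restriction: the right-hand side is
  bounded, and Lipschitz continuous in \<open>x\<close> uniformly in \<open>t\<close>.\<close>

definition classical_solution ::
    "(real \<times> (real ^ 'd::finite) \<Rightarrow> real ^ 'd ^ 'd) \<Rightarrow> (real \<times> (real ^ 'd) \<Rightarrow> real ^ 'd) \<Rightarrow>
     (real \<times> (real ^ 'd) \<Rightarrow> real ^ 'd) \<Rightarrow> (real ^ 'd \<Rightarrow> real) \<Rightarrow> real \<Rightarrow>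
     (real \<times> (real ^ 'd) \<Rightarrow> real) \<Rightarrow> bool" where
  "classical_solution a c b f T u \<longleftrightarrow>
     smooth_bounded_in_x {0..T} u \<and>
     (\<exists>L. \<forall>x. L-lipschitz_on {0..T} (\<lambda>t. u (t, x))) \<and>
     (AE t in lborel. t \<in> {0..T} \<longrightarrow>
        (\<forall>x. ((\<lambda>s. u (s, x)) has_real_derivative - elliptic_part a c b u t x)
               (at t within {0..T}))) \<and>
     (\<forall>x. u (T, x) = f x)"

end

theory Submission
  imports Defs
begin

text \<open>
  Write \<open>g = max \<bar>aa\<bar> \<bar>b\<bar>\<close>, \<open>V = \<bar>u\<bar> ^ n\<close>, \<open>P = \<bar>u\<bar> ^ (n - 1) \<bar>Du\<bar>\<close> and let \<open>\<zeta>\<close> be a weight with \<open>\<bar>D\<zeta>\<bar> \<le> \<mu> \<zeta>\<close>.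
  Testing the equation with \<open>u ^ (2 n - 1) \<zeta>\<close> and using the ellipticity of \<open>a\<close> bounds
  \<open>\<integral> V\<^sup>2 \<zeta>\<close> at time \<open>t\<close> and the space-time integral of \<open>P\<^sup>2 \<zeta>\<close> by \<open>\<integral> V\<^sup>2 \<zeta>\<close> at time \<open>T\<close> and by the space-time integral
  of \<open>(g\<^sup>2 + \<mu>\<^sup>2) V\<^sup>2 \<zeta>\<close> (\<open>energy_inequality\<close>). Everything depends on absorbing the drift term
  \<open>g\<^sup>2 V\<^sup>2 \<zeta>\<close>, for a \<open>g\<close> that is small only in a Morrey norm of order \<open>p > 2\<close>. If \<open>\<theta>\<close> is that Morrey norm on
  scales up to \<open>\<rho>\<close>, the absorption is the trace inequality (\<open>trace_estimate\<close>)

    \<open>\<integral>\<integral> g\<^sup>2 V\<^sup>2 \<zeta> \<le> C \<theta>\<^sup>2 (\<integral>\<integral> P\<^sup>2 \<zeta> + \<integral>\<integral> g\<^sup>2 V\<^sup>2 \<zeta> + \<integral> V(T)\<^sup>2 \<zeta> + 1 / \<rho>\<^sup>2 \<integral>\<integral> V\<^sup>2 \<zeta>)\<close>.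

  A spatial gradient alone does not control a function of \<open>(t, x)\<close>, so the equation is used a
  second time. Up to drift terms, \<open>u ^ n\<close> is a subsolution of a backward equation without lower order
  terms if \<open>n\<close> is even, and for \<open>n = 1\<close> both \<open>u\<close> and \<open>- u\<close> are. Hence smooth averages of \<open>u ^ n\<close> over balls
  of radius \<open>r k = \<rho> / 2 ^ k\<close>, taken at time \<open>t + \<vartheta> (r k)\<^sup>2\<close>, telescope from the value at \<open>(t, x)\<close> up to
  a scale comparable to \<open>\<rho>\<close>, or up to the final time \<open>T\<close> if that comes first. The errors are averages of \<open>P + g V\<close> and of
  \<open>g P\<close> over parabolic cylinders, so that \<open>V\<close> is at most a dyadic parabolic Riesz potential of order one
  of \<open>P + g V\<close>, plus one of order two of \<open>g P\<close>, plus an average of \<open>V(T)\<close>, plus an average of \<open>V\<close> at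
  that scale (\<open>representation\<close>).

  It remains to bound these operators from \<open>L\<^sup>2\<close> to \<open>L\<^sup>2(g\<^sup>2)\<close>, and one positive function serves all of
  them in Schur's test: \<open>\<Phi> = W powr (1 - 2 / p)\<close>, where \<open>W\<close> is a potential of \<open>g ^ p\<close>. Hoelder's
  inequality on each dyadic scale shows that \<open>\<Phi>\<close> is a supersolution: the second order potential of
  \<open>g\<^sup>2 \<Phi>\<close> is at most \<open>C \<Phi>\<close> (\<open>potential2_supersolution\<close>). The first order potential reduces to this because
  its square is dominated by the second order one, and the final value term because \<open>\<Phi>\<close> averaged over a time
  slice at distance \<open>(r k)\<^sup>2\<close> is still at most \<open>C \<Phi>\<close> (\<open>slice_\<Phi>\<close>).

  For small \<open>\<theta>\<close> the drift term is absorbed and Gronwall's lemma gives both estimates with rate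
  proportional to \<open>1 / \<rho>\<^sup>2\<close>. The weights must be comparable on balls of radius \<open>\<rho>\<close>, which asks for
  \<open>\<mu> \<rho> \<le> 1\<close>; with \<open>\<mu>\<close> near \<open>lam\<close> the choice \<open>\<rho> = \<rho>\<^sub>0 / (1 + lam \<rho>\<^sub>0)\<close> costs a factor
  \<open>(1 + lam \<rho>\<^sub>0)\<^sup>2 \<le> 4 exp (lam \<rho>\<^sub>0)\<close> in the rate. Finally \<open>exp (- lam \<bar>x\<bar>)\<close> is
  a limit of smooth strictly faster decaying weights, and Fatou's lemma passes the estimates on.
\<close>

section \<open>A weighted Schur test\<close>

text \<open>The conventions \<open>h / 0 = \<infinity>\<close> for \<open>h > 0\<close> and \<open>x / \<infinity> = 0\<close> keep Young's inequality true for extended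
  values, and so the weight \<open>q\<close> of \<open>schur_test\<close> may take any of them.\<close>

lemma ennreal_young:
  fixes h q :: ennreal and \<tau> :: real
  assumes "\<tau> > 0"
  shows "2 * h \<le> ennreal \<tau> * q + (h\<^sup>2 / q) / ennreal \<tau>"
proof (cases q)
  case (real q')
  show ?thesis
  proof (cases h)
    case h: (real h')
    show ?thesis
    proof (cases "q' = 0")
      case True
      then show ?thesis using real h assms
        by (cases "h' = 0") (auto simp: ennreal_divide_zero ennreal_top_divide zero_ennreal_def[symmetric] ennreal_zero_divide)
    next
      case False
      then have q': "q' > 0" using real by simp
      have "0 \<le> (\<tau> * q' - h')\<^sup>2" by simp
      then have "2 * h' * (\<tau> * q') \<le> (\<tau> * q')\<^sup>2 + h'\<^sup>2"
        by (simp add: power2_eq_square algebra_simps)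
      then have "2 * h' \<le> \<tau> * q' + h'\<^sup>2 / q' / \<tau>"
        using q' assms by (simp add: field_simps power2_eq_square)
      then have "ennreal (2 * h') \<le> ennreal (\<tau> * q' + h'\<^sup>2 / q' / \<tau>)"
        by (rule ennreal_leI)
      also have "\<dots> = ennreal \<tau> * q + (h\<^sup>2 / q) / ennreal \<tau>"
        using real h q' assms by (simp add: ennreal_mult ennreal_plus divide_ennreal ennreal_power)
      also have "ennreal (2 * h') = 2 * h" using h by (simp add: ennreal_mult)
      finally show ?thesis .
    qed
  next
    case top
    then show ?thesis using real assms
      by (cases "q' = 0") (auto simp: power2_eq_square ennreal_top_mult ennreal_mult_top ennreal_top_divide divide_ennreal_def ennreal_inverse_positive)
  qed
next
  case top
  then show ?thesis using assms by (simp add: ennreal_mult_top)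
qed

text \<open>Optimising over \<open>\<tau>\<close> recovers the Cauchy-Schwarz inequality from a family of Young inequalities. In the
  Schur test \<open>a\<close> is a finite bound while \<open>b\<close> may be infinite or zero, and this form avoids square
  roots of extended reals.\<close>

lemma ennreal_CS_from_young:
  fixes y b :: ennreal and a :: real
  assumes a: "a > 0" and Y: "\<And>\<tau>::real. \<tau> > 0 \<Longrightarrow> 2 * y \<le> ennreal (\<tau> * a) + b / ennreal \<tau>"
  shows "y\<^sup>2 \<le> ennreal a * b"
proof (cases b)
  case top
  then show ?thesis using a by (simp add: ennreal_mult_top)
next
  case b: (real B)
  have "2 * y \<le> ennreal (1 * a) + b / ennreal 1" by (rule Y) simp
  also have "\<dots> < top" using b by (simp add: divide_ennreal[of B 1, simplified])
  finally have "y \<noteq> top" by (auto simp: ennreal_mult_top)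
  then obtain y' where y: "y = ennreal y'" "y' \<ge> 0" by (cases y) auto
  have Y': "2 * y' \<le> \<tau> * a + B / \<tau>" if "\<tau> > 0" for \<tau>
  proof -
    have "ennreal (2 * y') \<le> ennreal (\<tau> * a + B / \<tau>)"
      using Y[OF that] b y that a by (simp add: ennreal_mult divide_ennreal ennreal_plus)
    then show ?thesis using that a b by (subst (asm) ennreal_le_iff) auto
  qed
  have "y'\<^sup>2 \<le> a * B"
  proof (cases "B = 0")
    case True
    have "y' \<le> 0"
    proof (rule ccontr)
      assume "\<not> y' \<le> 0"
      then show False using Y'[of "y' / a"] True a by (simp add: field_simps)
    qed
    then show ?thesis using y True by simp
  next
    case False
    then have B: "B > 0" using b by simp
    define \<tau> where "\<tau> = sqrt (B / a)"
    have \<tau>: "\<tau> > 0" using B a by (simp add: \<tau>_def)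
    have "\<tau>\<^sup>2 = B / a" using B a by (simp add: \<tau>_def)
    then have "B = \<tau>\<^sup>2 * a" using a by (simp add: field_simps)
    then have "y' \<le> \<tau> * a" using Y'[OF \<tau>] \<tau> by (simp add: power2_eq_square)
    then have "y'\<^sup>2 \<le> (\<tau> * a)\<^sup>2" using y by (intro power_mono) auto
    also have "\<dots> = a * B" using \<open>B = \<tau>\<^sup>2 * a\<close> by (simp add: power2_eq_square)
    finally show ?thesis .
  qed
  then have "ennreal (y'\<^sup>2) \<le> ennreal (a * B)" by (rule ennreal_leI)
  then show ?thesis using y b a by (simp add: ennreal_mult ennreal_power)
qed

lemma pair_borel: "f \<in> borel_measurable (borel \<Otimes>\<^sub>M borel) \<longleftrightarrow> f \<in> borel_measurable borel"
  for f :: "'a::second_countable_topology \<times> 'b::second_countable_topology \<Rightarrow> 'c::topological_space"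
  by (simp add: borel_prod)

lemma nn_integral_swap:
  fixes K :: "'x::euclidean_space \<Rightarrow> 'y::euclidean_space \<Rightarrow> ennreal"
  assumes "case_prod K \<in> borel_measurable borel"
  shows "(\<integral>\<^sup>+x. (\<integral>\<^sup>+y. K x y \<partial>lborel) \<partial>lborel) = (\<integral>\<^sup>+y. (\<integral>\<^sup>+x. K x y \<partial>lborel) \<partial>lborel)"
proof -
  have "case_prod K \<in> borel_measurable (lborel \<Otimes>\<^sub>M lborel)" using assms by (simp add: lborel_prod)
  then show ?thesis using lborel_pair.Fubini'[of K] by simp
qed

text \<open>Cauchy-Schwarz against the auxiliary weight \<open>q\<close> turns \<open>(\<integral> K h)\<^sup>2\<close> into \<open>C \<Phi> \<integral> K h\<^sup>2 / q\<close> by the first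
  integral condition; exchanging the integrals and using the second one removes \<open>q\<close> again. The weight \<open>q\<close>
  is left free because the potentials below need different ones for the same \<open>\<Phi>\<close>.\<close>

lemma schur_test:
  fixes K :: "'x::euclidean_space \<Rightarrow> 'y::euclidean_space \<Rightarrow> ennreal" and \<Phi> :: "'x \<Rightarrow> real"
  assumes K: "case_prod K \<in> borel_measurable borel"
    and G[measurable]: "G \<in> borel_measurable borel" and h[measurable]: "h \<in> borel_measurable borel"
    and q[measurable]: "q \<in> borel_measurable borel" and \<Phi>[measurable]: "\<Phi> \<in> borel_measurable borel"
    and pos: "\<And>x. \<Phi> x > 0" and C: "C > 0" and C': "C' \<ge> 0"
    and 1: "\<And>x. (\<integral>\<^sup>+y. K x y * q y \<partial>lborel) \<le> ennreal (C * \<Phi> x)"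
    and 2: "\<And>y. (\<integral>\<^sup>+x. G x * ennreal (\<Phi> x) * K x y \<partial>lborel) \<le> ennreal C' * q y"
  shows "(\<integral>\<^sup>+x. G x * (\<integral>\<^sup>+y. K x y * h y \<partial>lborel)\<^sup>2 \<partial>lborel) \<le> ennreal (C * C') * (\<integral>\<^sup>+y. (h y)\<^sup>2 \<partial>lborel)"
proof -
  have [measurable]: "case_prod K \<in> borel_measurable (borel \<Otimes>\<^sub>M borel)"
    using K by (simp add: pair_borel)
  have [measurable]: "\<And>x. K x \<in> borel_measurable borel" by measurable
  define X where "X x = (\<integral>\<^sup>+y. K x y * ((h y)\<^sup>2 / q y) \<partial>lborel)" for x
  have pt: "(\<integral>\<^sup>+y. K x y * h y \<partial>lborel)\<^sup>2 \<le> ennreal (C * \<Phi> x) * X x" for x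
  proof (rule ennreal_CS_from_young)
    show "0 < C * \<Phi> x" using pos C by simp
    fix \<tau> :: real assume \<tau>: "\<tau> > 0"
    have "2 * (\<integral>\<^sup>+y. K x y * h y \<partial>lborel) = (\<integral>\<^sup>+y. K x y * (2 * h y) \<partial>lborel)"
      by (subst nn_integral_cmult[symmetric]) (auto intro!: nn_integral_cong simp: mult_ac)
    also have "\<dots> \<le> (\<integral>\<^sup>+y. K x y * (ennreal \<tau> * q y + ((h y)\<^sup>2 / q y) / ennreal \<tau>) \<partial>lborel)"
      by (intro nn_integral_mono mult_left_mono ennreal_young \<tau>) auto
    also have "\<dots> = (\<integral>\<^sup>+y. ennreal \<tau> * (K x y * q y) + inverse (ennreal \<tau>) * (K x y * ((h y)\<^sup>2 / q y)) \<partial>lborel)"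
      by (intro nn_integral_cong) (simp add: distrib_left divide_ennreal_def mult_ac)
    also have "\<dots> = ennreal \<tau> * (\<integral>\<^sup>+y. K x y * q y \<partial>lborel) + X x / ennreal \<tau>"
      unfolding X_def by (subst nn_integral_add) (auto simp: nn_integral_cmult divide_ennreal_def mult_ac)
    also have "\<dots> \<le> ennreal \<tau> * ennreal (C * \<Phi> x) + X x / ennreal \<tau>"
      by (intro add_right_mono mult_left_mono 1) auto
    finally show "2 * (\<integral>\<^sup>+y. K x y * h y \<partial>lborel) \<le> ennreal (\<tau> * (C * \<Phi> x)) + X x / ennreal \<tau>"
      using \<tau> pos[of x] C by (simp add: ennreal_mult less_imp_le)
  qed
  have "(\<integral>\<^sup>+x. G x * (\<integral>\<^sup>+y. K x y * h y \<partial>lborel)\<^sup>2 \<partial>lborel)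
      \<le> (\<integral>\<^sup>+x. G x * (ennreal (C * \<Phi> x) * X x) \<partial>lborel)"
    by (intro nn_integral_mono mult_left_mono pt) auto
  also have "\<dots> = ennreal C * (\<integral>\<^sup>+x. (\<integral>\<^sup>+y. G x * ennreal (\<Phi> x) * K x y * ((h y)\<^sup>2 / q y) \<partial>lborel) \<partial>lborel)"
    unfolding X_def using C pos
    by (subst nn_integral_cmult[symmetric])
       (auto intro!: nn_integral_cong simp: ennreal_mult less_imp_le mult_ac nn_integral_cmult[symmetric])
  also have "(\<integral>\<^sup>+x. (\<integral>\<^sup>+y. G x * ennreal (\<Phi> x) * K x y * ((h y)\<^sup>2 / q y) \<partial>lborel) \<partial>lborel)
     = (\<integral>\<^sup>+y. (\<integral>\<^sup>+x. G x * ennreal (\<Phi> x) * K x y * ((h y)\<^sup>2 / q y) \<partial>lborel) \<partial>lborel)"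
    by (rule nn_integral_swap) (simp add: pair_borel[symmetric])
  also have "\<dots> = (\<integral>\<^sup>+y. (\<integral>\<^sup>+x. G x * ennreal (\<Phi> x) * K x y \<partial>lborel) * ((h y)\<^sup>2 / q y) \<partial>lborel)"
    by (intro nn_integral_cong nn_integral_multc) auto
  also have "\<dots> \<le> (\<integral>\<^sup>+y. ennreal C' * (h y)\<^sup>2 \<partial>lborel)"
  proof (intro nn_integral_mono)
    fix y
    have "(\<integral>\<^sup>+x. G x * ennreal (\<Phi> x) * K x y \<partial>lborel) * ((h y)\<^sup>2 / q y) \<le> (ennreal C' * q y) * ((h y)\<^sup>2 / q y)"
      by (intro mult_right_mono 2) auto
    also have "\<dots> \<le> ennreal C' * (h y)\<^sup>2"
    proof -
      have "q y * ((h y)\<^sup>2 / q y) \<le> (h y)\<^sup>2"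
      proof (cases "q y = 0 \<or> q y = top")
        case False
        then show ?thesis by (metis ennreal_mult_divide_eq ennreal_times_divide mult.commute order_refl)
      qed (auto simp: divide_ennreal_def)
      then show ?thesis by (metis mult.assoc mult_left_mono zero_le)
    qed
    finally show "(\<integral>\<^sup>+x. G x * ennreal (\<Phi> x) * K x y \<partial>lborel) * ((h y)\<^sup>2 / q y) \<le> ennreal C' * (h y)\<^sup>2" .
  qed
  also have "\<dots> = ennreal C' * (\<integral>\<^sup>+y. (h y)\<^sup>2 \<partial>lborel)" by (rule nn_integral_cmult) auto
  finally show ?thesis using C C' by (simp add: ennreal_mult mult_left_mono mult.assoc)
qed

section \<open>Averages over parabolic cylinders\<close>

text \<open>Cylinders symmetric in time make the averaging kernels symmetric, which the Schur test uses on
  both sides.\<close>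

definition cyl :: "real \<Rightarrow> real \<times> 'a::euclidean_space \<Rightarrow> (real \<times> 'a) set" where
  "cyl r z = {fst z - r\<^sup>2 <..< fst z + r\<^sup>2} \<times> ball (snd z) r"

lemma cyl_iff: "w \<in> cyl r z \<longleftrightarrow> \<bar>fst w - fst z\<bar> < r\<^sup>2 \<and> norm (snd w - snd z) < r"
  by (cases w) (auto simp: cyl_def dist_norm norm_minus_commute abs_less_iff)

lemma cyl_sym: "w \<in> cyl r z \<longleftrightarrow> z \<in> cyl r w"
  by (simp add: cyl_iff abs_minus_commute norm_minus_commute)

lemma open_cyl: "open (cyl r z)"
  unfolding cyl_def by (intro open_Times) auto

text \<open>The kernels are normalised by \<open>r ^ (d + 2)\<close> rather than by the measure of the cylinder; averages are
  thus off by the factor \<open>2 vol\<close>.\<close>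

definition kcyl :: "real \<Rightarrow> real \<times> 'a::euclidean_space \<Rightarrow> real \<times> 'a \<Rightarrow> ennreal" where
  "kcyl r z w = ennreal (1 / r ^ (DIM('a) + 2)) * indicator (cyl r z) w"

lemma kcyl_sym: "kcyl r z w = kcyl r w z"
  by (simp add: kcyl_def indicator_def cyl_sym[of w])

lemma kcyl_measurable': "case_prod (kcyl r) \<in> borel_measurable borel"
proof -
  have "open {x :: (real \<times> 'a) \<times> (real \<times> 'a). snd x \<in> cyl r (fst x)}"
    unfolding cyl_iff by (intro open_Collect_conj open_Collect_less continuous_intros)
  then have "{x :: (real \<times> 'a) \<times> (real \<times> 'a). snd x \<in> cyl r (fst x)} \<in> sets borel" by auto
  moreover have "case_prod (kcyl r) = (\<lambda>x :: (real \<times> 'a) \<times> (real \<times> 'a). ennreal (1 / r ^ (DIM('a) + 2)) * indicator {x. snd x \<in> cyl r (fst x)} x)"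
    by (auto simp: kcyl_def indicator_def fun_eq_iff)
  ultimately show ?thesis by simp
qed

lemma kcyl_measurable[measurable]:
  assumes "f \<in> M \<rightarrow>\<^sub>M borel" "g \<in> M \<rightarrow>\<^sub>M borel"
  shows "(\<lambda>x. kcyl r (f x) (g x)) \<in> borel_measurable M"
proof -
  have "(\<lambda>x. (f x, g x)) \<in> M \<rightarrow>\<^sub>M borel \<Otimes>\<^sub>M borel" using assms by measurable
  then have "(\<lambda>x. (f x, g x)) \<in> M \<rightarrow>\<^sub>M borel" by (simp add: borel_prod)
  from measurable_compose[OF this kcyl_measurable'[of r]] show ?thesis by simp
qed

abbreviation vol :: "'a::euclidean_space itself \<Rightarrow> real" where
  "vol _ \<equiv> unit_ball_vol (real DIM('a))"

lemma emeasure_cyl: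
  fixes z :: "real \<times> 'a::euclidean_space"
  assumes "r \<ge> 0"
  shows "emeasure lborel (cyl r z) = ennreal (2 * vol TYPE('a) * r ^ (DIM('a) + 2))"
proof -
  have "emeasure lborel (cyl r z) = emeasure (lborel \<Otimes>\<^sub>M lborel) ({fst z - r\<^sup>2 <..< fst z + r\<^sup>2} \<times> ball (snd z) r)"
    by (simp add: cyl_def lborel_prod)
  also have "\<dots> = emeasure lborel {fst z - r\<^sup>2 <..< fst z + r\<^sup>2} * emeasure lborel (ball (snd z) r)"
    by (rule lborel.emeasure_pair_measure_Times) auto
  also have "\<dots> = ennreal (2 * r\<^sup>2) * ennreal (vol TYPE('a) * r ^ DIM('a))"
    using assms by (simp add: emeasure_ball)
  also have "\<dots> = ennreal (2 * vol TYPE('a) * r ^ (DIM('a) + 2))"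
    using assms by (simp add: ennreal_mult[symmetric] power_add power2_eq_square mult_ac)
  finally show ?thesis .
qed

lemma integral_kcyl:
  fixes z :: "real \<times> 'a::euclidean_space"
  assumes "r > 0"
  shows "(\<integral>\<^sup>+w. kcyl r z w \<partial>lborel) = ennreal (2 * vol TYPE('a))"
proof -
  have "(\<integral>\<^sup>+w. kcyl r z w \<partial>lborel) = ennreal (1 / r ^ (DIM('a) + 2)) * emeasure lborel (cyl r z)"
    unfolding kcyl_def by (subst nn_integral_cmult_indicator) (auto simp: open_cyl)
  also have "\<dots> = ennreal (1 / r ^ (DIM('a) + 2) * (2 * vol TYPE('a) * r ^ (DIM('a) + 2)))"
    using assms by (simp only: emeasure_cyl less_imp_le) (subst ennreal_mult[symmetric], auto)
  also have "\<dots> = ennreal (2 * vol TYPE('a))" using assms by simp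
  finally show ?thesis .
qed

definition dconst :: "'a::euclidean_space itself \<Rightarrow> real" where
  "dconst _ = 2 ^ (DIM('a) + 3) * vol TYPE('a)"

lemma dconst_pos: "dconst TYPE('a::euclidean_space) > 0"
  by (simp add: dconst_def)

text \<open>A cylinder of radius \<open>s \<le> r\<close> centred in one of radius \<open>r\<close> lies within the double of the latter, and its
  kernel integrates to \<open>2 vol\<close>.\<close>

lemma kcyl_compose:
  fixes z y :: "real \<times> 'a::euclidean_space"
  assumes "0 < s" "s \<le> r"
  shows "(\<integral>\<^sup>+w. kcyl r z w * kcyl s w y \<partial>lborel) \<le> ennreal (dconst TYPE('a)) * kcyl (2 * r) z y"
proof (cases "y \<in> cyl (2 * r) z")
  case True
  have r: "r > 0" using assms by simp
  have "(\<integral>\<^sup>+w. kcyl r z w * kcyl s w y \<partial>lborel) \<le> (\<integral>\<^sup>+w. ennreal (1 / r ^ (DIM('a) + 2)) * kcyl s y w \<partial>lborel)"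
    by (intro nn_integral_mono mult_mono) (auto simp: kcyl_def indicator_def cyl_sym[of y])
  also have "\<dots> = ennreal (1 / r ^ (DIM('a) + 2) * (2 * vol TYPE('a)))"
    using assms r by (subst nn_integral_cmult) (auto simp: integral_kcyl ennreal_mult[symmetric])
  also have "1 / r ^ (DIM('a) + 2) * (2 * vol TYPE('a)) = dconst TYPE('a) * (1 / (2 * r) ^ (DIM('a) + 2))"
    using r by (simp add: dconst_def power_mult_distrib power_add)
  also have "ennreal \<dots> = ennreal (dconst TYPE('a)) * kcyl (2 * r) z y"
    using True r by (simp add: kcyl_def ennreal_mult[symmetric] dconst_pos less_imp_le)
  finally show ?thesis .
next
  case False
  have zero: "kcyl r z w * kcyl s w y = 0" for w
  proof (rule ccontr)
    assume "kcyl r z w * kcyl s w y \<noteq> 0"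
    then have w: "w \<in> cyl r z" "y \<in> cyl s w" by (auto simp: kcyl_def indicator_def split: if_splits)
    have "s\<^sup>2 \<le> r\<^sup>2" using assms by (intro power_mono) auto
    moreover have "norm (snd y - snd z) \<le> norm (snd y - snd w) + norm (snd w - snd z)"
      using norm_triangle_ineq[of "snd y - snd w" "snd w - snd z"] by simp
    moreover have "r\<^sup>2 > 0" using assms by simp
    moreover have "\<bar>fst y - fst z\<bar> < 4 * r\<^sup>2" if "s\<^sup>2 \<le> r\<^sup>2"
      using w that unfolding cyl_iff by arith
    ultimately have "y \<in> cyl (2 * r) z" using w assms unfolding cyl_iff power_mult_distrib
      by auto
    then show False using False by simp
  qed
  have "(\<integral>\<^sup>+w. kcyl r z w * kcyl s w y \<partial>lborel) = (\<integral>\<^sup>+w. 0 \<partial>(lborel :: (real \<times> 'a) measure))"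
    by (intro nn_integral_cong zero)
  then show ?thesis by simp
qed

definition cavg :: "real \<Rightarrow> (real \<times> 'a::euclidean_space \<Rightarrow> ennreal) \<Rightarrow> real \<times> 'a \<Rightarrow> ennreal" where
  "cavg r f z = (\<integral>\<^sup>+w. kcyl r z w * f w \<partial>lborel)"

lemma cavg_measurable[measurable]:
  assumes [measurable]: "f \<in> borel_measurable borel"
  shows "cavg r f \<in> borel_measurable borel"
  unfolding cavg_def by measurable

lemma cavg_mono: "(\<And>w. w \<in> cyl r z \<Longrightarrow> f w \<le> g w) \<Longrightarrow> cavg r f z \<le> cavg r g z"
  unfolding cavg_def kcyl_def by (intro nn_integral_mono) (auto simp: indicator_def mult_left_mono)

lemma cavg_const: "r > 0 \<Longrightarrow> cavg r (\<lambda>_. c) (z :: real \<times> 'a::euclidean_space) = ennreal (2 * vol TYPE('a)) * c"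
  unfolding cavg_def by (subst nn_integral_multc) (auto simp: integral_kcyl)

lemma cavg_cmult: "f \<in> borel_measurable borel \<Longrightarrow> cavg r (\<lambda>w. c * f w) z = c * cavg r f z"
  unfolding cavg_def by (subst nn_integral_cmult[symmetric]) (auto intro!: nn_integral_cong simp: mult_ac)

lemma cavg_add: "f \<in> borel_measurable borel \<Longrightarrow> g \<in> borel_measurable borel \<Longrightarrow> cavg r (\<lambda>w. f w + g w) z = cavg r f z + cavg r g z"
  unfolding cavg_def by (subst nn_integral_add[symmetric]) (auto intro!: nn_integral_cong simp: distrib_left)

lemma cavg_suminf: "(\<And>k. f k \<in> borel_measurable borel) \<Longrightarrow> cavg r (\<lambda>w. \<Sum>k. f k w) z = (\<Sum>k. cavg r (f k) z)"
  unfolding cavg_def by (subst nn_integral_suminf[symmetric]) (auto intro!: nn_integral_cong)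

lemma cavg_compose:
  fixes z :: "real \<times> 'a::euclidean_space"
  assumes "0 < r" "0 < s" "r \<le> R" "s \<le> R" "R = r \<or> R = s" and [measurable]: "f \<in> borel_measurable borel"
  shows "cavg r (cavg s f) z \<le> ennreal (dconst TYPE('a)) * cavg (2 * R) f z"
proof -
  have "cavg r (cavg s f) z = (\<integral>\<^sup>+w. (\<integral>\<^sup>+y. kcyl r z w * kcyl s w y * f y \<partial>lborel) \<partial>lborel)"
    unfolding cavg_def by (intro nn_integral_cong) (simp add: nn_integral_cmult[symmetric] mult.assoc)
  also have "\<dots> = (\<integral>\<^sup>+y. (\<integral>\<^sup>+w. kcyl r z w * kcyl s w y * f y \<partial>lborel) \<partial>lborel)"
    by (rule nn_integral_swap) (simp add: pair_borel[symmetric])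
  also have "\<dots> = (\<integral>\<^sup>+y. (\<integral>\<^sup>+w. kcyl r z w * kcyl s w y \<partial>lborel) * f y \<partial>lborel)"
    by (intro nn_integral_cong nn_integral_multc) auto
  also have "\<dots> \<le> (\<integral>\<^sup>+y. ennreal (dconst TYPE('a)) * kcyl (2 * R) z y * f y \<partial>lborel)"
  proof (intro nn_integral_mono mult_right_mono)
    fix y
    show "(\<integral>\<^sup>+w. kcyl r z w * kcyl s w y \<partial>lborel) \<le> ennreal (dconst TYPE('a)) * kcyl (2 * R) z y"
    proof (cases "R = r")
      case True
      then show ?thesis using kcyl_compose[of s r z y] assms by simp
    next
      case False
      then have "R = s" using assms by simp
      then have "(\<integral>\<^sup>+w. kcyl s y w * kcyl r w z \<partial>lborel) \<le> ennreal (dconst TYPE('a)) * kcyl (2 * R) y z"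
        using kcyl_compose[of r s y z] assms by simp
      then show ?thesis by (simp add: kcyl_sym[of _ y] kcyl_sym[of _ _ z] mult.commute)
    qed
  qed auto
  also have "\<dots> = ennreal (dconst TYPE('a)) * cavg (2 * R) f z"
    unfolding cavg_def by (subst nn_integral_cmult[symmetric]) (auto simp: mult.assoc)
  finally show ?thesis .
qed

section \<open>Sums over dyadic scales\<close>

lemma geometric_partial_sum_le:
  fixes q :: real
  assumes "0 \<le> q" "q < 1"
  shows "(\<Sum>k<n. q ^ k) \<le> 1 / (1 - q)"
proof -
  have "(\<Sum>k<n. q ^ k) \<le> (\<Sum>k. q ^ k)" using assms by (intro sum_le_suminf) (auto simp: summable_geometric)
  also have "\<dots> = 1 / (1 - q)" using assms by (subst suminf_geometric) auto
  finally show ?thesis .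
qed

text \<open>Only the terms with \<open>y \<eta> ^ j\<close> near 1 matter: they decay geometrically on both sides, so the bound is uniform
  in \<open>y\<close>.\<close>

lemma sum_min_inverse_geometric:
  fixes y \<eta> :: real
  assumes "0 < \<eta>" "\<eta> < 1" "y > 0"
  shows "(\<Sum>j<n. min (y * \<eta> ^ j) (1 / (y * \<eta> ^ j))) \<le> 2 / (1 - \<eta>)"
proof -
  have small: "(\<Sum>j<n. min (y * \<eta> ^ j) (1 / (y * \<eta> ^ j))) \<le> 1 / (1 - \<eta>)" if "y \<le> 1" "y > 0" for n y
  proof -
    have "(\<Sum>j<n. min (y * \<eta> ^ j) (1 / (y * \<eta> ^ j))) \<le> (\<Sum>j<n. \<eta> ^ j)"
      using that assms by (intro sum_mono) (auto intro!: min.coboundedI1 mult_left_le_one_le)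
    also have "\<dots> \<le> 1 / (1 - \<eta>)" using assms by (intro geometric_partial_sum_le) auto
    finally show ?thesis .
  qed
  define c where "c = \<eta> / (1 - \<eta>)"
  have c: "c > 0" "1 + c = 1 / (1 - \<eta>)" using assms by (auto simp: c_def field_simps)
  \<comment> \<open>The correction term is what makes the induction on the number of terms close: passing from
    y to y times eta consumes exactly 1 / y.\<close>
  have large: "(\<Sum>j<n. min (y * \<eta> ^ j) (1 / (y * \<eta> ^ j))) \<le> 2 / (1 - \<eta>) - c / y" if "y \<ge> 1" for n y
    using that
  proof (induction n arbitrary: y)
    case 0
    have "c / y \<le> c" using 0 c by (simp add: divide_le_eq)
    moreover have "c \<le> 2 / (1 - \<eta>)" unfolding c_def using assms by (intro divide_right_mono) auto
    ultimately show ?case by simp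
  next
    case (Suc n)
    have "(\<Sum>j<Suc n. min (y * \<eta> ^ j) (1 / (y * \<eta> ^ j)))
       = min y (1 / y) + (\<Sum>j<n. min ((y * \<eta>) * \<eta> ^ j) (1 / ((y * \<eta>) * \<eta> ^ j)))"
      by (subst sum.lessThan_Suc_shift) (simp add: mult.assoc)
    also have "\<dots> \<le> 1 / y + (\<Sum>j<n. min ((y * \<eta>) * \<eta> ^ j) (1 / ((y * \<eta>) * \<eta> ^ j)))" by simp
    also have "\<dots> \<le> 2 / (1 - \<eta>) - c / y"
    proof (cases "y * \<eta> \<ge> 1")
      case True
      have "1 / y - c / (y * \<eta>) = - (c / y)" using Suc.prems assms
        by (simp add: c_def field_simps)
      then show ?thesis using Suc.IH[OF True] by simp
    next
      case False
      then have "(\<Sum>j<n. min ((y * \<eta>) * \<eta> ^ j) (1 / ((y * \<eta>) * \<eta> ^ j))) \<le> 1 / (1 - \<eta>)"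
        using assms Suc.prems by (intro small) auto
      moreover have "(1 + c) / y \<le> 1 + c" using divide_left_mono[of 1 y "1 + c"] Suc.prems c(1) by simp
      moreover have "1 / y + c / y = (1 + c) / y" by (simp add: add_divide_distrib)
      moreover have "2 / (1 - \<eta>) = (1 + c) + 1 / (1 - \<eta>)" using c by simp
      ultimately show ?thesis by linarith
    qed
    finally show ?case .
  qed
  show ?thesis
  proof (cases "y \<le> 1")
    case True
    moreover have "1 / (1 - \<eta>) \<le> 2 / (1 - \<eta>)" using assms by (simp add: divide_right_mono)
    ultimately show ?thesis using small[of y n] assms by simp
  next
    case False
    have "c / y \<ge> 0" using c assms by simp
    with False show ?thesis using large[of y n] by simp
  qed
qed

lemma sum_min_powr_geometric:
  fixes x \<theta> a b :: real
  assumes "0 < \<theta>" "\<theta> < 1" "x > 0" "a > 0" "b > 0"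
  shows "(\<Sum>j<n. min ((x * \<theta> ^ j) powr a) ((x * \<theta> ^ j) powr (- b))) \<le> 2 / (1 - \<theta> powr min a b)"
proof -
  define e where "e = min a b"
  have e: "e > 0" "e \<le> a" "e \<le> b" using assms by (auto simp: e_def)
  have "min (y powr a) (y powr (-b)) \<le> min (y powr e) (1 / y powr e)" if "y > 0" for y
  proof (cases "y \<le> 1")
    case True
    have "y powr a \<le> y powr e" using True e that by (intro powr_mono') auto
    moreover have "y powr e \<le> 1" using True e that by (simp add: powr_le1)
    moreover have "1 / y powr e \<ge> 1" using \<open>y powr e \<le> 1\<close> that by simp
    ultimately show ?thesis by simp
  next
    case False
    have "y powr (-b) \<le> y powr (-e)" using False e by (intro powr_mono) auto
    moreover have "y powr e \<ge> 1" using False e by (simp add: ge_one_powr_ge_zero)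
    moreover have "1 / y powr e \<le> 1"
      by (rule order_trans[OF frac_le[of 1 1 1 "y powr e"]]) (use \<open>y powr e \<ge> 1\<close> in auto)
    ultimately show ?thesis by (simp add: powr_minus_divide)
  qed
  then have "(\<Sum>j<n. min ((x * \<theta> ^ j) powr a) ((x * \<theta> ^ j) powr (- b)))
     \<le> (\<Sum>j<n. min ((x * \<theta> ^ j) powr e) (1 / (x * \<theta> ^ j) powr e))"
    using assms by (intro sum_mono) auto
  also have "\<dots> = (\<Sum>j<n. min (x powr e * (\<theta> powr e) ^ j) (1 / (x powr e * (\<theta> powr e) ^ j)))"
  proof -
    have "(x * \<theta> ^ j) powr e = x powr e * (\<theta> powr e) ^ j" for j
      using assms by (simp add: powr_mult powr_power powr_powr powr_realpow[symmetric] mult.commute)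
    then show ?thesis by simp
  qed
  also have "\<dots> \<le> 2 / (1 - \<theta> powr e)"
  proof (rule sum_min_inverse_geometric)
    have "\<theta> powr e < \<theta> powr 0" using assms e by (intro powr_less_mono') auto
    then show "\<theta> powr e < 1" using assms by simp
  qed (use assms in auto)
  finally show ?thesis by (simp add: e_def)
qed

lemma suminf_ennreal_geometric:
  fixes q :: real
  assumes "0 \<le> q" "q < 1"
  shows "(\<Sum>k. ennreal (q ^ k)) = ennreal (1 / (1 - q))"
  using assms by (subst suminf_ennreal_eq[where x = "1 / (1 - q)"]) (auto intro: geometric_sums)

lemma suminf_ennreal_le:
  assumes "\<And>n. (\<Sum>k<n. f k) \<le> (c::ennreal)"
  shows "(\<Sum>k. f k) \<le> c"
  by (rule suminf_le_const) (auto simp: assms)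

text \<open>The exponent \<open>s = 2 + \<sigma> = p - \<sigma>\<close> is the midpoint of 2 and \<open>p\<close>. A Morrey function of order \<open>p\<close> has averages
  of \<open>g ^ p\<close> of size \<open>r powr - p\<close>; weighted by \<open>r powr s\<close>, the sum over scales larger than a given one is
  geometric since \<open>s < p\<close>, while \<open>s > 2\<close> leaves a geometric gain for the small scales even after the
  loss of a factor \<open>1 / r\<^sup>2\<close>.\<close>

locale dyadic =
  fixes \<rho> p :: real
  assumes \<rho>: "0 < \<rho>" and p: "2 < p"
begin

definition r :: "nat \<Rightarrow> real" where "r k = \<rho> / 2 ^ k"
definition s :: real where "s = (2 + p) / 2"
definition \<kappa> :: real where "\<kappa> = 1 - 2 / p"
definition \<sigma> :: real where "\<sigma> = (p - 2) / 2"
definition q :: real where "q = 2 powr (- \<sigma>)"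
definition Kq :: real where "Kq = 1 / (1 - q)"

lemma r_pos[simp]: "r k > 0" using \<rho> by (simp add: r_def)
lemma r_nonneg[simp]: "r k \<ge> 0" using r_pos[of k] by linarith
lemma r_ne[simp]: "r k \<noteq> 0" using r_pos[of k] by linarith
lemma r_0[simp]: "r 0 = \<rho>" by (simp add: r_def)
lemma r_Suc: "r (Suc k) = r k / 2" by (simp add: r_def)
lemma r_le_\<rho>: "r k \<le> \<rho>" using \<rho> by (simp add: r_def field_simps)
lemma r_antimono: "i \<le> j \<Longrightarrow> r j \<le> r i" using \<rho> by (simp add: r_def frac_le)
lemma r_double: "k \<ge> 1 \<Longrightarrow> 2 * r k = r (k - 1)" by (cases k) (auto simp: r_Suc)
lemma r_add: "r (i + k) = r i / 2 ^ k" by (simp add: r_def power_add)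

lemma \<kappa>: "0 < \<kappa>" "\<kappa> < 1" using p by (auto simp: \<kappa>_def field_simps)
lemma \<sigma>_pos: "\<sigma> > 0" using p by (simp add: \<sigma>_def)
lemma s_eq: "s = 2 + \<sigma>" "s = p - \<sigma>" by (auto simp: s_def \<sigma>_def field_simps)
lemma q: "0 < q" "q < 1"
proof -
  show "0 < q" by (simp add: q_def)
  have "q < 2 powr 0" unfolding q_def using \<sigma>_pos by (intro powr_less_mono) auto
  then show "q < 1" by simp
qed
lemma Kq: "Kq \<ge> 1" using q by (simp add: Kq_def)

lemma two_powr_\<sigma>: "((2::real) ^ k) powr (- \<sigma>) = q ^ k"
  by (simp add: q_def powr_powr powr_power powr_realpow[symmetric] mult.commute)

lemma r_powr_shift: "r (i + k) powr \<sigma> = r i powr \<sigma> * q ^ k"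
proof -
  have "r (i + k) powr \<sigma> = r i powr \<sigma> / (2 ^ k) powr \<sigma>" by (simp only: r_add powr_divide)
  then show ?thesis by (simp add: two_powr_\<sigma>[symmetric] powr_minus_divide)
qed

lemma sum_r_powr_neg: "(\<Sum>k<j. r k powr (- \<sigma>)) \<le> Kq * r j powr (- \<sigma>)"
proof -
  have "r k powr (- \<sigma>) = r j powr (- \<sigma>) * q ^ (j - k)" if "k < j" for k
  proof -
    have "r j powr \<sigma> = r k powr \<sigma> * q ^ (j - k)" using r_powr_shift[of k "j - k"] that by simp
    then show ?thesis using q by (simp add: powr_minus field_simps)
  qed
  then have "(\<Sum>k<j. r k powr (- \<sigma>)) = r j powr (- \<sigma>) * (\<Sum>k<j. q ^ (j - k))"
    by (simp add: sum_distrib_left)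
  also have "(\<Sum>k<j. q ^ (j - k)) = (\<Sum>k<j. q ^ Suc k)"
    by (rule sum.reindex_bij_witness[of _ "\<lambda>k. j - Suc k" "\<lambda>k. j - Suc k"]) (auto simp del: power_Suc simp: Suc_diff_Suc)
  also have "r j powr (- \<sigma>) * (\<Sum>k<j. q ^ Suc k) \<le> r j powr (- \<sigma>) * (\<Sum>k<j. q ^ k)"
    using q by (intro mult_left_mono sum_mono) (auto simp: mult_left_le_one_le)
  also have "\<dots> \<le> r j powr (- \<sigma>) * Kq"
    unfolding Kq_def using q by (intro mult_left_mono geometric_partial_sum_le) auto
  finally show ?thesis by (simp add: mult.commute)
qed

text \<open>A double sum over scales, cut at the scale \<open>j\<close>: for the large scales the \<open>k\<close>-th term is controlled
  by its predecessor, for the small ones by the single term of index \<open>j - 1\<close> times a geometric factor.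
  The shift by one scale absorbs the doubling of radii in \<open>kcyl_compose\<close>.\<close>

lemma split_sum:
  fixes \<alpha> \<beta> :: "nat \<Rightarrow> ennreal"
  assumes j: "j \<ge> 1"
    and le: "\<And>k. k < j \<Longrightarrow> \<beta> (Suc k) \<le> c * (ennreal (r (Suc k) powr s) * \<alpha> k)"
    and ge: "\<And>k. k \<ge> j \<Longrightarrow> \<beta> (Suc k) \<le> c * (ennreal (r (Suc k) powr \<sigma> * (r j)\<^sup>2) * \<alpha> (j - 1))"
  shows "(\<Sum>k. \<beta> (Suc k)) \<le> c * (ennreal (1 + Kq) * (\<Sum>k<j. ennreal (r k powr s) * \<alpha> k))"
proof -
  let ?E = "\<Sum>k<j. ennreal (r k powr s) * \<alpha> k"
  have s0: "s \<ge> 0" using p by (simp add: s_def)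
  have "(\<Sum>k. \<beta> (Suc k)) = (\<Sum>k. \<beta> (Suc (k + j))) + (\<Sum>k<j. \<beta> (Suc k))"
    by (rule suminf_offset) auto
  also have "(\<Sum>k<j. \<beta> (Suc k)) \<le> c * ?E"
    unfolding sum_distrib_left
  proof (intro sum_mono)
    fix k assume "k \<in> {..<j}"
    then have "\<beta> (Suc k) \<le> c * (ennreal (r (Suc k) powr s) * \<alpha> k)" using le by simp
    also have "\<dots> \<le> c * (ennreal (r k powr s) * \<alpha> k)"
      using s0 by (intro mult_left_mono mult_right_mono ennreal_leI powr_mono2 r_antimono) auto
    finally show "\<beta> (Suc k) \<le> c * (ennreal (r k powr s) * \<alpha> k)" .
  qed
  also have "(\<Sum>k. \<beta> (Suc (k + j))) \<le> (\<Sum>k. ennreal (q ^ k) * (c * ?E))"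
  proof (intro suminf_le allI)
    fix k
    have "r (Suc (k + j)) powr \<sigma> * (r j)\<^sup>2 \<le> q ^ k * r (j - 1) powr s"
    proof -
      have "r (Suc (k + j)) powr \<sigma> = r (Suc j) powr \<sigma> * q ^ k" using r_powr_shift[of "Suc j" k] by (simp add: add.commute)
      moreover have "r (Suc j) powr \<sigma> \<le> r (j - 1) powr \<sigma>" using \<sigma>_pos by (intro powr_mono2 r_antimono) auto
      moreover have "(r j)\<^sup>2 \<le> (r (j - 1))\<^sup>2" by (intro power_mono r_antimono) auto
      ultimately have "r (Suc (k + j)) powr \<sigma> * (r j)\<^sup>2 \<le> (r (j - 1) powr \<sigma> * q ^ k) * (r (j - 1))\<^sup>2"
        using q by (intro mult_mono) (auto intro!: mult_right_mono)
      also have "\<dots> = q ^ k * r (j - 1) powr s"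
        by (simp add: s_eq(1) powr_add mult_ac)
      finally show ?thesis .
    qed
    then have "ennreal (r (Suc (k + j)) powr \<sigma> * (r j)\<^sup>2) * \<alpha> (j - 1) \<le> ennreal (q ^ k * r (j - 1) powr s) * \<alpha> (j - 1)"
      by (intro mult_right_mono ennreal_leI) auto
    also have "\<dots> = ennreal (q ^ k) * (ennreal (r (j - 1) powr s) * \<alpha> (j - 1))"
      using q by (simp add: ennreal_mult mult.assoc)
    also have "\<dots> \<le> ennreal (q ^ k) * ?E"
      using j by (intro mult_left_mono member_le_sum[where f = "\<lambda>k. ennreal (r k powr s) * \<alpha> k"]) auto
    finally have "c * (ennreal (r (Suc (k + j)) powr \<sigma> * (r j)\<^sup>2) * \<alpha> (j - 1)) \<le> c * (ennreal (q ^ k) * ?E)"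
      by (intro mult_left_mono) auto
    with ge[of "k + j"] show "\<beta> (Suc (k + j)) \<le> ennreal (q ^ k) * (c * ?E)" by (simp add: mult_ac)
  qed auto
  also have "\<dots> = ennreal Kq * (c * ?E)"
    unfolding ennreal_suminf_multc Kq_def using q by (subst suminf_ennreal_geometric) auto
  finally have "(\<Sum>k. \<beta> (Suc k)) \<le> ennreal Kq * (c * ?E) + c * ?E" by (simp add: add_mono)
  also have "\<dots> = c * (ennreal (1 + Kq) * ?E)"
  proof -
    have "ennreal (1 + Kq) = 1 + ennreal Kq" using Kq by (subst ennreal_plus) auto
    then show ?thesis by (simp only: distrib_left distrib_right mult_1_left mult.left_commute[of _ c] add.commute)
  qed
  finally show ?thesis .
qed

end

section \<open>A supersolution for the second order potential\<close>

text \<open>The dyadic form of the parabolic Riesz potential of order two, truncated at scale \<open>\<rho>\<close>.\<close>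

definition (in dyadic) potential2 :: "(real \<times> 'a::euclidean_space \<Rightarrow> ennreal) \<Rightarrow> real \<times> 'a \<Rightarrow> ennreal" where
  "potential2 f z = (\<Sum>k. ennreal ((r (Suc k))\<^sup>2) * cavg (r (Suc k)) f z)"

text \<open>The Morrey condition is normalised to constant one; the boundedness of \<open>g\<close> makes the potential \<open>W\<close> finite.\<close>

locale morrey = dyadic +
  fixes g :: "real \<times> 'a::euclidean_space \<Rightarrow> real" and M :: real
  assumes g_meas[measurable]: "g \<in> borel_measurable borel"
    and g_bound: "\<And>z. 0 \<le> g z" "\<And>z. g z \<le> M"
    and g_morrey: "\<And>k z. cavg (r k) (\<lambda>w. ennreal (g w powr p)) z \<le> ennreal (r k powr (- p))"
begin

definition \<mu> :: "real \<times> 'a \<Rightarrow> ennreal" where "\<mu> w = ennreal (g w powr p)"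
abbreviation A :: "nat \<Rightarrow> (real \<times> 'a \<Rightarrow> ennreal) \<Rightarrow> real \<times> 'a \<Rightarrow> ennreal" where "A k \<equiv> cavg (r k)"
text \<open>
  \<open>W\<close> is a potential of \<open>g ^ p\<close> with scale factor between those of order two and of order \<open>p\<close>. Its
  additive constant is the value that the Morrey condition permits for the term of scale \<open>\<rho>\<close>, and it
  makes \<open>W\<close> strictly positive.
\<close>
definition W' :: "real \<times> 'a \<Rightarrow> ennreal" where
  "W' z = ennreal (\<rho> powr (- \<sigma>)) + (\<Sum>k. ennreal (r (Suc k) powr s) * A (Suc k) \<mu> z)"
definition W :: "real \<times> 'a \<Rightarrow> real" where "W z = enn2real (W' z)"
definition \<Phi> :: "real \<times> 'a \<Rightarrow> real" where "\<Phi> z = W z powr \<kappa>"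
text \<open>
  The part of \<open>W\<close> from the scales larger than the \<open>j\<close>-th; for the scale \<open>\<rho>\<close> itself, the additive constant in
  \<open>W\<close> dominates the term that is summed here.
\<close>
definition E :: "nat \<Rightarrow> real \<times> 'a \<Rightarrow> ennreal" where
  "E j z = (\<Sum>k<j. ennreal (r k powr s) * A k \<mu> z)"

lemma \<mu>_meas[measurable]: "\<mu> \<in> borel_measurable borel" unfolding \<mu>_def by measurable
lemma morrey_A: "A k \<mu> z \<le> ennreal (r k powr (- p))" unfolding \<mu>_def by (rule g_morrey)
lemma dc_pos: "(dconst TYPE('a)) > 0" by (rule dconst_pos)

lemma W'_meas[measurable]: "W' \<in> borel_measurable borel"
  unfolding W'_def by measurable

lemma W'_finite: "W' z < top"
proof -
  define m where "m = max 0 M powr p"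
  have "\<mu> w \<le> ennreal m" for w
    unfolding \<mu>_def m_def using p g_bound[of w] by (intro ennreal_leI powr_mono2) auto
  then have A: "A k \<mu> z \<le> ennreal (2 * vol TYPE('a) * m)" for k
    using cavg_mono[of "r k" z \<mu> "\<lambda>_. ennreal m"] by (simp add: cavg_const ennreal_mult[symmetric] m_def)
  have "(\<Sum>k. ennreal (r (Suc k) powr s) * A (Suc k) \<mu> z) \<le> (\<Sum>k. ennreal (\<rho> powr s * (2 * vol TYPE('a) * m)) * ennreal (q ^ k))"
  proof (intro suminf_le allI)
    fix k
    have "r (Suc k) powr s = r (Suc k) powr \<sigma> * (r (Suc k))\<^sup>2" by (simp add: s_eq(1) powr_add)
    also have "\<dots> \<le> (\<rho> powr \<sigma> * q ^ k) * \<rho>\<^sup>2"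
    proof (intro mult_mono)
      have "r (Suc k) powr \<sigma> = \<rho> powr \<sigma> * q ^ Suc k" using r_powr_shift[of 0 "Suc k"] by simp
      also have "\<dots> \<le> \<rho> powr \<sigma> * q ^ k" using q by (intro mult_left_mono) (auto simp: mult_left_le_one_le)
      finally show "r (Suc k) powr \<sigma> \<le> \<rho> powr \<sigma> * q ^ k" .
      show "(r (Suc k))\<^sup>2 \<le> \<rho>\<^sup>2" by (intro power_mono r_le_\<rho>) auto
    qed (use q in auto)
    also have "\<dots> = \<rho> powr s * q ^ k" using \<rho> by (simp add: s_eq(1) powr_add)
    finally have "ennreal (r (Suc k) powr s) * A (Suc k) \<mu> z \<le> ennreal (\<rho> powr s * q ^ k) * ennreal (2 * vol TYPE('a) * m)"
      by (intro mult_mono ennreal_leI A) auto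
    also have "\<dots> = ennreal (\<rho> powr s * (2 * vol TYPE('a) * m)) * ennreal (q ^ k)"
      using q by (simp add: ennreal_mult[symmetric] m_def mult_ac)
    finally show "ennreal (r (Suc k) powr s) * A (Suc k) \<mu> z \<le> ennreal (\<rho> powr s * (2 * vol TYPE('a) * m)) * ennreal (q ^ k)" .
  qed auto
  also have "\<dots> = ennreal (\<rho> powr s * (2 * vol TYPE('a) * m)) * ennreal Kq"
    unfolding ennreal_suminf_cmult Kq_def using q by (subst suminf_ennreal_geometric) auto
  also have "\<dots> < top" by (simp add: ennreal_mult_less_top)
  finally show ?thesis unfolding W'_def by simp
qed

lemma W'_eq: "W' z = ennreal (W z)"
  unfolding W_def using W'_finite[of z] by simp

lemma W_pos: "W z > 0"
proof -
  have "ennreal (\<rho> powr (- \<sigma>)) \<le> ennreal (W z)" unfolding W'_eq[symmetric] W'_def by simp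
  then have "\<rho> powr (- \<sigma>) \<le> W z" by (simp add: W_def)
  moreover have "\<rho> powr (- \<sigma>) > 0" using \<rho> by simp
  ultimately show ?thesis by linarith
qed

lemma W_meas[measurable]: "W \<in> borel_measurable borel"
  unfolding W_def by measurable
lemma \<Phi>_meas[measurable]: "\<Phi> \<in> borel_measurable borel"
  unfolding \<Phi>_def by measurable
lemma \<Phi>_pos: "\<Phi> z > 0" using W_pos[of z] by (simp add: \<Phi>_def)

lemma scale_term_le: "ennreal (r k powr s) * A k \<mu> z \<le> ennreal (r k powr (- \<sigma>))"
proof -
  have "ennreal (r k powr s) * A k \<mu> z \<le> ennreal (r k powr s) * ennreal (r k powr (- p))"
    by (intro mult_left_mono morrey_A) auto
  also have "\<dots> = ennreal (r k powr (- \<sigma>))"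
    by (simp add: ennreal_mult[symmetric] powr_add[symmetric] s_eq(2))
  finally show ?thesis .
qed

lemma E_le_W': "j \<ge> 1 \<Longrightarrow> E j z \<le> W' z"
proof -
  assume "j \<ge> 1"
  then obtain i where j: "j = Suc i" by (cases j) auto
  have "E j z = ennreal (r 0 powr s) * A 0 \<mu> z + (\<Sum>k<i. ennreal (r (Suc k) powr s) * A (Suc k) \<mu> z)"
    unfolding E_def j by (rule sum.lessThan_Suc_shift)
  also have "\<dots> \<le> ennreal (r 0 powr (- \<sigma>)) + (\<Sum>k. ennreal (r (Suc k) powr s) * A (Suc k) \<mu> z)"
    by (intro add_mono scale_term_le sum_le_suminf) auto
  finally show ?thesis unfolding W'_def by simp
qed

text \<open>Each term is at most \<open>r k powr - \<sigma>\<close> by the Morrey condition, and this grows geometrically in \<open>k\<close>.\<close>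

lemma E_le_r: "E j z \<le> ennreal (Kq * r j powr (- \<sigma>))"
proof -
  have "E j z \<le> (\<Sum>k<j. ennreal (r k powr (- \<sigma>)))" unfolding E_def by (intro sum_mono scale_term_le)
  also have "\<dots> = ennreal (\<Sum>k<j. r k powr (- \<sigma>))" by simp
  also have "\<dots> \<le> ennreal (Kq * r j powr (- \<sigma>))" by (intro ennreal_leI sum_r_powr_neg)
  finally show ?thesis .
qed

text \<open>Averaging twice is averaging once on the larger of the two scales, doubled.\<close>

lemma A_A:
  assumes "1 \<le> i" "1 \<le> j" and [measurable]: "f \<in> borel_measurable borel"
  shows "A i (A j f) z \<le> ennreal (dconst TYPE('a)) * A (min i j - 1) f z"
proof (cases "i \<le> j")
  case True
  then show ?thesis
    using cavg_compose[of "r i" "r j" "r i" f z] r_antimono[OF True] r_double[of i] assms by (simp add: min_def)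
next
  case False
  then show ?thesis
    using cavg_compose[of "r i" "r j" "r j" f z] r_antimono[of j i] r_double[of j] assms by (simp add: min_def)
qed

definition cA :: real where "cA = (2 * vol TYPE('a) + (dconst TYPE('a)) * (1 + Kq)) * (1 + Kq)"

lemma cA_pos: "cA > 0" unfolding cA_def using dc_pos Kq by (intro mult_pos_pos add_nonneg_pos) auto

text \<open>Averages of \<open>W\<close>, over cylinders as well as over time slices, are estimated by the large scale part
  \<open>E j\<close>. This has two consequences, used at different scales: a bound by \<open>W\<close> at the centre, and a bound
  by the size \<open>r j powr - \<sigma>\<close> which the Morrey condition allows.\<close>

lemma bounds_from_E:
  assumes j: "j \<ge> 1"
    and X: "X \<le> ennreal (2 * vol TYPE('a)) * ennreal (\<rho> powr (- \<sigma>)) + ennreal (dconst TYPE('a)) * (ennreal (1 + Kq) * E j z)"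
  shows "X \<le> ennreal (cA * W z)" "X \<le> ennreal (cA * r j powr (- \<sigma>))"
proof -
  have *: "X \<le> ennreal (cA * y)" if "\<rho> powr (- \<sigma>) \<le> y" "E j z \<le> ennreal (Kq * y)" "y \<ge> 0" for y
  proof -
    have "X \<le> ennreal (2 * vol TYPE('a)) * ennreal y + ennreal (dconst TYPE('a)) * (ennreal (1 + Kq) * ennreal (Kq * y))"
      by (rule order_trans[OF X]) (intro add_mono mult_left_mono ennreal_leI that; simp)
    also have "\<dots> = ennreal (2 * vol TYPE('a) * y + (dconst TYPE('a)) * ((1 + Kq) * (Kq * y)))"
      using Kq dc_pos that by (simp add: ennreal_mult[symmetric] ennreal_plus[symmetric] del: ennreal_plus)
    also have "\<dots> \<le> ennreal (cA * y)"
    proof (rule ennreal_leI)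
      have "(dconst TYPE('a)) * ((1 + Kq) * (Kq * y)) \<le> (dconst TYPE('a)) * ((1 + Kq) * ((1 + Kq) * y))"
        using Kq dc_pos that by (intro mult_left_mono mult_right_mono) auto
      moreover have "2 * vol TYPE('a) * y * 1 \<le> 2 * vol TYPE('a) * y * (1 + Kq)" using Kq that by (intro mult_left_mono) auto
      ultimately show "2 * vol TYPE('a) * y + (dconst TYPE('a)) * ((1 + Kq) * (Kq * y)) \<le> cA * y" unfolding cA_def by (simp add: algebra_simps)
    qed
    finally show ?thesis .
  qed
  have rj: "\<rho> powr (- \<sigma>) \<le> r j powr (- \<sigma>)"
    using \<sigma>_pos \<rho> r_le_\<rho>[of j] by (intro powr_mono2') auto
  show "X \<le> ennreal (cA * r j powr (- \<sigma>))"
    using rj E_le_r by (intro *) auto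
  show "X \<le> ennreal (cA * W z)"
  proof (intro *)
    have "ennreal (\<rho> powr (- \<sigma>)) \<le> ennreal (W z)" unfolding W'_eq[symmetric] W'_def by simp
    then show "\<rho> powr (- \<sigma>) \<le> W z" by (simp add: W_def)
    have "E j z \<le> ennreal (1 * W z)" using E_le_W'[OF j] by (simp add: W'_eq)
    also have "\<dots> \<le> ennreal (Kq * W z)" using Kq W_pos[of z] by (intro ennreal_leI mult_right_mono) auto
    finally show "E j z \<le> ennreal (Kq * W z)" .
  qed (use W_pos[of z] in auto)
qed

text \<open>Averaging at scale \<open>j\<close> does not change the terms of \<open>W\<close> with larger scale by more than a constant, and it
  replaces each term with smaller scale by an average at scale \<open>j\<close>, with a factor that is summable.\<close>

lemma A_W':
  assumes j: "j \<ge> 1"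
  shows "A j W' z \<le> ennreal (cA * W z)" "A j W' z \<le> ennreal (cA * r j powr (- \<sigma>))"
proof -
  have "A j W' z = A j (\<lambda>w. ennreal (\<rho> powr (- \<sigma>))) z + (\<Sum>k. A j (\<lambda>w. ennreal (r (Suc k) powr s) * A (Suc k) \<mu> w) z)"
    unfolding W'_def by (subst cavg_add) (auto simp: cavg_suminf)
  also have "A j (\<lambda>w. ennreal (\<rho> powr (- \<sigma>))) z = ennreal (2 * vol TYPE('a)) * ennreal (\<rho> powr (- \<sigma>))"
    by (rule cavg_const) simp
  also have "(\<Sum>k. A j (\<lambda>w. ennreal (r (Suc k) powr s) * A (Suc k) \<mu> w) z)
      = (\<Sum>k. (\<lambda>k. ennreal (r k powr s) * A j (A k \<mu>) z) (Suc k))"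
    by (simp add: cavg_cmult)
  also have "\<dots> \<le> ennreal (dconst TYPE('a)) * (ennreal (1 + Kq) * E j z)"
    unfolding E_def
  proof (rule split_sum[OF j])
    fix k assume k: "k < j"
    have "A j (A (Suc k) \<mu>) z \<le> ennreal (dconst TYPE('a)) * A k \<mu> z"
      using A_A[of j "Suc k" \<mu> z] j k by (simp add: min_absorb2)
    then have "ennreal (r (Suc k) powr s) * A j (A (Suc k) \<mu>) z \<le> ennreal (r (Suc k) powr s) * (ennreal (dconst TYPE('a)) * A k \<mu> z)"
      by (intro mult_left_mono) auto
    then show "ennreal (r (Suc k) powr s) * A j (A (Suc k) \<mu>) z \<le> ennreal (dconst TYPE('a)) * (ennreal (r (Suc k) powr s) * A k \<mu> z)"
      by (simp add: mult_ac)
  next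
    fix k assume k: "j \<le> k"
    have "A j (A (Suc k) \<mu>) z \<le> ennreal (dconst TYPE('a)) * A (j - 1) \<mu> z"
      using A_A[of j "Suc k" \<mu> z] j k by (simp add: min_def)
    moreover have "r (Suc k) powr s \<le> r (Suc k) powr \<sigma> * (r j)\<^sup>2"
      using k by (simp add: s_eq(1) powr_add mult_left_mono power_mono r_antimono)
    ultimately have "ennreal (r (Suc k) powr s) * A j (A (Suc k) \<mu>) z \<le> ennreal (r (Suc k) powr \<sigma> * (r j)\<^sup>2) * (ennreal (dconst TYPE('a)) * A (j - 1) \<mu> z)"
      by (intro mult_mono ennreal_leI) auto
    then show "ennreal (r (Suc k) powr s) * A j (A (Suc k) \<mu>) z \<le> ennreal (dconst TYPE('a)) * (ennreal (r (Suc k) powr \<sigma> * (r j)\<^sup>2) * A (j - 1) \<mu> z)"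
      by (simp add: mult_ac)
  qed
  finally have "A j W' z \<le> ennreal (2 * vol TYPE('a)) * ennreal (\<rho> powr (- \<sigma>)) + ennreal (dconst TYPE('a)) * (ennreal (1 + Kq) * E j z)"
    by (simp add: add_left_mono)
  from bounds_from_E[OF j this]
  show "A j W' z \<le> ennreal (cA * W z)" "A j W' z \<le> ennreal (cA * r j powr (- \<sigma>))" .
qed

text \<open>Hoelder's inequality for \<open>g\<^sup>2 \<Phi> = (g ^ p) powr (2 / p) * W powr (1 - 2 / p)\<close>. It is obtained by integrating the
  weighted arithmetic-geometric mean inequality, normalised by the bounds \<open>\<alpha>\<close> and \<open>\<beta>\<close> of the two averages.\<close>

lemma cavg_g2\<Phi>_le:
  assumes "\<alpha> > 0" "\<beta> > 0" "A j \<mu> z \<le> ennreal \<alpha>" "A j W' z \<le> ennreal \<beta>"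
  shows "A j (\<lambda>w. ennreal ((g w)\<^sup>2 * \<Phi> w)) z \<le> ennreal (\<alpha> powr (2 / p) * \<beta> powr \<kappa>)"
proof -
  define K where "K = \<alpha> powr (2 / p) * \<beta> powr \<kappa>"
  have K: "K > 0" using assms by (simp add: K_def)
  have pw: "(g w)\<^sup>2 * \<Phi> w \<le> K * (2 / p / \<alpha> * g w powr p + \<kappa> / \<beta> * W w)" for w
  proof (cases "g w = 0")
    case True
    then show ?thesis using K p \<kappa> assms W_pos[of w] by (simp add: less_imp_le)
  next
    case False
    then have g: "g w > 0" using g_bound(1)[of w] by simp
    have "(g w powr p / \<alpha>) powr (2 / p) * (W w / \<beta>) powr \<kappa> \<le> 2 / p * (g w powr p / \<alpha>) + \<kappa> * (W w / \<beta>)"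
      using p \<kappa> g W_pos[of w] assms by (intro Youngs_inequality_0) (auto simp: \<kappa>_def)
    moreover have "(g w powr p / \<alpha>) powr (2 / p) * (W w / \<beta>) powr \<kappa> = (g w)\<^sup>2 * \<Phi> w / K"
      using g p W_pos[of w] assms by (simp add: powr_divide powr_powr \<Phi>_def K_def)
    ultimately have "(g w)\<^sup>2 * \<Phi> w / K \<le> 2 / p * (g w powr p / \<alpha>) + \<kappa> * (W w / \<beta>)" by simp
    then have "(g w)\<^sup>2 * \<Phi> w \<le> (2 / p * (g w powr p / \<alpha>) + \<kappa> * (W w / \<beta>)) * K"
      using K by (simp only: pos_divide_le_eq)
    then show ?thesis by (simp add: mult.commute[of K])
  qed
  have "A j (\<lambda>w. ennreal ((g w)\<^sup>2 * \<Phi> w)) z \<le> A j (\<lambda>w. ennreal (K * (2 / p / \<alpha>)) * \<mu> w + ennreal (K * (\<kappa> / \<beta>)) * W' w) z"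
  proof (rule cavg_mono)
    fix w
    have "ennreal ((g w)\<^sup>2 * \<Phi> w) \<le> ennreal (K * (2 / p / \<alpha> * g w powr p + \<kappa> / \<beta> * W w))"
      by (intro ennreal_leI pw)
    also have "\<dots> = ennreal (K * (2 / p / \<alpha>)) * \<mu> w + ennreal (K * (\<kappa> / \<beta>)) * W' w"
      unfolding \<mu>_def W'_eq using K p \<kappa> assms W_pos[of w]
      by (simp add: ennreal_mult[symmetric] ennreal_plus[symmetric] distrib_left mult.assoc less_imp_le del: ennreal_plus)
    finally show "ennreal ((g w)\<^sup>2 * \<Phi> w) \<le> ennreal (K * (2 / p / \<alpha>)) * \<mu> w + ennreal (K * (\<kappa> / \<beta>)) * W' w" .
  qed
  also have "\<dots> = ennreal (K * (2 / p / \<alpha>)) * A j \<mu> z + ennreal (K * (\<kappa> / \<beta>)) * A j W' z"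
    by (simp add: cavg_add cavg_cmult)
  also have "\<dots> \<le> ennreal (K * (2 / p / \<alpha>)) * ennreal \<alpha> + ennreal (K * (\<kappa> / \<beta>)) * ennreal \<beta>"
    by (intro add_mono mult_left_mono assms) auto
  also have "\<dots> = ennreal (K * (2 / p / \<alpha>) * \<alpha> + K * (\<kappa> / \<beta>) * \<beta>)"
    using K p \<kappa> assms by (simp add: ennreal_mult[symmetric] ennreal_plus[symmetric] del: ennreal_plus)
  also have "K * (2 / p / \<alpha>) * \<alpha> + K * (\<kappa> / \<beta>) * \<beta> = K"
    using assms p by (simp add: \<kappa>_def field_simps)
  finally show ?thesis by (simp add: K_def)
qed

definition cB :: real where "cB = (1 + cA) * (2 / (1 - q powr min (2 / p) \<kappa>))"

lemma q_powr_less: "a > 0 \<Longrightarrow> q powr a < 1"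
proof -
  assume "a > 0"
  then have "q powr a < q powr 0" using q by (intro powr_less_mono') auto
  then show ?thesis using q by simp
qed

lemma cB_pos: "cB > 0"
  unfolding cB_def using cA_pos q_powr_less[of "min (2 / p) \<kappa>"] p \<kappa> by simp

text \<open>On the scale \<open>j\<close> put \<open>x = W z * r j powr \<sigma>\<close>. The two bounds of \<open>A_W'\<close>, together with
  the two bounds \<open>r j powr - s * W z\<close> and \<open>r j powr - p\<close> for the average of \<open>g ^ p\<close>, give through Hoelder's
  inequality \<open>\<Phi> z\<close> times \<open>x powr (2 / p)\<close> and \<open>\<Phi> z\<close> times \<open>x powr - \<kappa>\<close>. Since \<open>x\<close> runs through a geometric
  sequence in \<open>j\<close>, the minimum of the two is summable, uniformly in \<open>z\<close>.\<close>

lemma potential2_supersolution: "potential2 (\<lambda>w. ennreal ((g w)\<^sup>2 * \<Phi> w)) z \<le> ennreal (cB * \<Phi> z)"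
  unfolding potential2_def
proof (rule suminf_ennreal_le)
  fix n
  define x where "x j = W z * r j powr \<sigma>" for j
  have x_pos: "x j > 0" for j using W_pos[of z] by (simp add: x_def)
  have x_geo: "x (Suc j) = x 1 * q ^ j" for j
    using r_powr_shift[of 1 j] by (simp add: x_def)
  have cA1: "cA powr \<kappa> \<le> 1 + cA"
  proof -
    have "cA powr \<kappa> \<le> (1 + cA) powr \<kappa>" using cA_pos \<kappa> by (intro powr_mono2) auto
    also have "\<dots> \<le> (1 + cA) powr 1" using cA_pos \<kappa> by (intro powr_mono) auto
    finally show ?thesis using cA_pos by simp
  qed
  have tbound: "ennreal ((r j)\<^sup>2) * A j (\<lambda>w. ennreal ((g w)\<^sup>2 * \<Phi> w)) z
     \<le> ennreal ((1 + cA) * \<Phi> z * min (x j powr (2 / p)) (x j powr (- \<kappa>)))" if j: "j \<ge> 1" for j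
  proof -
    define rr where "rr = r j"
    have rr: "rr > 0" "(r j)\<^sup>2 = rr powr 2" by (auto simp: rr_def)
    define X where "X = A j (\<lambda>w. ennreal ((g w)\<^sup>2 * \<Phi> w)) z"
    have up: "ennreal (rr powr 2) * X \<le> ennreal ((1 + cA) * \<Phi> z * y)"
      if "X \<le> ennreal Y" "rr powr 2 * Y = cA powr \<kappa> * \<Phi> z * y" "y \<ge> 0" "Y \<ge> 0" for Y y
    proof -
      have "ennreal (rr powr 2) * X \<le> ennreal (rr powr 2) * ennreal Y"
        using that by (intro mult_left_mono) auto
      also have "\<dots> = ennreal (cA powr \<kappa> * \<Phi> z * y)" using that by (simp add: ennreal_mult[symmetric])
      also have "\<dots> \<le> ennreal ((1 + cA) * \<Phi> z * y)"
        using that cA1 \<Phi>_pos[of z] by (intro ennreal_leI mult_right_mono) auto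
      finally show ?thesis .
    qed
    \<comment> \<open>Small scales: both averages are compared with W at the centre.\<close>
    have t1: "ennreal (rr powr 2) * X \<le> ennreal ((1 + cA) * \<Phi> z * x j powr (2 / p))"
    proof (rule up)
      have "ennreal (r j powr s) * A j \<mu> z \<le> W' z"
      proof -
        obtain i where i: "j = Suc i" using j by (cases j) auto
        have "ennreal (r j powr s) * A j \<mu> z \<le> E (Suc j) z"
          unfolding E_def by (intro member_le_sum[where f = "\<lambda>k. ennreal (r k powr s) * A k \<mu> z"]) auto
        also have "\<dots> \<le> W' z" by (rule E_le_W') simp
        finally show ?thesis .
      qed
      then have "ennreal (r j powr (- s)) * (ennreal (r j powr s) * A j \<mu> z) \<le> ennreal (r j powr (- s)) * W' z"
        by (intro mult_left_mono) auto
      also have "ennreal (r j powr (- s)) * (ennreal (r j powr s) * A j \<mu> z) = A j \<mu> z"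
        by (simp add: mult.assoc[symmetric] ennreal_mult[symmetric] powr_add[symmetric])
      finally have "A j \<mu> z \<le> ennreal (rr powr (- s) * W z)"
        using W_pos[of z] by (simp add: W'_eq ennreal_mult rr_def less_imp_le)
      then show "X \<le> ennreal ((rr powr (- s) * W z) powr (2 / p) * (cA * W z) powr \<kappa>)"
        unfolding X_def using rr cA_pos W_pos[of z] A_W'(1)[OF j] by (intro cavg_g2\<Phi>_le) auto
      have "rr powr 2 * (rr powr (- s)) powr (2 / p) = (rr powr \<sigma>) powr (2 / p)"
      proof -
        have "2 + - s * (2 / p) = \<sigma> * (2 / p)" using p by (simp add: s_eq(2) left_diff_distrib diff_divide_distrib)
        then show ?thesis by (simp only: powr_powr powr_add[symmetric])
      qed
      then show "rr powr 2 * ((rr powr (- s) * W z) powr (2 / p) * (cA * W z) powr \<kappa>) = cA powr \<kappa> * \<Phi> z * x j powr (2 / p)"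
        using cA_pos W_pos[of z] by (simp add: powr_mult x_def rr_def[symmetric] \<Phi>_def mult_ac)
    qed auto
    \<comment> \<open>Large scales: both averages are bounded by the Morrey condition.\<close>
    have t2: "ennreal (rr powr 2) * X \<le> ennreal ((1 + cA) * \<Phi> z * x j powr (- \<kappa>))"
    proof (rule up)
      show "X \<le> ennreal ((rr powr (- p)) powr (2 / p) * (cA * rr powr (- \<sigma>)) powr \<kappa>)"
        unfolding X_def using rr cA_pos A_W'(2)[OF j] morrey_A[of j z] by (intro cavg_g2\<Phi>_le) (auto simp: rr_def)
      have "rr powr 2 * (rr powr (- p)) powr (2 / p) = 1"
      proof -
        have "2 + - p * (2 / p) = 0" using p by simp
        then have "rr powr 2 * (rr powr (- p)) powr (2 / p) = rr powr 0" by (simp only: powr_powr powr_add[symmetric])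
        then show ?thesis using rr by simp
      qed
      moreover have "(rr powr (- \<sigma>)) powr \<kappa> = (rr powr \<sigma>) powr (- \<kappa>)"
        by (simp add: powr_powr)
      moreover have "\<Phi> z * W z powr (- \<kappa>) = 1" using W_pos[of z] by (simp add: \<Phi>_def powr_add[symmetric])
      ultimately show "rr powr 2 * ((rr powr (- p)) powr (2 / p) * (cA * rr powr (- \<sigma>)) powr \<kappa>) = cA powr \<kappa> * \<Phi> z * x j powr (- \<kappa>)"
        using cA_pos W_pos[of z] by (simp add: powr_mult x_def rr_def[symmetric] mult_ac)
    qed auto
    show ?thesis using t1 t2 unfolding X_def[symmetric] rr(2) by (auto simp: min_def)
  qed
  have "(\<Sum>k<n. ennreal ((r (Suc k))\<^sup>2) * A (Suc k) (\<lambda>w. ennreal ((g w)\<^sup>2 * \<Phi> w)) z)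
     \<le> (\<Sum>k<n. ennreal ((1 + cA) * \<Phi> z * min (x (Suc k) powr (2 / p)) (x (Suc k) powr (- \<kappa>))))"
    by (intro sum_mono tbound) auto
  also have "\<dots> = ennreal ((1 + cA) * \<Phi> z * (\<Sum>k<n. min ((x 1 * q ^ k) powr (2 / p)) ((x 1 * q ^ k) powr (- \<kappa>))))"
    unfolding x_geo sum_distrib_left
    by (rule sum_ennreal) (intro mult_nonneg_nonneg less_imp_le[OF \<Phi>_pos] add_nonneg_nonneg less_imp_le[OF cA_pos]; simp)
  also have "\<dots> \<le> ennreal ((1 + cA) * \<Phi> z * (2 / (1 - q powr min (2 / p) \<kappa>)))"
    using cA_pos \<Phi>_pos[of z] q x_pos p \<kappa>
    by (intro ennreal_leI mult_left_mono sum_min_powr_geometric) auto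
  finally show "(\<Sum>k<n. ennreal ((r (Suc k))\<^sup>2) * A (Suc k) (\<lambda>w. ennreal ((g w)\<^sup>2 * \<Phi> w)) z) \<le> ennreal (cB * \<Phi> z)"
    unfolding cB_def mult.assoc mult.left_commute[of "\<Phi> z"] by (simp only: mult.assoc mult.commute[of "\<Phi> z"])
qed

end

section \<open>Bounds for the potentials in weighted square norms\<close>

lemma suminf_ennreal_swap:
  fixes f :: "nat \<Rightarrow> nat \<Rightarrow> ennreal"
  shows "(\<Sum>i. \<Sum>j. f i j) = (\<Sum>j. \<Sum>i. f i j)"
  using nn_integral_fst_count_space[of "case_prod f"] nn_integral_snd_count_space[of "case_prod f"]
  by (simp add: nn_integral_count_space_nat)

definition kball :: "real \<Rightarrow> 'a::euclidean_space \<Rightarrow> 'a \<Rightarrow> ennreal" where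
  "kball r x y = ennreal (1 / r ^ DIM('a)) * indicator (ball x r) y"

lemma kball_measurable[measurable]:
  fixes f g :: "'m \<Rightarrow> 'a::euclidean_space"
  assumes [measurable]: "f \<in> M \<rightarrow>\<^sub>M borel" "g \<in> M \<rightarrow>\<^sub>M borel"
  shows "(\<lambda>x. kball r (f x) (g x)) \<in> borel_measurable M"
proof -
  have "(\<lambda>x. kball r (f x) (g x)) = (\<lambda>x. ennreal (1 / r ^ DIM('a)) * (if dist (f x) (g x) < r then 1 else 0))"
    by (auto simp: kball_def fun_eq_iff)
  also have "\<dots> \<in> borel_measurable M" by measurable
  finally show ?thesis .
qed

lemma integral_kball:
  fixes x :: "'a::euclidean_space"
  assumes "r > 0"
  shows "(\<integral>\<^sup>+y. kball r x y \<partial>lborel) = ennreal (vol TYPE('a))"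
proof -
  have "(\<integral>\<^sup>+y. kball r x y \<partial>lborel) = ennreal (1 / r ^ DIM('a)) * ennreal (vol TYPE('a) * r ^ DIM('a))"
    unfolding kball_def using assms by (subst nn_integral_cmult_indicator) (auto simp: emeasure_ball)
  also have "\<dots> = ennreal (1 / r ^ DIM('a) * (vol TYPE('a) * r ^ DIM('a)))"
    using assms by (subst ennreal_mult[symmetric]) auto
  finally show ?thesis using assms by simp
qed

definition savg :: "real \<Rightarrow> ('a::euclidean_space \<Rightarrow> ennreal) \<Rightarrow> 'a \<Rightarrow> ennreal" where
  "savg r f x = (\<integral>\<^sup>+y. kball r x y * f y \<partial>lborel)"

text \<open>Averaging small cylinders whose centres lie on one time slice: the slice meets only the fraction \<open>s\<^sup>2 / r\<^sup>2\<close>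
  of the times, whence the loss of \<open>r\<^sup>2 / s\<^sup>2\<close> compared with \<open>kcyl_compose\<close>.\<close>

lemma kball_kcyl_small:
  fixes x :: "'a::euclidean_space" and t \<tau> :: real
  assumes "0 < s" "s \<le> r" "\<bar>t - \<tau>\<bar> \<le> r\<^sup>2"
  shows "(\<integral>\<^sup>+y. kball r x y * kcyl s (\<tau>, y) w \<partial>lborel) \<le> ennreal (dconst TYPE('a) * r\<^sup>2 / s\<^sup>2) * kcyl (2 * r) (t, x) w"
proof -
  have r: "r > 0" using assms by simp
  have "s\<^sup>2 \<le> r\<^sup>2" using assms by (intro power_mono) auto
  have pt: "kball r x y * kcyl s (\<tau>, y) w \<le> (ennreal (2 ^ (DIM('a) + 2) * r\<^sup>2 / s\<^sup>2) * kcyl (2 * r) (t, x) w) * kball s (snd w) y" for y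
  proof (cases "y \<in> ball x r \<and> w \<in> cyl s (\<tau>, y)")
    case True
    have n: "norm (y - x) < r" "\<bar>fst w - \<tau>\<bar> < s\<^sup>2" "norm (snd w - y) < s"
      using True by (auto simp: cyl_iff dist_norm norm_minus_commute)
    have "norm (snd w - x) \<le> norm (snd w - y) + norm (y - x)"
      using norm_triangle_ineq[of "snd w - y" "y - x"] by simp
    then have "norm (snd w - x) < 2 * r" using n assms by simp
    moreover have "\<bar>fst w - t\<bar> < 4 * r\<^sup>2"
      using n assms(3) \<open>s\<^sup>2 \<le> r\<^sup>2\<close> zero_le_power2[of r] by linarith
    ultimately have w: "w \<in> cyl (2 * r) (t, x)" by (simp add: cyl_iff power_mult_distrib)
    have "kball r x y * kcyl s (\<tau>, y) w = ennreal (1 / r ^ DIM('a) * (1 / s ^ (DIM('a) + 2)))"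
      using True r assms by (simp only: kball_def kcyl_def) (subst ennreal_mult, auto)
    also have "1 / r ^ DIM('a) * (1 / s ^ (DIM('a) + 2)) = (2 ^ (DIM('a) + 2) * r\<^sup>2 / s\<^sup>2) * (1 / (2 * r) ^ (DIM('a) + 2)) * (1 / s ^ DIM('a))"
      using r assms by (simp add: power_mult_distrib power_add field_simps power2_eq_square)
    also have "ennreal \<dots> = (ennreal (2 ^ (DIM('a) + 2) * r\<^sup>2 / s\<^sup>2) * kcyl (2 * r) (t, x) w) * kball s (snd w) y"
    proof -
      have em: "ennreal (X * Y * Z) = ennreal X * ennreal Y * ennreal Z" if "X \<ge> 0" "Y \<ge> 0" "Z \<ge> 0" for X Y Z
        using that by (simp add: ennreal_mult)
      show ?thesis using r assms w n
        by (subst em) (auto simp: kball_def kcyl_def dist_norm)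
    qed
    finally show ?thesis by simp
  qed (auto simp: kball_def kcyl_def indicator_def)
  have "(\<integral>\<^sup>+y. kball r x y * kcyl s (\<tau>, y) w \<partial>lborel)
     \<le> (\<integral>\<^sup>+y. (ennreal (2 ^ (DIM('a) + 2) * r\<^sup>2 / s\<^sup>2) * kcyl (2 * r) (t, x) w) * kball s (snd w) y \<partial>lborel)"
    by (intro nn_integral_mono pt)
  also have "\<dots> = ennreal (2 ^ (DIM('a) + 2) * r\<^sup>2 / s\<^sup>2) * kcyl (2 * r) (t, x) w * ennreal (vol TYPE('a))"
    using assms by (subst nn_integral_cmult) (auto simp: integral_kball)
  also have "\<dots> = ennreal (2 ^ (DIM('a) + 2) * r\<^sup>2 / s\<^sup>2 * vol TYPE('a)) * kcyl (2 * r) (t, x) w"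
  proof -
    have "ennreal (2 ^ (DIM('a) + 2) * r\<^sup>2 / s\<^sup>2 * vol TYPE('a)) = ennreal (2 ^ (DIM('a) + 2) * r\<^sup>2 / s\<^sup>2) * ennreal (vol TYPE('a))"
      by (rule ennreal_mult) auto
    then show ?thesis by (simp only: mult_ac)
  qed
  also have "\<dots> \<le> ennreal (dconst TYPE('a) * r\<^sup>2 / s\<^sup>2) * kcyl (2 * r) (t, x) w"
  proof (intro mult_right_mono ennreal_leI)
    have "dconst TYPE('a) * r\<^sup>2 / s\<^sup>2 = 2 * (2 ^ (DIM('a) + 2) * r\<^sup>2 / s\<^sup>2 * vol TYPE('a))"
      by (simp add: dconst_def power_add)
    moreover have "2 ^ (DIM('a) + 2) * r\<^sup>2 / s\<^sup>2 * vol TYPE('a) \<ge> 0" by simp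
    ultimately show "2 ^ (DIM('a) + 2) * r\<^sup>2 / s\<^sup>2 * vol TYPE('a) \<le> dconst TYPE('a) * r\<^sup>2 / s\<^sup>2" by linarith
  qed simp
  finally show ?thesis .
qed

lemma kball_kcyl_large:
  fixes x :: "'a::euclidean_space" and t \<tau> :: real
  assumes "0 < r" "r \<le> s" "\<bar>t - \<tau>\<bar> \<le> r\<^sup>2"
  shows "(\<integral>\<^sup>+y. kball r x y * kcyl s (\<tau>, y) w \<partial>lborel) \<le> ennreal (dconst TYPE('a)) * kcyl (2 * s) (t, x) w"
proof -
  have s: "s > 0" using assms by simp
  have "r\<^sup>2 \<le> s\<^sup>2" using assms by (intro power_mono) auto
  have pt: "kball r x y * kcyl s (\<tau>, y) w \<le> (ennreal (2 ^ (DIM('a) + 2)) * kcyl (2 * s) (t, x) w) * kball r x y" for y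
  proof (cases "y \<in> ball x r \<and> w \<in> cyl s (\<tau>, y)")
    case True
    have n: "norm (y - x) < r" "\<bar>fst w - \<tau>\<bar> < s\<^sup>2" "norm (snd w - y) < s"
      using True by (auto simp: cyl_iff dist_norm norm_minus_commute)
    have "norm (snd w - x) \<le> norm (snd w - y) + norm (y - x)"
      using norm_triangle_ineq[of "snd w - y" "y - x"] by simp
    then have "norm (snd w - x) < 2 * s" using n assms by simp
    moreover have "\<bar>fst w - t\<bar> < 4 * s\<^sup>2"
      using n assms(3) \<open>r\<^sup>2 \<le> s\<^sup>2\<close> zero_le_power2[of s] by linarith
    ultimately have w: "w \<in> cyl (2 * s) (t, x)" by (simp add: cyl_iff power_mult_distrib)
    have "1 / s ^ (DIM('a) + 2) = 2 ^ (DIM('a) + 2) * (1 / (2 * s) ^ (DIM('a) + 2))"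
      using s by (simp add: power_mult_distrib power_add)
    then have "kcyl s (\<tau>, y) w = ennreal (2 ^ (DIM('a) + 2)) * kcyl (2 * s) (t, x) w"
      using True s w by (simp only: kcyl_def) (simp add: ennreal_mult[symmetric])
    then show ?thesis by (simp add: mult.commute)
  qed (auto simp: kball_def kcyl_def indicator_def)
  have "(\<integral>\<^sup>+y. kball r x y * kcyl s (\<tau>, y) w \<partial>lborel)
     \<le> (\<integral>\<^sup>+y. (ennreal (2 ^ (DIM('a) + 2)) * kcyl (2 * s) (t, x) w) * kball r x y \<partial>lborel)"
    by (intro nn_integral_mono pt)
  also have "\<dots> = ennreal (2 ^ (DIM('a) + 2)) * kcyl (2 * s) (t, x) w * ennreal (vol TYPE('a))"
    using assms by (subst nn_integral_cmult) (auto simp: integral_kball)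
  also have "\<dots> = ennreal (2 ^ (DIM('a) + 2) * vol TYPE('a)) * kcyl (2 * s) (t, x) w"
    by (simp add: ennreal_mult mult_ac)
  also have "\<dots> \<le> ennreal (dconst TYPE('a)) * kcyl (2 * s) (t, x) w"
    by (intro mult_right_mono ennreal_leI) (auto simp: dconst_def power_add)
  finally show ?thesis .
qed

context dyadic begin

text \<open>
  The potential of order one starts at the scale \<open>r 2 = \<rho> / 4\<close>, so that the doublings in the composition of two
  of them stay below \<open>\<rho>\<close>.
\<close>
definition potential1 :: "(real \<times> 'a::euclidean_space \<Rightarrow> ennreal) \<Rightarrow> real \<times> 'a \<Rightarrow> ennreal" where
  "potential1 f z = (\<Sum>k. ennreal (r (k + 2)) * cavg (r (k + 2)) f z)"

text \<open>
  Final values enter at the scale comparable to the square root of the time that is left. The slabs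
  cut the time before \<open>\<tau>\<close> according to this scale, so that at most one term of the trace potential is
  nonzero.
\<close>
definition slab :: "real \<Rightarrow> nat \<Rightarrow> real set" where
  "slab \<tau> k = {\<tau> - (r k)\<^sup>2 <.. \<tau> - (r (Suc k))\<^sup>2}"

definition trace_potential :: "real \<Rightarrow> ('a::euclidean_space \<Rightarrow> ennreal) \<Rightarrow> real \<times> 'a \<Rightarrow> ennreal" where
  "trace_potential \<tau> f z = (\<Sum>k. indicator (slab \<tau> (k + 2)) (fst z) * savg (r (k + 2)) f (snd z))"

lemma slab_disjoint: "t \<in> slab \<tau> i \<Longrightarrow> t \<in> slab \<tau> j \<Longrightarrow> i = j"
proof (rule ccontr)
  assume t: "t \<in> slab \<tau> i" "t \<in> slab \<tau> j" and "i \<noteq> j"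
  then consider "Suc i \<le> j" | "Suc j \<le> i" by linarith
  then show False
  proof cases
    case 1
    then have "(r j)\<^sup>2 \<le> (r (Suc i))\<^sup>2" by (intro power_mono r_antimono) auto
    with t show False by (auto simp: slab_def)
  next
    case 2
    then have "(r i)\<^sup>2 \<le> (r (Suc j))\<^sup>2" by (intro power_mono r_antimono) auto
    with t show False by (auto simp: slab_def)
  qed
qed

lemma trace_potential_single: "fst z \<in> slab \<tau> (k + 2) \<Longrightarrow> trace_potential \<tau> f z = savg (r (k + 2)) f (snd z)"
proof -
  assume k: "fst z \<in> slab \<tau> (k + 2)"
  have *: "trace_potential \<tau> f z = (\<Sum>i\<in>{k}. indicator (slab \<tau> (i + 2)) (fst z) * savg (r (i + 2)) f (snd z))"
    unfolding trace_potential_def by (rule suminf_finite) (use k in \<open>auto simp: indicator_def dest: slab_disjoint\<close>)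
  show ?thesis unfolding * using k by simp
qed

end

context morrey begin

abbreviation F where "F \<equiv> (\<lambda>w. ennreal ((g w)\<^sup>2 * \<Phi> w))"
abbreviation G where "G \<equiv> (\<lambda>w. ennreal ((g w)\<^sup>2))"

lemma F_pt: "G w * ennreal (\<Phi> w) = F w"
  using \<Phi>_pos[of w] by (simp add: ennreal_mult less_imp_le)

text \<open>The kernels of the two potentials, for use in \<open>schur_test\<close>.\<close>
definition KT :: "real \<times> 'a \<Rightarrow> real \<times> 'a \<Rightarrow> ennreal" where
  "KT z w = (\<Sum>k. ennreal (r (k + 2)) * kcyl (r (k + 2)) z w)"
definition KB :: "real \<times> 'a \<Rightarrow> real \<times> 'a \<Rightarrow> ennreal" where
  "KB z w = (\<Sum>k. ennreal ((r (Suc k))\<^sup>2) * kcyl (r (Suc k)) z w)"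

lemma KT_sym: "KT z w = KT w z" unfolding KT_def by (simp add: kcyl_sym[of _ z w])
lemma KB_sym: "KB z w = KB w z" unfolding KB_def by (simp add: kcyl_sym[of _ z w])

lemma KT_meas: "case_prod KT \<in> borel_measurable borel"
  unfolding KT_def pair_borel[symmetric] by measurable
lemma KB_meas: "case_prod KB \<in> borel_measurable borel"
  unfolding KB_def pair_borel[symmetric] by measurable
lemma KB_meas'[measurable]: "case_prod KB \<in> borel_measurable (borel \<Otimes>\<^sub>M borel)"
  using KB_meas by (simp add: pair_borel)

lemma potential1_eq: "f \<in> borel_measurable borel \<Longrightarrow> potential1 f z = (\<integral>\<^sup>+w. KT z w * f w \<partial>lborel)"
  unfolding potential1_def KT_def cavg_def
  by (subst ennreal_suminf_multc[symmetric], subst nn_integral_suminf)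
     (auto intro!: suminf_cong simp: nn_integral_cmult[symmetric] mult.assoc)

lemma potential2_eq: "f \<in> borel_measurable borel \<Longrightarrow> potential2 f z = (\<integral>\<^sup>+w. KB z w * f w \<partial>lborel)"
  unfolding potential2_def KB_def cavg_def
  by (subst ennreal_suminf_multc[symmetric], subst nn_integral_suminf)
     (auto intro!: suminf_cong simp: nn_integral_cmult[symmetric] mult.assoc)

lemma potential1_meas[measurable]: "f \<in> borel_measurable borel \<Longrightarrow> potential1 f \<in> borel_measurable borel"
  unfolding potential1_def[abs_def] by measurable
lemma sum_r_tail: "(\<Sum>j. if i \<le> j then ennreal (r (j + 2)) else 0) = ennreal (2 * r (i + 2))"
proof -
  have "(\<Sum>j. if i \<le> j then ennreal (r (j + 2)) else 0) = (\<Sum>j. ennreal (r (j + i + 2)))"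
    by (subst suminf_offset[where i = i]) auto
  also have "\<dots> = (\<Sum>j. ennreal (r (i + 2)) * ennreal ((1 / 2) ^ j))"
  proof (intro suminf_cong)
    fix j
    have "r (j + i + 2) = r (i + 2) * (1 / 2) ^ j" by (simp add: r_def power_add power_one_over)
    then show "ennreal (r (j + i + 2)) = ennreal (r (i + 2)) * ennreal ((1 / 2) ^ j)"
      by (simp only:) (subst ennreal_mult, auto)
  qed
  also have "\<dots> = ennreal (r (i + 2)) * ennreal 2"
    unfolding ennreal_suminf_cmult by (subst suminf_ennreal_geometric) auto
  finally show ?thesis by (simp add: ennreal_mult mult.commute)
qed

text \<open>A composition of two averages is an average on the larger scale \<open>r i\<close>; summing the factors \<open>r i * r j\<close> over
  the smaller scales \<open>r j\<close> leaves a multiple of \<open>(r i)\<^sup>2\<close>, the factor of the second order potential.\<close>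

lemma potential1_twice_le:
  fixes f :: "real \<times> 'a \<Rightarrow> ennreal"
  assumes [measurable]: "f \<in> borel_measurable borel"
  shows "potential1 (potential1 f) z \<le> ennreal (4 * dconst TYPE('a)) * potential2 f z"
proof -
  define t where "t i j = ennreal (dconst TYPE('a)) * (ennreal (r (i + 2)) * (ennreal (r (j + 2)) * A (i + 1) f z))" for i j
  have "potential1 (potential1 f) z = (\<Sum>i. ennreal (r (i + 2)) * (\<Sum>j. ennreal (r (j + 2)) * A (i + 2) (A (j + 2) f) z))"
    unfolding potential1_def[of "potential1 f"] unfolding potential1_def[of f, abs_def] by (simp add: cavg_suminf cavg_cmult)
  also have "\<dots> = (\<Sum>i. \<Sum>j. ennreal (r (i + 2)) * (ennreal (r (j + 2)) * A (i + 2) (A (j + 2) f) z))"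
    by simp
  also have "\<dots> \<le> (\<Sum>i. \<Sum>j. (if i \<le> j then t i j else 0) + (if j \<le> i then t j i else 0))"
  proof (intro suminf_le allI)
    fix i j
    have "A (i + 2) (A (j + 2) f) z \<le> ennreal (dconst TYPE('a)) * A (min i j + 1) f z"
      using A_A[of "i + 2" "j + 2" f z] by (simp add: min_add_distrib_left flip: min_diff)
    then have *: "ennreal (r (i + 2)) * (ennreal (r (j + 2)) * A (i + 2) (A (j + 2) f) z) \<le>
       ennreal (r (i + 2)) * (ennreal (r (j + 2)) * (ennreal (dconst TYPE('a)) * A (min i j + 1) f z))"
      by (intro mult_left_mono) auto
    show "ennreal (r (i + 2)) * (ennreal (r (j + 2)) * A (i + 2) (A (j + 2) f) z) \<le>
       (if i \<le> j then t i j else 0) + (if j \<le> i then t j i else 0)"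
    proof (cases "i \<le> j")
      case True
      then have "ennreal (r (i + 2)) * (ennreal (r (j + 2)) * A (i + 2) (A (j + 2) f) z) \<le> t i j"
        using * by (simp add: t_def mult_ac min_absorb1)
      then show ?thesis using True by (simp add: add_increasing2)
    next
      case False
      then have "ennreal (r (i + 2)) * (ennreal (r (j + 2)) * A (i + 2) (A (j + 2) f) z) \<le> t j i"
        using * by (simp add: t_def mult_ac min_absorb2)
      then show ?thesis using False by simp
    qed
  qed auto
  also have "\<dots> = (\<Sum>i. \<Sum>j. if i \<le> j then t i j else 0) + (\<Sum>i. \<Sum>j. if j \<le> i then t j i else 0)"
    by (subst suminf_add) (auto simp: suminf_add)
  also have "(\<Sum>i. \<Sum>j. if j \<le> i then t j i else 0) = (\<Sum>i. \<Sum>j. if i \<le> j then t i j else 0)"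
    by (rule suminf_ennreal_swap)
  also have "(\<Sum>i. \<Sum>j. if i \<le> j then t i j else 0) \<le> (\<Sum>i. ennreal (2 * dconst TYPE('a)) * (ennreal ((r (Suc i))\<^sup>2) * A (Suc i) f z))"
  proof (intro suminf_le allI)
    fix i
    have "(\<Sum>j. if i \<le> j then t i j else 0) = (\<Sum>j. (ennreal (dconst TYPE('a)) * (ennreal (r (i + 2)) * A (i + 1) f z)) * (if i \<le> j then ennreal (r (j + 2)) else 0))"
      by (intro suminf_cong) (auto simp: t_def mult_ac)
    also have "\<dots> = (ennreal (dconst TYPE('a)) * (ennreal (r (i + 2)) * A (i + 1) f z)) * ennreal (2 * r (i + 2))"
      unfolding ennreal_suminf_cmult sum_r_tail ..
    also have "\<dots> = ennreal (2 * dconst TYPE('a)) * (ennreal ((r (i + 2))\<^sup>2) * A (Suc i) f z)"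
      using dconst_pos[where 'a = 'a] by (simp add: ennreal_mult power2_eq_square mult_ac)
    also have "\<dots> \<le> ennreal (2 * dconst TYPE('a)) * (ennreal ((r (Suc i))\<^sup>2) * A (Suc i) f z)"
      by (intro mult_left_mono mult_right_mono ennreal_leI power_mono r_antimono) auto
    finally show "(\<Sum>j. if i \<le> j then t i j else 0) \<le> ennreal (2 * dconst TYPE('a)) * (ennreal ((r (Suc i))\<^sup>2) * A (Suc i) f z)" .
  qed auto
  also have "\<dots> = ennreal (2 * dconst TYPE('a)) * potential2 f z" unfolding potential2_def by simp
  finally have "potential1 (potential1 f) z \<le> ennreal (2 * dconst TYPE('a)) * potential2 f z + ennreal (2 * dconst TYPE('a)) * potential2 f z"
    by (simp add: add_mono)
  also have "\<dots> = ennreal (4 * dconst TYPE('a)) * potential2 f z"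
    using dconst_pos[where 'a = 'a] by (simp add: distrib_right[symmetric] ennreal_plus[symmetric] del: ennreal_plus)
  finally show ?thesis .
qed

text \<open>Schur's test with \<open>q = potential1 (g\<^sup>2 \<Phi>)\<close>: the second condition is then the symmetry of the kernel, and
  the first is \<open>potential1_twice_le\<close> followed by the supersolution property.\<close>

lemma potential1_L2:
  assumes h[measurable]: "h \<in> borel_measurable borel"
  shows "(\<integral>\<^sup>+z. G z * (potential1 h z)\<^sup>2 \<partial>lborel) \<le> ennreal (4 * dconst TYPE('a) * cB) * (\<integral>\<^sup>+z. (h z)\<^sup>2 \<partial>lborel)"
proof -
  have "(\<integral>\<^sup>+z. G z * (\<integral>\<^sup>+w. KT z w * h w \<partial>lborel)\<^sup>2 \<partial>lborel) \<le> ennreal (4 * dconst TYPE('a) * cB * 1) * (\<integral>\<^sup>+z. (h z)\<^sup>2 \<partial>lborel)"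
  proof (rule schur_test[where \<Phi> = \<Phi> and q = "potential1 F"])
    show "(\<integral>\<^sup>+w. KT z w * potential1 F w \<partial>lborel) \<le> ennreal (4 * dconst TYPE('a) * cB * \<Phi> z)" for z
    proof -
      have "(\<integral>\<^sup>+w. KT z w * potential1 F w \<partial>lborel) \<le> ennreal (4 * dconst TYPE('a)) * potential2 F z"
        using potential1_twice_le[of F z] by (simp add: potential1_eq[of "potential1 F"])
      also have "\<dots> \<le> ennreal (4 * dconst TYPE('a)) * ennreal (cB * \<Phi> z)"
        by (intro mult_left_mono potential2_supersolution) auto
      finally show ?thesis using dconst_pos[where 'a = 'a] cB_pos \<Phi>_pos[of z]
        by (simp add: ennreal_mult[symmetric] mult.assoc less_imp_le)
    qed
    show "(\<integral>\<^sup>+z. G z * ennreal (\<Phi> z) * KT z w \<partial>lborel) \<le> ennreal 1 * potential1 F w" for w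
    proof -
      have "(\<integral>\<^sup>+z. G z * ennreal (\<Phi> z) * KT z w \<partial>lborel) = (\<integral>\<^sup>+z. KT w z * F z \<partial>lborel)"
        by (intro nn_integral_cong, subst F_pt, subst KT_sym, rule mult.commute)
      then show ?thesis by (simp add: potential1_eq)
    qed
  qed (use dconst_pos[where 'a = 'a] cB_pos \<Phi>_pos KT_meas in auto)
  then show ?thesis by (simp add: potential1_eq)
qed

text \<open>With one factor \<open>g\<close> moved into the kernel and \<open>q = g \<Phi>\<close>, both conditions of Schur's test are the
  supersolution property.\<close>

lemma potential2_L2:
  assumes h[measurable]: "h \<in> borel_measurable borel"
  shows "(\<integral>\<^sup>+z. G z * (potential2 (\<lambda>w. ennreal (g w) * h w) z)\<^sup>2 \<partial>lborel) \<le> ennreal (cB * cB) * (\<integral>\<^sup>+z. (h z)\<^sup>2 \<partial>lborel)"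
proof -
  have gF: "ennreal (g w) * (ennreal (g w) * ennreal (\<Phi> w)) = F w" for w
    using g_bound(1)[of w] \<Phi>_pos[of w] by (simp add: ennreal_mult[symmetric] power2_eq_square less_imp_le mult.assoc)
  have "(\<integral>\<^sup>+z. G z * (\<integral>\<^sup>+w. (KB z w * ennreal (g w)) * h w \<partial>lborel)\<^sup>2 \<partial>lborel) \<le> ennreal (cB * cB) * (\<integral>\<^sup>+z. (h z)\<^sup>2 \<partial>lborel)"
  proof (rule schur_test[where \<Phi> = \<Phi> and q = "\<lambda>w. ennreal (g w) * ennreal (\<Phi> w)"])
    show "(\<lambda>(z, w). KB z w * ennreal (g w)) \<in> borel_measurable borel"
      unfolding pair_borel[symmetric] by measurable
    show "(\<integral>\<^sup>+w. KB z w * ennreal (g w) * (ennreal (g w) * ennreal (\<Phi> w)) \<partial>lborel) \<le> ennreal (cB * \<Phi> z)" for z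
      using potential2_supersolution[of z] by (simp add: potential2_eq mult.assoc gF)
    show "(\<integral>\<^sup>+z. G z * ennreal (\<Phi> z) * (KB z w * ennreal (g w)) \<partial>lborel) \<le> ennreal cB * (ennreal (g w) * ennreal (\<Phi> w))" for w
    proof -
      have "(\<integral>\<^sup>+z. G z * ennreal (\<Phi> z) * (KB z w * ennreal (g w)) \<partial>lborel) = (\<integral>\<^sup>+z. ennreal (g w) * (KB w z * F z) \<partial>lborel)"
        by (intro nn_integral_cong, subst F_pt, subst KB_sym) (simp only: mult_ac)
      also have "\<dots> = ennreal (g w) * potential2 F w"
        by (subst nn_integral_cmult) (auto simp: potential2_eq)
      also have "\<dots> \<le> ennreal (g w) * ennreal (cB * \<Phi> w)" by (intro mult_left_mono potential2_supersolution) auto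
      also have "\<dots> = ennreal cB * (ennreal (g w) * ennreal (\<Phi> w))"
        using cB_pos \<Phi>_pos[of w] by (simp add: ennreal_mult less_imp_le mult_ac)
      finally show ?thesis .
    qed
  qed (use cB_pos \<Phi>_pos in auto)
  then show ?thesis by (simp add: potential2_eq mult.assoc)
qed

lemma A_g2_le: "A k G z \<le> ennreal ((1 + 2 * vol TYPE('a)) / (r k)\<^sup>2)"
proof -
  have pw: "(g w)\<^sup>2 \<le> (r k) powr (-2) * (2 / p * (r k powr p) * g w powr p + \<kappa>)" for w
  proof (cases "g w = 0")
    case True then show ?thesis using p \<kappa> by simp
  next
    case False
    then have g: "g w > 0" using g_bound(1)[of w] by simp
    have "(g w powr p * r k powr p) powr (2 / p) * 1 powr \<kappa> \<le> 2 / p * (g w powr p * r k powr p) + \<kappa> * 1"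
      using p \<kappa> g by (intro Youngs_inequality_0) (auto simp: \<kappa>_def)
    moreover have "(g w powr p * r k powr p) powr (2 / p) = (g w)\<^sup>2 * (r k) powr 2"
      using g p by (simp add: powr_mult powr_powr)
    ultimately have "(g w)\<^sup>2 * (r k) powr 2 \<le> 2 / p * (g w powr p * r k powr p) + \<kappa>" by simp
    then have "(r k) powr (-2) * ((g w)\<^sup>2 * (r k) powr 2) \<le> (r k) powr (-2) * (2 / p * (g w powr p * r k powr p) + \<kappa>)"
      by (intro mult_left_mono) auto
    also have "2 / p * (g w powr p * r k powr p) = 2 / p * (r k powr p) * g w powr p" by simp
    finally have "(r k) powr (-2) * ((g w)\<^sup>2 * (r k) powr 2) \<le> (r k) powr (-2) * (2 / p * (r k powr p) * g w powr p + \<kappa>)" .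
    moreover have "(r k) powr (-2) * ((g w)\<^sup>2 * (r k) powr 2) = (g w)\<^sup>2"
    proof -
      have "(r k) powr (-2) * (r k) powr 2 = 1" by (simp only: powr_add[symmetric]) simp
      then show ?thesis by (simp only: mult.left_commute[of "r k powr (-2)"] mult_1_right)
    qed
    ultimately show ?thesis by (simp only:)
  qed
  have "A k G z \<le> A k (\<lambda>w. ennreal ((r k) powr (-2) * (2 / p * (r k powr p))) * \<mu> w + ennreal ((r k) powr (-2) * \<kappa>)) z"
  proof (rule cavg_mono)
    fix w
    show "G w \<le> ennreal ((r k) powr (-2) * (2 / p * (r k powr p))) * \<mu> w + ennreal ((r k) powr (-2) * \<kappa>)"
      unfolding \<mu>_def using pw[of w] p \<kappa>
      by (simp add: ennreal_mult[symmetric] ennreal_plus[symmetric] distrib_left mult.assoc ennreal_leI del: ennreal_plus)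
  qed
  also have "\<dots> = ennreal ((r k) powr (-2) * (2 / p * (r k powr p))) * A k \<mu> z + ennreal (2 * vol TYPE('a)) * ennreal ((r k) powr (-2) * \<kappa>)"
    by (simp add: cavg_add cavg_cmult cavg_const)
  also have "\<dots> \<le> ennreal ((r k) powr (-2) * (2 / p * (r k powr p))) * ennreal (r k powr (- p)) + ennreal (2 * vol TYPE('a)) * ennreal ((r k) powr (-2) * \<kappa>)"
    by (intro add_mono mult_left_mono morrey_A) auto
  also have "\<dots> = ennreal ((r k) powr (-2) * (2 / p) * (r k powr p * r k powr (- p)) + 2 * vol TYPE('a) * ((r k) powr (-2) * \<kappa>))"
    using p \<kappa> by (simp add: ennreal_mult[symmetric] ennreal_plus[symmetric] mult.assoc del: ennreal_plus)
  also have "\<dots> \<le> ennreal ((r k) powr (-2) * 1 * 1 + 2 * vol TYPE('a) * ((r k) powr (-2) * 1))"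
    using p \<kappa> by (intro ennreal_leI add_mono mult_mono) (auto simp: powr_add[symmetric])
  also have "(r k) powr (-2) * 1 * 1 + 2 * vol TYPE('a) * ((r k) powr (-2) * 1) = (1 + 2 * vol TYPE('a)) / (r k)\<^sup>2"
    by (simp add: powr_minus field_simps)
  finally show ?thesis .
qed

text \<open>On a single scale the constant \<open>\<Phi> = 1\<close> is good enough; the average of \<open>g\<^sup>2\<close> costs \<open>1 / (r k)\<^sup>2\<close> by
  \<open>A_g2_le\<close>.\<close>

lemma cavg_L2:
  assumes h[measurable]: "h \<in> borel_measurable borel"
  shows "(\<integral>\<^sup>+z. G z * (A k h z)\<^sup>2 \<partial>lborel)
    \<le> ennreal (2 * vol TYPE('a) * ((1 + 2 * vol TYPE('a)) / (r k)\<^sup>2)) * (\<integral>\<^sup>+z. (h z)\<^sup>2 \<partial>lborel)"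
proof -
  have "(\<integral>\<^sup>+z. G z * (\<integral>\<^sup>+w. kcyl (r k) z w * h w \<partial>lborel)\<^sup>2 \<partial>lborel)
    \<le> ennreal (2 * vol TYPE('a) * ((1 + 2 * vol TYPE('a)) / (r k)\<^sup>2)) * (\<integral>\<^sup>+z. (h z)\<^sup>2 \<partial>lborel)"
  proof (rule schur_test[where \<Phi> = "\<lambda>_. 1" and q = "\<lambda>_. 1"])
    show "(\<integral>\<^sup>+z. G z * ennreal 1 * kcyl (r k) z w \<partial>lborel) \<le> ennreal ((1 + 2 * vol TYPE('a)) / (r k)\<^sup>2) * 1" for w
      using A_g2_le[of k w] by (simp add: cavg_def kcyl_sym[of _ w] mult.commute)
  qed (auto simp: integral_kcyl kcyl_measurable' intro!: divide_nonneg_nonneg add_nonneg_nonneg)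
  then show ?thesis by (simp add: cavg_def)
qed

text \<open>The analogue of \<open>A_W'\<close> for a time slice. The small scales now lose a factor \<open>(r j)\<^sup>2 / (r k)\<^sup>2\<close>, and it is
  here that the exponent \<open>s > 2\<close> in the definition of \<open>W\<close> is used in full.\<close>

lemma slice_W':
  assumes j: "j \<ge> 1" and t: "\<bar>t - \<tau>\<bar> \<le> (r j)\<^sup>2"
  shows "savg (r j) (\<lambda>y. W' (\<tau>, y)) x \<le> ennreal (cA * W (t, x))"
proof -
  have [measurable]: "(\<lambda>y. A k \<mu> (\<tau>, y)) \<in> borel_measurable borel" for k
  proof -
    have "(\<lambda>y::'a. (\<tau>, y)) \<in> borel \<rightarrow>\<^sub>M borel" by (intro borel_measurable_continuous_onI continuous_intros)
    then show ?thesis by measurable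
  qed
  have SA: "savg (r j) (\<lambda>y. A k \<mu> (\<tau>, y)) x = (\<integral>\<^sup>+w. (\<integral>\<^sup>+y. kball (r j) x y * kcyl (r k) (\<tau>, y) w \<partial>lborel) * \<mu> w \<partial>lborel)" for k
  proof -
    have [measurable]: "(\<lambda>(y::'a, w::real\<times>'a). kcyl (r k) (\<tau>, y) w) \<in> borel_measurable (borel \<Otimes>\<^sub>M borel)"
    proof -
      have "(\<lambda>x::'a \<times> (real \<times> 'a). (\<tau>, fst x)) \<in> borel \<rightarrow>\<^sub>M borel" by (intro borel_measurable_continuous_onI continuous_intros)
      then have [measurable]: "(\<lambda>x::'a \<times> (real \<times> 'a). (\<tau>, fst x)) \<in> borel \<Otimes>\<^sub>M borel \<rightarrow>\<^sub>M borel" by (simp add: borel_prod)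
      show ?thesis unfolding case_prod_beta by measurable
    qed
    have "savg (r j) (\<lambda>y. A k \<mu> (\<tau>, y)) x = (\<integral>\<^sup>+y. (\<integral>\<^sup>+w. kball (r j) x y * kcyl (r k) (\<tau>, y) w * \<mu> w \<partial>lborel) \<partial>lborel)"
      unfolding savg_def cavg_def by (intro nn_integral_cong) (simp add: nn_integral_cmult[symmetric] mult.assoc)
    also have "\<dots> = (\<integral>\<^sup>+w. (\<integral>\<^sup>+y. kball (r j) x y * kcyl (r k) (\<tau>, y) w * \<mu> w \<partial>lborel) \<partial>lborel)"
      by (rule nn_integral_swap) (simp add: pair_borel[symmetric])
    also have "\<dots> = (\<integral>\<^sup>+w. (\<integral>\<^sup>+y. kball (r j) x y * kcyl (r k) (\<tau>, y) w \<partial>lborel) * \<mu> w \<partial>lborel)"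
      by (intro nn_integral_cong nn_integral_multc) auto
    finally show ?thesis .
  qed
  have eq: "savg (r j) (\<lambda>y. W' (\<tau>, y)) x = (\<integral>\<^sup>+y. kball (r j) x y * ennreal (\<rho> powr (- \<sigma>)) \<partial>lborel)
     + (\<Sum>k. ennreal (r (Suc k) powr s) * savg (r j) (\<lambda>y. A (Suc k) \<mu> (\<tau>, y)) x)"
    unfolding savg_def W'_def distrib_left
    by (subst nn_integral_add, simp, simp)
       (simp add: nn_integral_suminf[symmetric] nn_integral_cmult[symmetric] ennreal_suminf_cmult[symmetric] mult_ac del: ennreal_suminf_cmult)
  have le1: "(\<integral>\<^sup>+y. kball (r j) x y * ennreal (\<rho> powr (- \<sigma>)) \<partial>lborel) \<le> ennreal (2 * vol TYPE('a)) * ennreal (\<rho> powr (- \<sigma>))"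
    by (subst nn_integral_multc) (auto simp: integral_kball intro!: mult_right_mono ennreal_leI)
  have le2: "(\<Sum>k. (\<lambda>k. ennreal (r k powr s) * savg (r j) (\<lambda>y. A k \<mu> (\<tau>, y)) x) (Suc k)) \<le> ennreal (dconst TYPE('a)) * (ennreal (1 + Kq) * E j (t, x))"
    unfolding E_def
  proof (rule split_sum[OF j])
    fix k assume k: "k < j"
    have "savg (r j) (\<lambda>y. A (Suc k) \<mu> (\<tau>, y)) x \<le> (\<integral>\<^sup>+w. (ennreal (dconst TYPE('a)) * kcyl (2 * r (Suc k)) (t, x) w) * \<mu> w \<partial>lborel)"
      unfolding SA using k t by (intro nn_integral_mono mult_right_mono kball_kcyl_large) (auto intro: r_antimono)
    also have "\<dots> = ennreal (dconst TYPE('a)) * A k \<mu> (t, x)"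
      unfolding cavg_def by (subst nn_integral_cmult[symmetric]) (auto simp: mult.assoc r_Suc)
    finally have "ennreal (r (Suc k) powr s) * savg (r j) (\<lambda>y. A (Suc k) \<mu> (\<tau>, y)) x \<le> ennreal (r (Suc k) powr s) * (ennreal (dconst TYPE('a)) * A k \<mu> (t, x))"
      by (intro mult_left_mono) auto
    then show "ennreal (r (Suc k) powr s) * savg (r j) (\<lambda>y. A (Suc k) \<mu> (\<tau>, y)) x \<le> ennreal (dconst TYPE('a)) * (ennreal (r (Suc k) powr s) * A k \<mu> (t, x))"
      by (simp add: mult_ac)
  next
    fix k assume k: "j \<le> k"
    let ?c = "dconst TYPE('a) * (r j)\<^sup>2 / (r (Suc k))\<^sup>2"
    have "savg (r j) (\<lambda>y. A (Suc k) \<mu> (\<tau>, y)) x \<le> (\<integral>\<^sup>+w. (ennreal ?c * kcyl (2 * r j) (t, x) w) * \<mu> w \<partial>lborel)"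
      unfolding SA using k t by (intro nn_integral_mono mult_right_mono kball_kcyl_small) (auto intro: r_antimono)
    also have "\<dots> = ennreal ?c * A (j - 1) \<mu> (t, x)"
      unfolding cavg_def by (subst nn_integral_cmult[symmetric]) (auto simp: mult.assoc r_double[OF j])
    finally have "ennreal (r (Suc k) powr s) * savg (r j) (\<lambda>y. A (Suc k) \<mu> (\<tau>, y)) x \<le> ennreal (r (Suc k) powr s) * (ennreal ?c * A (j - 1) \<mu> (t, x))"
      by (intro mult_left_mono) auto
    also have "\<dots> = ennreal (r (Suc k) powr s * ?c) * A (j - 1) \<mu> (t, x)"
    proof -
      have "?c \<ge> 0" using dconst_pos[where 'a = 'a] by simp
      then show ?thesis by (simp only: ennreal_mult[OF powr_ge_zero] mult.assoc)
    qed
    also have "r (Suc k) powr s * ?c = dconst TYPE('a) * (r (Suc k) powr \<sigma> * (r j)\<^sup>2)"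
      by (simp add: s_eq(1) powr_add)
    also have "ennreal \<dots> * A (j - 1) \<mu> (t, x) = ennreal (dconst TYPE('a)) * (ennreal (r (Suc k) powr \<sigma> * (r j)\<^sup>2) * A (j - 1) \<mu> (t, x))"
      using dconst_pos[where 'a = 'a] by (simp add: ennreal_mult mult.assoc)
    finally show "ennreal (r (Suc k) powr s) * savg (r j) (\<lambda>y. A (Suc k) \<mu> (\<tau>, y)) x \<le> ennreal (dconst TYPE('a)) * (ennreal (r (Suc k) powr \<sigma> * (r j)\<^sup>2) * A (j - 1) \<mu> (t, x))" .
  qed
  show ?thesis unfolding eq by (intro bounds_from_E(1)[OF j] add_mono le1 le2)
qed

text \<open>Concavity of \<open>\<lambda>w. w powr \<kappa>\<close>, in the form of its tangent inequality at the value \<open>\<beta>\<close>, carries the bound of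
  \<open>slice_W'\<close> over to \<open>\<Phi>\<close>.\<close>

lemma slice_\<Phi>:
  assumes j: "j \<ge> 1" and t: "\<bar>t - \<tau>\<bar> \<le> (r j)\<^sup>2"
  shows "savg (r j) (\<lambda>y. ennreal (\<Phi> (\<tau>, y))) x \<le> ennreal ((1 + cA) * (1 + vol TYPE('a)) * \<Phi> (t, x))"
proof -
  have [measurable]: "(\<lambda>y. W' (\<tau>, y)) \<in> borel_measurable borel"
  proof -
    have "(\<lambda>y::'a. (\<tau>, y)) \<in> borel \<rightarrow>\<^sub>M borel" by (intro borel_measurable_continuous_onI continuous_intros)
    then show ?thesis by measurable
  qed
  define \<beta> where "\<beta> = cA * W (t, x)"
  have \<beta>: "\<beta> > 0" using cA_pos W_pos[of "(t, x)"] by (simp add: \<beta>_def)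
  have pw: "\<Phi> w \<le> \<beta> powr \<kappa> * (\<kappa> / \<beta> * W w + 1)" for w
  proof -
    have "(W w / \<beta>) powr \<kappa> * 1 powr (1 - \<kappa>) \<le> \<kappa> * (W w / \<beta>) + (1 - \<kappa>) * 1"
      using \<kappa> W_pos[of w] \<beta> by (intro Youngs_inequality_0) auto
    then have "\<Phi> w / \<beta> powr \<kappa> \<le> \<kappa> / \<beta> * W w + 1" using \<kappa> W_pos[of w] \<beta> by (simp add: powr_divide \<Phi>_def)
    then have "\<Phi> w \<le> (\<kappa> / \<beta> * W w + 1) * \<beta> powr \<kappa>" using \<beta> by (subst (asm) pos_divide_le_eq) auto
    then show ?thesis by (simp add: mult.commute)
  qed
  have "savg (r j) (\<lambda>y. ennreal (\<Phi> (\<tau>, y))) x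
     \<le> (\<integral>\<^sup>+y. ennreal (\<beta> powr \<kappa> * (\<kappa> / \<beta>)) * (kball (r j) x y * W' (\<tau>, y)) + ennreal (\<beta> powr \<kappa>) * kball (r j) x y \<partial>lborel)"
    unfolding savg_def
  proof (intro nn_integral_mono)
    fix y
    have "ennreal (\<Phi> (\<tau>, y)) \<le> ennreal (\<beta> powr \<kappa> * (\<kappa> / \<beta>)) * W' (\<tau>, y) + ennreal (\<beta> powr \<kappa>)"
      unfolding W'_eq using pw[of "(\<tau>, y)"] \<beta> \<kappa> W_pos[of "(\<tau>, y)"]
      by (simp add: ennreal_mult[symmetric] ennreal_plus[symmetric] distrib_left mult.assoc ennreal_leI less_imp_le del: ennreal_plus)
    then have "kball (r j) x y * ennreal (\<Phi> (\<tau>, y)) \<le> kball (r j) x y * (ennreal (\<beta> powr \<kappa> * (\<kappa> / \<beta>)) * W' (\<tau>, y) + ennreal (\<beta> powr \<kappa>))"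
      by (intro mult_left_mono) auto
    then show "kball (r j) x y * ennreal (\<Phi> (\<tau>, y)) \<le> ennreal (\<beta> powr \<kappa> * (\<kappa> / \<beta>)) * (kball (r j) x y * W' (\<tau>, y)) + ennreal (\<beta> powr \<kappa>) * kball (r j) x y"
      by (simp add: distrib_left mult_ac)
  qed
  also have "\<dots> = ennreal (\<beta> powr \<kappa> * (\<kappa> / \<beta>)) * savg (r j) (\<lambda>y. W' (\<tau>, y)) x + ennreal (\<beta> powr \<kappa>) * ennreal (vol TYPE('a))"
    unfolding savg_def by (subst nn_integral_add) (auto simp: nn_integral_cmult integral_kball)
  also have "\<dots> \<le> ennreal (\<beta> powr \<kappa> * (\<kappa> / \<beta>)) * ennreal \<beta> + ennreal (\<beta> powr \<kappa>) * ennreal (vol TYPE('a))"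
    unfolding \<beta>_def by (intro add_mono mult_left_mono slice_W' assms) auto
  also have "\<dots> = ennreal (\<beta> powr \<kappa> * (\<kappa> + vol TYPE('a)))"
    using \<beta> \<kappa> by (simp add: ennreal_mult[symmetric] ennreal_plus[symmetric] distrib_left del: ennreal_plus)
  also have "\<dots> \<le> ennreal ((1 + cA) * (1 + vol TYPE('a)) * \<Phi> (t, x))"
  proof (rule ennreal_leI)
    have cA1: "cA powr \<kappa> \<le> 1 + cA"
    proof -
      have "cA powr \<kappa> \<le> (1 + cA) powr \<kappa>" using cA_pos \<kappa> by (intro powr_mono2) auto
      also have "\<dots> \<le> (1 + cA) powr 1" using cA_pos \<kappa> by (intro powr_mono) auto
      finally show ?thesis using cA_pos by simp
    qed
    have "\<beta> powr \<kappa> * (\<kappa> + vol TYPE('a)) = (cA powr \<kappa> * \<Phi> (t, x)) * (\<kappa> + vol TYPE('a))"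
      using cA_pos W_pos[of "(t, x)"] by (simp add: \<beta>_def \<Phi>_def powr_mult)
    also have "\<dots> \<le> ((1 + cA) * \<Phi> (t, x)) * (1 + vol TYPE('a))"
      using cA1 \<kappa> \<Phi>_pos[of "(t, x)"] cA_pos by (intro mult_mono mult_right_mono) auto
    finally show "\<beta> powr \<kappa> * (\<kappa> + vol TYPE('a)) \<le> (1 + cA) * (1 + vol TYPE('a)) * \<Phi> (t, x)" by (simp add: mult_ac)
  qed
  finally show ?thesis .
qed

definition KTr :: "real \<Rightarrow> real \<times> 'a \<Rightarrow> 'a \<Rightarrow> ennreal" where
  "KTr \<tau> z y = (\<Sum>k. indicator (slab \<tau> (k + 2)) (fst z) * kball (r (k + 2)) (snd z) y)"

lemma KTr_meas: "case_prod (KTr \<tau>) \<in> borel_measurable (borel \<Otimes>\<^sub>M borel)"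
proof -
  have [measurable]: "fst \<in> (borel :: (real \<times> 'a) measure) \<rightarrow>\<^sub>M borel" "snd \<in> (borel :: (real \<times> 'a) measure) \<rightarrow>\<^sub>M borel"
    by (intro borel_measurable_continuous_onI continuous_intros)+
  have [measurable]: "slab \<tau> k \<in> sets borel" for k by (simp add: slab_def)
  show ?thesis unfolding KTr_def by measurable
qed

lemma trace_potential_eq: "f \<in> borel_measurable borel \<Longrightarrow> trace_potential \<tau> f z = (\<integral>\<^sup>+y. KTr \<tau> z y * f y \<partial>lborel)"
  unfolding trace_potential_def KTr_def savg_def
  by (subst ennreal_suminf_multc[symmetric], subst nn_integral_suminf)
     (auto intro!: suminf_cong simp: nn_integral_cmult[symmetric] mult.assoc)

text \<open>Schur's test between space-time and the slice at time \<open>\<tau>\<close>, with \<open>q\<close> the restriction of \<open>\<Phi>\<close> to that slice. One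
  condition is \<open>slice_\<Phi>\<close>. For the other, the kernel is dominated by that of the second order
  potential centred at \<open>(\<tau>, y)\<close>: a ball kernel is \<open>r\<^sup>2\<close> times a cylinder kernel.\<close>

lemma trace_potential_L2:
  assumes h[measurable]: "h \<in> borel_measurable borel"
  shows "(\<integral>\<^sup>+z. G z * (trace_potential \<tau> h z)\<^sup>2 \<partial>lborel)
    \<le> ennreal ((1 + cA) * (1 + vol TYPE('a)) * cB) * (\<integral>\<^sup>+y. (h y)\<^sup>2 \<partial>lborel)"
proof -
  have pair: "(\<lambda>y::'a. (\<tau>, y)) \<in> borel \<rightarrow>\<^sub>M borel" by (intro borel_measurable_continuous_onI continuous_intros)
  have [measurable]: "(\<lambda>y. \<Phi> (\<tau>, y)) \<in> borel_measurable borel"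
    using measurable_compose[OF pair \<Phi>_meas] by simp
  note KTr_meas[measurable]
  have "(\<integral>\<^sup>+z. G z * (\<integral>\<^sup>+y. KTr \<tau> z y * h y \<partial>lborel)\<^sup>2 \<partial>lborel)
    \<le> ennreal ((1 + cA) * (1 + vol TYPE('a)) * cB) * (\<integral>\<^sup>+y. (h y)\<^sup>2 \<partial>lborel)"
  proof (rule schur_test[where \<Phi> = \<Phi> and q = "\<lambda>y. ennreal (\<Phi> (\<tau>, y))"])
    show "case_prod (KTr \<tau>) \<in> borel_measurable borel" using KTr_meas by (simp add: pair_borel)
    show "(\<integral>\<^sup>+y. KTr \<tau> z y * ennreal (\<Phi> (\<tau>, y)) \<partial>lborel) \<le> ennreal ((1 + cA) * (1 + vol TYPE('a)) * \<Phi> z)" for z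
    proof (cases "\<exists>k. fst z \<in> slab \<tau> (k + 2)")
      case True
      then obtain k where k: "fst z \<in> slab \<tau> (k + 2)" by blast
      have "\<bar>fst z - \<tau>\<bar> \<le> (r (k + 2))\<^sup>2"
        using k zero_le_power2[of "r (Suc (k + 2))"] unfolding slab_def greaterThanAtMost_iff by linarith
      then have "savg (r (k + 2)) (\<lambda>y. ennreal (\<Phi> (\<tau>, y))) (snd z) \<le> ennreal ((1 + cA) * (1 + vol TYPE('a)) * \<Phi> (fst z, snd z))"
        by (intro slice_\<Phi>) auto
      then show ?thesis using trace_potential_single[OF k] by (simp add: trace_potential_eq[symmetric])
    next
      case False
      then have "KTr \<tau> z y = 0" for y by (simp add: KTr_def)
      then show ?thesis by simp
    qed
    show "(\<integral>\<^sup>+z. G z * ennreal (\<Phi> z) * KTr \<tau> z y \<partial>lborel) \<le> ennreal cB * ennreal (\<Phi> (\<tau>, y))" for y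
    proof -
      have le: "KTr \<tau> z y \<le> KB (\<tau>, y) z" for z
      proof -
        have "KTr \<tau> z y \<le> (\<Sum>k. ennreal ((r (Suc (k + 1)))\<^sup>2) * kcyl (r (Suc (k + 1))) (\<tau>, y) z)"
          unfolding KTr_def
        proof (intro suminf_le allI)
          fix k
          define R where "R = r (k + 2)"
          have R: "R > 0" by (simp add: R_def)
          show "indicator (slab \<tau> (k + 2)) (fst z) * kball (r (k + 2)) (snd z) y \<le> ennreal ((r (Suc (k + 1)))\<^sup>2) * kcyl (r (Suc (k + 1))) (\<tau>, y) z"
          proof (cases "fst z \<in> slab \<tau> (k + 2) \<and> y \<in> ball (snd z) R")
            case True
            have "(r (Suc (k + 2)))\<^sup>2 > 0" "R\<^sup>2 > 0" using R by simp_all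
            then have "\<bar>fst z - \<tau>\<bar> < R\<^sup>2"
              using True unfolding slab_def greaterThanAtMost_iff R_def[symmetric] by linarith
            then have "z \<in> cyl R (\<tau>, y)" using True by (auto simp: cyl_iff dist_norm)
            moreover have "1 / R ^ DIM('a) = R\<^sup>2 * (1 / R ^ (DIM('a) + 2))"
              using R by (simp add: power_add power2_eq_square)
            moreover have "r (k + 2) = R" "r (Suc (k + 1)) = R" by (simp_all add: R_def)
            ultimately show ?thesis using True R
              by (simp only:) (simp add: kball_def kcyl_def ennreal_mult[symmetric])
          qed (auto simp: kball_def R_def indicator_def)
        qed auto
        also have "\<dots> \<le> KB (\<tau>, y) z" unfolding KB_def
          by (subst (2) suminf_offset[where i = 1]) auto
        finally show ?thesis .
      qed
      have "(\<integral>\<^sup>+z. G z * ennreal (\<Phi> z) * KTr \<tau> z y \<partial>lborel) \<le> (\<integral>\<^sup>+z. KB (\<tau>, y) z * F z \<partial>lborel)"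
        unfolding F_pt
      proof (intro nn_integral_mono)
        fix z
        show "F z * KTr \<tau> z y \<le> KB (\<tau>, y) z * F z"
          using mult_right_mono[OF le[of z], of "F z"] by (simp add: mult.commute)
      qed
      also have "\<dots> \<le> ennreal cB * ennreal (\<Phi> (\<tau>, y))"
        using potential2_supersolution[of "(\<tau>, y)"] cB_pos by (simp add: potential2_eq ennreal_mult'[symmetric])
      finally show ?thesis .
    qed
  qed (use cA_pos cB_pos \<Phi>_pos in \<open>auto intro!: mult_pos_pos add_pos_nonneg\<close>)
  then show ?thesis by (simp add: trace_potential_eq)
qed

text \<open>
  One constant that dominates those of all four operators; in the average over cylinders of radius
  \<open>r 2\<close> the factor 16 is \<open>\<rho>\<^sup>2 / (r 2)\<^sup>2\<close>.
\<close>
definition C_schur :: real where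
  "C_schur = 4 * dconst TYPE('a) * cB + cB * cB + (1 + cA) * (1 + vol TYPE('a)) * cB + 2 * vol TYPE('a) * (1 + 2 * vol TYPE('a)) * 16"

end

section \<open>Symmetric matrices with eigenvalues in an interval\<close>

lemma symmetric_dot:
  fixes A :: "real ^ 'n ^ 'n"
  assumes "transpose A = A"
  shows "x \<bullet> (A *v y) = (A *v x) \<bullet> y"
  using dot_lmul_matrix[of x A y] assms by (metis transpose_matrix_vector)

text \<open>A minimiser of the quadratic form on the unit sphere is an eigenvector, since the form minus
  \<open>c \<bar>x\<bar>\<^sup>2\<close> is nonnegative and vanishes at \<open>v\<close>, so its first variation at \<open>v\<close> vanishes too.\<close>

lemma symmetric_min_eigenvector:
  fixes A :: "real ^ 'n ^ 'n"
  assumes sym: "transpose A = A"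
  obtains v c where "v \<noteq> 0" "A *v v = c *\<^sub>R v" "\<And>x. c * (norm x)\<^sup>2 \<le> x \<bullet> (A *v x)"
proof -
  have cont: "continuous_on (sphere 0 1) (\<lambda>x. x \<bullet> (A *v x))"
    by (intro continuous_intros matrix_vector_mult_linear_continuous_on)
  have "(sphere (0 :: real ^ 'n) 1) \<noteq> {}" by simp
  then obtain v where v: "v \<in> sphere 0 1" and min: "\<And>x. x \<in> sphere 0 1 \<Longrightarrow> v \<bullet> (A *v v) \<le> x \<bullet> (A *v x)"
    using continuous_attains_inf[OF compact_sphere _ cont] by blast
  define c where "c = v \<bullet> (A *v v)"
  have nv: "norm v = 1" using v by simp
  have Q: "c * (norm x)\<^sup>2 \<le> x \<bullet> (A *v x)" for x
  proof (cases "x = 0")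
    case False
    define y where "y = (1 / norm x) *\<^sub>R x"
    have "y \<in> sphere 0 1" using False by (simp add: y_def)
    then have "c \<le> y \<bullet> (A *v y)" unfolding c_def by (rule min)
    also have "\<dots> = (x \<bullet> (A *v x)) / (norm x)\<^sup>2"
      by (simp add: y_def matrix_vector_mult_scaleR power2_eq_square)
    finally show ?thesis using False by (simp add: pos_le_divide_eq)
  qed simp
  have "w \<bullet> (A *v v - c *\<^sub>R v) = 0" for w
  proof -
    define p where "p = w \<bullet> (A *v v - c *\<^sub>R v)"
    define e where "e = w \<bullet> (A *v w) - c * (norm w)\<^sup>2"
    have e0: "e \<ge> 0" using Q[of w] by (simp add: e_def)
    have ge: "0 \<le> 2 * t * p + t\<^sup>2 * e" for t
    proof -
      have sw: "v \<bullet> (A *v w) = w \<bullet> (A *v v)" using symmetric_dot[OF sym, of v w] by (simp add: inner_commute)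
      have "c * (norm (v + t *\<^sub>R w))\<^sup>2 \<le> (v + t *\<^sub>R w) \<bullet> (A *v (v + t *\<^sub>R w))" by (rule Q)
      also have "\<dots> = c + 2 * t * (w \<bullet> (A *v v)) + t\<^sup>2 * (w \<bullet> (A *v w))"
        by (simp add: matrix_vector_right_distrib matrix_vector_mult_scaleR inner_add_left inner_add_right sw c_def power2_eq_square algebra_simps)
      also have "c * (norm (v + t *\<^sub>R w))\<^sup>2 = c * (1 + 2 * t * (w \<bullet> v) + t\<^sup>2 * (norm w)\<^sup>2)"
      proof -
        have "(norm (v + t *\<^sub>R w))\<^sup>2 = (norm v)\<^sup>2 + 2 * (v \<bullet> (t *\<^sub>R w)) + (norm (t *\<^sub>R w))\<^sup>2"
          by (simp only: power2_norm_eq_inner inner_add_left inner_add_right inner_commute[of "t *\<^sub>R w" v])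
        then show ?thesis using nv by (simp add: inner_commute power_mult_distrib)
      qed
      finally show ?thesis by (simp add: p_def e_def inner_diff_right algebra_simps)
    qed
    show "p = 0"
    proof (cases "e = 0")
      case True
      then show ?thesis using ge[of 1] ge[of "-1"] by simp
    next
      case False
      then have e: "e > 0" using e0 by simp
      have "0 \<le> 2 * (- p / e) * p + (- p / e)\<^sup>2 * e" by (rule ge)
      also have "\<dots> = - (p\<^sup>2 / e)" using e by (simp add: power2_eq_square field_simps)
      finally have "p\<^sup>2 / e \<le> 0" by simp
      then show ?thesis using e by (simp add: divide_le_0_iff)
    qed
  qed
  then have "A *v v - c *\<^sub>R v = 0" using inner_eq_zero_iff by blast
  moreover have "v \<noteq> 0" using nv by auto
  ultimately show ?thesis using that[of v c] Q by simp
qed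

lemma S_delta_coercive:
  assumes "A \<in> S_delta \<delta>"
  shows "\<delta> * (norm x)\<^sup>2 \<le> x \<bullet> (A *v x)"
proof -
  have sym: "transpose A = A" and ev: "\<And>c. eigenvalue A c \<Longrightarrow> \<delta> \<le> c"
    using assms by (auto simp: S_delta_def)
  obtain v c where v: "v \<noteq> 0" "A *v v = c *\<^sub>R v" and Q: "\<And>x. c * (norm x)\<^sup>2 \<le> x \<bullet> (A *v x)"
    using symmetric_min_eigenvector[OF sym] by blast
  have "\<delta> \<le> c" using v by (intro ev) (auto simp: eigenvalue_def)
  then have "\<delta> * (norm x)\<^sup>2 \<le> c * (norm x)\<^sup>2" by (intro mult_right_mono) auto
  with Q show ?thesis by (rule order_trans[rotated])
qed

text \<open>The largest value \<open>s\<^sup>2\<close> of \<open>\<bar>A x\<bar>\<^sup>2\<close> on the unit sphere is an eigenvalue of \<open>A A\<close>, with eigenvector \<open>v\<close>.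
  Then \<open>A v + s v\<close> is an eigenvector of \<open>A\<close> for \<open>s\<close>, unless it vanishes, and it cannot vanish because
  \<open>- s \<le> 0\<close> is no eigenvalue. So \<open>s \<le> 1 / \<delta>\<close>.\<close>

lemma S_delta_norm_le:
  assumes A: "A \<in> S_delta \<delta>" and \<delta>: "\<delta> > 0"
  shows "norm (A *v x) \<le> norm x / \<delta>"
proof -
  have sym: "transpose A = A" and ev: "\<And>c. eigenvalue A c \<Longrightarrow> \<delta> \<le> c \<and> c \<le> inverse \<delta>"
    using A by (auto simp: S_delta_def)
  define B where "B = - (A ** A)"
  have "transpose (A ** A) = A ** A" by (simp add: matrix_transpose_mul sym)
  then have "transpose B = B" unfolding B_def by (simp add: transpose_def vec_eq_iff)
  then obtain v c where v: "v \<noteq> 0" "B *v v = c *\<^sub>R v" and Q: "\<And>x. c * (norm x)\<^sup>2 \<le> x \<bullet> (B *v x)"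
    using symmetric_min_eigenvector by blast
  have Bx: "B *v y = - (A *v (A *v y))" for y
  proof -
    have "B *v y + (A ** A) *v y = 0"
      by (simp add: matrix_vector_mult_add_rdistrib[symmetric] B_def)
    then show ?thesis by (simp add: matrix_vector_mul_assoc eq_neg_iff_add_eq_0)
  qed
  have xB: "y \<bullet> (B *v y) = - (norm (A *v y))\<^sup>2" for y
    using symmetric_dot[OF sym, of y "A *v y"] by (simp add: Bx power2_norm_eq_inner)
  have AA: "A *v (A *v v) = (- c) *\<^sub>R v" using v(2) by (simp add: Bx) (metis minus_minus scaleR_minus_left)
  have c: "c \<le> 0"
  proof -
    have "c * (norm v)\<^sup>2 = - (norm (A *v v))\<^sup>2" using v(2) xB[of v] by (simp add: power2_norm_eq_inner)
    then have "c * (norm v)\<^sup>2 \<le> 0" by simp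
    moreover have "(norm v)\<^sup>2 > 0" using v(1) by simp
    ultimately show ?thesis by (metis mult_le_0_iff not_less)
  qed
  define s where "s = sqrt (- c)"
  have s: "s \<ge> 0" "s * s = - c" using c by (auto simp: s_def)
  define w where "w = A *v v + s *\<^sub>R v"
  have Aw: "A *v w = s *\<^sub>R w"
    using AA by (simp add: w_def matrix_vector_right_distrib matrix_vector_mult_scaleR scaleR_add_right s(2)[symmetric])
  have "w \<noteq> 0"
  proof
    assume "w = 0"
    then have "A *v v = (- s) *\<^sub>R v" by (simp add: w_def eq_neg_iff_add_eq_0)
    then have "\<delta> \<le> - s" using ev[of "- s"] v(1) by (auto simp: eigenvalue_def)
    then show False using s \<delta> by simp
  qed
  then have "s \<le> inverse \<delta>" using ev[of s] Aw by (auto simp: eigenvalue_def)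
  then have ss: "s * s \<le> inverse \<delta> * inverse \<delta>" using s \<delta> by (intro mult_mono) auto
  have "(norm (A *v x))\<^sup>2 \<le> (inverse \<delta> * inverse \<delta>) * (norm x)\<^sup>2"
  proof -
    have "(norm (A *v x))\<^sup>2 \<le> (s * s) * (norm x)\<^sup>2" using Q[of x] xB[of x] s(2) by simp
    also have "\<dots> \<le> (inverse \<delta> * inverse \<delta>) * (norm x)\<^sup>2"
      using ss by (intro mult_right_mono) auto
    finally show ?thesis .
  qed
  also have "\<dots> = (norm x / \<delta>)\<^sup>2"
    unfolding divide_inverse power_mult_distrib by (simp only: power2_eq_square mult.commute)
  finally have *: "(norm (A *v x))\<^sup>2 \<le> (norm x / \<delta>)\<^sup>2" .
  show ?thesis by (rule power2_le_imp_le[OF *]) (simp add: less_imp_le[OF \<delta>])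
qed

section \<open>Partial derivatives and gradients\<close>

lemma axis_line_deriv:
  fixes f :: "real ^ 'd::finite \<Rightarrow> real"
  assumes "\<And>x. f differentiable (at x)"
  shows "((\<lambda>s. f (x + s *\<^sub>R axis i 1)) has_real_derivative partial_deriv i f (x + s *\<^sub>R axis i 1)) (at s)"
proof -
  have D: "(\<lambda>s. f (y + s *\<^sub>R axis i 1)) field_differentiable (at s)" for y s
  proof -
    have "(\<lambda>s::real. f (y + s *\<^sub>R axis i 1)) differentiable (at s)"
      by (rule differentiable_chain_at[unfolded o_def, of "\<lambda>s. y + s *\<^sub>R axis i 1" s f]) (auto intro!: derivative_intros assms)
    then show ?thesis by (simp add: field_differentiable_def real_differentiable_def)
  qed
  have "((\<lambda>h. f ((x + s *\<^sub>R axis i 1) + h *\<^sub>R axis i 1)) has_real_derivative partial_deriv i f (x + s *\<^sub>R axis i 1)) (at 0)"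
    unfolding partial_deriv_def by (rule field_differentiable_derivI[OF D])
  then have "((\<lambda>h. f (x + (h + s) *\<^sub>R axis i 1)) has_real_derivative partial_deriv i f (x + s *\<^sub>R axis i 1)) (at 0)"
    by (simp add: algebra_simps)
  then show ?thesis
    using DERIV_shift[of "\<lambda>s. f (x + s *\<^sub>R axis i 1)" "partial_deriv i f (x + s *\<^sub>R axis i 1)" 0 s] by simp
qed

lemma axis_line_deriv0:
  fixes f :: "real ^ 'd::finite \<Rightarrow> real"
  assumes "\<And>x. f differentiable (at x)"
  shows "((\<lambda>s. f (x + s *\<^sub>R axis i 1)) has_real_derivative partial_deriv i f x) (at 0)"
  using axis_line_deriv[OF assms, of x i 0] by simp

lemma partial_derivI:
  "((\<lambda>s. f (x + s *\<^sub>R axis i 1)) has_real_derivative D) (at 0) \<Longrightarrow> partial_deriv i f x = D"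
  unfolding partial_deriv_def by (rule DERIV_imp_deriv)

lemma has_derivative_partial:
  fixes f :: "real ^ 'd::finite \<Rightarrow> real"
  assumes "(f has_derivative F) (at x)"
  shows "partial_deriv i f x = F (axis i 1)"
proof (rule partial_derivI)
  have "((\<lambda>s. x + s *\<^sub>R axis i 1) has_derivative (\<lambda>s. s *\<^sub>R axis i 1)) (at 0)"
    by (auto intro!: derivative_eq_intros)
  moreover have "(f has_derivative F) (at (x + 0 *\<^sub>R axis i 1))" using assms by simp
  ultimately have "((\<lambda>s. f (x + s *\<^sub>R axis i 1)) has_derivative (\<lambda>s. F (s *\<^sub>R axis i 1))) (at 0)"
    by (rule has_derivative_compose)
  moreover have "F (s *\<^sub>R axis i 1) = F (axis i 1) * s" for s
    using has_derivative_linear[OF assms] by (simp add: linear_cmul)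
  ultimately show "((\<lambda>s. f (x + s *\<^sub>R axis i 1)) has_real_derivative F (axis i 1)) (at 0)"
    by (simp add: has_field_derivative_def)
qed

lemma has_derivative_gradient:
  fixes f :: "real ^ 'd::finite \<Rightarrow> real"
  assumes "f differentiable (at x)"
  shows "(f has_derivative (\<lambda>h. gradient f x \<bullet> h)) (at x)"
proof -
  obtain F where F: "(f has_derivative F) (at x)" using assms by (auto simp: differentiable_def)
  have "F h = gradient f x \<bullet> h" for h
  proof -
    have "F h = F (\<Sum>i\<in>UNIV. (h $ i) *\<^sub>R axis i 1)"
      by (simp add: basis_expansion scalar_mult_eq_scaleR[symmetric])
    also have "\<dots> = (\<Sum>i\<in>UNIV. (h $ i) * F (axis i 1))"
      using has_derivative_linear[OF F] by (simp add: linear_sum linear_cmul)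
    also have "\<dots> = gradient f x \<bullet> h"
      by (simp add: inner_vec_def gradient_def has_derivative_partial[OF F] mult.commute)
    finally show ?thesis .
  qed
  then have "F = (\<lambda>h. gradient f x \<bullet> h)" by auto
  then show ?thesis using F by simp
qed

lemma partial_deriv_mult:
  fixes f g :: "real ^ 'd::finite \<Rightarrow> real"
  assumes f: "\<And>x. f differentiable (at x)" and g: "\<And>x. g differentiable (at x)"
  shows "partial_deriv i (\<lambda>y. f y * g y) x = partial_deriv i f x * g x + f x * partial_deriv i g x"
  using DERIV_mult[OF axis_line_deriv0[OF f, of x i] axis_line_deriv0[OF g, of x i]]
  by (intro partial_derivI) (simp add: mult.commute)

lemma partial_deriv_power:
  fixes f :: "real ^ 'd::finite \<Rightarrow> real"
  assumes f: "\<And>x. f differentiable (at x)"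
  shows "partial_deriv i (\<lambda>y. f y ^ k) x = real k * f x ^ (k - 1) * partial_deriv i f x"
  using DERIV_power[OF axis_line_deriv0[OF f, of x i], of k]
  by (intro partial_derivI) (simp add: mult_ac)

lemma partial_deriv_add:
  fixes f g :: "real ^ 'd::finite \<Rightarrow> real"
  assumes f: "\<And>x. f differentiable (at x)" and g: "\<And>x. g differentiable (at x)"
  shows "partial_deriv i (\<lambda>y. f y + g y) x = partial_deriv i f x + partial_deriv i g x"
  using DERIV_add[OF axis_line_deriv0[OF f, of x i] axis_line_deriv0[OF g, of x i]]
  by (intro partial_derivI) simp

lemma differentiable_imp_measurable:
  fixes f :: "real ^ 'd::finite \<Rightarrow> real"
  assumes f: "\<And>x. f differentiable (at x)"
  shows "f \<in> borel_measurable borel"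
  using assms by (intro borel_measurable_continuous_onI) (auto intro: differentiable_imp_continuous_on simp: continuous_on_eq_continuous_at differentiable_imp_continuous_within)

lemma partial_deriv_LIMSEQ:
  fixes f :: "real ^ 'd::finite \<Rightarrow> real"
  assumes f: "\<And>x. f differentiable (at x)"
  shows "(\<lambda>n. real (Suc n) * (f (x + (1 / real (Suc n)) *\<^sub>R axis i 1) - f x)) \<longlonglongrightarrow> partial_deriv i f x"
proof -
  have "((\<lambda>s. (f (x + s *\<^sub>R axis i 1) - f x) / s) \<longlongrightarrow> partial_deriv i f x) (at 0)"
    using axis_line_deriv0[OF f, of x i] by (simp add: has_field_derivative_iff)
  moreover have "filterlim (\<lambda>n. 1 / real (Suc n)) (at 0) sequentially"
    unfolding filterlim_at using LIMSEQ_inverse_real_of_nat by (auto simp: inverse_eq_divide)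
  ultimately have "(\<lambda>n. (f (x + (1 / real (Suc n)) *\<^sub>R axis i 1) - f x) / (1 / real (Suc n))) \<longlonglongrightarrow> partial_deriv i f x"
    by (rule filterlim_compose)
  then show ?thesis by (simp add: mult.commute)
qed

lemma partial_deriv_measurable:
  fixes f :: "real ^ 'd::finite \<Rightarrow> real"
  assumes f: "\<And>x. f differentiable (at x)"
  shows "partial_deriv i f \<in> borel_measurable borel"
proof (rule borel_measurable_LIMSEQ_metric)
  fix n
  have [measurable]: "f \<in> borel_measurable borel" by (rule differentiable_imp_measurable[OF f])
  show "(\<lambda>x. real (Suc n) * (f (x + (1 / real (Suc n)) *\<^sub>R axis i 1) - f x)) \<in> borel_measurable borel"
    by measurable
qed (rule partial_deriv_LIMSEQ[OF f])

section \<open>Bounded and exponentially decaying differentiable functions\<close>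

definition bdd_diff :: "(real ^ 'd::finite \<Rightarrow> real) \<Rightarrow> bool" where
  "bdd_diff f \<longleftrightarrow> (\<forall>x. f differentiable (at x)) \<and> (\<exists>M. \<forall>x. \<bar>f x\<bar> \<le> M \<and> (\<forall>i. \<bar>partial_deriv i f x\<bar> \<le> M))"

lemma bdd_diff_D: "bdd_diff f \<Longrightarrow> f differentiable (at x)" by (simp add: bdd_diff_def)

lemma bdd_diff_bound: assumes "bdd_diff f" obtains M where "M \<ge> 0" "\<And>x. \<bar>f x\<bar> \<le> M" "\<And>x i. \<bar>partial_deriv i f x\<bar> \<le> M"
proof -
  obtain M where M: "\<And>x. \<bar>f x\<bar> \<le> M \<and> (\<forall>i. \<bar>partial_deriv i f x\<bar> \<le> M)" using assms by (auto simp: bdd_diff_def)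
  have "M \<ge> 0" using M[of 0] by linarith
  with M that show ?thesis by blast
qed

lemma bdd_diffI:
  assumes "\<And>x. f differentiable (at x)" "\<And>x. \<bar>f x\<bar> \<le> M" "\<And>i. \<exists>M. \<forall>x. \<bar>partial_deriv i f x\<bar> \<le> M"
  shows "bdd_diff f"
proof -
  obtain K where K: "\<And>i x. \<bar>partial_deriv i f x\<bar> \<le> K i" using assms(3) by metis
  define K' where "K' = (\<Sum>i\<in>UNIV. \<bar>K i\<bar>)"
  have "\<bar>partial_deriv i f x\<bar> \<le> K'" for i x
  proof -
    have "\<bar>partial_deriv i f x\<bar> \<le> \<bar>K i\<bar>" using K[of i x] by simp
    also have "\<dots> \<le> K'" unfolding K'_def by (intro member_le_sum) auto
    finally show ?thesis .
  qed
  then show ?thesis unfolding bdd_diff_def using assms(1,2) by (intro conjI exI[of _ "max M K'"]) (auto simp: le_max_iff_disj)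
qed

lemma bdd_diff_const: "bdd_diff (\<lambda>_. c)"
proof (rule bdd_diffI[where M = "\<bar>c\<bar>"])
  have "partial_deriv i (\<lambda>_. c) x = 0" for i and x :: "real ^ 'a" by (rule partial_derivI) simp
  then show "\<exists>M. \<forall>x::real ^ 'a. \<bar>partial_deriv i (\<lambda>_. c) x\<bar> \<le> M" for i by auto
qed auto

lemma bdd_diff_add:
  assumes f: "bdd_diff f" and g: "bdd_diff g"
  shows "bdd_diff (\<lambda>x. f x + g x)"
proof -
  obtain M where M: "\<And>x. \<bar>f x\<bar> \<le> M" "\<And>x i. \<bar>partial_deriv i f x\<bar> \<le> M" by (rule bdd_diff_bound[OF f]) blast
  obtain K where K: "\<And>x. \<bar>g x\<bar> \<le> K" "\<And>x i. \<bar>partial_deriv i g x\<bar> \<le> K" by (rule bdd_diff_bound[OF g]) blast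
  show ?thesis
  proof (rule bdd_diffI[where M = "M + K"])
    show "(\<lambda>x. f x + g x) differentiable at x" for x using f g by (intro differentiable_add bdd_diff_D)
    show "\<bar>f x + g x\<bar> \<le> M + K" for x using M(1)[of x] K(1)[of x] by linarith
    have "\<bar>partial_deriv i (\<lambda>x. f x + g x) x\<bar> \<le> M + K" for i x
      using M(2)[of i x] K(2)[of i x] by (simp add: partial_deriv_add bdd_diff_D f g)
    then show "\<exists>M. \<forall>x. \<bar>partial_deriv i (\<lambda>x. f x + g x) x\<bar> \<le> M" for i by blast
  qed
qed

lemma bdd_diff_mult:
  assumes f: "bdd_diff f" and g: "bdd_diff g"
  shows "bdd_diff (\<lambda>x. f x * g x)"
proof -
  obtain M where M: "M \<ge> 0" "\<And>x. \<bar>f x\<bar> \<le> M" "\<And>x i. \<bar>partial_deriv i f x\<bar> \<le> M" by (rule bdd_diff_bound[OF f]) blast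
  obtain K where K: "K \<ge> 0" "\<And>x. \<bar>g x\<bar> \<le> K" "\<And>x i. \<bar>partial_deriv i g x\<bar> \<le> K" by (rule bdd_diff_bound[OF g]) blast
  show ?thesis
  proof (rule bdd_diffI[where M = "M * K"])
    show "(\<lambda>x. f x * g x) differentiable at x" for x using f g by (intro differentiable_mult bdd_diff_D)
    show "\<bar>f x * g x\<bar> \<le> M * K" for x using M K by (simp add: abs_mult mult_mono)
    have "\<bar>partial_deriv i (\<lambda>x. f x * g x) x\<bar> \<le> M * K + M * K" for i x
    proof -
      have "\<bar>partial_deriv i f x * g x + f x * partial_deriv i g x\<bar> \<le> \<bar>partial_deriv i f x\<bar> * \<bar>g x\<bar> + \<bar>f x\<bar> * \<bar>partial_deriv i g x\<bar>"
        by (rule order_trans[OF abs_triangle_ineq]) (simp add: abs_mult)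
      also have "\<dots> \<le> M * K + M * K" by (intro add_mono mult_mono M K abs_ge_zero)
      finally show ?thesis by (simp add: partial_deriv_mult bdd_diff_D f g)
    qed
    then show "\<exists>M. \<forall>x. \<bar>partial_deriv i (\<lambda>x. f x * g x) x\<bar> \<le> M" for i by blast
  qed
qed

lemma bdd_diff_power: "bdd_diff f \<Longrightarrow> bdd_diff (\<lambda>x. f x ^ k)"
  by (induction k) (auto intro: bdd_diff_mult bdd_diff_const)

lemma bdd_diff_sum: "finite S \<Longrightarrow> (\<And>k. k \<in> S \<Longrightarrow> bdd_diff (f k)) \<Longrightarrow> bdd_diff (\<lambda>x. \<Sum>k\<in>S. f k x)"
  by (induction S rule: finite_induct) (auto intro: bdd_diff_add bdd_diff_const)

lemma power_le_fact_exp: "(y::real) \<ge> 0 \<Longrightarrow> y ^ d \<le> fact d * exp y"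
proof -
  assume y: "y \<ge> 0"
  have "(\<Sum>n\<in>{d}. y ^ n / fact n) \<le> (\<Sum>n. y ^ n / fact n)"
    using y summable_exp[of y] by (intro sum_le_suminf) (auto simp: divide_inverse mult.commute)
  also have "\<dots> = exp y" by (simp add: exp_def divide_inverse mult.commute)
  finally show ?thesis by (simp add: divide_le_eq mult.commute)
qed

text \<open>On the shell \<open>n \<le> \<bar>x\<bar> < n + 1\<close> the integrand is at most \<open>exp (- \<mu> n)\<close>, while the volume grows only polynomially.\<close>

lemma integrable_exp_norm:
  fixes \<mu> :: real
  assumes "\<mu> > 0"
  shows "integrable lborel (\<lambda>x::'a::euclidean_space. exp (- \<mu> * norm x))"
proof (rule integrableI_bounded)
  show "(\<lambda>x::'a. exp (- \<mu> * norm x)) \<in> borel_measurable lborel" by measurable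
  define c where "c = (2 / \<mu>) ^ DIM('a) * fact DIM('a) * exp (\<mu> / 2) * vol TYPE('a)"
  have c: "c \<ge> 0" using assms by (simp add: c_def)
  have "(\<integral>\<^sup>+x. ennreal (norm (exp (- \<mu> * norm x))) \<partial>(lborel :: 'a measure))
     \<le> (\<integral>\<^sup>+x. (\<Sum>n. ennreal (exp (- \<mu> * real n)) * indicator (ball 0 (real n + 1)) x) \<partial>(lborel :: 'a measure))"
  proof (intro nn_integral_mono)
    fix x :: 'a
    define n where "n = nat \<lfloor>norm x\<rfloor>"
    have n: "real n \<le> norm x" "norm x < real n + 1" by (simp_all add: n_def)
    have "ennreal (norm (exp (- \<mu> * norm x))) \<le> ennreal (exp (- \<mu> * real n)) * indicator (ball 0 (real n + 1)) x"
      using n assms by (simp add: ennreal_leI)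
    also have "\<dots> = (\<Sum>k\<in>{n}. ennreal (exp (- \<mu> * real k)) * indicator (ball 0 (real k + 1)) x)"
      by (simp only: sum.insert[OF finite.emptyI] empty_iff not_False_eq_True sum.empty add_0_right)
    also have "\<dots> \<le> (\<Sum>n. ennreal (exp (- \<mu> * real n)) * indicator (ball 0 (real n + 1)) x)"
      by (rule sum_le_suminf) auto
    finally show "ennreal (norm (exp (- \<mu> * norm x))) \<le> (\<Sum>n. ennreal (exp (- \<mu> * real n)) * indicator (ball 0 (real n + 1)) x)" .
  qed
  also have "\<dots> = (\<Sum>n. ennreal (exp (- \<mu> * real n)) * ennreal (vol TYPE('a) * (real n + 1) ^ DIM('a)))"
  proof -
    have meas: "(\<lambda>x. ennreal (exp (- \<mu> * real n)) * indicator (ball 0 (real n + 1)) x) \<in> borel_measurable (lborel :: 'a measure)" for n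
      by (intro borel_measurable_times_ennreal borel_measurable_indicator borel_measurable_const) auto
    show ?thesis
      by (subst nn_integral_suminf[OF meas]) (auto simp: nn_integral_cmult_indicator emeasure_ball)
  qed
  also have "\<dots> \<le> (\<Sum>n. ennreal c * ennreal (exp (- \<mu> / 2) ^ n))"
  proof (intro suminf_le allI)
    fix n
    have "(\<mu> / 2 * (real n + 1)) ^ DIM('a) \<le> fact DIM('a) * exp (\<mu> / 2 * (real n + 1))"
      using assms by (intro power_le_fact_exp) auto
    then have "(2 / \<mu>) ^ DIM('a) * (\<mu> / 2 * (real n + 1)) ^ DIM('a) \<le> (2 / \<mu>) ^ DIM('a) * (fact DIM('a) * exp (\<mu> / 2 * (real n + 1)))"
      using assms by (intro mult_left_mono) auto
    then have le: "(real n + 1) ^ DIM('a) \<le> (2 / \<mu>) ^ DIM('a) * (fact DIM('a) * exp (\<mu> / 2 * (real n + 1)))"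
    proof -
      have "2 / \<mu> * (\<mu> / 2 * (real n + 1)) = real n + 1" using assms by simp
      then have "(2 / \<mu>) ^ DIM('a) * (\<mu> / 2 * (real n + 1)) ^ DIM('a) = (real n + 1) ^ DIM('a)"
        by (simp only: power_mult_distrib[symmetric])
      then show ?thesis using \<open>(2 / \<mu>) ^ DIM('a) * (\<mu> / 2 * (real n + 1)) ^ DIM('a) \<le> _\<close> by (simp only:)
    qed
    have "exp (- \<mu> * real n) * (vol TYPE('a) * (real n + 1) ^ DIM('a))
       \<le> exp (- \<mu> * real n) * (vol TYPE('a) * ((2 / \<mu>) ^ DIM('a) * (fact DIM('a) * exp (\<mu> / 2 * (real n + 1)))))"
      by (intro mult_left_mono le) auto
    also have "\<dots> = c * (exp (- \<mu> * real n) * exp (\<mu> / 2 * real n))"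
    proof -
      have "exp (\<mu> / 2 * (real n + 1)) = exp (\<mu> / 2) * exp (\<mu> / 2 * real n)"
        by (simp only: exp_add[symmetric]) (simp add: distrib_left add.commute)
      then show ?thesis by (simp only: c_def mult_ac)
    qed
    also have "exp (- \<mu> * real n) * exp (\<mu> / 2 * real n) = exp (- \<mu> / 2) ^ n"
      by (simp add: exp_add[symmetric] exp_of_nat_mult[symmetric] field_simps)
    finally show "ennreal (exp (- \<mu> * real n)) * ennreal (vol TYPE('a) * (real n + 1) ^ DIM('a)) \<le> ennreal c * ennreal (exp (- \<mu> / 2) ^ n)"
      using c by (simp add: ennreal_mult[symmetric] ennreal_leI)
  qed auto
  also have "\<dots> = ennreal c * ennreal (1 / (1 - exp (- \<mu> / 2)))"
    unfolding ennreal_suminf_cmult using assms by (subst suminf_ennreal_geometric) auto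
  also have "\<dots> < top" by (simp add: ennreal_mult_less_top)
  finally show "(\<integral>\<^sup>+x. ennreal (norm (exp (- \<mu> * norm x))) \<partial>(lborel :: 'a measure)) < \<infinity>" by simp
qed

text \<open>The test functions: bumps and exponential weights alike. Products with bounded differentiable
  functions stay in the class, and integrals of partial derivatives vanish on it.\<close>

definition exp_decay :: "(real ^ 'd::finite \<Rightarrow> real) \<Rightarrow> bool" where
  "exp_decay \<psi> \<longleftrightarrow> (\<forall>x. \<psi> differentiable (at x)) \<and>
     (\<exists>C \<mu>. \<mu> > 0 \<and> (\<forall>x. \<bar>\<psi> x\<bar> \<le> C * exp (- \<mu> * norm x) \<and> (\<forall>i. \<bar>partial_deriv i \<psi> x\<bar> \<le> C * exp (- \<mu> * norm x))))"

lemma exp_decay_D: "exp_decay f \<Longrightarrow> f differentiable (at x)" by (simp add: exp_decay_def)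

lemma exp_decay_bound:
  assumes "exp_decay \<psi>"
  obtains C \<mu> where "C \<ge> 0" "\<mu> > 0" "\<And>x. \<bar>\<psi> x\<bar> \<le> C * exp (- \<mu> * norm x)" "\<And>x i. \<bar>partial_deriv i \<psi> x\<bar> \<le> C * exp (- \<mu> * norm x)"
proof -
  obtain C \<mu> where *: "\<mu> > 0" "\<And>x. \<bar>\<psi> x\<bar> \<le> C * exp (- \<mu> * norm x)" "\<And>x i. \<bar>partial_deriv i \<psi> x\<bar> \<le> C * exp (- \<mu> * norm x)"
    using assms unfolding exp_decay_def by blast
  have "C \<ge> 0" using *(2)[of 0] by simp
  with * that show ?thesis by blast
qed

lemma exp_decay_integrable_mult:
  assumes \<psi>: "exp_decay \<psi>" and f[measurable]: "f \<in> borel_measurable borel" and M: "\<And>x. \<bar>f x\<bar> \<le> M"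
  shows "integrable lborel (\<lambda>x. f x * \<psi> x)" "integrable lborel (\<lambda>x. f x * partial_deriv i \<psi> x)"
proof -
  obtain C \<mu> where C: "C \<ge> 0" "\<mu> > 0" "\<And>x. \<bar>\<psi> x\<bar> \<le> C * exp (- \<mu> * norm x)" "\<And>x i. \<bar>partial_deriv i \<psi> x\<bar> \<le> C * exp (- \<mu> * norm x)"
    by (rule exp_decay_bound[OF \<psi>]) blast
  have [measurable]: "\<psi> \<in> borel_measurable borel" "partial_deriv i \<psi> \<in> borel_measurable borel"
    using differentiable_imp_measurable partial_deriv_measurable exp_decay_D[OF \<psi>] by blast+
  have M0: "M \<ge> 0" using M[of 0] by linarith
  have I: "integrable lborel (\<lambda>x::real^'a. (M * C) * exp (- \<mu> * norm x))"
    by (intro integrable_mult_right integrable_exp_norm C)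
  show "integrable lborel (\<lambda>x. f x * \<psi> x)"
  proof (rule Bochner_Integration.integrable_bound[OF I])
    show "AE x in lborel. norm (f x * \<psi> x) \<le> norm ((M * C) * exp (- \<mu> * norm x))"
    proof (rule AE_I2)
      fix x
      have "\<bar>f x\<bar> * \<bar>\<psi> x\<bar> \<le> M * (C * exp (- \<mu> * norm x))" by (rule mult_mono[OF M C(3) M0 abs_ge_zero])
      then show "norm (f x * \<psi> x) \<le> norm ((M * C) * exp (- \<mu> * norm x))" using C M0 by (simp add: abs_mult)
    qed
  qed measurable
  show "integrable lborel (\<lambda>x. f x * partial_deriv i \<psi> x)"
  proof (rule Bochner_Integration.integrable_bound[OF I])
    show "AE x in lborel. norm (f x * partial_deriv i \<psi> x) \<le> norm ((M * C) * exp (- \<mu> * norm x))"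
    proof (rule AE_I2)
      fix x
      have "\<bar>f x\<bar> * \<bar>partial_deriv i \<psi> x\<bar> \<le> M * (C * exp (- \<mu> * norm x))" by (rule mult_mono[OF M C(4) M0 abs_ge_zero])
      then show "norm (f x * partial_deriv i \<psi> x) \<le> norm ((M * C) * exp (- \<mu> * norm x))" using C M0 by (simp add: abs_mult)
    qed
  qed measurable
qed

lemma exp_decay_mult:
  assumes f: "bdd_diff f" and \<psi>: "exp_decay \<psi>"
  shows "exp_decay (\<lambda>x. f x * \<psi> x)"
proof -
  obtain M where M: "M \<ge> 0" "\<And>x. \<bar>f x\<bar> \<le> M" "\<And>x i. \<bar>partial_deriv i f x\<bar> \<le> M" by (rule bdd_diff_bound[OF f]) blast
  obtain C \<mu> where C: "C \<ge> 0" "\<mu> > 0" "\<And>x. \<bar>\<psi> x\<bar> \<le> C * exp (- \<mu> * norm x)" "\<And>x i. \<bar>partial_deriv i \<psi> x\<bar> \<le> C * exp (- \<mu> * norm x)"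
    by (rule exp_decay_bound[OF \<psi>]) blast
  have "(\<lambda>x. f x * \<psi> x) differentiable at x" for x using f \<psi> by (intro differentiable_mult bdd_diff_D exp_decay_D)
  moreover have "\<exists>C \<mu>. \<mu> > 0 \<and> (\<forall>x. \<bar>f x * \<psi> x\<bar> \<le> C * exp (- \<mu> * norm x) \<and> (\<forall>i. \<bar>partial_deriv i (\<lambda>x. f x * \<psi> x) x\<bar> \<le> C * exp (- \<mu> * norm x)))"
  proof (rule exI[of _ "2 * M * C"], rule exI[of _ \<mu>], intro conjI allI)
    fix x i
    have 1: "\<bar>f x\<bar> * \<bar>\<psi> x\<bar> \<le> M * (C * exp (- \<mu> * norm x))" by (rule mult_mono[OF M(2) C(3) M(1) abs_ge_zero])
    moreover have "M * (C * exp (- \<mu> * norm x)) \<ge> 0" using M C by simp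
    ultimately show "\<bar>f x * \<psi> x\<bar> \<le> 2 * M * C * exp (- \<mu> * norm x)" by (simp add: abs_mult)
    have "\<bar>partial_deriv i f x * \<psi> x + f x * partial_deriv i \<psi> x\<bar> \<le> \<bar>partial_deriv i f x\<bar> * \<bar>\<psi> x\<bar> + \<bar>f x\<bar> * \<bar>partial_deriv i \<psi> x\<bar>"
      by (rule order_trans[OF abs_triangle_ineq]) (simp add: abs_mult)
    also have "\<dots> \<le> M * (C * exp (- \<mu> * norm x)) + M * (C * exp (- \<mu> * norm x))"
      by (intro add_mono mult_mono M C abs_ge_zero)
    also have "\<dots> = 2 * M * C * exp (- \<mu> * norm x)" by simp
    finally show "\<bar>partial_deriv i (\<lambda>x. f x * \<psi> x) x\<bar> \<le> 2 * M * C * exp (- \<mu> * norm x)"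
      unfolding partial_deriv_mult[OF bdd_diff_D[OF f] exp_decay_D[OF \<psi>]] .
  qed (use C in auto)
  ultimately show ?thesis unfolding exp_decay_def by blast
qed

lemma integral_translate:
  fixes H :: "'a::euclidean_space \<Rightarrow> real"
  assumes "integrable lborel H"
  shows "integrable lborel (\<lambda>x. H (x + a))" "(\<integral>x. H (x + a) \<partial>lborel) = (\<integral>x. H x \<partial>lborel)"
proof -
  have [measurable]: "H \<in> borel_measurable borel" using assms by auto
  have d: "distr lborel borel ((+) a) = (lborel :: 'a measure)" by (rule lborel_distr_plus)
  have "integrable (distr lborel borel ((+) a)) H" using assms d by simp
  then show "integrable lborel (\<lambda>x. H (x + a))" by (subst (asm) integrable_distr_eq) (auto simp: add.commute)
  have "(\<integral>x. H x \<partial>distr lborel borel ((+) a)) = (\<integral>x. H (a + x) \<partial>lborel)"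
    by (rule integral_distr) auto
  then show "(\<integral>x. H (x + a) \<partial>lborel) = (\<integral>x. H x \<partial>lborel)" using d by (simp add: add.commute)
qed

text \<open>Difference quotients have integral zero by translation invariance and converge dominatedly, by the mean
  value theorem and the exponential decay of the derivative.\<close>

lemma integral_partial_deriv_zero:
  assumes H: "exp_decay H"
  shows "(\<integral>x. partial_deriv i H x \<partial>lborel) = 0"
proof -
  obtain C \<mu> where C: "C \<ge> 0" "\<mu> > 0" "\<And>x. \<bar>H x\<bar> \<le> C * exp (- \<mu> * norm x)" "\<And>x i. \<bar>partial_deriv i H x\<bar> \<le> C * exp (- \<mu> * norm x)"
    by (rule exp_decay_bound[OF H]) blast
  have d: "\<And>x. H differentiable at x" by (rule exp_decay_D[OF H])
  have [measurable]: "H \<in> borel_measurable borel" "partial_deriv i H \<in> borel_measurable borel"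
    using differentiable_imp_measurable partial_deriv_measurable d by blast+
  have IH: "integrable lborel H" using exp_decay_integrable_mult(1)[OF H, of "\<lambda>_. 1" 1] by simp
  let ?q = "\<lambda>n x. real (Suc n) * (H (x + (1 / real (Suc n)) *\<^sub>R axis i 1) - H x)"
  have q0: "(\<integral>x. ?q n x \<partial>lborel) = 0" for n
    using integral_translate[OF IH] IH by simp
  have "(\<lambda>n. \<integral>x. ?q n x \<partial>lborel) \<longlonglongrightarrow> (\<integral>x. partial_deriv i H x \<partial>lborel)"
  proof (rule integral_dominated_convergence[where w = "\<lambda>x. C * exp \<mu> * exp (- \<mu> * norm x)"])
    show "integrable lborel (\<lambda>x::real^'a. C * exp \<mu> * exp (- \<mu> * norm x))"
      by (intro integrable_mult_right integrable_exp_norm C(2))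
    show "AE x in lborel. (\<lambda>n. ?q n x) \<longlonglongrightarrow> partial_deriv i H x"
      by (intro AE_I2 partial_deriv_LIMSEQ d)
    fix n
    show "AE x in lborel. norm (?q n x) \<le> C * exp \<mu> * exp (- \<mu> * norm x)"
    proof (intro AE_I2)
      fix x
      define h where "h = 1 / real (Suc n)"
      have h: "0 < h" "h \<le> 1" by (auto simp: h_def)
      obtain s where s: "0 < s" "s < h" "H (x + h *\<^sub>R axis i 1) - H (x + 0 *\<^sub>R axis i 1) = (h - 0) * partial_deriv i H (x + s *\<^sub>R axis i 1)"
        using MVT2[OF h(1), of "\<lambda>s. H (x + s *\<^sub>R axis i 1)" "\<lambda>s. partial_deriv i H (x + s *\<^sub>R axis i 1)"] axis_line_deriv[OF d]
        by blast
      then have "?q n x = partial_deriv i H (x + s *\<^sub>R axis i 1)"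
        by (simp add: h_def[symmetric]) (simp add: h_def)
      moreover have "norm x \<le> norm (x + s *\<^sub>R axis i 1) + 1"
      proof -
        have "norm x \<le> norm (x + s *\<^sub>R axis i 1) + norm (s *\<^sub>R (axis i 1 :: real^'a))"
          by (metis add_diff_cancel norm_triangle_ineq4)
        also have "norm (s *\<^sub>R (axis i 1 :: real^'a)) \<le> 1" using s h by (simp add: norm_axis_1)
        finally show ?thesis by simp
      qed
      then have "\<mu> * norm x \<le> \<mu> * (norm (x + s *\<^sub>R axis i 1) + 1)"
        using C by (intro mult_left_mono) auto
      then have "exp (- \<mu> * norm (x + s *\<^sub>R axis i 1)) \<le> exp \<mu> * exp (- \<mu> * norm x)"
        unfolding exp_add[symmetric] by (simp add: distrib_left)
      then have "C * exp (- \<mu> * norm (x + s *\<^sub>R axis i 1)) \<le> C * (exp \<mu> * exp (- \<mu> * norm x))"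
        using C by (intro mult_left_mono) auto
      ultimately show "norm (?q n x) \<le> C * exp \<mu> * exp (- \<mu> * norm x)"
        using C(4)[of i "x + s *\<^sub>R axis i 1"] by (simp add: mult.assoc)
    qed
  qed measurable
  then show ?thesis using q0 by (simp add: LIMSEQ_const_iff)
qed

section \<open>Increments of Lipschitz functions\<close>

text \<open>The integral over \<open>{a..b}\<close> of the difference quotient with step \<open>h\<close> is the difference of the means of \<open>m\<close>
  over \<open>{b..b + h}\<close> and \<open>{a..a + h}\<close>, hence converges to \<open>m b - m a\<close>. As the quotients are bounded by the Lipschitz
  constant, the limit may be taken under the integral.\<close>

lemma lipschitz_ftc_ge:
  fixes m Z :: "real \<Rightarrow> real"
  assumes ab: "a \<le> b" and lip: "L-lipschitz_on {a..b} m"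
    and Z: "set_integrable lborel {a..b} Z"
    and lim: "AE t in lborel. a < t \<and> t < b \<longrightarrow> (\<exists>X. (\<lambda>n. real (Suc n) * (m (t + 1 / real (Suc n)) - m t)) \<longlonglongrightarrow> X \<and> Z t \<le> X)"
  shows "(LINT t:{a..b}|lborel. Z t) \<le> m b - m a"
proof -
  \<comment> \<open>Constant extension beyond the interval, so that the shifted arguments cause no trouble.\<close>
  define c where "c t = max a (min b t)" for t
  define M where "M t = m (c t)" for t
  have c_in: "c t \<in> {a..b}" for t using ab by (auto simp: c_def)
  have L0: "L \<ge> 0" using lip by (rule lipschitz_on_nonneg)
  have lipM: "\<bar>M x - M y\<bar> \<le> L * \<bar>x - y\<bar>" for x y
  proof -
    have "dist (m (c x)) (m (c y)) \<le> L * dist (c x) (c y)" by (rule lipschitz_onD[OF lip c_in c_in])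
    also have "\<dots> \<le> L * \<bar>x - y\<bar>" using L0 by (intro mult_left_mono) (auto simp: c_def dist_real_def)
    finally show ?thesis by (simp add: M_def dist_real_def)
  qed
  have contM: "continuous_on UNIV M"
    by (rule lipschitz_on_continuous_on[of L]) (auto simp: lipschitz_on_def dist_real_def lipM L0)
  then have [measurable]: "M \<in> borel_measurable borel" by (rule borel_measurable_continuous_onI)
  define P where "P t = integral {a - 1..t} M" for t
  have P: "(P has_real_derivative M t) (at t)" if "t \<in> {a<..<b + 3} \<or> t = a" for t
  proof -
    have "(P has_real_derivative M t) (at t within {a - 1..b + 4})"
      unfolding P_def using that ab by (intro integral_has_real_derivative continuous_on_subset[OF contM]) auto
    moreover have "at t within {a - 1..b + 4} = at t" using that ab by (intro at_within_interior) (auto simp: interior_atLeastAtMost_real)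
    ultimately show ?thesis by simp
  qed
  define D where "D n t = real (Suc n) * (M (t + 1 / real (Suc n)) - M t)" for n t
  have intD: "(LINT t:{a..b}|lborel. D n t) = real (Suc n) * (P (b + 1 / real (Suc n)) - P b) - real (Suc n) * (P (a + 1 / real (Suc n)) - P a)" for n
  proof -
    define h where "h = 1 / real (Suc n)"
    have h: "0 < h" "h \<le> 1" by (auto simp: h_def)
    define R where "R t = real (Suc n) * (P (t + h) - P t)" for t
    have R: "(R has_vector_derivative D n t) (at t within {a..b})" if "t \<in> {a..b}" for t
    proof -
      have 1: "(P has_real_derivative M t) (at t)" using that by (intro P) auto
      have 2: "(P has_real_derivative M (t + h)) (at (t + h))" using that h by (intro P) auto
      then have "((\<lambda>t. P (t + h)) has_real_derivative M (t + h)) (at t)"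
        using DERIV_shift[of P "M (t + h)" t h] by simp
      then have "(R has_real_derivative real (Suc n) * (M (t + h) - M t)) (at t)"
        unfolding R_def using 1 by (intro derivative_eq_intros) auto
      then show ?thesis unfolding D_def h_def[symmetric] has_real_derivative_iff_has_vector_derivative
        by (rule has_vector_derivative_at_within)
    qed
    have cD: "continuous_on {a..b} (D n)" unfolding D_def
      by (intro continuous_intros continuous_on_compose2[OF contM]) auto
    have "(D n has_integral (R b - R a)) {a..b}"
      using ab R by (rule fundamental_theorem_of_calculus)
    moreover have "set_integrable lborel {a..b} (D n)" by (rule borel_integrable_atLeastAtMost'[OF cD])
    ultimately have "(LINT t:{a..b}|lborel. D n t) = R b - R a"
      using set_borel_integral_eq_integral(2) integral_unique by metis
    then show ?thesis by (simp add: R_def h_def)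
  qed
  have lim1: "(\<lambda>n. real (Suc n) * (P (t + 1 / real (Suc n)) - P t)) \<longlonglongrightarrow> M t" if "t = a \<or> t = b" for t
  proof -
    have "(P has_real_derivative M t) (at t)" using that ab by (intro P) auto
    then have "((\<lambda>h. (P (t + h) - P t) / h) \<longlongrightarrow> M t) (at 0)" by (simp add: DERIV_def)
    moreover have "filterlim (\<lambda>n. 1 / real (Suc n)) (at 0) sequentially"
      unfolding filterlim_at using LIMSEQ_inverse_real_of_nat by (auto simp: inverse_eq_divide)
    ultimately have "(\<lambda>n. (P (t + 1 / real (Suc n)) - P t) / (1 / real (Suc n))) \<longlonglongrightarrow> M t"
      by (rule filterlim_compose)
    then show ?thesis by (simp add: mult.commute)
  qed
  have intlim: "(\<lambda>n. LINT t:{a..b}|lborel. D n t) \<longlonglongrightarrow> M b - M a"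
    unfolding intD by (intro tendsto_diff lim1) auto
  define X where "X t = lim (\<lambda>n. D n t)" for t
  have [measurable]: "D n \<in> borel_measurable borel" for n unfolding D_def by measurable
  have [measurable]: "X \<in> borel_measurable borel" unfolding X_def by measurable
  have ae: "AE t in lborel. t \<in> {a..b} \<longrightarrow> (\<lambda>n. D n t) \<longlonglongrightarrow> X t \<and> Z t \<le> X t"
    using lim AE_lborel_singleton[of a] AE_lborel_singleton[of b]
  proof eventually_elim
    case (elim t)
    show ?case
    proof
      assume "t \<in> {a..b}"
      then have t: "a < t" "t < b" using elim by auto
      then obtain Y where Y: "(\<lambda>n. real (Suc n) * (m (t + 1 / real (Suc n)) - m t)) \<longlonglongrightarrow> Y" "Z t \<le> Y"
        using elim by blast
      have "(\<lambda>n. t + 1 / real (Suc n)) \<longlonglongrightarrow> t + 0"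
        by (intro tendsto_intros) (use LIMSEQ_inverse_real_of_nat in \<open>simp add: inverse_eq_divide\<close>)
      then have "eventually (\<lambda>n. t + 1 / real (Suc n) < b) sequentially"
        using t by (intro order_tendstoD) auto
      then have "eventually (\<lambda>n. real (Suc n) * (m (t + 1 / real (Suc n)) - m t) = D n t) sequentially"
      proof eventually_elim
        case (elim n)
        have p: "1 / real (Suc n) > 0" by simp
        have "c (t + 1 / real (Suc n)) = t + 1 / real (Suc n)" "c t = t" using elim t p unfolding c_def by linarith+
        then show ?case unfolding D_def M_def by simp
      qed
      then have "(\<lambda>n. D n t) \<longlonglongrightarrow> Y" using Y(1) by (rule Lim_transform_eventually[rotated])
      then show "(\<lambda>n. D n t) \<longlonglongrightarrow> X t \<and> Z t \<le> X t" using Y(2) unfolding X_def by (simp add: limI)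
    qed
  qed
  have Dle: "\<bar>D n t\<bar> \<le> L" for n t
  proof -
    have "\<bar>D n t\<bar> = real (Suc n) * \<bar>M (t + 1 / real (Suc n)) - M t\<bar>"
      unfolding D_def by (simp add: abs_mult del: of_nat_Suc)
    also have "\<dots> \<le> real (Suc n) * (L * \<bar>t + 1 / real (Suc n) - t\<bar>)"
      by (intro mult_left_mono lipM) auto
    also have "\<dots> = L" by (simp del: of_nat_Suc)
    finally show ?thesis .
  qed
  have IL: "set_integrable lborel {a..b} (\<lambda>_. L)"
    by (rule borel_integrable_atLeastAtMost') simp
  have "(\<lambda>n. LINT t:{a..b}|lborel. D n t) \<longlonglongrightarrow> (LINT t:{a..b}|lborel. X t)"
    unfolding set_lebesgue_integral_def
  proof (rule integral_dominated_convergence[where w = "\<lambda>t. indicator {a..b} t *\<^sub>R L"])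
    show "integrable lborel (\<lambda>t. indicator {a..b} t *\<^sub>R L)" using IL by (simp add: set_integrable_def)
    show "AE t in lborel. (\<lambda>n. indicator {a..b} t *\<^sub>R D n t) \<longlonglongrightarrow> indicator {a..b} t *\<^sub>R X t"
      using ae by eventually_elim (auto simp: indicator_def)
    show "AE t in lborel. norm (indicator {a..b} t *\<^sub>R D n t) \<le> indicator {a..b} t *\<^sub>R L" for n
      using Dle by (intro AE_I2) (auto simp: indicator_def)
  qed measurable
  then have XM: "(LINT t:{a..b}|lborel. X t) = M b - M a" using intlim by (rule LIMSEQ_unique)
  have IX: "set_integrable lborel {a..b} X" unfolding set_integrable_def
  proof (rule Bochner_Integration.integrable_bound[OF IL[unfolded set_integrable_def]])
    show "AE t in lborel. norm (indicator {a..b} t *\<^sub>R X t) \<le> norm (indicator {a..b} t *\<^sub>R L)"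
      using ae
    proof eventually_elim
      case (elim t)
      show ?case
      proof (cases "t \<in> {a..b}")
        case True
        then have "(\<lambda>n. \<bar>D n t\<bar>) \<longlonglongrightarrow> \<bar>X t\<bar>" using elim by (intro tendsto_rabs) auto
        then have "\<bar>X t\<bar> \<le> L" by (rule LIMSEQ_le_const2) (use Dle in auto)
        then show ?thesis using True L0 by simp
      qed simp
    qed
  qed measurable
  have "(LINT t:{a..b}|lborel. Z t) \<le> (LINT t:{a..b}|lborel. X t)"
    unfolding set_lebesgue_integral_def
    by (rule integral_mono_AE[OF Z[unfolded set_integrable_def] IX[unfolded set_integrable_def]])
       (use ae in \<open>eventually_elim, auto simp: indicator_def\<close>)
  also have "\<dots> = m b - m a" using XM ab by (simp add: M_def c_def)
  finally show ?thesis .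
qed

section \<open>Coefficients\<close>

text \<open>Replacing \<open>x\<close> by the first point within distance \<open>1 / (n + 1)\<close> in an enumeration of a countable dense set
  gives a jointly measurable function, and by continuity in \<open>x\<close> these converge.\<close>

lemma measurable_of_measurable_continuous:
  fixes h :: "real \<times> 'a::euclidean_space \<Rightarrow> real"
  assumes t: "\<And>x. (\<lambda>t. h (t, x)) \<in> borel_measurable borel"
    and x: "\<And>t. continuous_on UNIV (\<lambda>x. h (t, x))"
  shows "h \<in> borel_measurable borel"
proof -
  obtain D :: "'a set" where D: "countable D" "\<And>X. open X \<Longrightarrow> X \<noteq> {} \<Longrightarrow> \<exists>d\<in>D. d \<in> X"
    using countable_dense_exists[where 'a = 'a] by blast
  have "D \<noteq> {}" using D(2)[of UNIV] by auto
  define e where "e = from_nat_into D"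
  have e: "\<exists>k. dist y (e k) < \<epsilon>" if "\<epsilon> > 0" for y :: 'a and \<epsilon> :: real
  proof -
    have "ball y \<epsilon> \<noteq> {}" using that by simp
    then obtain d where "d \<in> D" "d \<in> ball y \<epsilon>" using D(2)[OF open_ball] by blast
    then obtain k where "e k = d" unfolding e_def using from_nat_into_surj[OF D(1)] by metis
    then show ?thesis using \<open>d \<in> ball y \<epsilon>\<close> by auto
  qed
  define idx where "idx n y = (LEAST k. dist y (e k) < 1 / real (Suc n))" for n y
  have idx: "dist y (e (idx n y)) < 1 / real (Suc n)" for n y
    unfolding idx_def by (rule LeastI_ex) (rule e, simp)
  have sndm: "snd \<in> (borel :: (real \<times> 'a) measure) \<rightarrow>\<^sub>M borel" and fstm: "fst \<in> (borel :: (real \<times> 'a) measure) \<rightarrow>\<^sub>M borel"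
    by (intro borel_measurable_continuous_onI continuous_intros)+
  have [measurable]: "(\<lambda>z::real \<times> 'a. idx n (snd z)) \<in> borel \<rightarrow>\<^sub>M count_space UNIV" for n
  proof -
    have "idx n \<in> borel \<rightarrow>\<^sub>M count_space UNIV" unfolding idx_def by measurable
    from measurable_compose[OF sndm this] show ?thesis .
  qed
  show ?thesis
  proof (rule borel_measurable_LIMSEQ_metric)
    fix n
    have *: "(\<lambda>z::real \<times> 'a. h (fst z, e k)) \<in> borel_measurable borel" for k
      using measurable_compose[OF fstm t[of "e k"]] .
    show "(\<lambda>z. h (fst z, e (idx n (snd z)))) \<in> borel_measurable borel"
      by (rule measurable_compose_countable[OF *]) measurable
  next
    fix z :: "real \<times> 'a"
    have "(\<lambda>n. e (idx n (snd z))) \<longlonglongrightarrow> snd z"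
    proof (rule metric_LIMSEQ_I)
      fix r :: real assume "r > 0"
      then obtain N where N: "1 / real (Suc N) < r" using nat_approx_posE by metis
      have "dist (e (idx n (snd z))) (snd z) < r" if "n \<ge> N" for n
      proof -
        have "1 / real (Suc n) \<le> 1 / real (Suc N)" using that by (simp add: frac_le)
        then show ?thesis using idx[of "snd z" n] N by (simp add: dist_commute)
      qed
      then show "\<exists>N. \<forall>n\<ge>N. dist (e (idx n (snd z))) (snd z) < r" by blast
    qed
    from continuous_on_tendsto_compose[OF x[of "fst z"] this] show "(\<lambda>n. h (fst z, e (idx n (snd z)))) \<longlonglongrightarrow> h z" by simp
  qed
qed

lemma differentiable_abs_diff_le:
  fixes f :: "real ^ 'd::finite \<Rightarrow> real"
  assumes d: "\<And>x. f differentiable (at x)" and g: "\<And>x. norm (gradient f x) \<le> K"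
  shows "\<bar>f x - f y\<bar> \<le> K * norm (x - y)"
proof -
  have "norm (f x - f y) \<le> K * norm (x - y)"
  proof (rule differentiable_bound[of UNIV f "\<lambda>x h. gradient f x \<bullet> h"])
    show "(f has_derivative (\<lambda>h. gradient f x \<bullet> h)) (at x within UNIV)" for x
      using has_derivative_gradient[OF d] by simp
    show "onorm (\<lambda>h. gradient f x \<bullet> h) \<le> K" for x
      by (rule order_trans[OF onorm_le[of _ "norm (gradient f x)"] g]) (simp add: Cauchy_Schwarz_ineq2)
  qed auto
  then show ?thesis by simp
qed

lemma partial_derivs_simps: "partial_derivs [] g = g" "partial_derivs (i # is) g = partial_deriv i (partial_derivs is g)"
  by (simp_all add: partial_derivs_def)

lemma smooth_bounded_bound:
  assumes "smooth_bounded_in_x I g"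
  obtains M where "\<And>t x. t \<in> I \<Longrightarrow> \<bar>partial_derivs is (\<lambda>y. g (t, y)) x\<bar> \<le> M"
proof -
  have "bounded ((\<lambda>(t, x). partial_derivs is (\<lambda>y. g (t, y)) x) ` (I \<times> UNIV))"
    using assms by (simp add: smooth_bounded_in_x_def)
  then have "\<exists>M. \<forall>t\<in>I. \<forall>x. \<bar>partial_derivs is (\<lambda>y. g (t, y)) x\<bar> \<le> M"
    by (simp add: bounded_iff)
  then show ?thesis using that by blast
qed

lemma smooth_bounded_differentiable:
  "smooth_bounded_in_x I g \<Longrightarrow> t \<in> I \<Longrightarrow> partial_derivs is (\<lambda>y. g (t, y)) differentiable (at x)"
  by (simp add: smooth_bounded_in_x_def infinitely_differentiable_def)

lemma smooth_bounded_bdd_diff: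
  assumes g: "smooth_bounded_in_x I g" and t: "t \<in> I"
  shows "bdd_diff (partial_derivs is (\<lambda>y. g (t, y)))"
proof -
  obtain M where M: "\<And>t x. t \<in> I \<Longrightarrow> \<bar>partial_derivs is (\<lambda>y. g (t, y)) x\<bar> \<le> M" by (rule smooth_bounded_bound[OF g]) blast
  show ?thesis
  proof (rule bdd_diffI)
    show "partial_derivs is (\<lambda>y. g (t, y)) differentiable (at x)" for x by (rule smooth_bounded_differentiable[OF g t])
    show "\<bar>partial_derivs is (\<lambda>y. g (t, y)) x\<bar> \<le> M" for x by (rule M[OF t])
    fix i
    obtain K where K: "\<And>t x. t \<in> I \<Longrightarrow> \<bar>partial_derivs (i # is) (\<lambda>y. g (t, y)) x\<bar> \<le> K" by (rule smooth_bounded_bound[OF g]) blast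
    then show "\<exists>M. \<forall>x. \<bar>partial_deriv i (partial_derivs is (\<lambda>y. g (t, y))) x\<bar> \<le> M"
      using t by (auto simp: partial_derivs_simps)
  qed
qed

lemma B0_measurable:
  fixes g :: "real \<times> (real ^ 'd::finite) \<Rightarrow> real"
  assumes "g \<in> B0_infinity"
  shows "g \<in> borel_measurable borel"
proof (rule measurable_of_measurable_continuous)
  show "(\<lambda>t. g (t, x)) \<in> borel_measurable borel" for x using assms by (simp add: B0_infinity_def)
  fix t
  have "smooth_bounded_in_x UNIV g" using assms by (simp add: B0_infinity_def)
  from smooth_bounded_differentiable[OF this, of t "[]"]
  show "continuous_on UNIV (\<lambda>x. g (t, x))"
    by (auto intro!: differentiable_imp_continuous_on simp: partial_derivs_simps differentiable_on_def differentiable_at_withinI)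
qed

lemma B0_bounded:
  assumes "g \<in> B0_infinity"
  obtains M where "\<And>z. \<bar>g z\<bar> \<le> M"
proof -
  have "smooth_bounded_in_x UNIV g" using assms by (simp add: B0_infinity_def)
  then obtain M where "\<And>t x. t \<in> UNIV \<Longrightarrow> \<bar>partial_derivs [] (\<lambda>y. g (t, y)) x\<bar> \<le> M" by (rule smooth_bounded_bound) blast
  then show ?thesis using that[of M] by (auto simp: partial_derivs_simps)
qed

lemma B0_vec_measurable:
  fixes g :: "real \<times> (real ^ 'd::finite) \<Rightarrow> real ^ 'd"
  assumes "g \<in> B0_infinity_vec"
  shows "g \<in> borel_measurable borel"
proof -
  have "(\<lambda>z. g z $ i) \<in> borel_measurable borel" for i
    using assms by (intro B0_measurable) (simp add: B0_infinity_vec_def)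
  then show ?thesis by (subst borel_measurable_euclidean_space) (auto simp: Basis_vec_def inner_axis)
qed

lemma B0_vec_bounded:
  fixes g :: "real \<times> (real ^ 'd::finite) \<Rightarrow> real ^ 'd"
  assumes "g \<in> B0_infinity_vec"
  obtains M where "\<And>z. norm (g z) \<le> M"
proof -
  have "\<exists>M. \<forall>z. \<bar>g z $ i\<bar> \<le> M" for i
  proof -
    have "(\<lambda>z. g z $ i) \<in> B0_infinity" using assms by (simp add: B0_infinity_vec_def)
    then obtain M where "\<And>z. \<bar>g z $ i\<bar> \<le> M" by (rule B0_bounded) blast
    then show ?thesis by blast
  qed
  then obtain M where M: "\<And>i z. \<bar>g z $ i\<bar> \<le> M i" by metis
  have "norm (g z) \<le> (\<Sum>i\<in>UNIV. M i)" for z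
    by (rule order_trans[OF norm_le_l1_cart]) (intro sum_mono M)
  then show ?thesis by (rule that)
qed

lemma abs_power_diff_le:
  fixes x y M :: real
  assumes "\<bar>x\<bar> \<le> M" "\<bar>y\<bar> \<le> M"
  shows "\<bar>x ^ k - y ^ k\<bar> \<le> real k * M ^ (k - 1) * \<bar>x - y\<bar>"
proof -
  have M: "M \<ge> 0" using assms(1) by linarith
  have eq: "\<bar>x ^ k - y ^ k\<bar> = \<bar>x - y\<bar> * \<bar>\<Sum>i<k. y ^ (k - Suc i) * x ^ i\<bar>"
    by (simp add: power_diff_sumr2 abs_mult)
  have "\<bar>\<Sum>i<k. y ^ (k - Suc i) * x ^ i\<bar> \<le> (\<Sum>i<k. M ^ (k - 1))"
  proof (rule order_trans[OF sum_abs], rule sum_mono)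
    fix i assume "i \<in> {..<k}"
    then have "k - 1 = (k - Suc i) + i" by simp
    then have "M ^ (k - 1) = M ^ (k - Suc i) * M ^ i" by (simp only: power_add)
    moreover have "\<bar>y ^ (k - Suc i) * x ^ i\<bar> \<le> M ^ (k - Suc i) * M ^ i"
      unfolding abs_mult power_abs using assms M by (intro mult_mono power_mono) auto
    ultimately show "\<bar>y ^ (k - Suc i) * x ^ i\<bar> \<le> M ^ (k - 1)" by simp
  qed
  then have "\<bar>x - y\<bar> * \<bar>\<Sum>i<k. y ^ (k - Suc i) * x ^ i\<bar> \<le> \<bar>x - y\<bar> * (\<Sum>i<k. M ^ (k - 1))"
    by (rule mult_left_mono) simp
  with eq show ?thesis by (simp add: mult_ac)
qed

section \<open>The differential identity for powers of the solution\<close>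

locale solution =
  fixes \<delta> T :: real
    and a :: "real \<times> (real ^ 'd::finite) \<Rightarrow> real ^ 'd ^ 'd"
    and aa b :: "real \<times> (real ^ 'd) \<Rightarrow> real ^ 'd" and f :: "real ^ 'd \<Rightarrow> real"
    and u :: "real \<times> (real ^ 'd) \<Rightarrow> real"
  assumes \<delta>: "0 < \<delta>" "\<delta> \<le> 1" and T: "0 < T"
    and a: "a \<in> B0_infinity_mat" and aa: "aa \<in> B0_infinity_vec" and b: "b \<in> B0_infinity_vec"
    and a_S: "range a \<subseteq> S_delta \<delta>"
    and sol: "classical_solution a aa b f T u"
begin

text \<open>
  Times are clamped to \<open>{0..T}\<close>, because nothing is known about \<open>u\<close> outside; thus \<open>U\<close> is bounded and Lipschitz
  for all times.
\<close>
definition c :: "real \<Rightarrow> real" where "c t = max 0 (min T t)"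
definition U :: "real \<Rightarrow> real ^ 'd \<Rightarrow> real" where "U t = (\<lambda>x. u (c t, x))"
definition Du :: "real \<Rightarrow> real ^ 'd \<Rightarrow> real ^ 'd" where "Du t x = gradient (U t) x"
text \<open>The flux: the equation reads \<open>\<partial>u / \<partial>t + div H / 2 + b \<bullet> Du = 0\<close>.\<close>
definition H :: "real \<Rightarrow> real ^ 'd \<Rightarrow> real ^ 'd" where
  "H t x = a (c t, x) *v Du t x + U t x *\<^sub>R aa (c t, x)"

lemma c_in: "c t \<in> {0..T}" using T by (auto simp: c_def)
lemma c_id: "t \<in> {0..T} \<Longrightarrow> c t = t" by (auto simp: c_def)
lemma c_lip: "\<bar>c s - c t\<bar> \<le> \<bar>s - t\<bar>" by (auto simp: c_def)

lemma sb: "smooth_bounded_in_x {0..T} u" using sol by (simp add: classical_solution_def)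

lemma U_bdd_diff: "bdd_diff (U t)" using smooth_bounded_bdd_diff[OF sb c_in, of "[]" t] by (simp add: partial_derivs_simps U_def)
lemma DU_bdd_diff: "bdd_diff (partial_deriv i (U t))"
  using smooth_bounded_bdd_diff[OF sb c_in, of "[i]" t] by (simp add: partial_derivs_simps U_def)

lemma Du_nth: "Du t x $ i = partial_deriv i (U t) x" by (simp add: Du_def gradient_def)

lemma coeff_bdd_diff:
  "bdd_diff (\<lambda>x. aa (t, x) $ i)" "bdd_diff (\<lambda>x. b (t, x) $ i)" "bdd_diff (\<lambda>x. a (t, x) $ i $ j)"
proof -
  have s: "smooth_bounded_in_x UNIV (\<lambda>z. aa z $ i)" "smooth_bounded_in_x UNIV (\<lambda>z. b z $ i)" "smooth_bounded_in_x UNIV (\<lambda>z. a z $ i $ j)"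
    using a aa b by (simp_all add: B0_infinity_vec_def B0_infinity_mat_def B0_infinity_def)
  show "bdd_diff (\<lambda>x. aa (t, x) $ i)" "bdd_diff (\<lambda>x. b (t, x) $ i)" "bdd_diff (\<lambda>x. a (t, x) $ i $ j)"
    using smooth_bounded_bdd_diff[OF s(1), of t "[]"] smooth_bounded_bdd_diff[OF s(2), of t "[]"] smooth_bounded_bdd_diff[OF s(3), of t "[]"]
    by (simp_all add: partial_derivs_simps)
qed

lemma H_nth: "H t x $ i = (\<Sum>j\<in>UNIV. a (c t, x) $ i $ j * partial_deriv j (U t) x) + aa (c t, x) $ i * U t x"
  by (simp add: H_def matrix_vector_mult_def Du_nth)

lemma H_bdd_diff: "bdd_diff (\<lambda>x. H t x $ i)"
  unfolding H_nth by (intro bdd_diff_add bdd_diff_sum bdd_diff_mult coeff_bdd_diff U_bdd_diff DU_bdd_diff finite)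

lemma elliptic_eq: "elliptic_part a aa b u (c t) x = 1 / 2 * (\<Sum>i\<in>UNIV. partial_deriv i (\<lambda>y. H t y $ i) x) + b (c t, x) \<bullet> Du t x"
  unfolding elliptic_part_def H_nth by (simp add: inner_vec_def Du_nth U_def)

text \<open>The density of the time derivative of \<open>\<integral> u ^ k \<psi>\<close>, after integrating the flux term by parts.\<close>

definition energy_density :: "nat \<Rightarrow> (real ^ 'd \<Rightarrow> real) \<Rightarrow> real \<Rightarrow> real ^ 'd \<Rightarrow> real" where
  "energy_density k \<psi> t x = 1 / 2 * real k * real (k - 1) * U t x ^ (k - 2) * (H t x \<bullet> Du t x) * \<psi> x
     + 1 / 2 * real k * U t x ^ (k - 1) * (H t x \<bullet> gradient \<psi> x)
     - real k * U t x ^ (k - 1) * (b (c t, x) \<bullet> Du t x) * \<psi> x"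

lemma inner_bdd_diff:
  fixes v w :: "real ^ 'd \<Rightarrow> real ^ 'd"
  shows "(\<And>i. bdd_diff (\<lambda>x. v x $ i)) \<Longrightarrow> (\<And>i. bdd_diff (\<lambda>x. w x $ i)) \<Longrightarrow> bdd_diff (\<lambda>x. v x \<bullet> w x)"
  unfolding inner_vec_def inner_real_def by (intro bdd_diff_sum bdd_diff_mult) auto

lemma Du_bdd_diff: "bdd_diff (\<lambda>x. Du t x $ i)" unfolding Du_nth by (rule DU_bdd_diff)

lemma exp_decay_integrable: "exp_decay \<psi> \<Longrightarrow> bdd_diff h \<Longrightarrow> integrable lborel (\<lambda>x. h x * \<psi> x)"
  "exp_decay \<psi> \<Longrightarrow> bdd_diff h \<Longrightarrow> integrable lborel (\<lambda>x. h x * partial_deriv i \<psi> x)"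
proof -
  assume \<psi>: "exp_decay \<psi>" and h: "bdd_diff h"
  obtain M where M: "\<And>x. \<bar>h x\<bar> \<le> M" by (rule bdd_diff_bound[OF h]) blast
  have m: "h \<in> borel_measurable borel" by (rule differentiable_imp_measurable[OF bdd_diff_D[OF h]])
  show "integrable lborel (\<lambda>x. h x * \<psi> x)" "integrable lborel (\<lambda>x. h x * partial_deriv i \<psi> x)"
    using exp_decay_integrable_mult[OF \<psi> m M] by auto
qed

lemma inner_gradient: "v \<bullet> gradient \<psi> x = (\<Sum>i\<in>UNIV. v $ i * partial_deriv i \<psi> x)"
  by (simp add: inner_vec_def gradient_def)

lemma energy_density_integrable:
  assumes \<psi>: "exp_decay \<psi>"
  shows "integrable lborel (energy_density k \<psi> t)"
proof -
  have eq: "energy_density k \<psi> t = (\<lambda>x. (1 / 2 * real k * real (k - 1) * U t x ^ (k - 2) * (H t x \<bullet> Du t x)) * \<psi> x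
     + (\<Sum>i\<in>UNIV. (1 / 2 * real k * U t x ^ (k - 1) * H t x $ i) * partial_deriv i \<psi> x)
     - (real k * U t x ^ (k - 1) * (b (c t, x) \<bullet> Du t x)) * \<psi> x)"
    by (simp add: energy_density_def fun_eq_iff inner_gradient sum_distrib_left mult_ac)
  show ?thesis unfolding eq
    by (intro Bochner_Integration.integrable_add Bochner_Integration.integrable_diff Bochner_Integration.integrable_sum
      exp_decay_integrable \<psi> bdd_diff_mult bdd_diff_const bdd_diff_power U_bdd_diff inner_bdd_diff H_bdd_diff Du_bdd_diff coeff_bdd_diff)
qed

text \<open>The two integrands differ by half the divergence of \<open>k u ^ (k - 1) \<psi> H\<close>, whose integral vanishes.\<close>

lemma flux_identity:
  assumes \<psi>: "exp_decay \<psi>"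
  shows "integrable lborel (\<lambda>x. real k * U t x ^ (k - 1) * (- elliptic_part a aa b u (c t) x) * \<psi> x)"
    and "(\<integral>x. real k * U t x ^ (k - 1) * (- elliptic_part a aa b u (c t) x) * \<psi> x \<partial>lborel) = (\<integral>x. energy_density k \<psi> t x \<partial>lborel)"
proof -
  define w where "w i x = real k * U t x ^ (k - 1) * H t x $ i" for i x
  have w: "bdd_diff (w i)" for i unfolding w_def by (intro bdd_diff_mult bdd_diff_const bdd_diff_power U_bdd_diff H_bdd_diff)
  have r: "exp_decay (\<lambda>x. w i x * \<psi> x)" for i by (rule exp_decay_mult[OF w \<psi>])
  have wd: "partial_deriv i (w i) x = real k * real (k - 1) * U t x ^ (k - 2) * Du t x $ i * H t x $ i + real k * U t x ^ (k - 1) * partial_deriv i (\<lambda>y. H t y $ i) x" for i x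
  proof -
    have "partial_deriv i (w i) x = partial_deriv i (\<lambda>x. real k * U t x ^ (k - 1)) x * H t x $ i + (real k * U t x ^ (k - 1)) * partial_deriv i (\<lambda>y. H t y $ i) x"
      unfolding w_def by (intro partial_deriv_mult bdd_diff_D bdd_diff_mult bdd_diff_const bdd_diff_power U_bdd_diff H_bdd_diff)
    also have "partial_deriv i (\<lambda>x. real k * U t x ^ (k - 1)) x = partial_deriv i (\<lambda>x. real k) x * U t x ^ (k - 1) + real k * partial_deriv i (\<lambda>x. U t x ^ (k - 1)) x"
      by (intro partial_deriv_mult bdd_diff_D bdd_diff_const bdd_diff_power U_bdd_diff)
    also have "partial_deriv i (\<lambda>x. real k) x = 0" by (rule partial_derivI) simp
    also have "partial_deriv i (\<lambda>x. U t x ^ (k - 1)) x = real (k - 1) * U t x ^ (k - 1 - 1) * partial_deriv i (U t) x"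
      by (rule partial_deriv_power[OF bdd_diff_D[OF U_bdd_diff]])
    also have "k - 1 - 1 = k - 2" by simp
    finally show ?thesis by (simp add: Du_nth mult_ac)
  qed
  have pt: "real k * U t x ^ (k - 1) * (- elliptic_part a aa b u (c t) x) * \<psi> x = energy_density k \<psi> t x - 1 / 2 * (\<Sum>i\<in>UNIV. partial_deriv i (\<lambda>x. w i x * \<psi> x) x)" for x
  proof -
    have "(\<Sum>i\<in>UNIV. partial_deriv i (\<lambda>x. w i x * \<psi> x) x) = (\<Sum>i\<in>UNIV. partial_deriv i (w i) x * \<psi> x + w i x * partial_deriv i \<psi> x)"
      by (intro sum.cong partial_deriv_mult bdd_diff_D[OF w] exp_decay_D[OF \<psi>] refl)
    also have "\<dots> = real k * real (k - 1) * U t x ^ (k - 2) * (H t x \<bullet> Du t x) * \<psi> x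
        + real k * U t x ^ (k - 1) * (\<Sum>i\<in>UNIV. partial_deriv i (\<lambda>y. H t y $ i) x) * \<psi> x
        + real k * U t x ^ (k - 1) * (H t x \<bullet> gradient \<psi> x)"
      unfolding wd inner_vec_def inner_real_def w_def gradient_def vec_lambda_beta
      by (simp only: sum_distrib_left sum_distrib_right sum.distrib[symmetric]) (intro sum.cong refl, simp add: algebra_simps)
    finally show ?thesis unfolding elliptic_eq energy_density_def by (simp add: field_simps)
  qed
  have int0: "(\<integral>x. partial_deriv i (\<lambda>x. w i x * \<psi> x) x \<partial>lborel) = 0" for i by (rule integral_partial_deriv_zero[OF r])
  have inti: "integrable lborel (\<lambda>x. partial_deriv i (\<lambda>x. w i x * \<psi> x) x)" for i
    using exp_decay_integrable(2)[OF r bdd_diff_const[of 1]] by simp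
  show "integrable lborel (\<lambda>x. real k * U t x ^ (k - 1) * (- elliptic_part a aa b u (c t) x) * \<psi> x)"
    unfolding pt using inti by (intro Bochner_Integration.integrable_diff energy_density_integrable \<psi> integrable_mult_right Bochner_Integration.integrable_sum)
  show "(\<integral>x. real k * U t x ^ (k - 1) * (- elliptic_part a aa b u (c t) x) * \<psi> x \<partial>lborel) = (\<integral>x. energy_density k \<psi> t x \<partial>lborel)"
    unfolding pt using inti int0
    by (subst Bochner_Integration.integral_diff) (auto intro: energy_density_integrable \<psi>)
qed

definition Mu :: real where
  "Mu = (SOME M. M \<ge> 0 \<and> (\<forall>t x. \<bar>U t x\<bar> \<le> M \<and> norm (Du t x) \<le> M))"

lemma Mu: "Mu \<ge> 0" "\<bar>U t x\<bar> \<le> Mu" "norm (Du t x) \<le> Mu"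
proof -
  obtain M0 where M0: "\<And>t x. t \<in> {0..T} \<Longrightarrow> \<bar>partial_derivs [] (\<lambda>y. u (t, y)) x\<bar> \<le> M0" by (rule smooth_bounded_bound[OF sb]) blast
  have "\<forall>i. \<exists>K. \<forall>t\<in>{0..T}. \<forall>x. \<bar>partial_derivs [i] (\<lambda>y. u (t, y)) x\<bar> \<le> K"
    by (metis smooth_bounded_bound[OF sb])
  then obtain K where K: "\<And>i t x. t \<in> {0..T} \<Longrightarrow> \<bar>partial_derivs [i] (\<lambda>y. u (t, y)) x\<bar> \<le> K i" by metis
  have "norm (Du t x) \<le> (\<Sum>i\<in>UNIV. K i)" for t x
    by (rule order_trans[OF norm_le_l1_cart], rule sum_mono) (use K[OF c_in] in \<open>simp add: Du_nth U_def partial_derivs_simps\<close>)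
  moreover have "\<bar>U t x\<bar> \<le> M0" for t x using M0[OF c_in] by (simp add: U_def partial_derivs_simps)
  ultimately have "\<exists>M. M \<ge> 0 \<and> (\<forall>t x. \<bar>U t x\<bar> \<le> M \<and> norm (Du t x) \<le> M)"
    by (intro exI[of _ "max 0 (max M0 (\<Sum>i\<in>UNIV. K i))"]) (auto simp: le_max_iff_disj)
  from someI_ex[OF this] show "Mu \<ge> 0" "\<bar>U t x\<bar> \<le> Mu" "norm (Du t x) \<le> Mu" by (auto simp: Mu_def)
qed

definition Lt :: real where "Lt = (SOME L. \<forall>x. L-lipschitz_on {0..T} (\<lambda>t. u (t, x)))"

lemma Lt: "Lt \<ge> 0" "\<bar>U s x - U t x\<bar> \<le> Lt * \<bar>s - t\<bar>"
proof -
  have "\<exists>L. \<forall>x. L-lipschitz_on {0..T} (\<lambda>t. u (t, x))" using sol by (simp add: classical_solution_def)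
  from someI_ex[OF this] have L: "\<And>x. Lt-lipschitz_on {0..T} (\<lambda>t. u (t, x))" by (simp add: Lt_def)
  show L0: "Lt \<ge> 0" using L[of x] by (rule lipschitz_on_nonneg)
  have "\<bar>U s x - U t x\<bar> \<le> Lt * \<bar>c s - c t\<bar>"
    using lipschitz_onD[OF L c_in c_in, of s x t] by (simp add: U_def dist_real_def)
  also have "\<dots> \<le> Lt * \<bar>s - t\<bar>" by (intro mult_left_mono c_lip L0)
  finally show "\<bar>U s x - U t x\<bar> \<le> Lt * \<bar>s - t\<bar>" .
qed

definition m :: "nat \<Rightarrow> (real ^ 'd \<Rightarrow> real) \<Rightarrow> real \<Rightarrow> real" where
  "m k \<psi> t = (\<integral>x. U t x ^ k * \<psi> x \<partial>lborel)"

lemma U_pow_integrable: "exp_decay \<psi> \<Longrightarrow> integrable lborel (\<lambda>x. U t x ^ k * \<psi> x)"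
  by (intro exp_decay_integrable bdd_diff_power U_bdd_diff)

lemma U_pow_diff: "\<bar>U s x ^ k - U t x ^ k\<bar> \<le> real k * Mu ^ (k - 1) * Lt * \<bar>s - t\<bar>"
proof -
  have "\<bar>U s x ^ k - U t x ^ k\<bar> \<le> real k * Mu ^ (k - 1) * \<bar>U s x - U t x\<bar>"
    by (intro abs_power_diff_le Mu)
  also have "\<dots> \<le> real k * Mu ^ (k - 1) * (Lt * \<bar>s - t\<bar>)" using Mu(1) by (intro mult_left_mono Lt) auto
  finally show ?thesis by (simp add: mult_ac)
qed

lemma m_lipschitz:
  assumes \<psi>: "exp_decay \<psi>"
  shows "\<exists>L. L-lipschitz_on UNIV (m k \<psi>)"
proof -
  define K where "K = real k * Mu ^ (k - 1) * Lt"
  have K: "K \<ge> 0" using Mu(1) Lt(1) by (simp add: K_def)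
  have I\<psi>: "integrable lborel (\<lambda>x. \<bar>\<psi> x\<bar>)" using exp_decay_integrable(1)[OF \<psi> bdd_diff_const[of 1]] by (intro integrable_abs) simp
  have "(K * (\<integral>x. \<bar>\<psi> x\<bar> \<partial>lborel))-lipschitz_on UNIV (m k \<psi>)"
  proof (rule lipschitz_onI)
    fix s t :: real
    have "\<bar>m k \<psi> s - m k \<psi> t\<bar> = \<bar>\<integral>x. (U s x ^ k - U t x ^ k) * \<psi> x \<partial>lborel\<bar>"
      unfolding m_def by (subst Bochner_Integration.integral_diff[symmetric]) (auto intro!: U_pow_integrable \<psi> simp: left_diff_distrib)
    also have "\<dots> \<le> (\<integral>x. K * \<bar>s - t\<bar> * \<bar>\<psi> x\<bar> \<partial>lborel)"
    proof (rule order_trans[OF integral_abs_bound], rule integral_mono_AE)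
      show "integrable lborel (\<lambda>x. \<bar>(U s x ^ k - U t x ^ k) * \<psi> x\<bar>)"
        unfolding left_diff_distrib by (intro integrable_abs Bochner_Integration.integrable_diff U_pow_integrable \<psi>)
      show "integrable lborel (\<lambda>x. K * \<bar>s - t\<bar> * \<bar>\<psi> x\<bar>)" by (intro integrable_mult_right I\<psi>)
      show "AE x in lborel. \<bar>(U s x ^ k - U t x ^ k) * \<psi> x\<bar> \<le> K * \<bar>s - t\<bar> * \<bar>\<psi> x\<bar>"
        unfolding abs_mult K_def by (intro AE_I2 mult_right_mono U_pow_diff) auto
    qed
    also have "\<dots> = K * (\<integral>x. \<bar>\<psi> x\<bar> \<partial>lborel) * \<bar>s - t\<bar>" by simp
    finally show "dist (m k \<psi> s) (m k \<psi> t) \<le> K * (\<integral>x. \<bar>\<psi> x\<bar> \<partial>lborel) * dist s t"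
      by (simp add: dist_real_def)
  qed (use K in simp)
  then show ?thesis by blast
qed

text \<open>Stated for one-sided difference quotients along \<open>1 / (n + 1)\<close>, the form that
  \<open>lipschitz_ftc_ge\<close> accepts; domination comes from the Lipschitz continuity of \<open>u\<close> in time.\<close>

lemma m_derivative:
  assumes \<psi>: "exp_decay \<psi>"
  shows "AE t in lborel. 0 < t \<and> t < T \<longrightarrow>
    (\<lambda>n. real (Suc n) * (m k \<psi> (t + 1 / real (Suc n)) - m k \<psi> t)) \<longlonglongrightarrow> (\<integral>x. energy_density k \<psi> t x \<partial>lborel)"
proof -
  have ae: "AE t in lborel. t \<in> {0..T} \<longrightarrow> (\<forall>x. ((\<lambda>s. u (s, x)) has_real_derivative - elliptic_part a aa b u t x) (at t within {0..T}))"
    using sol by (simp add: classical_solution_def)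
  have I\<psi>: "integrable lborel (\<lambda>x. \<bar>\<psi> x\<bar>)" using exp_decay_integrable(1)[OF \<psi> bdd_diff_const[of 1]] by (intro integrable_abs) simp
  show ?thesis using ae
  proof eventually_elim
    case (elim t)
    show ?case
    proof
      assume t: "0 < t \<and> t < T"
      then have ct: "c t = t" by (intro c_id) auto
      have der: "((\<lambda>s. u (s, x)) has_real_derivative - elliptic_part a aa b u t x) (at t)" for x
      proof -
        have "at t within {0..T} = at t" using t by (intro at_within_interior) (simp add: interior_atLeastAtMost_real)
        then show ?thesis using elim t by auto
      qed
      define q where "q n x = real (Suc n) * (U (t + 1 / real (Suc n)) x ^ k - U t x ^ k) * \<psi> x" for n x
      have mq: "real (Suc n) * (m k \<psi> (t + 1 / real (Suc n)) - m k \<psi> t) = (\<integral>x. q n x \<partial>lborel)" for n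
      proof -
        have "(\<integral>x. q n x \<partial>lborel) = (\<integral>x. real (Suc n) * (U (t + 1 / real (Suc n)) x ^ k * \<psi> x - U t x ^ k * \<psi> x) \<partial>lborel)"
          by (simp add: q_def algebra_simps)
        also have "\<dots> = real (Suc n) * (m k \<psi> (t + 1 / real (Suc n)) - m k \<psi> t)"
          unfolding m_def by (subst integral_mult_right_zero, subst Bochner_Integration.integral_diff) (auto intro!: U_pow_integrable \<psi>)
        finally show ?thesis ..
      qed
      have lim: "(\<lambda>n. q n x) \<longlonglongrightarrow> real k * U t x ^ (k - 1) * (- elliptic_part a aa b u (c t) x) * \<psi> x" for x
      proof -
        have "((\<lambda>s. u (s, x) ^ k) has_real_derivative real k * (- elliptic_part a aa b u t x * u (t, x) ^ (k - 1))) (at t)"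
          using DERIV_power[OF der, of x k] by simp
        then have "((\<lambda>h. (u (t + h, x) ^ k - u (t, x) ^ k) / h) \<longlongrightarrow> real k * (- elliptic_part a aa b u t x * u (t, x) ^ (k - 1))) (at 0)"
          by (simp add: DERIV_def)
        moreover have "filterlim (\<lambda>n. 1 / real (Suc n)) (at 0) sequentially"
          unfolding filterlim_at using LIMSEQ_inverse_real_of_nat by (auto simp: inverse_eq_divide)
        ultimately have "(\<lambda>n. (u (t + 1 / real (Suc n), x) ^ k - u (t, x) ^ k) / (1 / real (Suc n))) \<longlonglongrightarrow> real k * (- elliptic_part a aa b u t x * u (t, x) ^ (k - 1))"
          by (rule filterlim_compose)
        then have L: "(\<lambda>n. real (Suc n) * (u (t + 1 / real (Suc n), x) ^ k - u (t, x) ^ k) * \<psi> x) \<longlonglongrightarrow> real k * (- elliptic_part a aa b u t x * u (t, x) ^ (k - 1)) * \<psi> x"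
          by (intro tendsto_mult_right) (simp add: mult.commute)
        have "(\<lambda>n. t + 1 / real (Suc n)) \<longlonglongrightarrow> t + 0"
          by (intro tendsto_intros) (use LIMSEQ_inverse_real_of_nat in \<open>simp add: inverse_eq_divide\<close>)
        then have "eventually (\<lambda>n. t + 1 / real (Suc n) < T) sequentially"
          using t by (intro order_tendstoD) auto
        then have "eventually (\<lambda>n. real (Suc n) * (u (t + 1 / real (Suc n), x) ^ k - u (t, x) ^ k) * \<psi> x = q n x) sequentially"
        proof eventually_elim
          case (elim n)
          have "0 < 1 / real (Suc n)" by simp
          then have "c (t + 1 / real (Suc n)) = t + 1 / real (Suc n)" using elim t by (intro c_id) auto
          then show ?case by (simp add: q_def U_def ct)
        qed
        then have "(\<lambda>n. q n x) \<longlonglongrightarrow> real k * (- elliptic_part a aa b u t x * u (t, x) ^ (k - 1)) * \<psi> x"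
          using L by (rule Lim_transform_eventually[rotated])
        then show ?thesis by (simp add: U_def ct mult_ac)
      qed
      have [measurable]: "\<psi> \<in> borel_measurable borel" "U s \<in> borel_measurable borel" for s
        using differentiable_imp_measurable exp_decay_D[OF \<psi>] bdd_diff_D[OF U_bdd_diff] by blast+
      have "(\<lambda>n. \<integral>x. q n x \<partial>lborel) \<longlonglongrightarrow> (\<integral>x. real k * U t x ^ (k - 1) * (- elliptic_part a aa b u (c t) x) * \<psi> x \<partial>lborel)"
      proof (rule integral_dominated_convergence[where w = "\<lambda>x. (real k * Mu ^ (k - 1) * Lt) * \<bar>\<psi> x\<bar>"])
        show "(\<lambda>x. real k * U t x ^ (k - 1) * (- elliptic_part a aa b u (c t) x) * \<psi> x) \<in> borel_measurable lborel"
          using flux_identity(1)[OF \<psi>] by auto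
        show "q n \<in> borel_measurable lborel" for n unfolding q_def by measurable
        show "integrable lborel (\<lambda>x. (real k * Mu ^ (k - 1) * Lt) * \<bar>\<psi> x\<bar>)" by (intro integrable_mult_right I\<psi>)
        show "AE x in lborel. (\<lambda>n. q n x) \<longlonglongrightarrow> real k * U t x ^ (k - 1) * (- elliptic_part a aa b u (c t) x) * \<psi> x"
          by (intro AE_I2 lim)
        show "AE x in lborel. norm (q n x) \<le> (real k * Mu ^ (k - 1) * Lt) * \<bar>\<psi> x\<bar>" for n
        proof (rule AE_I2)
          fix x
          have "real (Suc n) * \<bar>U (t + 1 / real (Suc n)) x ^ k - U t x ^ k\<bar> \<le> real (Suc n) * (real k * Mu ^ (k - 1) * Lt * \<bar>t + 1 / real (Suc n) - t\<bar>)"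
            by (intro mult_left_mono U_pow_diff) auto
          also have "\<dots> = real k * Mu ^ (k - 1) * Lt" by (simp del: of_nat_Suc)
          finally have "real (Suc n) * \<bar>U (t + 1 / real (Suc n)) x ^ k - U t x ^ k\<bar> * \<bar>\<psi> x\<bar> \<le> (real k * Mu ^ (k - 1) * Lt) * \<bar>\<psi> x\<bar>"
            by (intro mult_right_mono) auto
          then show "norm (q n x) \<le> (real k * Mu ^ (k - 1) * Lt) * \<bar>\<psi> x\<bar>"
            by (simp add: q_def abs_mult del: of_nat_Suc)
        qed
      qed
      then show "(\<lambda>n. real (Suc n) * (m k \<psi> (t + 1 / real (Suc n)) - m k \<psi> t)) \<longlonglongrightarrow> (\<integral>x. energy_density k \<psi> t x \<partial>lborel)"
        unfolding mq flux_identity(2)[OF \<psi>] .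
    qed
  qed
qed

lemma m_increment_ge:
  assumes \<psi>: "exp_decay \<psi>" and t: "0 \<le> t1" "t1 \<le> t2" "t2 \<le> T"
    and Z: "set_integrable lborel {t1..t2} Z"
    and le: "\<And>t. t \<in> {t1..t2} \<Longrightarrow> Z t \<le> \<sigma> * (\<integral>x. energy_density k \<psi> t x \<partial>lborel)"
  shows "(LINT t:{t1..t2}|lborel. Z t) \<le> \<sigma> * m k \<psi> t2 - \<sigma> * m k \<psi> t1"
proof -
  obtain L where L: "L-lipschitz_on UNIV (m k \<psi>)" using m_lipschitz[OF \<psi>] by blast
  have "(\<bar>\<sigma>\<bar> * L)-lipschitz_on {t1..t2} (\<lambda>t. \<sigma> * m k \<psi> t)"
    using lipschitz_on_subset[OF lipschitz_on_cmult_real[OF L]] by auto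
  then show ?thesis
  proof (rule lipschitz_ftc_ge[OF t(2) _ Z])
    show "AE s in lborel. t1 < s \<and> s < t2 \<longrightarrow> (\<exists>X. (\<lambda>n. real (Suc n) * (\<sigma> * m k \<psi> (s + 1 / real (Suc n)) - \<sigma> * m k \<psi> s)) \<longlonglongrightarrow> X \<and> Z s \<le> X)"
      using m_derivative[OF \<psi>, of k]
    proof eventually_elim
      case (elim s)
      show ?case
      proof
        assume s: "t1 < s \<and> s < t2"
        then have "(\<lambda>n. \<sigma> * (real (Suc n) * (m k \<psi> (s + 1 / real (Suc n)) - m k \<psi> s))) \<longlonglongrightarrow> \<sigma> * (\<integral>x. energy_density k \<psi> s x \<partial>lborel)"
          using elim t by (intro tendsto_mult tendsto_const) auto
        then have "(\<lambda>n. real (Suc n) * (\<sigma> * m k \<psi> (s + 1 / real (Suc n)) - \<sigma> * m k \<psi> s)) \<longlonglongrightarrow> \<sigma> * (\<integral>x. energy_density k \<psi> s x \<partial>lborel)"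
          by (simp add: algebra_simps)
        moreover have "Z s \<le> \<sigma> * (\<integral>x. energy_density k \<psi> s x \<partial>lborel)" using le s by auto
        ultimately show "\<exists>X. (\<lambda>n. real (Suc n) * (\<sigma> * m k \<psi> (s + 1 / real (Suc n)) - \<sigma> * m k \<psi> s)) \<longlonglongrightarrow> X \<and> Z s \<le> X" by blast
      qed
    qed
  qed
qed

lemma U_joint: "(\<lambda>z. U (fst z) (snd z)) \<in> borel_measurable borel"
proof -
  have "(\<lambda>z. (\<lambda>z. U (fst z) (snd z)) z) \<in> borel_measurable borel"
  proof (rule measurable_of_measurable_continuous)
    fix x
    have "Lt-lipschitz_on UNIV (\<lambda>t. U t x)" using Lt by (intro lipschitz_onI) (auto simp: dist_real_def)
    then have "continuous_on UNIV (\<lambda>t. U t x)" by (rule lipschitz_on_continuous_on)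
    then show "(\<lambda>t. U (fst (t, x)) (snd (t, x))) \<in> borel_measurable borel" by (simp add: borel_measurable_continuous_onI)
  next
    fix t
    show "continuous_on UNIV (\<lambda>x. U (fst (t, x)) (snd (t, x)))"
      using bdd_diff_D[OF U_bdd_diff] by (auto intro!: differentiable_imp_continuous_on simp: differentiable_on_def differentiable_at_withinI)
  qed
  then show ?thesis .
qed

lemma U_joint'[measurable]: "case_prod U \<in> borel_measurable (borel \<Otimes>\<^sub>M borel)"
  using U_joint by (simp add: borel_prod case_prod_beta')

lemma DU_joint: "(\<lambda>z. partial_deriv i (U (fst z)) (snd z)) \<in> borel_measurable (borel \<Otimes>\<^sub>M borel)"
proof (rule borel_measurable_LIMSEQ_metric)
  show "(\<lambda>z. real (Suc n) * (U (fst z) (snd z + (1 / real (Suc n)) *\<^sub>R axis i 1) - U (fst z) (snd z))) \<in> borel_measurable (borel \<Otimes>\<^sub>M borel)" for n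
    by measurable
  show "(\<lambda>n. real (Suc n) * (U (fst z) (snd z + (1 / real (Suc n)) *\<^sub>R axis i 1) - U (fst z) (snd z))) \<longlonglongrightarrow> partial_deriv i (U (fst z)) (snd z)" for z
    by (rule partial_deriv_LIMSEQ[OF bdd_diff_D[OF U_bdd_diff]])
qed

lemma Du_joint[measurable]: "case_prod Du \<in> borel_measurable (borel \<Otimes>\<^sub>M borel)"
proof (subst borel_measurable_euclidean_space, rule ballI)
  fix e :: "real ^ 'd" assume "e \<in> Basis"
  then obtain i where "e = axis i 1" by (auto simp: Basis_vec_def)
  then show "(\<lambda>x. (case x of (t, x) \<Rightarrow> Du t x) \<bullet> e) \<in> borel_measurable (borel \<Otimes>\<^sub>M borel)"
    using DU_joint[of i] by (simp add: case_prod_beta' inner_axis Du_nth)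
qed

end

section \<open>Smooth averages over balls\<close>

lemma ball_sets_borel[measurable]: "ball (x :: 'a::metric_space) r \<in> sets borel"
  by simp

text \<open>A truncated quadratic, squared to make it continuously differentiable.\<close>

definition bump0 :: "real ^ 'd::finite \<Rightarrow> real" where
  "bump0 y = (max 0 (1 - (norm y)\<^sup>2))\<^sup>2"

definition bump_mass :: "'d::finite itself \<Rightarrow> real" where
  "bump_mass _ = (\<integral>y. bump0 (y :: real ^ 'd) \<partial>lborel)"

definition bump :: "real \<Rightarrow> real ^ 'd::finite \<Rightarrow> real ^ 'd \<Rightarrow> real" where
  "bump r x y = bump0 ((1 / r) *\<^sub>R (y - x)) / (bump_mass TYPE('d) * r ^ CARD('d))"

lemma max_square_deriv: "((\<lambda>s::real. (max 0 s)\<^sup>2) has_real_derivative 2 * max 0 s) (at s)"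
proof -
  consider "s > 0" | "s < 0" | "s = 0" by linarith
  then show ?thesis
  proof cases
    case 1
    have "((\<lambda>s::real. s\<^sup>2) has_real_derivative 2 * max 0 s) (at s)"
      using 1 by (auto intro!: derivative_eq_intros)
    then show ?thesis
      by (rule has_field_derivative_transform_within_open[of _ _ _ "{0<..}"]) (use 1 in auto)
  next
    case 2
    have "((\<lambda>s::real. 0) has_real_derivative 2 * max 0 s) (at s)" using 2 by auto
    then show ?thesis
      by (rule has_field_derivative_transform_within_open[of _ _ _ "{..<0}"]) (use 2 in auto)
  next
    case 3
    have "((\<lambda>h. ((max 0 (0 + h))\<^sup>2 - (max 0 0)\<^sup>2) / h) \<longlongrightarrow> 0) (at (0::real))"
    proof (rule Lim_null_comparison)
      show "eventually (\<lambda>h::real. norm (((max 0 (0 + h))\<^sup>2 - (max 0 0)\<^sup>2) / h) \<le> \<bar>h\<bar>) (at 0)"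
        by (rule always_eventually) (auto simp: max_def power2_eq_square)
      show "((\<lambda>h::real. \<bar>h\<bar>) \<longlongrightarrow> 0) (at 0)" by (auto intro!: tendsto_eq_intros)
    qed
    then show ?thesis using 3 by (simp add: DERIV_def)
  qed
qed

lemma bump0_has_derivative: "(bump0 has_derivative (\<lambda>h. (- 4 * max 0 (1 - (norm y)\<^sup>2)) * (y \<bullet> h))) (at y)"
proof -
  have 1: "((\<lambda>y::real^'a. 1 - (norm y)\<^sup>2) has_derivative (\<lambda>h. - (2 * (y \<bullet> h)))) (at y)"
    unfolding power2_norm_eq_inner by (auto intro!: derivative_eq_intros simp: inner_commute)
  have 2: "((\<lambda>s::real. (max 0 s)\<^sup>2) has_derivative (\<lambda>h. 2 * max 0 (1 - (norm y)\<^sup>2) * h)) (at (1 - (norm y)\<^sup>2))"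
    using max_square_deriv[of "1 - (norm y)\<^sup>2"] by (simp add: has_field_derivative_def)
  have "((\<lambda>y::real^'a. (max 0 (1 - (norm y)\<^sup>2))\<^sup>2) has_derivative (\<lambda>h. 2 * max 0 (1 - (norm y)\<^sup>2) * - (2 * (y \<bullet> h)))) (at y)"
    by (rule has_derivative_compose[OF 1 2])
  then show ?thesis unfolding bump0_def[abs_def] by (simp add: mult_ac)
qed

lemma bump0_nonneg: "bump0 y \<ge> 0" by (simp add: bump0_def)
lemma bump0_le: "bump0 y \<le> 1"
proof -
  have "max 0 (1 - (norm y)\<^sup>2) \<le> 1" by simp
  then have "(max 0 (1 - (norm y)\<^sup>2))\<^sup>2 \<le> 1\<^sup>2" by (intro power_mono) auto
  then show ?thesis by (simp add: bump0_def)
qed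
lemma bump0_zero: "norm y \<ge> 1 \<Longrightarrow> bump0 y = 0"
  using power_mono[of 1 "norm y" 2] by (simp add: bump0_def)

lemma bump0_measurable[measurable]: "bump0 \<in> borel_measurable borel"
  unfolding bump0_def[abs_def] by measurable

lemma bump0_integrable: "integrable lborel (bump0 :: real ^ 'd::finite \<Rightarrow> real)"
proof (rule Bochner_Integration.integrable_bound)
  show "integrable lborel (\<lambda>x::real^'d. indicator (ball 0 1) x :: real)"
    using emeasure_lborel_ball_finite[of "0::real^'d" 1] by (intro integrable_real_indicator) auto
  show "AE x in lborel. norm (bump0 (x::real^'d)) \<le> norm (indicator (ball 0 1) x :: real)"
  proof (rule AE_I2)
    fix x :: "real ^ 'd"
    show "norm (bump0 x) \<le> norm (indicator (ball 0 1) x :: real)"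
      using bump0_le[of x] bump0_zero[of x] bump0_nonneg[of x] by (auto simp: indicator_def)
  qed
qed auto

lemma bump_mass_pos: "bump_mass TYPE('d::finite) > 0"
proof -
  have "bump_mass TYPE('d) \<noteq> 0"
  proof
    assume "bump_mass TYPE('d) = 0"
    then have "AE y in lborel. bump0 (y::real^'d) = 0"
      unfolding bump_mass_def using integral_nonneg_eq_0_iff_AE[OF bump0_integrable] bump0_nonneg by auto
    then have "AE y in lborel. y \<notin> ball (0::real^'d) 1"
    proof eventually_elim
      case (elim y)
      show ?case
      proof
        assume "y \<in> ball 0 1"
        then have "(norm y)\<^sup>2 < 1" by (simp add: power_less_one_iff abs_square_less_1)
        then have "bump0 y > 0" by (simp add: bump0_def)
        then show False using elim by simp
      qed
    qed
    then have "emeasure lborel (ball (0::real^'d) 1) = 0"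
      by (subst (asm) AE_iff_measurable[of "ball 0 1"]) auto
    then show False using unit_ball_vol_pos[of "real CARD('d)"] by (simp add: emeasure_ball)
  qed
  moreover have "bump_mass TYPE('d) \<ge> 0" unfolding bump_mass_def using bump0_nonneg by (intro integral_nonneg_AE) auto
  ultimately show ?thesis by simp
qed

definition bump_const :: "'d::finite itself \<Rightarrow> real" where
  "bump_const _ = 4 / bump_mass TYPE('d)"

lemma bump_const_pos: "bump_const TYPE('d::finite) > 0"
  using bump_mass_pos[where 'd = 'd] by (simp add: bump_const_def)

lemma bump_nonneg: "r > 0 \<Longrightarrow> bump r x (y :: real ^ 'd::finite) \<ge> 0"
  using bump_mass_pos[where 'd = 'd] bump0_nonneg[of "(1 / r) *\<^sub>R (y - x)"] by (simp add: bump_def)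

lemma bump_le:
  fixes x y :: "real ^ 'd::finite"
  assumes "r > 0"
  shows "bump r x y \<le> bump_const TYPE('d) / r ^ CARD('d) * indicator (ball x r) y"
proof (cases "y \<in> ball x r")
  case True
  have "bump r x y \<le> 4 / (bump_mass TYPE('d) * r ^ CARD('d))"
    unfolding bump_def using bump0_le[of "(1 / r) *\<^sub>R (y - x)"] bump_mass_pos[where 'd = 'd] assms
    by (intro divide_right_mono) auto
  then show ?thesis using True by (simp add: bump_const_def)
next
  case False
  then have "norm ((1 / r) *\<^sub>R (y - x)) \<ge> 1" using assms by (simp add: dist_norm norm_minus_commute)
  then show ?thesis using False by (simp add: bump_def bump0_zero)
qed

lemma bump_has_derivative:
  fixes x y :: "real ^ 'd::finite"
  assumes "r > 0"
  shows "(bump r x has_derivative (\<lambda>h. ((- 4 * max 0 (1 - (norm ((1 / r) *\<^sub>R (y - x)))\<^sup>2)) / (bump_mass TYPE('d) * r ^ CARD('d) * r)) *\<^sub>R ((1 / r) *\<^sub>R (y - x)) \<bullet> h)) (at y)"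
proof -
  have 1: "((\<lambda>y. (1 / r) *\<^sub>R (y - x)) has_derivative (\<lambda>h. (1 / r) *\<^sub>R h)) (at y)"
    by (auto intro!: derivative_eq_intros)
  have "((\<lambda>y. bump0 ((1 / r) *\<^sub>R (y - x))) has_derivative (\<lambda>h. (- 4 * max 0 (1 - (norm ((1 / r) *\<^sub>R (y - x)))\<^sup>2)) * (((1 / r) *\<^sub>R (y - x)) \<bullet> ((1 / r) *\<^sub>R h)))) (at y)"
    by (rule has_derivative_compose[OF 1 bump0_has_derivative])
  then have "((\<lambda>y. bump0 ((1 / r) *\<^sub>R (y - x)) / (bump_mass TYPE('d) * r ^ CARD('d))) has_derivative (\<lambda>h. (- 4 * max 0 (1 - (norm ((1 / r) *\<^sub>R (y - x)))\<^sup>2)) * (((1 / r) *\<^sub>R (y - x)) \<bullet> ((1 / r) *\<^sub>R h)) / (bump_mass TYPE('d) * r ^ CARD('d)))) (at y)"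
    by (rule bounded_linear.has_derivative[OF bounded_linear_divide])
  then show ?thesis unfolding bump_def[abs_def] using assms by (simp add: mult_ac)
qed

lemma bump_differentiable: "r > 0 \<Longrightarrow> bump r x differentiable (at y)"
  using bump_has_derivative by (auto simp: differentiable_def)

lemma gradient_eqI:
  fixes f :: "real ^ 'd::finite \<Rightarrow> real"
  assumes "(f has_derivative (\<lambda>h. v \<bullet> h)) (at y)"
  shows "gradient f y = v"
  by (simp add: vec_eq_iff gradient_def has_derivative_partial[OF assms] inner_axis)

lemma bump_gradient_le:
  fixes x y :: "real ^ 'd::finite"
  assumes r: "r > 0"
  shows "norm (gradient (bump r x) y) \<le> bump_const TYPE('d) / r ^ (CARD('d) + 1) * indicator (ball x r) y"
proof -
  let ?z = "(1 / r) *\<^sub>R (y - x)"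
  have g: "gradient (bump r x) y = ((- 4 * max 0 (1 - (norm ?z)\<^sup>2)) / (bump_mass TYPE('d) * r ^ CARD('d) * r)) *\<^sub>R ?z"
    by (rule gradient_eqI[OF bump_has_derivative[OF r]])
  show ?thesis
  proof (cases "y \<in> ball x r")
    case True
    then have z: "norm ?z \<le> 1" using r by (simp add: dist_norm norm_minus_commute)
    have "norm (gradient (bump r x) y) = (4 * max 0 (1 - (norm ?z)\<^sup>2) * norm ?z) / (bump_mass TYPE('d) * r ^ CARD('d) * r)"
      unfolding g norm_scaleR using r bump_mass_pos[where 'd = 'd] by (simp add: abs_mult)
    also have "\<dots> \<le> (4 * 1 * 1) / (bump_mass TYPE('d) * r ^ CARD('d) * r)"
      using r bump_mass_pos[where 'd = 'd] z by (intro divide_right_mono mult_mono) auto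
    finally show ?thesis using True by (simp add: bump_const_def mult_ac)
  next
    case False
    then have "norm ?z \<ge> 1" using r by (simp add: dist_norm norm_minus_commute)
    then have "(norm ?z)\<^sup>2 \<ge> 1" using power_mono[of 1 "norm ?z" 2] by simp
    then have "gradient (bump r x) y = 0" unfolding g by (simp add: max_def)
    then show ?thesis using False by simp
  qed
qed

lemma abs_partial_le_gradient: "\<bar>partial_deriv i f x\<bar> \<le> norm (gradient f x)"
  using component_le_norm_cart[of "gradient f x" i] by (simp add: gradient_def)

lemma bump_exp_decay:
  fixes x :: "real ^ 'd::finite"
  assumes r: "r > 0"
  shows "exp_decay (bump r x)"
proof -
  define C where "C = (bump_const TYPE('d) / r ^ CARD('d) + bump_const TYPE('d) / r ^ (CARD('d) + 1)) * exp (norm x + r)"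
  have p: "bump_const TYPE('d) / r ^ CARD('d) \<ge> 0" "bump_const TYPE('d) / r ^ (CARD('d) + 1) \<ge> 0"
    using bump_const_pos[where 'd = 'd] r by auto
  have ind: "indicator (ball x r) y \<le> exp (norm x + r) * exp (- 1 * norm y)" for y
  proof (cases "y \<in> ball x r")
    case True
    then have "norm y \<le> norm x + r" using norm_triangle_ineq[of "y - x" x] by (simp add: dist_norm norm_minus_commute)
    then show ?thesis using True by (simp add: exp_add[symmetric])
  qed simp
  have "\<bar>bump r x y\<bar> \<le> C * exp (- 1 * norm y) \<and> (\<forall>i. \<bar>partial_deriv i (bump r x) y\<bar> \<le> C * exp (- 1 * norm y))" for y
  proof -
    have le: "(\<alpha> :: real) * indicator (ball x r) y \<le> C * exp (- 1 * norm y)" if "0 \<le> \<alpha>" "\<alpha> \<le> bump_const TYPE('d) / r ^ CARD('d) + bump_const TYPE('d) / r ^ (CARD('d) + 1)" for \<alpha>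
      unfolding C_def mult.assoc using that p by (intro mult_mono ind) auto
    have "\<bar>bump r x y\<bar> \<le> C * exp (- 1 * norm y)"
      using bump_nonneg[OF r, of x y] bump_le[OF r, of x y] le[OF p(1)] p by auto
    moreover have "\<bar>partial_deriv i (bump r x) y\<bar> \<le> C * exp (- 1 * norm y)" for i
      using order_trans[OF abs_partial_le_gradient bump_gradient_le[OF r]] le[OF p(2)] p by (meson order_trans le_add_same_cancel2)
    ultimately show ?thesis by blast
  qed
  then show ?thesis unfolding exp_decay_def using bump_differentiable[OF r]
    by (intro conjI allI exI[of _ C] exI[of _ "1::real"]) auto
qed

lemma nn_integral_affine:
  fixes F :: "'a::euclidean_space \<Rightarrow> ennreal"
  assumes [measurable]: "F \<in> borel_measurable borel" and r: "r > 0"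
  shows "(\<integral>\<^sup>+y. F y \<partial>lborel) = ennreal (r ^ DIM('a)) * (\<integral>\<^sup>+y. F (x + r *\<^sub>R y) \<partial>lborel)"
proof -
  have "(\<integral>\<^sup>+y. F y \<partial>lborel) = (\<integral>\<^sup>+y. F y \<partial>density (distr lborel borel (\<lambda>y. x + r *\<^sub>R y)) (\<lambda>_. ennreal (\<bar>r\<bar> ^ DIM('a))))"
    using lborel_affine[of r x] r by simp
  also have "\<dots> = (\<integral>\<^sup>+y. ennreal (r ^ DIM('a)) * F y \<partial>distr lborel borel (\<lambda>y. x + r *\<^sub>R y))"
    using r by (subst nn_integral_density) auto
  also have "\<dots> = (\<integral>\<^sup>+y. ennreal (r ^ DIM('a)) * F (x + r *\<^sub>R y) \<partial>lborel)"
    by (subst nn_integral_distr) auto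
  finally show ?thesis by (simp add: nn_integral_cmult)
qed

lemma bump_measurable[measurable]: "bump r x \<in> borel_measurable borel"
  unfolding bump_def[abs_def] by measurable

text \<open>The bump normalised to integral one, at unit scale.\<close>

definition chi :: "real ^ 'd::finite \<Rightarrow> real" where "chi y = bump0 y / bump_mass TYPE('d)"

lemma chi_measurable[measurable]: "chi \<in> borel_measurable borel" unfolding chi_def[abs_def] by measurable
lemma chi_nonneg: "chi (y :: real ^ 'd::finite) \<ge> 0" using bump0_nonneg[of y] bump_mass_pos[where 'd = 'd] by (simp add: chi_def)
lemma chi_le: "chi (y :: real ^ 'd::finite) \<le> bump_const TYPE('d) * indicator (ball 0 1) y"
  using bump_le[of 1 0 y] by (simp add: bump_def chi_def)
lemma chi_integral: "(\<integral>y. chi (y :: real ^ 'd::finite) \<partial>lborel) = 1"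
  using bump_mass_pos[where 'd = 'd] unfolding chi_def bump_mass_def[symmetric] by (simp add: bump_mass_def)
lemma chi_integrable: "integrable lborel (chi :: real ^ 'd::finite \<Rightarrow> real)"
  unfolding chi_def[abs_def] by (intro integrable_divide bump0_integrable)

lemma bump_change:
  fixes w :: "real ^ 'd::finite \<Rightarrow> real"
  assumes r: "r > 0" and [measurable]: "w \<in> borel_measurable borel" and M: "\<And>y. \<bar>w y\<bar> \<le> M"
  shows "(\<integral>y. w y * bump r x y \<partial>lborel) = (\<integral>y. w (x + r *\<^sub>R y) * chi y \<partial>lborel)"
    and "integrable lborel (\<lambda>y. w (x + r *\<^sub>R y) * chi y)"
proof -
  have "lborel = density (distr lborel borel (\<lambda>y. x + r *\<^sub>R y)) (\<lambda>_. ennreal (\<bar>r\<bar> ^ DIM(real ^ 'd)))"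
    using lborel_affine[of r x] r by simp
  then have "(\<integral>y. w y * bump r x y \<partial>lborel) = (\<integral>y. w y * bump r x y \<partial>density (distr lborel borel (\<lambda>y. x + r *\<^sub>R y)) (\<lambda>_. ennreal (\<bar>r\<bar> ^ DIM(real ^ 'd))))"
    by (rule arg_cong)
  also have "\<dots> = (\<integral>y. r ^ CARD('d) * (w y * bump r x y) \<partial>distr lborel borel (\<lambda>y. x + r *\<^sub>R y))"
    using r by (subst integral_density) auto
  also have "\<dots> = (\<integral>y. r ^ CARD('d) * (w (x + r *\<^sub>R y) * bump r x (x + r *\<^sub>R y)) \<partial>lborel)"
    by (subst integral_distr) auto
  also have "\<dots> = (\<integral>y. w (x + r *\<^sub>R y) * chi y \<partial>lborel)"
    using r by (intro Bochner_Integration.integral_cong refl) (simp add: bump_def chi_def)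
  finally show "(\<integral>y. w y * bump r x y \<partial>lborel) = (\<integral>y. w (x + r *\<^sub>R y) * chi y \<partial>lborel)" .
  show "integrable lborel (\<lambda>y. w (x + r *\<^sub>R y) * chi y)"
  proof (rule Bochner_Integration.integrable_bound)
    show "integrable lborel (\<lambda>y::real^'d. M * chi y)" by (intro integrable_mult_right chi_integrable)
    show "AE y in lborel. norm (w (x + r *\<^sub>R y) * chi y) \<le> norm (M * chi y)"
    proof (rule AE_I2)
      fix y
      have "\<bar>w (x + r *\<^sub>R y)\<bar> \<le> \<bar>M\<bar>" using M[of "x + r *\<^sub>R y"] by linarith
      then show "norm (w (x + r *\<^sub>R y) * chi y) \<le> norm (M * chi y)"
        using chi_nonneg[of y] by (simp add: abs_mult mult_right_mono)
    qed
  qed measurable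
qed

text \<open>After rescaling to the unit ball, the two averages differ by an integral of \<open>w (x + r y) - w (x + r y / 2)\<close>.
  The fundamental theorem of calculus on the segment between the two points, and a change of variables for each
  point of the segment, give the integral of the gradient over the ball. A Poincare inequality between scales.\<close>

lemma bump_scale_step:
  fixes w :: "real ^ 'd::finite \<Rightarrow> real"
  assumes w: "bdd_diff w" and Dw: "\<And>i. bdd_diff (partial_deriv i w)" and r: "r > 0"
  shows "ennreal \<bar>(\<integral>y. w y * bump r x y \<partial>lborel) - (\<integral>y. w y * bump (r / 2) x y \<partial>lborel)\<bar>
    \<le> ennreal (2 ^ CARD('d) * bump_const TYPE('d) * r / r ^ CARD('d)) * (\<integral>\<^sup>+y\<in>ball x r. ennreal (norm (gradient w y)) \<partial>lborel)"
proof -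
  have [measurable]: "w \<in> borel_measurable borel" "partial_deriv i w \<in> borel_measurable borel" for i
    using differentiable_imp_measurable partial_deriv_measurable bdd_diff_D[OF w] by blast+
  have gm[measurable]: "gradient w \<in> borel_measurable borel"
  proof (subst borel_measurable_euclidean_space, rule ballI)
    fix e :: "real ^ 'd" assume "e \<in> Basis"
    then obtain i where "e = axis i 1" by (auto simp: Basis_vec_def)
    then show "(\<lambda>x. gradient w x \<bullet> e) \<in> borel_measurable borel" by (simp add: inner_axis gradient_def)
  qed
  have gc: "continuous_on UNIV (gradient w)"
    unfolding gradient_def[abs_def]
    by (intro continuous_on_vec_lambda) (auto intro!: differentiable_imp_continuous_on simp: differentiable_on_def differentiable_at_withinI bdd_diff_D[OF Dw])
  obtain M where M: "\<And>y. \<bar>w y\<bar> \<le> M" by (rule bdd_diff_bound[OF w]) blast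
  define N where "N = (\<integral>\<^sup>+y\<in>ball x r. ennreal (norm (gradient w y)) \<partial>lborel)"
  let ?K = "bump_const TYPE('d)"
  \<comment> \<open>The increment along the ray from x through y, between half the radius and the full radius.\<close>
  have line: "ennreal \<bar>w (x + r *\<^sub>R y) - w (x + (r / 2) *\<^sub>R y)\<bar>
     \<le> (\<integral>\<^sup>+s\<in>{1/2..1}. ennreal (r * norm (gradient w (x + (r * s) *\<^sub>R y))) \<partial>lborel)" if y: "norm y \<le> 1" for y
  proof -
    define G where "G s = gradient w (x + (r * s) *\<^sub>R y) \<bullet> (r *\<^sub>R y)" for s
    have der: "((\<lambda>s. w (x + (r * s) *\<^sub>R y)) has_vector_derivative G s) (at s within {1/2..1})" for s
    proof -
      have 1: "((\<lambda>s. x + (r * s) *\<^sub>R y) has_derivative (\<lambda>h. h *\<^sub>R (r *\<^sub>R y))) (at s)"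
        by (auto intro!: derivative_eq_intros simp: mult.commute)
      have "((\<lambda>s. w (x + (r * s) *\<^sub>R y)) has_derivative (\<lambda>h. gradient w (x + (r * s) *\<^sub>R y) \<bullet> (h *\<^sub>R (r *\<^sub>R y)))) (at s)"
        by (rule has_derivative_compose[OF 1 has_derivative_gradient[OF bdd_diff_D[OF w]]])
      then have "((\<lambda>s. w (x + (r * s) *\<^sub>R y)) has_vector_derivative G s) (at s)"
        unfolding has_vector_derivative_def G_def by (simp add: mult.assoc)
      then show ?thesis by (rule has_vector_derivative_at_within)
    qed
    have cG: "continuous_on {1/2..1} G" unfolding G_def
      by (intro continuous_intros continuous_on_compose2[OF gc]) auto
    have "(G has_integral (w (x + (r * 1) *\<^sub>R y) - w (x + (r * (1 / 2)) *\<^sub>R y))) {1/2..1}"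
      by (rule fundamental_theorem_of_calculus) (auto intro: der)
    moreover have sG: "set_integrable lborel {1/2..1} G" by (rule borel_integrable_atLeastAtMost'[OF cG])
    ultimately have "(LINT s:{1/2..1}|lborel. G s) = w (x + r *\<^sub>R y) - w (x + (r / 2) *\<^sub>R y)"
      using set_borel_integral_eq_integral(2)[OF sG] integral_unique by (metis mult.right_neutral times_divide_eq_right)
    then have "ennreal \<bar>w (x + r *\<^sub>R y) - w (x + (r / 2) *\<^sub>R y)\<bar> = ennreal (norm (LINT s|lborel. indicator {1/2..1} s *\<^sub>R G s))"
      by (simp add: set_lebesgue_integral_def)
    also have "\<dots> \<le> (\<integral>\<^sup>+s. ennreal (norm (indicator {1/2..1} s *\<^sub>R G s)) \<partial>lborel)"
      by (rule integral_norm_bound_ennreal) (use sG in \<open>simp add: set_integrable_def\<close>)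
    also have "\<dots> \<le> (\<integral>\<^sup>+s\<in>{1/2..1}. ennreal (r * norm (gradient w (x + (r * s) *\<^sub>R y))) \<partial>lborel)"
    proof (intro nn_integral_mono)
      fix s :: real
      have "\<bar>G s\<bar> \<le> norm (gradient w (x + (r * s) *\<^sub>R y)) * norm (r *\<^sub>R y)" unfolding G_def by (rule Cauchy_Schwarz_ineq2)
      also have "\<dots> \<le> norm (gradient w (x + (r * s) *\<^sub>R y)) * r" using r y by (intro mult_left_mono) (auto simp: mult_left_le)
      finally show "ennreal (norm (indicator {1/2..1} s *\<^sub>R G s)) \<le> ennreal (r * norm (gradient w (x + (r * s) *\<^sub>R y))) * indicator {1/2..1} s"
        by (auto simp: indicator_def mult.commute ennreal_leI)
    qed
    finally show ?thesis .
  qed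
  have "ennreal \<bar>(\<integral>y. w y * bump r x y \<partial>lborel) - (\<integral>y. w y * bump (r / 2) x y \<partial>lborel)\<bar>
     = ennreal (norm (\<integral>y. (w (x + r *\<^sub>R y) - w (x + (r / 2) *\<^sub>R y)) * chi y \<partial>lborel))"
    using bump_change[of r w M x] bump_change[of "r / 2" w M x] r M
    by (simp add: left_diff_distrib)
  also have "\<dots> \<le> (\<integral>\<^sup>+y. ennreal (norm ((w (x + r *\<^sub>R y) - w (x + (r / 2) *\<^sub>R y)) * chi y)) \<partial>lborel)"
    using bump_change(2)[of r w M x] bump_change(2)[of "r / 2" w M x] r M
    by (intro integral_norm_bound_ennreal) (simp add: left_diff_distrib)
  also have "\<dots> \<le> (\<integral>\<^sup>+y. (\<integral>\<^sup>+s. indicator {1/2..1} s * (ennreal (r * ?K) * (ennreal (norm (gradient w (x + (r * s) *\<^sub>R y))) * indicator (ball 0 1) y)) \<partial>lborel) \<partial>lborel)"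
  proof (intro nn_integral_mono)
    fix y :: "real ^ 'd"
    show "ennreal (norm ((w (x + r *\<^sub>R y) - w (x + (r / 2) *\<^sub>R y)) * chi y)) \<le>
      (\<integral>\<^sup>+s. indicator {1/2..1} s * (ennreal (r * ?K) * (ennreal (norm (gradient w (x + (r * s) *\<^sub>R y))) * indicator (ball 0 1) y)) \<partial>lborel)"
    proof (cases "y \<in> ball 0 1")
      case True
      have "ennreal (norm ((w (x + r *\<^sub>R y) - w (x + (r / 2) *\<^sub>R y)) * chi y)) = ennreal \<bar>w (x + r *\<^sub>R y) - w (x + (r / 2) *\<^sub>R y)\<bar> * ennreal (chi y)"
        using chi_nonneg[of y] by (simp add: abs_mult ennreal_mult)
      also have "\<dots> \<le> (\<integral>\<^sup>+s\<in>{1/2..1}. ennreal (r * norm (gradient w (x + (r * s) *\<^sub>R y))) \<partial>lborel) * ennreal ?K"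
        using True chi_le[of y] by (intro mult_mono line ennreal_leI) auto
      also have "\<dots> = (\<integral>\<^sup>+s. indicator {1/2..1} s * (ennreal (r * ?K) * (ennreal (norm (gradient w (x + (r * s) *\<^sub>R y))) * indicator (ball 0 1) y)) \<partial>lborel)"
        using True r bump_const_pos[where 'd = 'd]
        by (subst nn_integral_multc[symmetric]) (auto intro!: nn_integral_cong simp: ennreal_mult mult_ac)
      finally show ?thesis .
    next
      case False
      then have "chi y = 0" using chi_le[of y] chi_nonneg[of y] by simp
      then show ?thesis by simp
    qed
  qed
  also have "\<dots> = (\<integral>\<^sup>+s. (\<integral>\<^sup>+y. indicator {1/2..1} s * (ennreal (r * ?K) * (ennreal (norm (gradient w (x + (r * s) *\<^sub>R y))) * indicator (ball 0 1) y)) \<partial>lborel) \<partial>lborel)"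
  proof (rule nn_integral_swap)
    have [measurable]: "ball (0::real^'d) 1 \<in> sets borel" "{1/2..1::real} \<in> sets borel" by auto
    show "(\<lambda>(y, s). indicator {1/2..1} s * (ennreal (r * ?K) * (ennreal (norm (gradient w (x + (r * s) *\<^sub>R y))) * indicator (ball 0 1) y))) \<in> borel_measurable borel"
      unfolding pair_borel[symmetric] by measurable
  qed
  also have "\<dots> \<le> (\<integral>\<^sup>+s. indicator {1/2..1} s * (ennreal (r * ?K) * (ennreal (2 ^ CARD('d) / r ^ CARD('d)) * N)) \<partial>(lborel :: real measure))"
  proof (intro nn_integral_mono)
    fix s :: real
    show "(\<integral>\<^sup>+y. indicator {1/2..1} s * (ennreal (r * ?K) * (ennreal (norm (gradient w (x + (r * s) *\<^sub>R y))) * indicator (ball 0 1) y)) \<partial>lborel)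
      \<le> indicator {1/2..1} s * (ennreal (r * ?K) * (ennreal (2 ^ CARD('d) / r ^ CARD('d)) * N))"
    proof (cases "s \<in> {1/2..1}")
      case True
      define R where "R = r * s"
      have R: "R > 0" "R \<le> r" "r / 2 \<le> R" using True r by (auto simp: R_def)
      have "N \<ge> (\<integral>\<^sup>+y. ennreal (norm (gradient w y)) * indicator (ball x R) y \<partial>lborel)"
        unfolding N_def using R by (intro nn_integral_mono) (auto simp: indicator_def)
      also have "(\<integral>\<^sup>+y. ennreal (norm (gradient w y)) * indicator (ball x R) y \<partial>lborel)
        = ennreal (R ^ CARD('d)) * (\<integral>\<^sup>+y. ennreal (norm (gradient w (x + R *\<^sub>R y))) * indicator (ball x R) (x + R *\<^sub>R y) \<partial>lborel)"
      proof -
        have [measurable]: "ball x R \<in> sets borel" by simp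
        have "(\<lambda>y. ennreal (norm (gradient w y)) * indicator (ball x R) y) \<in> borel_measurable borel" by measurable
        from nn_integral_affine[OF this R(1), of x] show ?thesis by simp
      qed
      also have "(\<lambda>y. indicator (ball x R) (x + R *\<^sub>R y)) = (indicator (ball 0 1) :: real ^ 'd \<Rightarrow> ennreal)"
        using R by (auto simp: indicator_def dist_norm fun_eq_iff)
      then have "(\<integral>\<^sup>+y. ennreal (norm (gradient w (x + R *\<^sub>R y))) * indicator (ball x R) (x + R *\<^sub>R y) \<partial>lborel) = (\<integral>\<^sup>+y. ennreal (norm (gradient w (x + R *\<^sub>R y))) * indicator (ball 0 1) y \<partial>lborel)" (is "_ = ?X")
        by (simp add: fun_eq_iff)
      finally have NX: "ennreal (R ^ CARD('d)) * ?X \<le> N" by simp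
      have "?X = ennreal (1 / R ^ CARD('d)) * (ennreal (R ^ CARD('d)) * ?X)"
        using R by (simp add: mult.assoc[symmetric] ennreal_mult[symmetric])
      also have "\<dots> \<le> ennreal (2 ^ CARD('d) / r ^ CARD('d)) * N"
      proof (intro mult_mono NX ennreal_leI)
        have "1 / R ^ CARD('d) \<le> 1 / (r / 2) ^ CARD('d)" using R r by (intro divide_left_mono power_mono mult_pos_pos) auto
        then show "1 / R ^ CARD('d) \<le> 2 ^ CARD('d) / r ^ CARD('d)" by (simp add: power_divide)
      qed auto
      finally have X: "?X \<le> ennreal (2 ^ CARD('d) / r ^ CARD('d)) * N" .
      have "(\<integral>\<^sup>+y. indicator {1/2..1} s * (ennreal (r * ?K) * (ennreal (norm (gradient w (x + (r * s) *\<^sub>R y))) * indicator (ball 0 1) y)) \<partial>lborel)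
         = ennreal (r * ?K) * ?X"
        using True by (simp add: nn_integral_cmult R_def)
      also have "\<dots> \<le> ennreal (r * ?K) * (ennreal (2 ^ CARD('d) / r ^ CARD('d)) * N)" by (intro mult_left_mono X) auto
      finally show ?thesis using True by simp
    qed simp
  qed
  also have "\<dots> = ennreal (1 / 2) * (ennreal (r * ?K) * (ennreal (2 ^ CARD('d) / r ^ CARD('d)) * N))"
    by (subst nn_integral_multc) auto
  also have "\<dots> \<le> 1 * (ennreal (r * ?K) * (ennreal (2 ^ CARD('d) / r ^ CARD('d)) * N))"
  proof (rule mult_right_mono)
    have "ennreal (1 / 2) \<le> ennreal 1" by (rule ennreal_leI) simp
    then show "ennreal (1 / 2) \<le> 1" by (simp only: ennreal_1)
  qed simp
  also have "\<dots> = ennreal ((r * ?K) * (2 ^ CARD('d) / r ^ CARD('d))) * N"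
    using r bump_const_pos[where 'd = 'd] by (subst ennreal_mult) (auto simp: mult.assoc)
  also have "(r * ?K) * (2 ^ CARD('d) / r ^ CARD('d)) = 2 ^ CARD('d) * ?K * r / r ^ CARD('d)" by simp
  finally show ?thesis by (simp add: N_def)
qed

section \<open>Lower bounds for the energy density\<close>

lemma young_eps: "(\<epsilon>::real) > 0 \<Longrightarrow> x * y \<le> \<epsilon> * x\<^sup>2 + y\<^sup>2 / (4 * \<epsilon>)"
proof -
  assume e: "\<epsilon> > 0"
  have "0 \<le> (2 * \<epsilon> * x - y)\<^sup>2" by simp
  then have "x * y * (4 * \<epsilon>) \<le> (2 * \<epsilon> * x)\<^sup>2 + y\<^sup>2" by (simp add: power2_eq_square algebra_simps)
  then have "x * y \<le> ((2 * \<epsilon> * x)\<^sup>2 + y\<^sup>2) / (4 * \<epsilon>)" using e by (subst pos_le_divide_eq) auto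
  also have "\<dots> = \<epsilon> * x\<^sup>2 + y\<^sup>2 / (4 * \<epsilon>)" using e by (simp add: add_divide_distrib power2_eq_square)
  finally show ?thesis .
qed

locale power_solution = solution \<delta> T a aa b f u
  for \<delta> T :: real
    and a :: "real \<times> (real ^ 'd::finite) \<Rightarrow> real ^ 'd ^ 'd"
    and aa b :: "real \<times> (real ^ 'd) \<Rightarrow> real ^ 'd" and f :: "real ^ 'd \<Rightarrow> real"
    and u :: "real \<times> (real ^ 'd) \<Rightarrow> real" +
  fixes n :: nat
  assumes n: "n = 1 \<or> (even n \<and> n \<ge> 2)"
begin

definition g :: "real \<times> (real ^ 'd) \<Rightarrow> real" where "g z = max (norm (b z)) (norm (aa z))"
definition gg :: "real \<Rightarrow> real ^ 'd \<Rightarrow> real" where "gg t x = g (c t, x)"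
text \<open>
  \<open>V\<close> and \<open>P\<close> are taken with absolute values, so \<open>P\<close> equals \<open>\<bar>DV\<bar> / n\<close> wherever \<open>u\<close> does not vanish.
\<close>
definition V :: "real \<Rightarrow> real ^ 'd \<Rightarrow> real" where "V t x = \<bar>U t x\<bar> ^ n"
definition P :: "real \<Rightarrow> real ^ 'd \<Rightarrow> real" where "P t x = \<bar>U t x\<bar> ^ (n - 1) * norm (Du t x)"

lemma n1: "n \<ge> 1" using n by auto
lemma g_nonneg: "g z \<ge> 0" by (simp add: g_def le_max_iff_disj)
lemma gg_nonneg: "gg t x \<ge> 0" by (simp add: gg_def g_nonneg)
lemma V_nonneg: "V t x \<ge> 0" by (simp add: V_def)
lemma P_nonneg: "P t x \<ge> 0" by (simp add: P_def)

lemma gg_b: "norm (b (c t, x)) \<le> gg t x" and gg_aa: "norm (aa (c t, x)) \<le> gg t x"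
  by (simp_all add: gg_def g_def)

lemma a_in: "a z \<in> S_delta \<delta>" using a_S by auto

lemma H_Du_ge: "H t x \<bullet> Du t x \<ge> \<delta> * (norm (Du t x))\<^sup>2 - gg t x * \<bar>U t x\<bar> * norm (Du t x)"
proof -
  have "H t x \<bullet> Du t x = Du t x \<bullet> (a (c t, x) *v Du t x) + U t x * (aa (c t, x) \<bullet> Du t x)"
    by (simp add: H_def inner_add_left inner_add_right inner_commute)
  moreover have "\<delta> * (norm (Du t x))\<^sup>2 \<le> Du t x \<bullet> (a (c t, x) *v Du t x)" by (rule S_delta_coercive[OF a_in])
  moreover have "\<bar>U t x * (aa (c t, x) \<bullet> Du t x)\<bar> \<le> gg t x * \<bar>U t x\<bar> * norm (Du t x)"
  proof -
    have "\<bar>aa (c t, x) \<bullet> Du t x\<bar> \<le> gg t x * norm (Du t x)"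
      by (rule order_trans[OF Cauchy_Schwarz_ineq2]) (intro mult_right_mono gg_aa norm_ge_zero)
    then have "\<bar>U t x\<bar> * \<bar>aa (c t, x) \<bullet> Du t x\<bar> \<le> \<bar>U t x\<bar> * (gg t x * norm (Du t x))" by (rule mult_left_mono) simp
    then show ?thesis by (simp add: abs_mult mult_ac)
  qed
  ultimately show ?thesis by linarith
qed

lemma H_norm_le: "norm (H t x) \<le> norm (Du t x) / \<delta> + gg t x * \<bar>U t x\<bar>"
proof -
  have "norm (H t x) \<le> norm (a (c t, x) *v Du t x) + norm (U t x *\<^sub>R aa (c t, x))"
    unfolding H_def by (rule norm_triangle_ineq)
  also have "\<dots> \<le> norm (Du t x) / \<delta> + gg t x * \<bar>U t x\<bar>"
    using mult_right_mono[OF gg_aa[of t x], of "\<bar>U t x\<bar>"]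
    by (intro add_mono S_delta_norm_le[OF a_in] \<delta>) (simp add: mult.commute)
  finally show ?thesis .
qed

lemma b_Du_le: "\<bar>b (c t, x) \<bullet> Du t x\<bar> \<le> gg t x * norm (Du t x)"
  by (rule order_trans[OF Cauchy_Schwarz_ineq2]) (intro mult_right_mono gg_b norm_ge_zero)

lemma pow_n: "\<bar>U t x\<bar> ^ (n - 1) * \<bar>U t x\<bar> = V t x"
proof -
  have "n = Suc (n - 1)" using n1 by simp
  then have "V t x = \<bar>U t x\<bar> ^ Suc (n - 1)" by (simp only: V_def)
  then show ?thesis by simp
qed

text \<open>The signs \<open>sg\<close> for which \<open>sg * u ^ n\<close> is a subsolution. The term with \<open>n (n - 1) u ^ (n - 2)\<close> has a sign for
  even \<open>n\<close> and vanishes for \<open>n = 1\<close>; in the latter case \<open>- u\<close> is as good as \<open>u\<close>.\<close>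

definition admissible :: "real \<Rightarrow> bool" where "admissible sg \<longleftrightarrow> (sg = 1 \<and> even n) \<or> (n = 1 \<and> \<bar>sg\<bar> = 1)"

lemma admissible_abs: "admissible sg \<Longrightarrow> \<bar>sg\<bar> = 1" by (auto simp: admissible_def)

definition C_flux :: real where "C_flux = (real n)\<^sup>2 / \<delta>"

lemma C_flux_pos: "C_flux > 0" using n1 \<delta> by (simp add: C_flux_def)

text \<open>The elliptic part of the first term has the good sign and is dropped. What is left are the flux against the gradient of
  \<open>\<psi>\<close> and the drift terms.\<close>

lemma energy_density_ge_n:
  assumes sg: "admissible sg" and \<psi>: "\<psi> x \<ge> 0"
  shows "- (C_flux * ((P t x + gg t x * V t x) * norm (gradient \<psi> x) + gg t x * P t x * \<psi> x)) \<le> sg * energy_density n \<psi> t x"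
proof -
  let ?A = "\<bar>U t x\<bar>" and ?D = "norm (Du t x)" and ?G = "gg t x" and ?E = "norm (gradient \<psi> x)" and ?Y = "\<psi> x"
  have asg: "\<bar>sg\<bar> = 1" by (rule admissible_abs[OF sg])
  define N where "N = real n"
  have N: "N \<ge> 1" using n1 by (simp add: N_def)
  have t1: "sg * (1 / 2 * real n * real (n - 1) * U t x ^ (n - 2) * (H t x \<bullet> Du t x) * ?Y) \<ge> - (1 / 2 * N * (N - 1) * (?G * P t x) * ?Y)"
  proof (cases "n = 1")
    case True
    then show ?thesis by (simp add: N_def)
  next
    case False
    then have e: "even n" "n \<ge> 2" "sg = 1" using n sg by (auto simp: admissible_def)
    then have Ue: "U t x ^ (n - 2) = ?A ^ (n - 2)" by (simp add: power_even_abs)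
    have "H t x \<bullet> Du t x \<ge> - (?G * ?A * ?D)"
    proof -
      have "0 \<le> \<delta> * ?D\<^sup>2" using \<delta> by simp
      then show ?thesis using H_Du_ge[of t x] by linarith
    qed
    then have "?A ^ (n - 2) * (H t x \<bullet> Du t x) \<ge> ?A ^ (n - 2) * - (?G * ?A * ?D)" by (intro mult_left_mono) auto
    also have "?A ^ (n - 2) * - (?G * ?A * ?D) = - (?G * P t x)"
    proof -
      have "?A ^ (n - 2) * ?A = ?A ^ (n - 1)"
      proof -
        have "n - 1 = Suc (n - 2)" using e by simp
        then show ?thesis by simp
      qed
      then show ?thesis unfolding P_def by (simp add: mult_ac)
    qed
    finally have "- (?G * P t x) \<le> U t x ^ (n - 2) * (H t x \<bullet> Du t x)" unfolding Ue .
    then have "(1 / 2 * N * (N - 1) * ?Y) * - (?G * P t x) \<le> (1 / 2 * N * (N - 1) * ?Y) * (U t x ^ (n - 2) * (H t x \<bullet> Du t x))"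
      using N \<psi> by (intro mult_left_mono) auto
    then show ?thesis using e n1 by (simp add: N_def of_nat_diff mult_ac)
  qed
  have t2: "\<bar>sg * (1 / 2 * real n * U t x ^ (n - 1) * (H t x \<bullet> gradient \<psi> x))\<bar> \<le> 1 / 2 * N * (P t x / \<delta> + ?G * V t x) * ?E"
  proof -
    have "\<bar>H t x \<bullet> gradient \<psi> x\<bar> \<le> (?D / \<delta> + ?G * ?A) * ?E"
      by (rule order_trans[OF Cauchy_Schwarz_ineq2]) (intro mult_right_mono H_norm_le norm_ge_zero)
    then have "?A ^ (n - 1) * \<bar>H t x \<bullet> gradient \<psi> x\<bar> \<le> ?A ^ (n - 1) * ((?D / \<delta> + ?G * ?A) * ?E)"
      by (intro mult_left_mono) auto
    also have "\<dots> = (P t x / \<delta> + ?G * (?A ^ (n - 1) * ?A)) * ?E" by (simp add: P_def algebra_simps)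
    finally have "1 / 2 * N * (?A ^ (n - 1) * \<bar>H t x \<bullet> gradient \<psi> x\<bar>) \<le> 1 / 2 * N * ((P t x / \<delta> + ?G * V t x) * ?E)"
      unfolding pow_n using N by (intro mult_left_mono) auto
    then show ?thesis using asg by (simp add: abs_mult power_abs N_def mult_ac)
  qed
  have t3: "\<bar>sg * (real n * U t x ^ (n - 1) * (b (c t, x) \<bullet> Du t x) * ?Y)\<bar> \<le> N * (?G * P t x) * ?Y"
  proof -
    have "?A ^ (n - 1) * \<bar>b (c t, x) \<bullet> Du t x\<bar> \<le> ?A ^ (n - 1) * (?G * ?D)" by (intro mult_left_mono b_Du_le) auto
    then have "N * ?Y * (?A ^ (n - 1) * \<bar>b (c t, x) \<bullet> Du t x\<bar>) \<le> N * ?Y * (?A ^ (n - 1) * (?G * ?D))"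
      by (rule mult_left_mono) (use N \<psi> in simp)
    then show ?thesis using asg \<psi> by (simp add: abs_mult power_abs N_def P_def mult_ac)
  qed
  have id1: "1 / \<delta> \<ge> 1" using \<delta> by simp
  have CN: "C_flux = N\<^sup>2 / \<delta>" by (simp add: C_flux_def N_def)
  have N2: "N \<le> N\<^sup>2" using N by (simp add: power2_eq_square)
  have c1: "1 / 2 * N * (N - 1) + N \<le> C_flux"
  proof -
    have "1 / 2 * N * (N - 1) + N \<le> N\<^sup>2" using N2 by (simp add: power2_eq_square field_simps)
    also have "\<dots> \<le> C_flux" unfolding CN using \<delta> N by (simp add: le_divide_eq mult_left_le)
    finally show ?thesis .
  qed
  have c2: "1 / 2 * N / \<delta> \<le> C_flux" unfolding CN using N2 N \<delta> by (intro divide_right_mono) auto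
  have c3: "1 / 2 * N \<le> C_flux"
  proof -
    have "1 / 2 * N \<le> N" "0 \<le> 1 / 2 * N * (N - 1)" using N by auto
    then show ?thesis using c1 by linarith
  qed
  have GP: "?G * P t x * ?Y \<ge> 0" using gg_nonneg P_nonneg \<psi> by simp
  have PE: "P t x * ?E \<ge> 0" using P_nonneg by simp
  have GVE: "?G * V t x * ?E \<ge> 0" using gg_nonneg V_nonneg by simp
  have "sg * energy_density n \<psi> t x = sg * (1 / 2 * real n * real (n - 1) * U t x ^ (n - 2) * (H t x \<bullet> Du t x) * ?Y)
     + sg * (1 / 2 * real n * U t x ^ (n - 1) * (H t x \<bullet> gradient \<psi> x))
     - sg * (real n * U t x ^ (n - 1) * (b (c t, x) \<bullet> Du t x) * ?Y)"
    by (simp add: energy_density_def algebra_simps)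
  also have "\<dots> \<ge> - ((1 / 2 * N * (N - 1) + N) * (?G * P t x * ?Y) + 1 / 2 * N / \<delta> * (P t x * ?E) + 1 / 2 * N * (?G * V t x * ?E))"
  proof -
    \<comment> \<open>The products are generalised to variables, and only linear arithmetic remains.\<close>
    have lin: "- (A1 + A3 + A2) \<le> X1 + X2 - X3" if "- A1 \<le> X1" "\<bar>X2\<bar> \<le> A2" "\<bar>X3\<bar> \<le> A3" for A1 A2 A3 X1 X2 X3 :: real
      using that by linarith
    have "(1 / 2 * N * (N - 1) + N) * (?G * P t x * ?Y) + 1 / 2 * N / \<delta> * (P t x * ?E) + 1 / 2 * N * (?G * V t x * ?E)
      = 1 / 2 * N * (N - 1) * (?G * P t x) * ?Y + N * (?G * P t x) * ?Y + 1 / 2 * N * (P t x / \<delta> + ?G * V t x) * ?E"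
      by (simp add: algebra_simps add_divide_distrib)
    then show ?thesis using lin[OF t1 t2 t3] by (simp only:)
  qed
  moreover have "(1 / 2 * N * (N - 1) + N) * (?G * P t x * ?Y) \<le> C_flux * (?G * P t x * ?Y)" by (intro mult_right_mono c1 GP)
  moreover have "1 / 2 * N / \<delta> * (P t x * ?E) \<le> C_flux * (P t x * ?E)" by (intro mult_right_mono c2 PE)
  moreover have "1 / 2 * N * (?G * V t x * ?E) \<le> C_flux * (?G * V t x * ?E)" by (intro mult_right_mono c3 GVE)
  ultimately show ?thesis by (simp add: algebra_simps)
qed

definition C_energy :: real where "C_energy = (2 * (real n)\<^sup>2 + real n)\<^sup>2 / (real n * \<delta>) + real n / \<delta> ^ 3 + real n"

lemma C_energy_pos: "C_energy > 0" using n1 \<delta> unfolding C_energy_def by (intro add_nonneg_pos) auto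

text \<open>Now the elliptic part is kept. Half of it absorbs, by Young's inequality, the terms linear in \<open>P\<close>;
  the rest is quadratic in \<open>V\<close>.\<close>

lemma energy_density_ge_2n:
  assumes \<zeta>: "\<zeta> x \<ge> 0" and E: "norm (gradient \<zeta> x) \<le> \<mu> * \<zeta> x" and \<mu>: "\<mu> \<ge> 0"
  shows "(real n * \<delta> / 2 * (P t x)\<^sup>2 - C_energy * ((gg t x)\<^sup>2 + \<mu>\<^sup>2) * (V t x)\<^sup>2) * \<zeta> x \<le> energy_density (2 * n) \<zeta> t x"
proof -
  let ?A = "\<bar>U t x\<bar>" and ?D = "norm (Du t x)" and ?Z = "\<zeta> x"
  define G where "G = gg t x"
  define v where "v = V t x"
  define w where "w = P t x"
  define N where "N = real n"
  have N: "N \<ge> 1" using n1 by (simp add: N_def)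
  have nn: "G \<ge> 0" "v \<ge> 0" "w \<ge> 0" using gg_nonneg V_nonneg P_nonneg by (auto simp: G_def v_def w_def)
  have U1: "U t x ^ (2 * n - 2) = (?A ^ (n - 1))\<^sup>2"
  proof -
    have "2 * n - 2 = 2 * (n - 1)" by simp
    then have "U t x ^ (2 * n - 2) = ((U t x)\<^sup>2) ^ (n - 1)" by (simp only: power_mult)
    also have "\<dots> = (?A\<^sup>2) ^ (n - 1)" by simp
    finally show ?thesis by (simp only: power_mult[symmetric] mult.commute)
  qed
  have U2: "?A ^ (2 * n - 1) = ?A ^ (n - 1) * v"
  proof -
    have "2 * n - 1 = (n - 1) + n" using n1 by simp
    then show ?thesis by (simp only: power_add v_def V_def)
  qed
  have t1: "U t x ^ (2 * n - 2) * (H t x \<bullet> Du t x) \<ge> \<delta> * w\<^sup>2 - G * w * v"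
  proof -
    have "(?A ^ (n - 1))\<^sup>2 * (H t x \<bullet> Du t x) \<ge> (?A ^ (n - 1))\<^sup>2 * (\<delta> * ?D\<^sup>2 - G * ?A * ?D)"
      unfolding G_def by (intro mult_left_mono H_Du_ge) auto
    also have "(?A ^ (n - 1))\<^sup>2 * (\<delta> * ?D\<^sup>2 - G * ?A * ?D) = \<delta> * (?A ^ (n - 1) * ?D)\<^sup>2 - G * (?A ^ (n - 1) * ?D) * (?A ^ (n - 1) * ?A)"
      by (simp add: power_mult_distrib power2_eq_square algebra_simps)
    finally show ?thesis unfolding U1 pow_n by (simp add: w_def v_def P_def)
  qed
  have t2: "\<bar>U t x ^ (2 * n - 1) * (H t x \<bullet> gradient \<zeta> x)\<bar> \<le> (w * v / \<delta> + G * v\<^sup>2) * (\<mu> * ?Z)"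
  proof -
    have "\<bar>H t x \<bullet> gradient \<zeta> x\<bar> \<le> (?D / \<delta> + G * ?A) * (\<mu> * ?Z)"
      unfolding G_def using \<delta> gg_nonneg
      by (intro order_trans[OF Cauchy_Schwarz_ineq2] mult_mono H_norm_le E add_nonneg_nonneg) auto
    then have "?A ^ (n - 1) * v * \<bar>H t x \<bullet> gradient \<zeta> x\<bar> \<le> ?A ^ (n - 1) * v * ((?D / \<delta> + G * ?A) * (\<mu> * ?Z))"
      using nn by (intro mult_left_mono) auto
    also have "\<dots> = ((?A ^ (n - 1) * ?D) * v / \<delta> + G * v * (?A ^ (n - 1) * ?A)) * (\<mu> * ?Z)"
      by (simp add: algebra_simps)
    also have "\<dots> = (w * v / \<delta> + G * v\<^sup>2) * (\<mu> * ?Z)"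
      unfolding pow_n by (simp add: w_def v_def P_def power2_eq_square)
    finally show ?thesis unfolding abs_mult power_abs U2 .
  qed
  have t3: "\<bar>U t x ^ (2 * n - 1) * (b (c t, x) \<bullet> Du t x)\<bar> \<le> G * w * v"
  proof -
    have "?A ^ (n - 1) * v * \<bar>b (c t, x) \<bullet> Du t x\<bar> \<le> ?A ^ (n - 1) * v * (G * ?D)"
      unfolding G_def using nn by (intro mult_left_mono b_Du_le) auto
    then show ?thesis unfolding abs_mult power_abs U2 by (simp add: w_def P_def mult_ac)
  qed
  have r21: "real (2 * n - 1) = 2 * N - 1" using n1 by (simp add: N_def of_nat_diff)
  have r2: "real (2 * n) = 2 * N" by (simp add: N_def)
  have "energy_density (2 * n) \<zeta> t x = N * (2 * N - 1) * (U t x ^ (2 * n - 2) * (H t x \<bullet> Du t x)) * ?Z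
     + N * (U t x ^ (2 * n - 1) * (H t x \<bullet> gradient \<zeta> x)) - 2 * N * (U t x ^ (2 * n - 1) * (b (c t, x) \<bullet> Du t x)) * ?Z"
    unfolding energy_density_def r21 r2 by simp
  moreover have "N * (2 * N - 1) * (U t x ^ (2 * n - 2) * (H t x \<bullet> Du t x)) * ?Z \<ge> N * (2 * N - 1) * (\<delta> * w\<^sup>2 - G * w * v) * ?Z"
    using t1 N \<zeta> by (intro mult_right_mono mult_left_mono) auto
  moreover have "N * (U t x ^ (2 * n - 1) * (H t x \<bullet> gradient \<zeta> x)) \<ge> N * - ((w * v / \<delta> + G * v\<^sup>2) * (\<mu> * ?Z))"
    using t2 N by (intro mult_left_mono) auto
  moreover have "2 * N * (U t x ^ (2 * n - 1) * (b (c t, x) \<bullet> Du t x)) * ?Z \<le> 2 * N * (G * w * v) * ?Z"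
    using t3 N \<zeta> by (intro mult_right_mono mult_left_mono) auto
  ultimately have main: "energy_density (2 * n) \<zeta> t x \<ge> (N * (2 * N - 1) * (\<delta> * w\<^sup>2) - w * ((2 * N\<^sup>2 + N) * G * v) - w * (N * \<mu> / \<delta> * v) - N * \<mu> * G * v\<^sup>2) * ?Z"
    by (simp add: algebra_simps power2_eq_square)
  have "N * \<delta> * w\<^sup>2 \<le> N * (2 * N - 1) * (\<delta> * w\<^sup>2)"
  proof -
    have "1 * (\<delta> * w\<^sup>2) \<le> (2 * N - 1) * (\<delta> * w\<^sup>2)" using N \<delta> by (intro mult_right_mono) auto
    then have "N * (1 * (\<delta> * w\<^sup>2)) \<le> N * ((2 * N - 1) * (\<delta> * w\<^sup>2))" using N by (intro mult_left_mono) auto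
    then show ?thesis by (simp add: mult.assoc)
  qed
  moreover have "w * ((2 * N\<^sup>2 + N) * G * v) \<le> N * \<delta> / 4 * w\<^sup>2 + (2 * N\<^sup>2 + N)\<^sup>2 / (N * \<delta>) * (G\<^sup>2 * v\<^sup>2)"
    using young_eps[of "N * \<delta> / 4" w "(2 * N\<^sup>2 + N) * G * v"] N \<delta> by (simp add: power_mult_distrib)
  moreover have "w * (N * \<mu> / \<delta> * v) \<le> N * \<delta> / 4 * w\<^sup>2 + N / \<delta> ^ 3 * (\<mu>\<^sup>2 * v\<^sup>2)"
  proof -
    have "(N * \<mu> / \<delta> * v)\<^sup>2 / (4 * (N * \<delta> / 4)) = N / \<delta> ^ 3 * (\<mu>\<^sup>2 * v\<^sup>2)"
      using N \<delta> by (simp add: power_mult_distrib power_divide power2_eq_square power3_eq_cube mult_ac)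
    then show ?thesis using young_eps[of "N * \<delta> / 4" w "N * \<mu> / \<delta> * v"] N \<delta> by simp
  qed
  moreover have "N * \<mu> * G * v\<^sup>2 \<le> N * (G\<^sup>2 + \<mu>\<^sup>2) * v\<^sup>2"
  proof -
    have "0 \<le> (\<mu> - G)\<^sup>2" by simp
    then have "2 * (\<mu> * G) \<le> G\<^sup>2 + \<mu>\<^sup>2" by (simp add: power2_eq_square algebra_simps)
    moreover have "0 \<le> \<mu> * G" using \<mu> nn by simp
    ultimately have "\<mu> * G \<le> G\<^sup>2 + \<mu>\<^sup>2" by linarith
    then have "N * v\<^sup>2 * (\<mu> * G) \<le> N * v\<^sup>2 * (G\<^sup>2 + \<mu>\<^sup>2)" using N by (intro mult_left_mono) auto
    then show ?thesis by (simp add: mult_ac)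
  qed
  moreover have "N * \<delta> / 2 * w\<^sup>2 = N * \<delta> * w\<^sup>2 - N * \<delta> / 4 * w\<^sup>2 - N * \<delta> / 4 * w\<^sup>2" by simp
  ultimately have le: "N * \<delta> * w\<^sup>2 \<le> N * (2 * N - 1) * (\<delta> * w\<^sup>2)"
    "w * ((2 * N\<^sup>2 + N) * G * v) \<le> N * \<delta> / 4 * w\<^sup>2 + (2 * N\<^sup>2 + N)\<^sup>2 / (N * \<delta>) * (G\<^sup>2 * v\<^sup>2)"
    "w * (N * \<mu> / \<delta> * v) \<le> N * \<delta> / 4 * w\<^sup>2 + N / \<delta> ^ 3 * (\<mu>\<^sup>2 * v\<^sup>2)"
    "N * \<mu> * G * v\<^sup>2 \<le> N * (G\<^sup>2 + \<mu>\<^sup>2) * v\<^sup>2"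
    "N * \<delta> / 2 * w\<^sup>2 = N * \<delta> * w\<^sup>2 - N * \<delta> / 4 * w\<^sup>2 - N * \<delta> / 4 * w\<^sup>2" .
  have 1: "N * \<delta> / 2 * w\<^sup>2 - ((2 * N\<^sup>2 + N)\<^sup>2 / (N * \<delta>) * (G\<^sup>2 * v\<^sup>2) + N / \<delta> ^ 3 * (\<mu>\<^sup>2 * v\<^sup>2) + N * (G\<^sup>2 + \<mu>\<^sup>2) * v\<^sup>2)
     \<le> N * (2 * N - 1) * (\<delta> * w\<^sup>2) - w * ((2 * N\<^sup>2 + N) * G * v) - w * (N * \<mu> / \<delta> * v) - N * \<mu> * G * v\<^sup>2"
  proof -
    \<comment> \<open>The products are generalised to variables, and only linear arithmetic remains.\<close>
    have lin: "h - (r1 + r2 + r3) \<le> B - x - y - z"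
      if "A \<le> B" "x \<le> q + r1" "y \<le> q + r2" "z \<le> r3" "h = A - q - q" for A B x y z q r1 r2 r3 h :: real
      using that by linarith
    show ?thesis by (rule lin[where q = "N * \<delta> / 4 * w\<^sup>2" and A = "N * \<delta> * w\<^sup>2"]) (fact le)+
  qed
  have "(2 * N\<^sup>2 + N)\<^sup>2 / (N * \<delta>) * (G\<^sup>2 * v\<^sup>2) + N / \<delta> ^ 3 * (\<mu>\<^sup>2 * v\<^sup>2) + N * (G\<^sup>2 + \<mu>\<^sup>2) * v\<^sup>2 \<le> C_energy * (G\<^sup>2 + \<mu>\<^sup>2) * v\<^sup>2"
  proof -
    have "0 \<le> (2 * N\<^sup>2 + N)\<^sup>2 / (N * \<delta>) * (\<mu>\<^sup>2 * v\<^sup>2)" "0 \<le> N / \<delta> ^ 3 * (G\<^sup>2 * v\<^sup>2)" using N \<delta> by auto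
    then show ?thesis unfolding C_energy_def N_def[symmetric] by (simp add: distrib_right distrib_left)
  qed
  then have "N * \<delta> / 2 * w\<^sup>2 - C_energy * (G\<^sup>2 + \<mu>\<^sup>2) * v\<^sup>2 \<le> N * (2 * N - 1) * (\<delta> * w\<^sup>2) - w * ((2 * N\<^sup>2 + N) * G * v) - w * (N * \<mu> / \<delta> * v) - N * \<mu> * G * v\<^sup>2"
    using 1 by linarith
  then have "(N * \<delta> / 2 * w\<^sup>2 - C_energy * (G\<^sup>2 + \<mu>\<^sup>2) * v\<^sup>2) * ?Z \<le> (N * (2 * N - 1) * (\<delta> * w\<^sup>2) - w * ((2 * N\<^sup>2 + N) * G * v) - w * (N * \<mu> / \<delta> * v) - N * \<mu> * G * v\<^sup>2) * ?Z"
    using \<zeta> by (intro mult_right_mono) auto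
  with main show ?thesis by (simp add: N_def G_def v_def w_def)
qed

lemma g_meas[measurable]: "g \<in> borel_measurable borel"
  unfolding g_def[abs_def] using B0_vec_measurable[OF b] B0_vec_measurable[OF aa] by measurable

definition Mg :: real where "Mg = (SOME M. \<forall>z. g z \<le> M)"

lemma g_le: "g z \<le> Mg"
proof -
  obtain M1 where "\<And>z. norm (b z) \<le> M1" using B0_vec_bounded[OF b] by blast
  moreover obtain M2 where "\<And>z. norm (aa z) \<le> M2" using B0_vec_bounded[OF aa] by blast
  ultimately have "\<exists>M. \<forall>z. g z \<le> M" by (intro exI[of _ "max M1 M2"] allI) (simp only: g_def max.mono)
  from someI_ex[OF this] have "\<forall>z. g z \<le> Mg" unfolding Mg_def .
  then show ?thesis by blast
qed

lemma c_meas[measurable]: "c \<in> borel_measurable borel" unfolding c_def[abs_def] by measurable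

lemma gg_meas[measurable]: "case_prod gg \<in> borel_measurable (borel \<Otimes>\<^sub>M borel)"
proof -
  have "(\<lambda>z::real \<times> (real^'d). (c (fst z), snd z)) \<in> borel \<Otimes>\<^sub>M borel \<rightarrow>\<^sub>M borel \<Otimes>\<^sub>M borel" by measurable
  then have "(\<lambda>z::real \<times> (real^'d). (c (fst z), snd z)) \<in> borel \<Otimes>\<^sub>M borel \<rightarrow>\<^sub>M borel" by (simp add: borel_prod)
  from measurable_compose[OF this g_meas] show ?thesis by (simp add: gg_def case_prod_beta')
qed

lemma V_meas[measurable]: "case_prod V \<in> borel_measurable (borel \<Otimes>\<^sub>M borel)" unfolding V_def[abs_def] by measurable
lemma P_meas[measurable]: "case_prod P \<in> borel_measurable (borel \<Otimes>\<^sub>M borel)" unfolding P_def[abs_def] by measurable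

lemma V_le: "V t x \<le> Mu ^ n" unfolding V_def by (intro power_mono Mu) auto
lemma P_le: "P t x \<le> Mu ^ (n - 1) * Mu" unfolding P_def using Mu by (intro mult_mono power_mono) auto
lemma gg_le: "gg t x \<le> Mg" by (simp add: gg_def g_le)
lemma Mg_nonneg: "Mg \<ge> 0" using g_nonneg[of 0] g_le[of 0] by linarith

text \<open>
  The sources in the representation of \<open>V\<close>, restricted to times in \<open>{t0..T}\<close> so that the estimates may be started
  at any \<open>t0\<close>, as Gronwall's lemma requires.
\<close>
definition h1 :: "real \<Rightarrow> real \<times> (real ^ 'd) \<Rightarrow> ennreal" where
  "h1 t0 z = indicator {t0..T} (fst z) * ennreal (P (fst z) (snd z) + gg (fst z) (snd z) * V (fst z) (snd z))"
definition h2 :: "real \<Rightarrow> real \<times> (real ^ 'd) \<Rightarrow> ennreal" where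
  "h2 t0 z = indicator {t0..T} (fst z) * ennreal (gg (fst z) (snd z) * P (fst z) (snd z))"
definition hV :: "real \<Rightarrow> real \<times> (real ^ 'd) \<Rightarrow> ennreal" where
  "hV t0 z = indicator {t0..T} (fst z) * ennreal (V (fst z) (snd z))"

lemma fst_snd_meas: "fst \<in> (borel :: (real \<times> (real^'d)) measure) \<rightarrow>\<^sub>M borel" "snd \<in> (borel :: (real \<times> (real^'d)) measure) \<rightarrow>\<^sub>M borel"
  by (intro borel_measurable_continuous_onI continuous_intros)+

lemma h_meas[measurable]: "h1 t0 \<in> borel_measurable borel" "h2 t0 \<in> borel_measurable borel" "hV t0 \<in> borel_measurable borel"
proof -
  note fst_snd_meas[measurable]
  show "h1 t0 \<in> borel_measurable borel" "h2 t0 \<in> borel_measurable borel" "hV t0 \<in> borel_measurable borel"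
    unfolding h1_def[abs_def] h2_def[abs_def] hV_def[abs_def] by measurable
qed

end

section \<open>The pointwise representation\<close>

lemma ennreal_add_le: "y \<ge> 0 \<Longrightarrow> ennreal (x + y) \<le> ennreal x + ennreal y"
proof (cases "x \<ge> 0")
  case False
  assume "y \<ge> 0"
  have "ennreal (x + y) \<le> ennreal y" using False by (intro ennreal_leI) simp
  also have "\<dots> \<le> ennreal x + ennreal y" by simp
  finally show ?thesis .
qed simp

lemma nn_integral_pair:
  fixes Q :: "'x::euclidean_space \<times> 'y::euclidean_space \<Rightarrow> ennreal"
  assumes "Q \<in> borel_measurable borel"
  shows "(\<integral>\<^sup>+x. (\<integral>\<^sup>+y. Q (x, y) \<partial>lborel) \<partial>lborel) = (\<integral>\<^sup>+z. Q z \<partial>lborel)"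
proof -
  have "Q \<in> borel_measurable (lborel \<Otimes>\<^sub>M lborel)" using assms by (simp add: lborel_prod)
  from lborel.nn_integral_fst[OF this] show ?thesis by (simp add: lborel_prod)
qed

lemma gradient_measurable:
  fixes w :: "real ^ 'd::finite \<Rightarrow> real"
  assumes "\<And>x. w differentiable (at x)"
  shows "gradient w \<in> borel_measurable borel"
proof (subst borel_measurable_euclidean_space, rule ballI)
  fix e :: "real ^ 'd" assume "e \<in> Basis"
  then obtain i where "e = axis i 1" by (auto simp: Basis_vec_def)
  then show "(\<lambda>x. gradient w x \<bullet> e) \<in> borel_measurable borel"
    using partial_deriv_measurable[of w i] assms by (simp add: inner_axis gradient_def)
qed

context power_solution begin

definition C_time :: real where "C_time = C_flux * bump_const TYPE('d) * 2 ^ (CARD('d) + 1)"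
definition C_space :: real where "C_space = 2 ^ CARD('d) * bump_const TYPE('d) * real n"

lemma C_time_pos: "C_time > 0" using C_flux_pos bump_const_pos[where 'd = 'd] by (simp add: C_time_def)
lemma C_space_pos: "C_space > 0" using n1 bump_const_pos[where 'd = 'd] by (simp add: C_space_def)

text \<open>Moving an average of \<open>u ^ n\<close> forward in time at a fixed scale. The gradient of the bump costs \<open>1 / r0\<close>, so over a
  time span of \<open>R\<^sup>2\<close> the source \<open>h1\<close> enters with the factor \<open>R\<close> of a first order potential and \<open>h2\<close> with \<open>R\<^sup>2\<close>.
  The scales \<open>r0\<close> and \<open>R\<close> may differ by a factor two, which is needed for the last step up to the time \<open>T\<close>.\<close>

lemma time_step:
  assumes sg: "admissible sg" and t: "0 \<le> t0" "t0 \<le> t" "t \<le> t1" "t1 \<le> t2" "t2 \<le> T"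
    and r0: "0 < r0" "r0 \<le> R" "R \<le> 2 * r0" and tR: "t2 < t + R\<^sup>2"
  shows "ennreal (sg * m n (bump r0 x) t1) \<le> ennreal (sg * m n (bump r0 x) t2)
    + ennreal C_time * (ennreal R * cavg R (h1 t0) (t, x) + ennreal (R\<^sup>2) * cavg R (h2 t0) (t, x))"
proof -
  let ?bc = "bump_const TYPE('d)" and ?d = "CARD('d)"
  have R: "R > 0" using r0 by simp
  have \<psi>: "exp_decay (bump r0 x)" by (rule bump_exp_decay[OF r0(1)])
  have [measurable]: "gradient (bump r0 x) \<in> borel_measurable borel"
    by (rule gradient_measurable[OF bump_differentiable[OF r0(1)]])
  define F where "F \<tau> y = C_flux * ((P \<tau> y + gg \<tau> y * V \<tau> y) * norm (gradient (bump r0 x) y) + gg \<tau> y * P \<tau> y * bump r0 x y)" for \<tau> y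
  have F_meas[measurable]: "case_prod F \<in> borel_measurable (borel \<Otimes>\<^sub>M borel)" unfolding F_def[abs_def] by measurable
  have F0: "F \<tau> y \<ge> 0" for \<tau> y
    unfolding F_def using C_flux_pos P_nonneg gg_nonneg V_nonneg bump_nonneg[OF r0(1), of x y]
    by (intro mult_nonneg_nonneg add_nonneg_nonneg) auto
  define b1 b2 where "b1 = ?bc / r0 ^ (?d + 1)" and "b2 = ?bc / r0 ^ ?d"
  have b12: "b1 \<ge> 0" "b2 \<ge> 0" using r0 bump_const_pos[where 'd = 'd] by (auto simp: b1_def b2_def)
  have F_le1: "F \<tau> y \<le> C_flux * ((P \<tau> y + gg \<tau> y * V \<tau> y) * b1 + gg \<tau> y * P \<tau> y * b2) * indicator (ball x r0) y" for \<tau> y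
  proof -
    have "F \<tau> y \<le> C_flux * ((P \<tau> y + gg \<tau> y * V \<tau> y) * (b1 * indicator (ball x r0) y) + gg \<tau> y * P \<tau> y * (b2 * indicator (ball x r0) y))"
      unfolding F_def b1_def b2_def using C_flux_pos P_nonneg[of \<tau> y] gg_nonneg[of \<tau> y] V_nonneg[of \<tau> y]
      by (intro mult_left_mono add_mono bump_gradient_le bump_le r0) auto
    then show ?thesis by (simp add: algebra_simps)
  qed
  \<comment> \<open>A crude finite bound, for integrability only.\<close>
  define KF where "KF = C_flux * ((Mu ^ (n - 1) * Mu + Mg * Mu ^ n) * b1 + Mg * (Mu ^ (n - 1) * Mu) * b2)"
  have KF: "KF \<ge> 0" unfolding KF_def using C_flux_pos Mu(1) Mg_nonneg b12 by (intro mult_nonneg_nonneg add_nonneg_nonneg) auto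
  have F_le2: "F \<tau> y \<le> KF * indicator (ball x r0) y" for \<tau> y
  proof -
    have "C_flux * ((P \<tau> y + gg \<tau> y * V \<tau> y) * b1 + gg \<tau> y * P \<tau> y * b2) \<le> KF"
      unfolding KF_def using C_flux_pos b12 Mg_nonneg Mu(1)
      by (intro mult_left_mono add_mono mult_right_mono mult_mono P_le V_le gg_le P_nonneg V_nonneg gg_nonneg) auto
    then have "C_flux * ((P \<tau> y + gg \<tau> y * V \<tau> y) * b1 + gg \<tau> y * P \<tau> y * b2) * indicator (ball x r0) y \<le> KF * indicator (ball x r0) y"
      by (rule mult_right_mono) simp
    then show ?thesis using F_le1[of \<tau> y] by linarith
  qed
  have I_ball: "integrable lborel (\<lambda>y. KF * indicator (ball x r0) y :: real)"
    using emeasure_lborel_ball_finite[of x r0] by (intro integrable_mult_right integrable_real_indicator) auto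
  have F_int: "integrable lborel (F \<tau>)" for \<tau>
    by (rule Bochner_Integration.integrable_bound[OF I_ball]) (use F0 F_le2 KF in \<open>auto simp: abs_of_nonneg\<close>)
  define Y where "Y \<tau> = (\<integral>y. F \<tau> y \<partial>lborel)" for \<tau>
  have Y_meas[measurable]: "Y \<in> borel_measurable borel" unfolding Y_def by measurable
  have Y0: "Y \<tau> \<ge> 0" for \<tau> unfolding Y_def by (intro integral_nonneg_AE AE_I2 F0)
  define KY where "KY = (\<integral>y. KF * indicator (ball x r0) y \<partial>lborel)"
  have Y_le: "Y \<tau> \<le> KY" for \<tau> unfolding Y_def KY_def by (intro integral_mono F_int I_ball F_le2)
  have SY: "set_integrable lborel {t1..t2} Y" unfolding set_integrable_def
  proof (rule Bochner_Integration.integrable_bound)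
    show "integrable lborel (\<lambda>\<tau>. KY * indicator {t1..t2} \<tau> :: real)"
      by (intro integrable_mult_right integrable_real_indicator) (auto simp: emeasure_lborel_Icc_eq)
    show "AE \<tau> in lborel. norm (indicator {t1..t2} \<tau> *\<^sub>R Y \<tau>) \<le> norm (KY * indicator {t1..t2} \<tau> :: real)"
    proof (rule AE_I2)
      fix \<tau> :: real
      show "norm (indicator {t1..t2} \<tau> *\<^sub>R Y \<tau>) \<le> norm (KY * indicator {t1..t2} \<tau> :: real)"
        using Y0[of \<tau>] Y_le[of \<tau>] by (auto simp: indicator_def)
    qed
  qed measurable
  have "(LINT \<tau>:{t1..t2}|lborel. - Y \<tau>) \<le> sg * m n (bump r0 x) t2 - sg * m n (bump r0 x) t1"
  proof (rule m_increment_ge[OF \<psi>])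
    show "0 \<le> t1" "t1 \<le> t2" "t2 \<le> T" using t by auto
    show "set_integrable lborel {t1..t2} (\<lambda>\<tau>. - Y \<tau>)" using SY by (simp add: set_integrable_def)
    fix \<tau> assume "\<tau> \<in> {t1..t2}"
    have "- Y \<tau> = (\<integral>y. - F \<tau> y \<partial>lborel)" by (simp add: Y_def)
    also have "\<dots> \<le> (\<integral>y. sg * energy_density n (bump r0 x) \<tau> y \<partial>lborel)"
    proof (rule integral_mono)
      show "integrable lborel (\<lambda>y. - F \<tau> y)" using F_int by simp
      show "integrable lborel (\<lambda>y. sg * energy_density n (bump r0 x) \<tau> y)" by (intro integrable_mult_right energy_density_integrable \<psi>)
      show "- F \<tau> y \<le> sg * energy_density n (bump r0 x) \<tau> y" for y
        unfolding F_def by (rule energy_density_ge_n[OF sg bump_nonneg[OF r0(1)]])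
    qed
    finally show "- Y \<tau> \<le> sg * (\<integral>y. energy_density n (bump r0 x) \<tau> y \<partial>lborel)" by simp
  qed
  then have "sg * m n (bump r0 x) t1 \<le> sg * m n (bump r0 x) t2 + (LINT \<tau>:{t1..t2}|lborel. Y \<tau>)"
    by (simp add: set_lebesgue_integral_def)
  moreover have "(LINT \<tau>:{t1..t2}|lborel. Y \<tau>) \<ge> 0" unfolding set_lebesgue_integral_def
    by (intro integral_nonneg_AE AE_I2) (auto simp: indicator_def Y0)
  ultimately have "ennreal (sg * m n (bump r0 x) t1) \<le> ennreal (sg * m n (bump r0 x) t2) + ennreal (LINT \<tau>:{t1..t2}|lborel. Y \<tau>)"
    using ennreal_add_le order_trans[OF ennreal_leI] by blast
  also have "ennreal (LINT \<tau>:{t1..t2}|lborel. Y \<tau>) = (\<integral>\<^sup>+\<tau>. ennreal (indicator {t1..t2} \<tau> *\<^sub>R Y \<tau>) \<partial>lborel)"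
    unfolding set_lebesgue_integral_def
    by (rule nn_integral_eq_integral[symmetric]) (use SY Y0 in \<open>auto simp: set_integrable_def indicator_def\<close>)
  also have "\<dots> = (\<integral>\<^sup>+\<tau>. (\<integral>\<^sup>+y. indicator {t1..t2} \<tau> * ennreal (F \<tau> y) \<partial>lborel) \<partial>lborel)"
  proof (intro nn_integral_cong)
    fix \<tau>
    have "ennreal (Y \<tau>) = (\<integral>\<^sup>+y. ennreal (F \<tau> y) \<partial>lborel)" unfolding Y_def
      by (rule nn_integral_eq_integral[symmetric]) (use F_int F0 in auto)
    then show "ennreal (indicator {t1..t2} \<tau> *\<^sub>R Y \<tau>) = (\<integral>\<^sup>+y. indicator {t1..t2} \<tau> * ennreal (F \<tau> y) \<partial>lborel)"
      by (subst nn_integral_cmult) (auto simp: indicator_def)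
  qed
  also have "\<dots> \<le> (\<integral>\<^sup>+\<tau>. (\<integral>\<^sup>+y. ennreal C_time * (ennreal R * (kcyl R (t, x) (\<tau>, y) * h1 t0 (\<tau>, y)) + ennreal (R\<^sup>2) * (kcyl R (t, x) (\<tau>, y) * h2 t0 (\<tau>, y))) \<partial>lborel) \<partial>lborel)"
  proof (intro nn_integral_mono)
    fix \<tau> y
    show "indicator {t1..t2} \<tau> * ennreal (F \<tau> y) \<le> ennreal C_time * (ennreal R * (kcyl R (t, x) (\<tau>, y) * h1 t0 (\<tau>, y)) + ennreal (R\<^sup>2) * (kcyl R (t, x) (\<tau>, y) * h2 t0 (\<tau>, y)))"
    proof (cases "\<tau> \<in> {t1..t2} \<and> y \<in> ball x r0")
      case True
      then have "\<bar>\<tau> - t\<bar> < R\<^sup>2" using t tR by auto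
      then have cy: "(\<tau>, y) \<in> cyl R (t, x)" using True r0 by (auto simp: cyl_iff dist_norm norm_minus_commute)
      have ti: "\<tau> \<in> {t0..T}" using True t by auto
      define w1 w2 where "w1 = P \<tau> y + gg \<tau> y * V \<tau> y" and "w2 = gg \<tau> y * P \<tau> y"
      have w: "w1 \<ge> 0" "w2 \<ge> 0" using P_nonneg gg_nonneg V_nonneg by (auto simp: w1_def w2_def)
      define e where "e = 1 / R ^ (?d + 2)"
      have e: "e \<ge> 0" using R by (simp add: e_def)
      have Rr: "1 / r0 ^ k \<le> 2 ^ k / R ^ k" for k
      proof -
        have "1 / r0 ^ k \<le> 1 / (R / 2) ^ k" using r0 R by (intro divide_left_mono power_mono mult_pos_pos) auto
        then show ?thesis by (simp add: power_divide)
      qed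
      have B1: "b1 \<le> ?bc * 2 ^ (?d + 1) * (R * e)"
      proof -
        have "b1 \<le> ?bc * (2 ^ (?d + 1) / R ^ (?d + 1))" unfolding b1_def
          using mult_left_mono[OF Rr[of "?d + 1"], of ?bc] bump_const_pos[where 'd = 'd] by simp
        also have "1 / R ^ (?d + 1) = R * e" using R by (simp add: e_def)
        then have "2 ^ (?d + 1) / R ^ (?d + 1) = 2 ^ (?d + 1) * (R * e)" by (metis times_divide_eq_right mult.right_neutral)
        finally show ?thesis by (simp only: mult.assoc)
      qed
      have B2: "b2 \<le> ?bc * 2 ^ (?d + 1) * (R\<^sup>2 * e)"
      proof -
        have "b2 \<le> ?bc * (2 ^ ?d / R ^ ?d)" unfolding b2_def
          using mult_left_mono[OF Rr[of ?d], of ?bc] bump_const_pos[where 'd = 'd] by simp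
        also have "\<dots> \<le> ?bc * (2 ^ (?d + 1) / R ^ ?d)"
          using R bump_const_pos[where 'd = 'd] by (intro mult_left_mono divide_right_mono) auto
        also have "1 / R ^ ?d = R\<^sup>2 * e" using R by (simp add: e_def power_add power2_eq_square)
        then have "2 ^ (?d + 1) / R ^ ?d = 2 ^ (?d + 1) * (R\<^sup>2 * e)" by (metis times_divide_eq_right mult.right_neutral)
        finally show ?thesis by (simp only: mult.assoc)
      qed
      have "F \<tau> y \<le> C_flux * (w1 * b1 + w2 * b2)" using F_le1[of \<tau> y] True by (simp add: w1_def w2_def)
      also have "\<dots> \<le> C_flux * (w1 * (?bc * 2 ^ (?d + 1) * (R * e)) + w2 * (?bc * 2 ^ (?d + 1) * (R\<^sup>2 * e)))"
        using C_flux_pos w by (intro mult_left_mono add_mono B1 B2) auto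
      also have "\<dots> = C_time * (R * (e * w1) + R\<^sup>2 * (e * w2))" by (simp add: C_time_def algebra_simps)
      finally have "ennreal (F \<tau> y) \<le> ennreal (C_time * (R * (e * w1) + R\<^sup>2 * (e * w2)))" by (rule ennreal_leI)
      also have "\<dots> = ennreal C_time * (ennreal R * (ennreal e * ennreal w1) + ennreal (R\<^sup>2) * (ennreal e * ennreal w2))"
        using C_time_pos R e w by (simp add: ennreal_mult ennreal_plus)
      finally show ?thesis using True cy ti by (simp add: kcyl_def h1_def h2_def e_def w1_def w2_def)
    next
      case False
      then have z0: "indicator {t1..t2} \<tau> * ennreal (F \<tau> y) = 0"
        using F_le2[of \<tau> y] F0[of \<tau> y] by (auto simp: indicator_def)
      show ?thesis by (simp only: z0 zero_le)
    qed
  qed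
  also have "\<dots> = (\<integral>\<^sup>+w. ennreal C_time * (ennreal R * (kcyl R (t, x) w * h1 t0 w) + ennreal (R\<^sup>2) * (kcyl R (t, x) w * h2 t0 w)) \<partial>lborel)"
    by (rule nn_integral_pair[of "\<lambda>w. ennreal C_time * (ennreal R * (kcyl R (t, x) w * h1 t0 w) + ennreal (R\<^sup>2) * (kcyl R (t, x) w * h2 t0 w))"]) measurable
  also have "\<dots> = ennreal C_time * (ennreal R * cavg R (h1 t0) (t, x) + ennreal (R\<^sup>2) * cavg R (h2 t0) (t, x))"
    unfolding cavg_def by (simp add: nn_integral_cmult nn_integral_add)
  finally show ?thesis by (simp add: add_left_mono)
qed

lemma space_step:
  assumes sg: "\<bar>sg\<bar> = 1" and R: "R > 0"
  shows "ennreal (sg * m n (bump (R / 2) x) t) \<le> ennreal (sg * m n (bump R x) t)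
    + ennreal (C_space * R / R ^ CARD('d)) * (\<integral>\<^sup>+y\<in>ball x R. ennreal (P t y) \<partial>lborel)"
proof -
  define w where "w y = U t y ^ n" for y
  have w: "bdd_diff w" unfolding w_def by (intro bdd_diff_power U_bdd_diff)
  have pw: "partial_deriv i w = (\<lambda>y. real n * U t y ^ (n - 1) * partial_deriv i (U t) y)" for i
    unfolding w_def[abs_def] by (rule ext) (rule partial_deriv_power[OF bdd_diff_D[OF U_bdd_diff]])
  have Dw: "bdd_diff (partial_deriv i w)" for i unfolding pw by (intro bdd_diff_mult bdd_diff_const bdd_diff_power U_bdd_diff DU_bdd_diff)
  have "gradient w y = (real n * U t y ^ (n - 1)) *\<^sub>R Du t y" for y
    by (simp add: vec_eq_iff gradient_def pw Du_nth)
  then have gw: "norm (gradient w y) = real n * P t y" for y by (simp add: P_def power_abs abs_mult)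
  let ?A = "m n (bump R x) t" and ?B = "m n (bump (R / 2) x) t"
  let ?I = "\<integral>\<^sup>+y\<in>ball x R. ennreal (P t y) \<partial>lborel"
  have [measurable]: "P t \<in> borel_measurable borel" by measurable
  have "sg * ?B \<le> sg * ?A + \<bar>?A - ?B\<bar>"
  proof -
    have "sg * (?B - ?A) \<le> \<bar>sg * (?B - ?A)\<bar>" by simp
    also have "\<dots> = \<bar>?A - ?B\<bar>" using sg by (simp add: abs_mult abs_minus_commute)
    finally show ?thesis by (simp add: right_diff_distrib)
  qed
  then have "ennreal (sg * ?B) \<le> ennreal (sg * ?A) + ennreal \<bar>?A - ?B\<bar>"
    using ennreal_add_le[of "\<bar>?A - ?B\<bar>" "sg * ?A"] order_trans[OF ennreal_leI] by (meson abs_ge_zero)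
  also have "ennreal \<bar>?A - ?B\<bar> \<le> ennreal (2 ^ CARD('d) * bump_const TYPE('d) * R / R ^ CARD('d)) * (\<integral>\<^sup>+y\<in>ball x R. ennreal (norm (gradient w y)) \<partial>lborel)"
    using bump_scale_step[OF w Dw R, of x] by (simp add: m_def w_def)
  also have "(\<integral>\<^sup>+y\<in>ball x R. ennreal (norm (gradient w y)) \<partial>lborel) = ennreal (real n) * ?I"
    unfolding gw using P_nonneg by (subst nn_integral_cmult[symmetric]) (auto intro!: nn_integral_cong simp: ennreal_mult mult.assoc)
  also have "ennreal (2 ^ CARD('d) * bump_const TYPE('d) * R / R ^ CARD('d)) * (ennreal (real n) * ?I) = ennreal (C_space * R / R ^ CARD('d)) * ?I"
  proof -
    have "C_space * R / R ^ CARD('d) = (2 ^ CARD('d) * bump_const TYPE('d) * R / R ^ CARD('d)) * real n" by (simp add: C_space_def)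
    moreover have "2 ^ CARD('d) * bump_const TYPE('d) * R / R ^ CARD('d) \<ge> 0" using R bump_const_pos[where 'd = 'd] by simp
    ultimately show ?thesis by (simp only: ennreal_mult of_nat_0_le_iff mult.assoc)
  qed
  finally show ?thesis by (simp add: add_left_mono)
qed

lemma U_x_diff: "\<bar>U t y - U t x\<bar> \<le> Mu * norm (y - x)"
  using Mu(3) by (intro differentiable_abs_diff_le bdd_diff_D[OF U_bdd_diff]) (simp add: Du_def)

lemma m_bump_close:
  assumes r0: "r0 > 0"
  shows "\<bar>m n (bump r0 x) \<tau> - U t x ^ n\<bar> \<le> real n * Mu ^ (n - 1) * (Lt * \<bar>\<tau> - t\<bar> + Mu * r0)"
proof -
  define K where "K = real n * Mu ^ (n - 1) * (Lt * \<bar>\<tau> - t\<bar> + Mu * r0)"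
  have K: "K \<ge> 0" using Mu(1) Lt(1) r0 by (simp add: K_def)
  have B: "\<bar>U \<tau> y ^ n\<bar> \<le> Mu ^ n" for y unfolding power_abs by (intro power_mono Mu) auto
  have "m n (bump r0 x) \<tau> = (\<integral>y. U \<tau> (x + r0 *\<^sub>R y) ^ n * chi y \<partial>lborel)"
    unfolding m_def using bump_change(1)[of r0 "\<lambda>y. U \<tau> y ^ n" "Mu ^ n" x] r0 B by simp
  moreover have I1: "integrable lborel (\<lambda>y. U \<tau> (x + r0 *\<^sub>R y) ^ n * chi y)"
    using bump_change(2)[of r0 "\<lambda>y. U \<tau> y ^ n" "Mu ^ n" x] r0 B by simp
  moreover have I2: "integrable lborel (\<lambda>y::real^'d. U t x ^ n * chi y)" by (intro integrable_mult_right chi_integrable)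
  ultimately have "m n (bump r0 x) \<tau> - U t x ^ n = (\<integral>y. (U \<tau> (x + r0 *\<^sub>R y) ^ n - U t x ^ n) * chi y \<partial>lborel)"
    by (simp add: left_diff_distrib chi_integral)
  also have "\<bar>\<dots>\<bar> \<le> (\<integral>y. K * chi (y :: real ^ 'd) \<partial>lborel)"
  proof (rule order_trans[OF integral_abs_bound], rule integral_mono)
    show "integrable lborel (\<lambda>y. \<bar>(U \<tau> (x + r0 *\<^sub>R y) ^ n - U t x ^ n) * chi y\<bar>)"
      unfolding left_diff_distrib by (intro integrable_abs Bochner_Integration.integrable_diff I1 I2)
    show "integrable lborel (\<lambda>y::real^'d. K * chi y)" by (intro integrable_mult_right chi_integrable)
    fix y :: "real ^ 'd"
    show "\<bar>(U \<tau> (x + r0 *\<^sub>R y) ^ n - U t x ^ n) * chi y\<bar> \<le> K * chi y"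
    proof (cases "norm y < 1")
      case True
      have "\<bar>U \<tau> (x + r0 *\<^sub>R y) - U t x\<bar> \<le> \<bar>U \<tau> (x + r0 *\<^sub>R y) - U t (x + r0 *\<^sub>R y)\<bar> + \<bar>U t (x + r0 *\<^sub>R y) - U t x\<bar>" by linarith
      also have "\<dots> \<le> Lt * \<bar>\<tau> - t\<bar> + Mu * norm ((x + r0 *\<^sub>R y) - x)" by (intro add_mono Lt U_x_diff)
      also have "Mu * norm ((x + r0 *\<^sub>R y) - x) \<le> Mu * r0"
        using True r0 Mu(1) by (intro mult_left_mono) (auto simp: mult_left_le)
      finally have d: "\<bar>U \<tau> (x + r0 *\<^sub>R y) - U t x\<bar> \<le> Lt * \<bar>\<tau> - t\<bar> + Mu * r0" by simp
      have "\<bar>U \<tau> (x + r0 *\<^sub>R y) ^ n - U t x ^ n\<bar> \<le> real n * Mu ^ (n - 1) * \<bar>U \<tau> (x + r0 *\<^sub>R y) - U t x\<bar>"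
        by (intro abs_power_diff_le Mu)
      also have "\<dots> \<le> K" unfolding K_def using Mu(1) by (intro mult_left_mono d) auto
      finally have "\<bar>U \<tau> (x + r0 *\<^sub>R y) ^ n - U t x ^ n\<bar> * chi y \<le> K * chi y" by (rule mult_right_mono[OF _ chi_nonneg])
      then show ?thesis using chi_nonneg[of y] by (simp add: abs_mult)
    next
      case False
      then have "chi y = 0" using chi_le[of y] chi_nonneg[of y] by simp
      then show ?thesis by simp
    qed
  qed
  also have "\<dots> = K" by (simp add: chi_integral)
  finally show ?thesis unfolding K_def .
qed

lemma m_bump_le:
  assumes sg: "\<bar>sg\<bar> = 1" and r0: "r0 > 0"
  shows "ennreal (sg * m n (bump r0 x) t) \<le> ennreal (bump_const TYPE('d) / r0 ^ CARD('d)) * (\<integral>\<^sup>+y\<in>ball x r0. ennreal (V t y) \<partial>lborel)"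
proof -
  have \<psi>: "exp_decay (bump r0 x)" by (rule bump_exp_decay[OF r0])
  have [measurable]: "V t \<in> borel_measurable borel" by measurable
  have "ennreal (sg * m n (bump r0 x) t) \<le> ennreal (norm (m n (bump r0 x) t))"
  proof (rule ennreal_leI)
    have "sg * m n (bump r0 x) t \<le> \<bar>sg * m n (bump r0 x) t\<bar>" by simp
    then show "sg * m n (bump r0 x) t \<le> norm (m n (bump r0 x) t)" using sg by (simp add: abs_mult)
  qed
  also have "\<dots> \<le> (\<integral>\<^sup>+y. ennreal (norm (U t y ^ n * bump r0 x y)) \<partial>lborel)"
    unfolding m_def by (rule integral_norm_bound_ennreal[OF U_pow_integrable[OF \<psi>]])
  also have "\<dots> \<le> (\<integral>\<^sup>+y. ennreal (bump_const TYPE('d) / r0 ^ CARD('d)) * (ennreal (V t y) * indicator (ball x r0) y) \<partial>lborel)"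
  proof (intro nn_integral_mono)
    fix y
    have "norm (U t y ^ n * bump r0 x y) = V t y * bump r0 x y"
      using bump_nonneg[OF r0, of x y] by (simp add: V_def abs_mult power_abs)
    also have "\<dots> \<le> V t y * (bump_const TYPE('d) / r0 ^ CARD('d) * indicator (ball x r0) y)"
      by (intro mult_left_mono bump_le r0 V_nonneg)
    finally have "ennreal (norm (U t y ^ n * bump r0 x y)) \<le> ennreal (V t y * (bump_const TYPE('d) / r0 ^ CARD('d) * indicator (ball x r0) y))"
      by (rule ennreal_leI)
    also have "\<dots> = ennreal (bump_const TYPE('d) / r0 ^ CARD('d)) * (ennreal (V t y) * indicator (ball x r0) y)"
      using V_nonneg[of t y] r0 bump_const_pos[where 'd = 'd] by (simp add: ennreal_mult[symmetric] indicator_def mult.commute)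
    finally show "ennreal (norm (U t y ^ n * bump r0 x y)) \<le> ennreal (bump_const TYPE('d) / r0 ^ CARD('d)) * (ennreal (V t y) * indicator (ball x r0) y)" .
  qed
  also have "\<dots> = ennreal (bump_const TYPE('d) / r0 ^ CARD('d)) * (\<integral>\<^sup>+y\<in>ball x r0. ennreal (V t y) \<partial>lborel)"
    by (rule nn_integral_cmult) measurable
  finally show ?thesis .
qed

text \<open>Spatial integrals at the single time \<open>t + \<theta> l\<close> are not controlled by averages over cylinders, but their mean over
  \<open>\<theta>\<close> is. This is why the telescoping below carries the parameter \<open>\<theta>\<close>.\<close>

lemma time_average:
  fixes \<Psi> :: "real \<Rightarrow> real ^ 'd \<Rightarrow> ennreal" and h :: "real \<times> (real ^ 'd) \<Rightarrow> ennreal"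
  assumes [measurable]: "case_prod \<Psi> \<in> borel_measurable (borel \<Otimes>\<^sub>M borel)" "h \<in> borel_measurable borel"
    and l: "0 < l" "l \<le> R\<^sup>2" and R: "R > 0"
    and le: "\<And>\<tau> y. t < \<tau> \<Longrightarrow> \<tau> < t + l \<Longrightarrow> \<Psi> \<tau> y \<le> h (\<tau>, y)"
  shows "(\<integral>\<^sup>+\<theta>\<in>{0<..<1}. (\<integral>\<^sup>+y\<in>ball x R. \<Psi> (t + \<theta> * l) y \<partial>lborel) \<partial>lborel)
    \<le> ennreal (R ^ (CARD('d) + 2) / l) * cavg R h (t, x)"
proof -
  define f where "f \<tau> = (\<integral>\<^sup>+y\<in>ball x R. \<Psi> \<tau> y \<partial>lborel) * indicator {t<..<t + l} \<tau>" for \<tau>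
  have [measurable]: "f \<in> borel_measurable borel" unfolding f_def by measurable
  have "(\<integral>\<^sup>+\<theta>\<in>{0<..<1}. (\<integral>\<^sup>+y\<in>ball x R. \<Psi> (t + \<theta> * l) y \<partial>lborel) \<partial>lborel) = (\<integral>\<^sup>+\<theta>. f (t + l * \<theta>) \<partial>lborel)"
  proof (intro nn_integral_cong)
    fix \<theta> :: real
    have "t + l * \<theta> \<in> {t<..<t + l} \<longleftrightarrow> \<theta> \<in> {0<..<1}" using l by (auto simp: zero_less_mult_iff)
    then show "(\<integral>\<^sup>+y\<in>ball x R. \<Psi> (t + \<theta> * l) y \<partial>lborel) * indicator {0<..<1} \<theta> = f (t + l * \<theta>)"
      by (simp only: f_def mult.commute[of l] indicator_def)
  qed
  also have "\<dots> = ennreal (1 / l) * (\<integral>\<^sup>+\<tau>. f \<tau> \<partial>lborel)"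
    using nn_integral_real_affine[of f l t] l by (simp add: mult.assoc[symmetric] ennreal_mult[symmetric])
  also have "(\<integral>\<^sup>+\<tau>. f \<tau> \<partial>lborel) \<le> (\<integral>\<^sup>+\<tau>. (\<integral>\<^sup>+y. ennreal (R ^ (CARD('d) + 2)) * (kcyl R (t, x) (\<tau>, y) * h (\<tau>, y)) \<partial>lborel) \<partial>lborel)"
  proof (intro nn_integral_mono)
    fix \<tau> :: real
    have "f \<tau> = (\<integral>\<^sup>+y. \<Psi> \<tau> y * indicator (ball x R) y * indicator {t<..<t + l} \<tau> \<partial>lborel)"
      unfolding f_def by (rule nn_integral_multc[symmetric]) measurable
    also have "\<dots> \<le> (\<integral>\<^sup>+y. ennreal (R ^ (CARD('d) + 2)) * (kcyl R (t, x) (\<tau>, y) * h (\<tau>, y)) \<partial>lborel)"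
    proof (intro nn_integral_mono)
      fix y
      show "\<Psi> \<tau> y * indicator (ball x R) y * indicator {t<..<t + l} \<tau> \<le> ennreal (R ^ (CARD('d) + 2)) * (kcyl R (t, x) (\<tau>, y) * h (\<tau>, y))"
      proof (cases "y \<in> ball x R \<and> \<tau> \<in> {t<..<t + l}")
        case True
        then have "(\<tau>, y) \<in> cyl R (t, x)" using l by (auto simp: cyl_iff dist_norm norm_minus_commute)
        then have "ennreal (R ^ (CARD('d) + 2)) * (kcyl R (t, x) (\<tau>, y) * h (\<tau>, y)) = h (\<tau>, y)"
          using R by (simp add: kcyl_def mult.assoc[symmetric] ennreal_mult[symmetric])
        then show ?thesis using True le[of \<tau> y] by simp
      qed (auto simp: indicator_def)
    qed
    finally show "f \<tau> \<le> (\<integral>\<^sup>+y. ennreal (R ^ (CARD('d) + 2)) * (kcyl R (t, x) (\<tau>, y) * h (\<tau>, y)) \<partial>lborel)" .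
  qed
  also have "\<dots> = (\<integral>\<^sup>+w. ennreal (R ^ (CARD('d) + 2)) * (kcyl R (t, x) w * h w) \<partial>lborel)"
    by (rule nn_integral_pair[of "\<lambda>w. ennreal (R ^ (CARD('d) + 2)) * (kcyl R (t, x) w * h w)"]) measurable
  also have "\<dots> = ennreal (R ^ (CARD('d) + 2)) * cavg R h (t, x)"
    unfolding cavg_def by (rule nn_integral_cmult) measurable
  finally have "(\<integral>\<^sup>+\<theta>\<in>{0<..<1}. (\<integral>\<^sup>+y\<in>ball x R. \<Psi> (t + \<theta> * l) y \<partial>lborel) \<partial>lborel) \<le> ennreal (1 / l) * (ennreal (R ^ (CARD('d) + 2)) * cavg R h (t, x))"
    by (simp add: mult_left_mono)
  also have "\<dots> = ennreal (R ^ (CARD('d) + 2) / l) * cavg R h (t, x)"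
  proof -
    have "R ^ (CARD('d) + 2) / l = 1 / l * R ^ (CARD('d) + 2)" by simp
    moreover have "1 / l \<ge> 0" "R ^ (CARD('d) + 2) \<ge> 0" using l R by auto
    ultimately show ?thesis by (simp only: ennreal_mult mult.assoc)
  qed
  finally show ?thesis .
qed

end

lemma suminf_ennreal_shift_le: "(\<Sum>k. F (k + i)) \<le> (\<Sum>k. F k)" for F :: "nat \<Rightarrow> ennreal"
  by (subst (2) suminf_offset[where i = i]) auto

locale solution_at_scales = power_solution \<delta> T a aa b f u n + dyadic \<rho> p
  for \<delta> T :: real
    and a :: "real \<times> (real ^ 'd::finite) \<Rightarrow> real ^ 'd ^ 'd"
    and aa b :: "real \<times> (real ^ 'd) \<Rightarrow> real ^ 'd" and f :: "real ^ 'd \<Rightarrow> real"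
    and u :: "real \<times> (real ^ 'd) \<Rightarrow> real" and n :: nat and \<rho> p :: real
begin

definition C_rep :: real where
  "C_rep = 2 * C_time + 4 * C_space + bump_const TYPE('d) * 2 ^ CARD('d) + bump_const TYPE('d)"

lemma r_tendsto: "r \<longlonglongrightarrow> 0"
proof -
  have "(\<lambda>k. \<rho> * (1 / 2) ^ k) \<longlonglongrightarrow> \<rho> * 0" by (intro tendsto_intros LIMSEQ_power_zero) auto
  moreover have "r = (\<lambda>k. \<rho> * (1 / 2) ^ k)" by (rule ext) (simp add: r_def power_one_over)
  ultimately show ?thesis by simp
qed

lemma r_sq_tendsto: "(\<lambda>k. (r k)\<^sup>2) \<longlonglongrightarrow> 0"
  using tendsto_power[OF r_tendsto, of 2] by simp

text \<open>
  The errors of a time step and of a space step at scale \<open>r k\<close>, and the average of \<open>sg * u ^ n\<close> at scale \<open>r k\<close>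
  and time \<open>t + \<theta> (r k)\<^sup>2\<close>.
\<close>
definition e1 :: "real \<Rightarrow> real \<times> (real ^ 'd) \<Rightarrow> nat \<Rightarrow> ennreal" where
  "e1 t0 z k = ennreal C_time * (ennreal (r k) * cavg (r k) (h1 t0) z + ennreal ((r k)\<^sup>2) * cavg (r k) (h2 t0) z)"
definition e2 :: "real \<Rightarrow> real ^ 'd \<Rightarrow> real \<Rightarrow> nat \<Rightarrow> ennreal" where
  "e2 t x \<theta> k = ennreal (C_space * r k / r k ^ CARD('d)) * (\<integral>\<^sup>+y\<in>ball x (r k). ennreal (P (t + \<theta> * (r (Suc k))\<^sup>2) y) \<partial>lborel)"
definition bb :: "real \<Rightarrow> real \<Rightarrow> real ^ 'd \<Rightarrow> real \<Rightarrow> nat \<Rightarrow> real" where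
  "bb sg t x \<theta> k = sg * m n (bump (r k) x) (t + \<theta> * (r k)\<^sup>2)"

text \<open>From scale \<open>r (k + 1)\<close> to \<open>r k\<close> one first enlarges the ball and then moves forward in time. As the scale tends to zero the
  averages converge to the value at \<open>(t, x)\<close>.\<close>

lemma chain:
  assumes sg: "admissible sg" and t: "0 \<le> t0" "t0 \<le> t" and J: "(r J)\<^sup>2 \<le> T - t" and \<theta>: "0 < \<theta>" "\<theta> < 1"
  shows "ennreal (sg * U t x ^ n) \<le> ennreal (bb sg t x \<theta> J) + (\<Sum>k. e1 t0 (t, x) (k + J) + e2 t x \<theta> (k + J))"
proof -
  have step: "ennreal (bb sg t x \<theta> (Suc k)) \<le> ennreal (bb sg t x \<theta> k) + (e1 t0 (t, x) k + e2 t x \<theta> k)" if k: "k \<ge> J" for k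
  proof -
    have rk: "(r k)\<^sup>2 \<le> T - t" by (rule order_trans[OF power_mono[OF r_antimono[OF k]] J]) simp
    have rs: "(r (Suc k))\<^sup>2 \<le> (r k)\<^sup>2" by (intro power_mono r_antimono) auto
    have rp: "(r k)\<^sup>2 > 0" "(r (Suc k))\<^sup>2 > 0" by simp_all
    have th: "\<theta> * (r k)\<^sup>2 < (r k)\<^sup>2" "0 \<le> \<theta> * (r (Suc k))\<^sup>2" "\<theta> * (r (Suc k))\<^sup>2 \<le> \<theta> * (r k)\<^sup>2"
      using \<theta> rp rs by (auto intro: mult_left_mono)
    have "ennreal (bb sg t x \<theta> (Suc k)) = ennreal (sg * m n (bump (r k / 2) x) (t + \<theta> * (r (Suc k))\<^sup>2))"
      by (simp add: bb_def r_Suc)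
    also have "\<dots> \<le> ennreal (sg * m n (bump (r k) x) (t + \<theta> * (r (Suc k))\<^sup>2)) + e2 t x \<theta> k"
      unfolding e2_def by (rule space_step[OF admissible_abs[OF sg]]) simp
    also have "ennreal (sg * m n (bump (r k) x) (t + \<theta> * (r (Suc k))\<^sup>2)) \<le> ennreal (bb sg t x \<theta> k) + e1 t0 (t, x) k"
      unfolding bb_def e1_def using th rk t by (intro time_step[OF sg t]) (linarith | simp)+
    finally show ?thesis by (simp add: add_mono add.assoc)
  qed
  have "ennreal (bb sg t x \<theta> (N + J)) \<le> ennreal (bb sg t x \<theta> J) + (\<Sum>k<N. e1 t0 (t, x) (k + J) + e2 t x \<theta> (k + J))" for N
  proof (induction N)
    case (Suc N)
    have "ennreal (bb sg t x \<theta> (Suc N + J)) \<le> ennreal (bb sg t x \<theta> (N + J)) + (e1 t0 (t, x) (N + J) + e2 t x \<theta> (N + J))"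
      using step[of "N + J"] by simp
    also have "\<dots> \<le> (ennreal (bb sg t x \<theta> J) + (\<Sum>k<N. e1 t0 (t, x) (k + J) + e2 t x \<theta> (k + J))) + (e1 t0 (t, x) (N + J) + e2 t x \<theta> (N + J))"
      by (rule add_right_mono[OF Suc])
    finally show ?case by (simp add: add.assoc)
  qed simp
  also have "ennreal (bb sg t x \<theta> J) + (\<Sum>k<N. e1 t0 (t, x) (k + J) + e2 t x \<theta> (k + J))
      \<le> ennreal (bb sg t x \<theta> J) + (\<Sum>k. e1 t0 (t, x) (k + J) + e2 t x \<theta> (k + J))" for N
    by (intro add_left_mono sum_le_suminf) auto
  finally have le: "ennreal (bb sg t x \<theta> (N + J)) \<le> ennreal (bb sg t x \<theta> J) + (\<Sum>k. e1 t0 (t, x) (k + J) + e2 t x \<theta> (k + J))" for N .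
  have "(\<lambda>k. m n (bump (r k) x) (t + \<theta> * (r k)\<^sup>2)) \<longlonglongrightarrow> U t x ^ n"
  proof (rule LIM_zero_cancel, rule Lim_null_comparison)
    show "eventually (\<lambda>k. norm (m n (bump (r k) x) (t + \<theta> * (r k)\<^sup>2) - U t x ^ n) \<le> real n * Mu ^ (n - 1) * (Lt * \<bar>t + \<theta> * (r k)\<^sup>2 - t\<bar> + Mu * r k)) sequentially"
    proof (intro always_eventually allI)
      fix k
      show "norm (m n (bump (r k) x) (t + \<theta> * (r k)\<^sup>2) - U t x ^ n) \<le> real n * Mu ^ (n - 1) * (Lt * \<bar>t + \<theta> * (r k)\<^sup>2 - t\<bar> + Mu * r k)"
        unfolding real_norm_def by (rule m_bump_close[OF r_pos])
    qed
    have "(\<lambda>k. real n * Mu ^ (n - 1) * (Lt * \<bar>t + \<theta> * (r k)\<^sup>2 - t\<bar> + Mu * r k)) \<longlonglongrightarrow> real n * Mu ^ (n - 1) * (Lt * \<bar>t + \<theta> * 0 - t\<bar> + Mu * 0)"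
      by (intro tendsto_intros r_tendsto r_sq_tendsto)
    then show "(\<lambda>k. real n * Mu ^ (n - 1) * (Lt * \<bar>t + \<theta> * (r k)\<^sup>2 - t\<bar> + Mu * r k)) \<longlonglongrightarrow> 0" by simp
  qed
  then have "(\<lambda>k. bb sg t x \<theta> k) \<longlonglongrightarrow> sg * U t x ^ n" unfolding bb_def by (intro tendsto_mult tendsto_const)
  then have "(\<lambda>N. bb sg t x \<theta> (N + J)) \<longlonglongrightarrow> sg * U t x ^ n" by (rule LIMSEQ_ignore_initial_segment)
  then have "(\<lambda>N. ennreal (bb sg t x \<theta> (N + J))) \<longlonglongrightarrow> ennreal (sg * U t x ^ n)" by (rule tendsto_ennrealI)
  then show ?thesis by (rule LIMSEQ_le_const2) (use le in blast)
qed

lemma e2_average: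
  assumes t: "t0 \<le> t" and J: "(r J)\<^sup>2 \<le> T - t" and k: "k \<ge> J"
  shows "(\<integral>\<^sup>+\<theta>\<in>{0<..<1}. e2 t x \<theta> k \<partial>lborel) \<le> ennreal (4 * C_space) * (ennreal (r k) * cavg (r k) (h1 t0) (t, x))"
proof -
  let ?I = "\<lambda>\<theta>. (\<integral>\<^sup>+y\<in>ball x (r k). ennreal (P (t + \<theta> * (r (Suc k))\<^sup>2) y) \<partial>lborel)"
  have rk: "(r (Suc k))\<^sup>2 \<le> T - t"
    by (rule order_trans[OF power_mono[OF r_antimono[of J "Suc k"]] J]) (use k in auto)
  have "(\<integral>\<^sup>+\<theta>\<in>{0<..<1}. e2 t x \<theta> k \<partial>lborel) = ennreal (C_space * r k / r k ^ CARD('d)) * (\<integral>\<^sup>+\<theta>\<in>{0<..<1}. ?I \<theta> \<partial>lborel)"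
    unfolding e2_def by (subst nn_integral_cmult[symmetric]) (auto simp: mult.assoc)
  also have "(\<integral>\<^sup>+\<theta>\<in>{0<..<1}. ?I \<theta> \<partial>lborel) \<le> ennreal (r k ^ (CARD('d) + 2) / (r (Suc k))\<^sup>2) * cavg (r k) (h1 t0) (t, x)"
  proof (rule time_average)
    show "(\<lambda>(\<tau>, y). ennreal (P \<tau> y)) \<in> borel_measurable (borel \<Otimes>\<^sub>M borel)" by measurable
    show "0 < (r (Suc k))\<^sup>2" "(r (Suc k))\<^sup>2 \<le> (r k)\<^sup>2" "0 < r k" by (auto intro!: power_mono r_antimono)
    fix \<tau> y assume "t < \<tau>" "\<tau> < t + (r (Suc k))\<^sup>2"
    then have "\<tau> \<in> {t0..T}" using t rk by auto
    then show "ennreal (P \<tau> y) \<le> h1 t0 (\<tau>, y)"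
      using gg_nonneg[of \<tau> y] V_nonneg[of \<tau> y] by (simp add: h1_def ennreal_leI)
  qed measurable
  also have "ennreal (C_space * r k / r k ^ CARD('d)) * (ennreal (r k ^ (CARD('d) + 2) / (r (Suc k))\<^sup>2) * cavg (r k) (h1 t0) (t, x))
     = ennreal (4 * C_space) * (ennreal (r k) * cavg (r k) (h1 t0) (t, x))"
  proof -
    have "C_space * r k / r k ^ CARD('d) * (r k ^ (CARD('d) + 2) / (r (Suc k))\<^sup>2) = 4 * C_space * r k"
      by (simp add: r_Suc power_add power_divide power2_eq_square)
    then have "ennreal (C_space * r k / r k ^ CARD('d)) * ennreal (r k ^ (CARD('d) + 2) / (r (Suc k))\<^sup>2) = ennreal (4 * C_space) * ennreal (r k)"
      using C_space_pos by (simp add: ennreal_mult[symmetric])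
    then show ?thesis by (simp add: mult.assoc[symmetric])
  qed
  finally show ?thesis by (simp add: mult_left_mono)
qed

text \<open>Integrating \<open>chain\<close> over \<open>\<theta>\<close> turns the space errors into averages over cylinders.\<close>

lemma average_chain:
  assumes sg: "admissible sg" and t: "0 \<le> t0" "t0 \<le> t" and J: "(r J)\<^sup>2 \<le> T - t" "J \<ge> 2"
    and I0: "\<And>\<theta>. 0 < \<theta> \<Longrightarrow> \<theta> < 1 \<Longrightarrow> ennreal (bb sg t x \<theta> J) \<le> I0 \<theta>" and [measurable]: "I0 \<in> borel_measurable borel"
  shows "ennreal (sg * U t x ^ n) \<le> (\<integral>\<^sup>+\<theta>\<in>{0<..<1}. I0 \<theta> \<partial>lborel)
     + ennreal (C_time + 4 * C_space) * potential1 (h1 t0) (t, x) + ennreal C_time * potential2 (h2 t0) (t, x)"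
proof -
  let ?X1 = "potential1 (h1 t0) (t, x)" and ?X2 = "potential2 (h2 t0) (t, x)"
  have [measurable]: "(\<lambda>\<theta>. e2 t x \<theta> k) \<in> borel_measurable borel" for k unfolding e2_def by measurable
  obtain i where i: "J = i + 2" using J(2) by (metis le_add_diff_inverse2)
  have "ennreal (sg * U t x ^ n) = (\<integral>\<^sup>+\<theta>\<in>{0<..<1::real}. ennreal (sg * U t x ^ n) \<partial>lborel)"
    by (simp add: nn_integral_cmult_indicator)
  also have "\<dots> \<le> (\<integral>\<^sup>+\<theta>. I0 \<theta> * indicator {0<..<1} \<theta> + ((\<Sum>k. e1 t0 (t, x) (k + J) * indicator {0<..<1} \<theta>) + (\<Sum>k. e2 t x \<theta> (k + J) * indicator {0<..<1} \<theta>)) \<partial>(lborel :: real measure))"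
  proof (intro nn_integral_mono)
    fix \<theta> :: real
    show "ennreal (sg * U t x ^ n) * indicator {0<..<1} \<theta> \<le> I0 \<theta> * indicator {0<..<1} \<theta> + ((\<Sum>k. e1 t0 (t, x) (k + J) * indicator {0<..<1} \<theta>) + (\<Sum>k. e2 t x \<theta> (k + J) * indicator {0<..<1} \<theta>))"
    proof (cases "\<theta> \<in> {0<..<1}")
      case True
      then have th: "0 < \<theta>" "\<theta> < 1" by auto
      have "ennreal (sg * U t x ^ n) \<le> ennreal (bb sg t x \<theta> J) + (\<Sum>k. e1 t0 (t, x) (k + J) + e2 t x \<theta> (k + J))"
        by (rule chain[OF sg t J(1) th])
      also have "\<dots> \<le> I0 \<theta> + (\<Sum>k. e1 t0 (t, x) (k + J) + e2 t x \<theta> (k + J))" by (intro add_right_mono I0 th)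
      also have "(\<Sum>k. e1 t0 (t, x) (k + J) + e2 t x \<theta> (k + J)) = (\<Sum>k. e1 t0 (t, x) (k + J)) + (\<Sum>k. e2 t x \<theta> (k + J))"
        by (rule suminf_add[symmetric]) auto
      finally show ?thesis using True by simp
    qed simp
  qed
  also have "\<dots> = (\<integral>\<^sup>+\<theta>\<in>{0<..<1}. I0 \<theta> \<partial>lborel) + ((\<Sum>k. \<integral>\<^sup>+\<theta>\<in>{0<..<1::real}. e1 t0 (t, x) (k + J) \<partial>lborel) + (\<Sum>k. \<integral>\<^sup>+\<theta>\<in>{0<..<1}. e2 t x \<theta> (k + J) \<partial>lborel))"
    by (simp add: nn_integral_add nn_integral_suminf del: ennreal_suminf_multc)
  also have "(\<Sum>k. \<integral>\<^sup>+\<theta>\<in>{0<..<1::real}. e1 t0 (t, x) (k + J) \<partial>lborel) = (\<Sum>k. e1 t0 (t, x) (k + J))"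
    by (simp add: nn_integral_cmult_indicator)
  also have "\<dots> \<le> ennreal C_time * (?X1 + ?X2)"
  proof -
    have "(\<Sum>k. e1 t0 (t, x) (k + J)) = ennreal C_time * ((\<Sum>k. ennreal (r (k + J)) * cavg (r (k + J)) (h1 t0) (t, x)) + (\<Sum>k. ennreal ((r (k + J))\<^sup>2) * cavg (r (k + J)) (h2 t0) (t, x)))"
      unfolding e1_def by (simp add: suminf_add)
    also have "(\<Sum>k. ennreal (r (k + J)) * cavg (r (k + J)) (h1 t0) (t, x)) \<le> ?X1"
      using suminf_ennreal_shift_le[of "\<lambda>k. ennreal (r (k + 2)) * cavg (r (k + 2)) (h1 t0) (t, x)" i]
      unfolding potential1_def i add.assoc .
    also have "(\<Sum>k. ennreal ((r (k + J))\<^sup>2) * cavg (r (k + J)) (h2 t0) (t, x)) \<le> ?X2"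
      using suminf_ennreal_shift_le[of "\<lambda>k. ennreal ((r (Suc k))\<^sup>2) * cavg (r (Suc k)) (h2 t0) (t, x)" "Suc i"]
      unfolding potential2_def i by simp
    finally show ?thesis by (simp add: mult_left_mono add_mono)
  qed
  also have "(\<Sum>k. \<integral>\<^sup>+\<theta>\<in>{0<..<1}. e2 t x \<theta> (k + J) \<partial>lborel) \<le> ennreal (4 * C_space) * ?X1"
  proof -
    have "(\<Sum>k. \<integral>\<^sup>+\<theta>\<in>{0<..<1}. e2 t x \<theta> (k + J) \<partial>lborel) \<le> (\<Sum>k. ennreal (4 * C_space) * (ennreal (r (k + J)) * cavg (r (k + J)) (h1 t0) (t, x)))"
      by (intro suminf_le allI e2_average[OF t(2) J(1)]) auto
    also have "\<dots> = ennreal (4 * C_space) * (\<Sum>k. ennreal (r (k + J)) * cavg (r (k + J)) (h1 t0) (t, x))" by simp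
    also have "(\<Sum>k. ennreal (r (k + J)) * cavg (r (k + J)) (h1 t0) (t, x)) \<le> ?X1"
      using suminf_ennreal_shift_le[of "\<lambda>k. ennreal (r (k + 2)) * cavg (r (k + 2)) (h1 t0) (t, x)" i]
      unfolding potential1_def i add.assoc .
    finally show ?thesis by (simp add: mult_left_mono)
  qed
  finally have "ennreal (sg * U t x ^ n) \<le> (\<integral>\<^sup>+\<theta>\<in>{0<..<1}. I0 \<theta> \<partial>lborel) + (ennreal C_time * (?X1 + ?X2) + ennreal (4 * C_space) * ?X1)"
    by (simp add: add_mono)
  also have "ennreal C_time * (?X1 + ?X2) + ennreal (4 * C_space) * ?X1 = ennreal (C_time + 4 * C_space) * ?X1 + ennreal C_time * ?X2"
  proof -
    have "ennreal (C_time + 4 * C_space) = ennreal C_time + ennreal (4 * C_space)" using C_time_pos C_space_pos by (intro ennreal_plus) auto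
    then show ?thesis by (simp only: distrib_left distrib_right ac_simps)
  qed
  finally show ?thesis by (simp add: add.assoc)
qed

text \<open>The telescoping starts at the scale \<open>r 2\<close> if the time that is left permits, with an average of \<open>V\<close> over a cylinder as
  initial term. Otherwise it starts at the first scale \<open>J\<close> that fits into \<open>{t..T}\<close>; then \<open>T - t < (2 r J)\<^sup>2\<close>, and
  one further time step leads to an average of the final values, with \<open>t\<close> in the slab belonging to the scale
  \<open>2 r J\<close>.\<close>

lemma representation_signed:
  assumes sg: "admissible sg" and t: "0 \<le> t0" "t0 \<le> t" "t < T"
  shows "ennreal (sg * U t x ^ n) \<le> ennreal C_rep * (potential1 (h1 t0) (t, x) + potential2 (h2 t0) (t, x)
    + trace_potential T (\<lambda>y. ennreal (V T y)) (t, x) + cavg (r 2) (hV t0) (t, x))"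
proof -
  let ?X1 = "potential1 (h1 t0) (t, x)" and ?X2 = "potential2 (h2 t0) (t, x)"
  let ?X3 = "trace_potential T (\<lambda>y. ennreal (V T y)) (t, x)" and ?X4 = "cavg (r 2) (hV t0) (t, x)"
  let ?bc = "bump_const TYPE('d)"
  have bc: "?bc > 0" by (rule bump_const_pos)
  have "ennreal (sg * U t x ^ n) \<le> ennreal (2 * C_time + 4 * C_space) * ?X1 + ennreal (2 * C_time) * ?X2 + ennreal (?bc * 2 ^ CARD('d)) * ?X3 + ennreal ?bc * ?X4"
  proof (cases "(r 2)\<^sup>2 \<le> T - t")
    case True
    let ?I0 = "\<lambda>\<theta>. ennreal (?bc / r 2 ^ CARD('d)) * (\<integral>\<^sup>+y\<in>ball x (r 2). ennreal (V (t + \<theta> * (r 2)\<^sup>2) y) \<partial>lborel)"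
    have "(\<integral>\<^sup>+\<theta>\<in>{0<..<1}. ?I0 \<theta> \<partial>lborel) = ennreal (?bc / r 2 ^ CARD('d)) * (\<integral>\<^sup>+\<theta>\<in>{0<..<1}. (\<integral>\<^sup>+y\<in>ball x (r 2). ennreal (V (t + \<theta> * (r 2)\<^sup>2) y) \<partial>lborel) \<partial>lborel)"
      by (subst nn_integral_cmult[symmetric]) (auto simp: mult.assoc)
    also have "\<dots> \<le> ennreal (?bc / r 2 ^ CARD('d)) * (ennreal (r 2 ^ (CARD('d) + 2) / (r 2)\<^sup>2) * ?X4)"
    proof (intro mult_left_mono time_average)
      show "(\<lambda>(\<tau>, y). ennreal (V \<tau> y)) \<in> borel_measurable (borel \<Otimes>\<^sub>M borel)" by measurable
      fix \<tau> y assume "t < \<tau>" "\<tau> < t + (r 2)\<^sup>2"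
      then have "\<tau> \<in> {t0..T}" using t True by auto
      then show "ennreal (V \<tau> y) \<le> hV t0 (\<tau>, y)" by (simp add: hV_def)
    qed auto
    also have "\<dots> = ennreal ?bc * ?X4"
    proof -
      have "?bc / r 2 ^ CARD('d) * (r 2 ^ (CARD('d) + 2) / (r 2)\<^sup>2) = ?bc" by (simp add: power_add power2_eq_square)
      then have "ennreal (?bc / r 2 ^ CARD('d)) * ennreal (r 2 ^ (CARD('d) + 2) / (r 2)\<^sup>2) = ennreal ?bc"
        using bc by (subst ennreal_mult[symmetric]) auto
      then show ?thesis by (simp add: mult.assoc[symmetric])
    qed
    finally have I: "(\<integral>\<^sup>+\<theta>\<in>{0<..<1}. ?I0 \<theta> \<partial>lborel) \<le> ennreal ?bc * ?X4" .
    have "ennreal (sg * U t x ^ n) \<le> (\<integral>\<^sup>+\<theta>\<in>{0<..<1}. ?I0 \<theta> \<partial>lborel) + ennreal (C_time + 4 * C_space) * ?X1 + ennreal C_time * ?X2"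
    proof (rule average_chain[OF sg t(1,2) True])
      show "ennreal (bb sg t x \<theta> 2) \<le> ?I0 \<theta>" for \<theta> unfolding bb_def by (rule m_bump_le[OF admissible_abs[OF sg]]) simp
    qed auto
    also have "\<dots> \<le> ennreal ?bc * ?X4 + ennreal (2 * C_time + 4 * C_space) * ?X1 + ennreal (2 * C_time) * ?X2"
      using C_time_pos C_space_pos by (intro add_mono I mult_right_mono ennreal_leI) auto
    also have "\<dots> \<le> ennreal (2 * C_time + 4 * C_space) * ?X1 + ennreal (2 * C_time) * ?X2 + ennreal (?bc * 2 ^ CARD('d)) * ?X3 + ennreal ?bc * ?X4"
      by (simp add: ac_simps add_increasing2 add_increasing)
    finally show ?thesis .
  next
    case False
    \<comment> \<open>Too little time is left for the scale r 2, so the final value takes over.\<close>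
    define J where "J = (LEAST k. (r k)\<^sup>2 \<le> T - t)"
    have "\<exists>k. (r k)\<^sup>2 \<le> T - t"
    proof -
      have "eventually (\<lambda>k. (r k)\<^sup>2 < T - t) sequentially" using order_tendstoD(2)[OF r_sq_tendsto, of "T - t"] t(3) by simp
      then show ?thesis unfolding eventually_sequentially by (meson order_refl less_imp_le)
    qed
    then have J: "(r J)\<^sup>2 \<le> T - t" unfolding J_def by (rule LeastI_ex)
    have notJ: "\<not> (r k)\<^sup>2 \<le> T - t" if "k < J" for k using that not_less_Least unfolding J_def by blast
    have J3: "J \<ge> 3"
    proof (rule ccontr)
      assume "\<not> J \<ge> 3"
      then have "(r 2)\<^sup>2 \<le> (r J)\<^sup>2" by (intro power_mono r_antimono) auto
      then show False using J False by linarith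
    qed
    then have "J = Suc ((J - 3) + 2)" by simp
    then obtain i where i: "J = Suc (i + 2)" by blast
    have Ti: "T - t < (r (i + 2))\<^sup>2" using notJ[of "i + 2"] i by simp
    have rJ: "r J = r (i + 2) / 2" by (simp add: i r_Suc)
    let ?I0 = "ennreal (?bc * 2 ^ CARD('d)) * ?X3 + ennreal C_time * (?X1 + ?X2)"
    have sl: "fst (t, x) \<in> slab T (i + 2)" using Ti J by (auto simp: slab_def i)
    have "ennreal (sg * m n (bump (r J) x) T) \<le> ennreal (?bc / r J ^ CARD('d)) * (\<integral>\<^sup>+y\<in>ball x (r J). ennreal (V T y) \<partial>lborel)"
      by (rule m_bump_le[OF admissible_abs[OF sg]]) simp
    also have "\<dots> \<le> ennreal (?bc / r J ^ CARD('d)) * (\<integral>\<^sup>+y. ennreal (V T y) * indicator (ball x (r (i + 2))) y \<partial>lborel)"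
    proof (rule mult_left_mono, rule nn_integral_mono)
      fix y
      have "y \<in> ball x (r J) \<Longrightarrow> y \<in> ball x (r (i + 2))"
        unfolding mem_ball rJ using zero_le_dist[of x y] by linarith
      then show "ennreal (V T y) * indicator (ball x (r J)) y \<le> ennreal (V T y) * indicator (ball x (r (i + 2))) y"
        by (auto simp: indicator_def simp del: mem_ball)
    qed simp
    also have "\<dots> = (\<integral>\<^sup>+y. ennreal (?bc / r J ^ CARD('d)) * (ennreal (V T y) * indicator (ball x (r (i + 2))) y) \<partial>lborel)"
      by (rule nn_integral_cmult[symmetric]) measurable
    also have "\<dots> = (\<integral>\<^sup>+y. ennreal (?bc * 2 ^ CARD('d)) * (kball (r (i + 2)) x y * ennreal (V T y)) \<partial>lborel)"
    proof (intro nn_integral_cong)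
      fix y
      have "?bc / r J ^ CARD('d) = ?bc * 2 ^ CARD('d) * (1 / r (i + 2) ^ CARD('d))" by (simp add: rJ power_divide)
      then have "ennreal (?bc / r J ^ CARD('d)) = ennreal (?bc * 2 ^ CARD('d)) * ennreal (1 / r (i + 2) ^ CARD('d))"
        using bc by (simp only:) (subst ennreal_mult, auto)
      then show "ennreal (?bc / r J ^ CARD('d)) * (ennreal (V T y) * indicator (ball x (r (i + 2))) y) = ennreal (?bc * 2 ^ CARD('d)) * (kball (r (i + 2)) x y * ennreal (V T y))"
        by (simp add: kball_def mult_ac)
    qed
    also have "\<dots> = ennreal (?bc * 2 ^ CARD('d)) * savg (r (i + 2)) (\<lambda>y. ennreal (V T y)) x"
      unfolding savg_def by (rule nn_integral_cmult) measurable
    also have "savg (r (i + 2)) (\<lambda>y. ennreal (V T y)) x = ?X3" using trace_potential_single[OF sl] by simp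
    finally have mT: "ennreal (sg * m n (bump (r J) x) T) \<le> ennreal (?bc * 2 ^ CARD('d)) * ?X3" .
    have "ennreal (sg * U t x ^ n) \<le> (\<integral>\<^sup>+\<theta>\<in>{0<..<1::real}. ?I0 \<partial>lborel) + ennreal (C_time + 4 * C_space) * ?X1 + ennreal C_time * ?X2"
    proof (rule average_chain[OF sg t(1,2) J])
      show "J \<ge> 2" using J3 by simp
      fix \<theta> :: real assume th: "0 < \<theta>" "\<theta> < 1"
      have thJ: "\<theta> * (r J)\<^sup>2 \<le> T - t"
        by (rule order_trans[OF mult_left_le_one_le J]) (use th in auto)
      have "ennreal (bb sg t x \<theta> J) \<le> ennreal (sg * m n (bump (r J) x) T) + e1 t0 (t, x) (i + 2)"
        unfolding bb_def e1_def
      proof (rule time_step[OF sg t(1,2)])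
        show "t \<le> t + \<theta> * (r J)\<^sup>2" using th by simp
        show "t + \<theta> * (r J)\<^sup>2 \<le> T" using thJ by simp
        show "r J \<le> r (i + 2)" "r (i + 2) \<le> 2 * r J" by (auto simp: rJ)
        show "T < t + (r (i + 2))\<^sup>2" using Ti by simp
      qed auto
      also have "e1 t0 (t, x) (i + 2) \<le> ennreal C_time * (?X1 + ?X2)"
      proof -
        have "ennreal (r (i + 2)) * cavg (r (i + 2)) (h1 t0) (t, x) \<le> ?X1"
          unfolding potential1_def using sum_le_suminf[of "\<lambda>k. ennreal (r (k + 2)) * cavg (r (k + 2)) (h1 t0) (t, x)" "{i}"] by simp
        moreover have "ennreal ((r (i + 2))\<^sup>2) * cavg (r (i + 2)) (h2 t0) (t, x) \<le> ?X2"
          unfolding potential2_def using sum_le_suminf[of "\<lambda>k. ennreal ((r (Suc k))\<^sup>2) * cavg (r (Suc k)) (h2 t0) (t, x)" "{Suc i}"] by simp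
        ultimately show ?thesis unfolding e1_def by (intro mult_left_mono add_mono) auto
      qed
      finally show "ennreal (bb sg t x \<theta> J) \<le> ?I0" using mT by (meson add_mono order_trans order_refl)
    qed auto
    also have "(\<integral>\<^sup>+\<theta>\<in>{0<..<1::real}. ?I0 \<partial>lborel) = ?I0" by (simp add: nn_integral_cmult_indicator)
    also have "?I0 + ennreal (C_time + 4 * C_space) * ?X1 + ennreal C_time * ?X2 = ennreal (2 * C_time + 4 * C_space) * ?X1 + ennreal (2 * C_time) * ?X2 + ennreal (?bc * 2 ^ CARD('d)) * ?X3"
    proof -
      have "ennreal (2 * C_time + 4 * C_space) = ennreal C_time + ennreal (C_time + 4 * C_space)" using C_time_pos C_space_pos by (subst ennreal_plus[symmetric]) auto
      moreover have "ennreal (2 * C_time) = ennreal C_time + ennreal C_time" using C_time_pos by (subst ennreal_plus[symmetric]) auto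
      ultimately show ?thesis by (simp only: distrib_left distrib_right ac_simps)
    qed
    also have "\<dots> \<le> ennreal (2 * C_time + 4 * C_space) * ?X1 + ennreal (2 * C_time) * ?X2 + ennreal (?bc * 2 ^ CARD('d)) * ?X3 + ennreal ?bc * ?X4" by simp
    finally show ?thesis .
  qed
  also have "\<dots> \<le> ennreal C_rep * ?X1 + ennreal C_rep * ?X2 + ennreal C_rep * ?X3 + ennreal C_rep * ?X4"
    using C_time_pos C_space_pos bc by (intro add_mono mult_right_mono ennreal_leI) (auto simp: C_rep_def add_nonneg_nonneg)
  finally show ?thesis by (simp add: distrib_left)
qed

text \<open>If \<open>n\<close> is even then \<open>V = u ^ n\<close>, and for \<open>n = 1\<close> the sign of \<open>u\<close> decides which of the two bounds to use.\<close>

lemma representation: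
  assumes t: "0 \<le> t0" "t0 \<le> t" "t < T"
  shows "ennreal (V t x) \<le> ennreal C_rep * (potential1 (h1 t0) (t, x) + potential2 (h2 t0) (t, x)
    + trace_potential T (\<lambda>y. ennreal (V T y)) (t, x) + cavg (r 2) (hV t0) (t, x))"
proof (cases "U t x ^ n \<ge> 0")
  case True
  then have "V t x = 1 * U t x ^ n" by (simp add: V_def power_abs[symmetric])
  moreover have "admissible 1" using n by (auto simp: admissible_def)
  ultimately show ?thesis using representation_signed[of 1, OF _ t] by (simp only:)
next
  case False
  then have "V t x = (-1) * U t x ^ n" by (simp add: V_def power_abs[symmetric])
  moreover have "admissible (-1)" using n False by (auto simp: admissible_def)
  ultimately show ?thesis using representation_signed[of "-1", OF _ t] by (simp only:)
qed

lemma V_T: "V T y = \<bar>f y\<bar> ^ n"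
proof -
  have "c T = T" using T by (intro c_id) auto
  then show ?thesis using sol by (simp add: V_def U_def classical_solution_def)
qed

end

section \<open>Absorbing the drift term\<close>

lemma ennreal_add_sq_le: "(a + b)\<^sup>2 \<le> 2 * (a\<^sup>2 + b\<^sup>2)" for a b :: ennreal
proof (cases a; cases b)
  fix x y assume x: "0 \<le> x" "a = ennreal x" and y: "0 \<le> y" "b = ennreal y"
  have "(x + y)\<^sup>2 \<le> 2 * (x\<^sup>2 + y\<^sup>2)" using zero_le_power2[of "x - y"] by (simp add: power2_eq_square algebra_simps)
  then have le: "ennreal ((x + y)\<^sup>2) \<le> ennreal (2 * (x\<^sup>2 + y\<^sup>2))" by (rule ennreal_leI)
  have "(a + b)\<^sup>2 = ennreal ((x + y)\<^sup>2)"
  proof -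
    have "a + b = ennreal (x + y)" using x y by simp
    then show ?thesis using x y by (simp add: ennreal_power del: ennreal_plus)
  qed
  moreover have "2 * (a\<^sup>2 + b\<^sup>2) = ennreal (2 * (x\<^sup>2 + y\<^sup>2))"
    using x y by (simp add: ennreal_power ennreal_mult)
  ultimately show ?thesis using le by (simp only:)
qed (auto simp: power2_eq_square ennreal_mult_top ennreal_top_mult)

lemma ennreal_add4_sq_le: "(a + b + c + d)\<^sup>2 \<le> 4 * (a\<^sup>2 + b\<^sup>2 + c\<^sup>2 + d\<^sup>2)" for a b c d :: ennreal
proof -
  have "(a + b + c + d)\<^sup>2 = ((a + b) + (c + d))\<^sup>2" by (simp add: add.assoc)
  also have "\<dots> \<le> 2 * ((a + b)\<^sup>2 + (c + d)\<^sup>2)" by (rule ennreal_add_sq_le)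
  also have "\<dots> \<le> 2 * (2 * (a\<^sup>2 + b\<^sup>2) + 2 * (c\<^sup>2 + d\<^sup>2))" by (intro mult_left_mono add_mono ennreal_add_sq_le) auto
  also have "\<dots> = 4 * (a\<^sup>2 + b\<^sup>2 + c\<^sup>2 + d\<^sup>2)"
    by (simp add: distrib_left mult.assoc[symmetric] add.assoc)
  finally show ?thesis .
qed

text \<open>If \<open>S\<close> is the supremum of \<open>m t * exp (- 2 \<beta> (T - t))\<close>, the assumption gives \<open>S \<le> A + S / 2\<close>: doubling the rate makes the
  integral operator a contraction by one half.\<close>

lemma gronwall_backward:
  fixes m :: "real \<Rightarrow> real"
  assumes A: "A \<ge> 0" and \<beta>: "\<beta> > 0" and T: "T > 0"
    and m0: "\<And>t. t \<in> {0..T} \<Longrightarrow> 0 \<le> m t" and mB: "\<And>t. t \<in> {0..T} \<Longrightarrow> m t \<le> B"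
    and mi: "\<And>t. t \<in> {0..T} \<Longrightarrow> set_integrable lborel {t..T} m"
    and ineq: "\<And>t. t \<in> {0..T} \<Longrightarrow> m t \<le> A + \<beta> * (LINT s:{t..T}|lborel. m s)"
    and t: "t \<in> {0..T}"
  shows "m t \<le> 2 * A * exp (2 * \<beta> * (T - t))"
    and "\<beta> * (LINT s:{t..T}|lborel. m s) \<le> A * exp (2 * \<beta> * (T - t))"
proof -
  define S where "S = (SUP t\<in>{0..T}. m t * exp (- (2 * \<beta> * (T - t))))"
  have bdd: "bdd_above ((\<lambda>t. m t * exp (- (2 * \<beta> * (T - t)))) ` {0..T})"
  proof (rule bdd_aboveI2)
    fix t assume t: "t \<in> {0..T}"
    have "m t * exp (- (2 * \<beta> * (T - t))) \<le> m t * 1" using m0[OF t] t \<beta> by (intro mult_left_mono) auto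
    then show "m t * exp (- (2 * \<beta> * (T - t))) \<le> B" using mB[OF t] by simp
  qed
  have up: "m t \<le> S * exp (2 * \<beta> * (T - t))" if "t \<in> {0..T}" for t
  proof -
    have "m t * exp (- (2 * \<beta> * (T - t))) \<le> S" unfolding S_def by (rule cSUP_upper[OF that bdd])
    then have "m t * exp (- (2 * \<beta> * (T - t))) * exp (2 * \<beta> * (T - t)) \<le> S * exp (2 * \<beta> * (T - t))" by (rule mult_right_mono) simp
    moreover have "m t * exp (- (2 * \<beta> * (T - t))) * exp (2 * \<beta> * (T - t)) = m t"
      by (simp add: mult.assoc exp_minus_inverse exp_add[symmetric])
    ultimately show ?thesis by simp
  qed
  have S0: "S \<ge> 0"
  proof -
    have "0 \<le> m T * exp (- (2 * \<beta> * (T - T)))" using m0[of T] T by simp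
    also have "\<dots> \<le> S" unfolding S_def by (rule cSUP_upper[OF _ bdd]) (use T in auto)
    finally show ?thesis .
  qed
  have intb: "\<beta> * (LINT s:{t..T}|lborel. m s) \<le> S / 2 * exp (2 * \<beta> * (T - t))" if t: "t \<in> {0..T}" for t
  proof -
    define E where "E s = - (S / (2 * \<beta>)) * exp (2 * \<beta> * (T - s))" for s
    have der: "(E has_vector_derivative S * exp (2 * \<beta> * (T - s))) (at s within {t..T})" for s
      unfolding has_real_derivative_iff_has_vector_derivative[symmetric] E_def
      using \<beta> by (auto intro!: derivative_eq_intros)
    have hi: "((\<lambda>s. S * exp (2 * \<beta> * (T - s))) has_integral (E T - E t)) {t..T}"
      using t der by (intro fundamental_theorem_of_calculus) auto
    have si: "set_integrable lborel {t..T} (\<lambda>s. S * exp (2 * \<beta> * (T - s)))"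
      by (rule borel_integrable_atLeastAtMost') (intro continuous_intros)
    have "(LINT s:{t..T}|lborel. m s) \<le> (LINT s:{t..T}|lborel. S * exp (2 * \<beta> * (T - s)))"
      by (rule set_integral_mono[OF mi[OF t] si]) (use t up in auto)
    also have "\<dots> = E T - E t" by (rule trans[OF set_borel_integral_eq_integral(2)[OF si] integral_unique[OF hi]])
    also have "\<dots> \<le> S / (2 * \<beta>) * exp (2 * \<beta> * (T - t))" using S0 \<beta> by (simp add: E_def)
    finally have "\<beta> * (LINT s:{t..T}|lborel. m s) \<le> \<beta> * (S / (2 * \<beta>) * exp (2 * \<beta> * (T - t)))" using \<beta> by (intro mult_left_mono) auto
    then show ?thesis using \<beta> by simp
  qed
  have "(SUP t\<in>{0..T}. m t * exp (- (2 * \<beta> * (T - t)))) \<le> A + S / 2"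
  proof (rule cSUP_least)
    show "{0..T} \<noteq> {}" using T by auto
    fix t assume t: "t \<in> {0..T}"
    have "m t \<le> A + S / 2 * exp (2 * \<beta> * (T - t))" using ineq[OF t] intb[OF t] by linarith
    also have "\<dots> \<le> A * exp (2 * \<beta> * (T - t)) + S / 2 * exp (2 * \<beta> * (T - t))"
      using A t \<beta> by (intro add_right_mono) (simp add: mult_le_cancel_left1)
    also have "\<dots> = (A + S / 2) * exp (2 * \<beta> * (T - t))" by (simp add: distrib_right)
    finally have "m t * exp (- (2 * \<beta> * (T - t))) \<le> (A + S / 2) * exp (2 * \<beta> * (T - t)) * exp (- (2 * \<beta> * (T - t)))"
      by (rule mult_right_mono) simp
    also have "\<dots> = A + S / 2" by (simp add: mult.assoc exp_add[symmetric])
    finally show "m t * exp (- (2 * \<beta> * (T - t))) \<le> A + S / 2" .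
  qed
  then have S2: "S \<le> 2 * A" unfolding S_def[symmetric] by simp
  show "m t \<le> 2 * A * exp (2 * \<beta> * (T - t))"
    by (rule order_trans[OF up[OF t] mult_right_mono[OF S2]]) simp
  have "S / 2 * exp (2 * \<beta> * (T - t)) \<le> A * exp (2 * \<beta> * (T - t))" using S2 by (intro mult_right_mono) auto
  then show "\<beta> * (LINT s:{t..T}|lborel. m s) \<le> A * exp (2 * \<beta> * (T - t))" using intb[OF t] by linarith
qed

text \<open>
  The weight is comparable at points of distance at most \<open>\<rho>\<close>, and thus commutes with the potentials up to a constant.
  The number \<open>\<theta>\<close> bounds the Morrey norm of \<open>g\<close>; after division by it, \<open>g1\<close> satisfies the normalised
  condition of \<open>morrey\<close>.
\<close>
locale energy = solution_at_scales \<delta> T a aa b f u n \<rho> p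
  for \<delta> T :: real
    and a :: "real \<times> (real ^ 'd::finite) \<Rightarrow> real ^ 'd ^ 'd"
    and aa b :: "real \<times> (real ^ 'd) \<Rightarrow> real ^ 'd" and f :: "real ^ 'd \<Rightarrow> real"
    and u :: "real \<times> (real ^ 'd) \<Rightarrow> real" and n :: nat and \<rho> p :: real +
  fixes \<zeta> :: "real ^ 'd \<Rightarrow> real" and \<mu>0 \<theta> :: real
  assumes \<zeta>_exp_decay: "exp_decay \<zeta>" and \<zeta>_pos: "\<And>x. \<zeta> x > 0"
    and \<zeta>_grad: "\<And>x. norm (gradient \<zeta> x) \<le> \<mu>0 * \<zeta> x" and \<mu>0: "\<mu>0 \<ge> 0" "\<mu>0 * \<rho> \<le> 1"
    and \<zeta>_ratio: "\<And>x y. norm (x - y) \<le> \<rho> \<Longrightarrow> \<zeta> x \<le> 4 * \<zeta> y"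
    and \<theta>: "0 < \<theta>" "\<theta> \<le> 1"
    and morrey_g: "\<And>k z. cavg (r k) (\<lambda>w. ennreal (g w powr p)) z \<le> ennreal ((\<theta> / r k) powr p)"
begin

definition g1 :: "real \<times> (real ^ 'd) \<Rightarrow> real" where "g1 z = g z / \<theta>"

lemma morrey_g1: "morrey \<rho> p g1 (Mg / \<theta>)"
proof unfold_locales
  show "g1 \<in> borel_measurable borel" unfolding g1_def[abs_def] by measurable
  show "0 \<le> g1 z" "g1 z \<le> Mg / \<theta>" for z using g_nonneg[of z] g_le[of z] \<theta> by (auto simp: g1_def divide_right_mono)
  fix k z
  have "cavg (r k) (\<lambda>w. ennreal (g1 w powr p)) z = cavg (r k) (\<lambda>w. ennreal (1 / \<theta> powr p) * ennreal (g w powr p)) z"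
    unfolding g1_def using g_nonneg \<theta> by (simp add: powr_divide ennreal_mult[symmetric])
  also have "\<dots> = ennreal (1 / \<theta> powr p) * cavg (r k) (\<lambda>w. ennreal (g w powr p)) z"
    by (rule cavg_cmult) measurable
  also have "\<dots> \<le> ennreal (1 / \<theta> powr p) * ennreal ((\<theta> / r k) powr p)" by (intro mult_left_mono morrey_g) auto
  also have "\<dots> = ennreal (r k powr (- p))"
    using \<theta> by (simp add: ennreal_mult[symmetric] powr_divide powr_minus_divide)
  finally show "cavg (r k) (\<lambda>w. ennreal (g1 w powr p)) z \<le> ennreal (r k powr (- p))" .
qed

sublocale M: morrey \<rho> p g1 "Mg / \<theta>" by (rule morrey_g1)

definition sq :: "real ^ 'd \<Rightarrow> real" where "sq x = sqrt (\<zeta> x)"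

lemma sq_nonneg: "sq x \<ge> 0" using \<zeta>_pos[of x] by (simp add: sq_def)
lemma sq_sq: "(sq x)\<^sup>2 = \<zeta> x" using \<zeta>_pos[of x] by (simp add: sq_def)
lemma sq_ratio: "norm (x - y) \<le> \<rho> \<Longrightarrow> sq x \<le> 2 * sq y"
proof -
  assume "norm (x - y) \<le> \<rho>"
  then have "sqrt (\<zeta> x) \<le> sqrt (4 * \<zeta> y)" using \<zeta>_ratio by simp
  then show ?thesis by (simp add: sq_def real_sqrt_mult)
qed
lemma \<zeta>_meas[measurable]: "\<zeta> \<in> borel_measurable borel" by (rule differentiable_imp_measurable[OF exp_decay_D[OF \<zeta>_exp_decay]])
lemma sq_meas[measurable]: "sq \<in> borel_measurable borel" unfolding sq_def[abs_def] by measurable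

lemma weight_cavg:
  assumes "r0 \<le> \<rho>" and [measurable]: "h \<in> borel_measurable borel"
  shows "ennreal (sq x) * cavg r0 h (t, x) \<le> 2 * cavg r0 (\<lambda>w. ennreal (sq (snd w)) * h w) (t, x)"
proof -
  note fst_snd_meas[measurable]
  have "ennreal (sq x) * cavg r0 h (t, x) = (\<integral>\<^sup>+w. ennreal (sq x) * (kcyl r0 (t, x) w * h w) \<partial>lborel)"
    unfolding cavg_def by (rule nn_integral_cmult[symmetric]) measurable
  also have "\<dots> \<le> (\<integral>\<^sup>+w. 2 * (kcyl r0 (t, x) w * (ennreal (sq (snd w)) * h w)) \<partial>lborel)"
  proof (intro nn_integral_mono)
    fix w
    show "ennreal (sq x) * (kcyl r0 (t, x) w * h w) \<le> 2 * (kcyl r0 (t, x) w * (ennreal (sq (snd w)) * h w))"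
    proof (cases "w \<in> cyl r0 (t, x)")
      case True
      then have "norm (x - snd w) \<le> \<rho>" using assms(1) by (simp add: cyl_iff norm_minus_commute)
      then have "ennreal (sq x) \<le> ennreal (2 * sq (snd w))" by (intro ennreal_leI sq_ratio)
      also have "\<dots> = 2 * ennreal (sq (snd w))" using sq_nonneg by (simp add: ennreal_mult)
      finally have "ennreal (sq x) * (kcyl r0 (t, x) w * h w) \<le> 2 * ennreal (sq (snd w)) * (kcyl r0 (t, x) w * h w)"
        by (rule mult_right_mono) simp
      then show ?thesis by (simp add: mult_ac)
    qed (simp add: kcyl_def)
  qed
  also have "\<dots> = 2 * cavg r0 (\<lambda>w. ennreal (sq (snd w)) * h w) (t, x)"
    unfolding cavg_def by (rule nn_integral_cmult) measurable
  finally show ?thesis .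
qed

lemma weight_potential1:
  assumes [measurable]: "h \<in> borel_measurable borel"
  shows "ennreal (sq x) * potential1 h (t, x) \<le> 2 * potential1 (\<lambda>w. ennreal (sq (snd w)) * h w) (t, x)"
proof -
  have "ennreal (sq x) * potential1 h (t, x) = (\<Sum>k. ennreal (r (k + 2)) * (ennreal (sq x) * cavg (r (k + 2)) h (t, x)))"
    unfolding potential1_def by (simp add: ennreal_suminf_cmult[symmetric] mult_ac del: ennreal_suminf_cmult)
  also have "\<dots> \<le> (\<Sum>k. ennreal (r (k + 2)) * (2 * cavg (r (k + 2)) (\<lambda>w. ennreal (sq (snd w)) * h w) (t, x)))"
    by (intro suminf_le allI mult_left_mono weight_cavg r_le_\<rho>) auto
  also have "\<dots> = 2 * potential1 (\<lambda>w. ennreal (sq (snd w)) * h w) (t, x)"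
    unfolding potential1_def by (simp add: ennreal_suminf_cmult[symmetric] mult_ac del: ennreal_suminf_cmult)
  finally show ?thesis .
qed

lemma weight_potential2:
  assumes [measurable]: "h \<in> borel_measurable borel"
  shows "ennreal (sq x) * potential2 h (t, x) \<le> 2 * potential2 (\<lambda>w. ennreal (sq (snd w)) * h w) (t, x)"
proof -
  have "ennreal (sq x) * potential2 h (t, x) = (\<Sum>k. ennreal ((r (Suc k))\<^sup>2) * (ennreal (sq x) * cavg (r (Suc k)) h (t, x)))"
    unfolding potential2_def by (simp add: ennreal_suminf_cmult[symmetric] mult_ac del: ennreal_suminf_cmult)
  also have "\<dots> \<le> (\<Sum>k. ennreal ((r (Suc k))\<^sup>2) * (2 * cavg (r (Suc k)) (\<lambda>w. ennreal (sq (snd w)) * h w) (t, x)))"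
    by (intro suminf_le allI mult_left_mono weight_cavg r_le_\<rho>) auto
  also have "\<dots> = 2 * potential2 (\<lambda>w. ennreal (sq (snd w)) * h w) (t, x)"
    unfolding potential2_def by (simp add: ennreal_suminf_cmult[symmetric] mult_ac del: ennreal_suminf_cmult)
  finally show ?thesis .
qed

lemma weight_savg:
  assumes "r0 \<le> \<rho>" and [measurable]: "h \<in> borel_measurable borel"
  shows "ennreal (sq x) * savg r0 h x \<le> 2 * savg r0 (\<lambda>y. ennreal (sq y) * h y) x"
proof -
  have "ennreal (sq x) * savg r0 h x = (\<integral>\<^sup>+y. ennreal (sq x) * (kball r0 x y * h y) \<partial>lborel)"
    unfolding savg_def by (rule nn_integral_cmult[symmetric]) measurable
  also have "\<dots> \<le> (\<integral>\<^sup>+y. 2 * (kball r0 x y * (ennreal (sq y) * h y)) \<partial>lborel)"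
  proof (intro nn_integral_mono)
    fix y
    show "ennreal (sq x) * (kball r0 x y * h y) \<le> 2 * (kball r0 x y * (ennreal (sq y) * h y))"
    proof (cases "y \<in> ball x r0")
      case True
      then have "norm (x - y) \<le> \<rho>" using assms(1) by (simp add: dist_norm)
      then have "ennreal (sq x) \<le> ennreal (2 * sq y)" by (intro ennreal_leI sq_ratio)
      also have "\<dots> = 2 * ennreal (sq y)" using sq_nonneg by (simp add: ennreal_mult)
      finally have "ennreal (sq x) * (kball r0 x y * h y) \<le> 2 * ennreal (sq y) * (kball r0 x y * h y)"
        by (rule mult_right_mono) simp
      then show ?thesis by (simp add: mult_ac)
    qed (simp add: kball_def)
  qed
  also have "\<dots> = 2 * savg r0 (\<lambda>y. ennreal (sq y) * h y) x"
    unfolding savg_def by (rule nn_integral_cmult) measurable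
  finally show ?thesis .
qed

lemma weight_trace_potential:
  assumes [measurable]: "h \<in> borel_measurable borel"
  shows "ennreal (sq x) * trace_potential \<tau> h (t, x) \<le> 2 * trace_potential \<tau> (\<lambda>y. ennreal (sq y) * h y) (t, x)"
proof -
  have "ennreal (sq x) * trace_potential \<tau> h (t, x) = (\<Sum>k. indicator (slab \<tau> (k + 2)) t * (ennreal (sq x) * savg (r (k + 2)) h x))"
    unfolding trace_potential_def by (simp add: ennreal_suminf_cmult[symmetric] mult_ac del: ennreal_suminf_cmult)
  also have "\<dots> \<le> (\<Sum>k. indicator (slab \<tau> (k + 2)) t * (2 * savg (r (k + 2)) (\<lambda>y. ennreal (sq y) * h y) x))"
    by (intro suminf_le allI mult_left_mono weight_savg r_le_\<rho>) auto
  also have "\<dots> = 2 * trace_potential \<tau> (\<lambda>y. ennreal (sq y) * h y) (t, x)"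
    unfolding trace_potential_def by (simp add: ennreal_suminf_cmult[symmetric] mult_ac del: ennreal_suminf_cmult)
  finally show ?thesis .
qed

definition drift_integral :: "real \<Rightarrow> ennreal" where
  "drift_integral t0 = (\<integral>\<^sup>+z. indicator {t0..T} (fst z) * ennreal ((gg (fst z) (snd z))\<^sup>2 * (V (fst z) (snd z))\<^sup>2 * \<zeta> (snd z)) \<partial>lborel)"
definition gradient_integral :: "real \<Rightarrow> ennreal" where
  "gradient_integral t0 = (\<integral>\<^sup>+z. indicator {t0..T} (fst z) * ennreal ((P (fst z) (snd z))\<^sup>2 * \<zeta> (snd z)) \<partial>lborel)"
definition mass_integral :: "real \<Rightarrow> ennreal" where
  "mass_integral t0 = (\<integral>\<^sup>+z. indicator {t0..T} (fst z) * ennreal ((V (fst z) (snd z))\<^sup>2 * \<zeta> (snd z)) \<partial>lborel)"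
definition final_integral :: ennreal where "final_integral = (\<integral>\<^sup>+x. ennreal ((V T x)\<^sup>2 * \<zeta> x) \<partial>lborel)"

definition C_trace :: real where "C_trace = 48 * C_rep\<^sup>2 * M.C_schur"

lemma C_rep_pos: "C_rep > 0" unfolding C_rep_def using C_time_pos C_space_pos bump_const_pos[where 'd = 'd] by (intro add_pos_pos) auto

lemma C_schur_ge:
  "4 * dconst TYPE(real^'d) * M.cB \<le> M.C_schur" "M.cB * M.cB \<le> M.C_schur"
  "(1 + M.cA) * (1 + vol TYPE(real^'d)) * M.cB \<le> M.C_schur"
  "2 * vol TYPE(real^'d) * (1 + 2 * vol TYPE(real^'d)) * 16 \<le> M.C_schur" "0 < M.C_schur"
proof -
  have p: "0 < 4 * dconst TYPE(real^'d) * M.cB" "0 < M.cB * M.cB" "0 < (1 + M.cA) * (1 + vol TYPE(real^'d)) * M.cB"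
    "0 \<le> 2 * vol TYPE(real^'d) * (1 + 2 * vol TYPE(real^'d)) * 16"
    using dconst_pos[where 'a = "real^'d"] M.cB_pos M.cA_pos by (auto intro!: mult_pos_pos mult_nonneg_nonneg add_pos_nonneg)
  then show "4 * dconst TYPE(real^'d) * M.cB \<le> M.C_schur" "M.cB * M.cB \<le> M.C_schur"
    "(1 + M.cA) * (1 + vol TYPE(real^'d)) * M.cB \<le> M.C_schur"
    "2 * vol TYPE(real^'d) * (1 + 2 * vol TYPE(real^'d)) * 16 \<le> M.C_schur" "0 < M.C_schur"
    unfolding M.C_schur_def by linarith+
qed

lemma AE_fst_neq: "AE z in (lborel :: (real \<times> (real ^ 'd)) measure). fst z \<noteq> T"
proof -
  have "emeasure (lborel \<Otimes>\<^sub>M lborel) ({T} \<times> (UNIV :: (real ^ 'd) set)) = emeasure lborel {T} * emeasure lborel (UNIV :: (real ^ 'd) set)"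
    by (rule lborel.emeasure_pair_measure_Times) auto
  then have "emeasure lborel ({T} \<times> (UNIV :: (real ^ 'd) set)) = 0" by (simp add: lborel_prod)
  moreover have "{T} \<times> (UNIV :: (real ^ 'd) set) \<in> sets lborel" by (simp add: borel_closed closed_Times)
  ultimately show ?thesis by (intro AE_I[where N = "{T} \<times> UNIV"]) auto
qed

text \<open>The weight \<open>\<zeta>\<close> is split into two square roots, one for each factor \<open>V\<close>, and moved inside the potentials of the
  representation. Then each of the four terms is estimated by its weighted bound. The factor \<open>\<theta>\<^sup>2\<close> comes from
  \<open>g = \<theta> * g1\<close>; the sources \<open>P + g V\<close> and \<open>g P\<close> return the gradient and the drift integral, the second
  through \<open>g P \<le> g1 P\<close>, where \<open>\<theta> \<le> 1\<close> is used.\<close>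

lemma trace_estimate:
  assumes t0: "0 \<le> t0"
  shows "drift_integral t0 \<le> ennreal (C_trace * \<theta>\<^sup>2) * (gradient_integral t0 + drift_integral t0 + final_integral + ennreal (1 / \<rho>\<^sup>2) * mass_integral t0)"
proof -
  note fst_snd_meas[measurable]
  define q1 where "q1 w = ennreal (sq (snd w)) * h1 t0 w" for w
  define q2 where "q2 w = ennreal (sq (snd w)) * h2 t0 w" for w
  define qV where "qV w = ennreal (sq (snd w)) * hV t0 w" for w
  define qT where "qT y = ennreal (sq y) * ennreal (V T y)" for y
  define hP where "hP w = ennreal (sq (snd w)) * (indicator {t0..T} (fst w) * ennreal (P (fst w) (snd w)))" for w
  have [measurable]: "V T \<in> borel_measurable borel" by measurable
  have [measurable]: "(\<lambda>z. P (fst z) (snd z)) \<in> borel_measurable borel" "(\<lambda>z. V (fst z) (snd z)) \<in> borel_measurable borel" "(\<lambda>z. gg (fst z) (snd z)) \<in> borel_measurable borel"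
    by measurable
  have [measurable]: "q1 \<in> borel_measurable borel" "q2 \<in> borel_measurable borel" "qV \<in> borel_measurable borel" "qT \<in> borel_measurable borel" "hP \<in> borel_measurable borel"
    unfolding q1_def q2_def qV_def qT_def hP_def by measurable
  define X1 where "X1 z = potential1 q1 z" for z
  define X2 where "X2 z = potential2 q2 z" for z
  define X3 where "X3 z = trace_potential T qT z" for z
  define X4 where "X4 z = cavg (r 2) qV z" for z
  have [measurable]: "X1 \<in> borel_measurable borel" "X2 \<in> borel_measurable borel" "X4 \<in> borel_measurable borel"
    unfolding X1_def X2_def X4_def potential1_def potential2_def by measurable
  have [measurable]: "X3 \<in> borel_measurable borel"
  proof -
    note M.KTr_meas[measurable]
    have "X3 = (\<lambda>z. \<integral>\<^sup>+y. M.KTr T z y * qT y \<partial>lborel)" unfolding X3_def by (intro ext M.trace_potential_eq) measurable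
    then show ?thesis by (simp only:) measurable
  qed
  let ?G = "\<lambda>z. ennreal ((g1 z)\<^sup>2)"
  have pt: "indicator {t0..T} (fst z) * ennreal ((gg (fst z) (snd z))\<^sup>2 * (V (fst z) (snd z))\<^sup>2 * \<zeta> (snd z))
    \<le> ennreal (16 * C_rep\<^sup>2 * \<theta>\<^sup>2) * (?G z * (X1 z)\<^sup>2 + ?G z * (X2 z)\<^sup>2 + ?G z * (X3 z)\<^sup>2 + ?G z * (X4 z)\<^sup>2)" if "fst z \<noteq> T" for z
  proof (cases "fst z \<in> {t0..T}")
    case True
    obtain t x where z: "z = (t, x)" by (cases z)
    have t: "t0 \<le> t" "t < T" using True that z by auto
    have gz: "gg t x = \<theta> * g1 z" using t t0 \<theta> by (simp add: gg_def g1_def z c_id)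
    have "ennreal (V t x * sq x) = ennreal (sq x) * ennreal (V t x)" using V_nonneg sq_nonneg by (simp add: ennreal_mult mult.commute)
    also have "\<dots> \<le> ennreal (sq x) * (ennreal C_rep * (potential1 (h1 t0) (t, x) + potential2 (h2 t0) (t, x)
        + trace_potential T (\<lambda>y. ennreal (V T y)) (t, x) + cavg (r 2) (hV t0) (t, x)))"
      by (intro mult_left_mono representation t0 t) auto
    also have "\<dots> = ennreal C_rep * (ennreal (sq x) * potential1 (h1 t0) (t, x) + ennreal (sq x) * potential2 (h2 t0) (t, x)
        + ennreal (sq x) * trace_potential T (\<lambda>y. ennreal (V T y)) (t, x) + ennreal (sq x) * cavg (r 2) (hV t0) (t, x))"
      by (simp add: distrib_left mult.left_commute)
    also have "\<dots> \<le> ennreal C_rep * (2 * X1 z + 2 * X2 z + 2 * X3 z + 2 * X4 z)"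
      unfolding X1_def X2_def X3_def X4_def z q1_def[abs_def] q2_def[abs_def] qT_def[abs_def] qV_def[abs_def]
      by (intro mult_left_mono add_mono weight_potential1 weight_potential2 weight_trace_potential weight_cavg r_le_\<rho>) auto
    also have "\<dots> = ennreal (2 * C_rep) * (X1 z + X2 z + X3 z + X4 z)"
      using C_rep_pos by (simp add: ennreal_mult distrib_left mult_ac)
    finally have "(ennreal (V t x * sq x))\<^sup>2 \<le> (ennreal (2 * C_rep) * (X1 z + X2 z + X3 z + X4 z))\<^sup>2" by (intro power_mono) auto
    also have "\<dots> = ennreal (4 * C_rep\<^sup>2) * (X1 z + X2 z + X3 z + X4 z)\<^sup>2"
      using C_rep_pos by (simp add: power_mult_distrib ennreal_power)
    also have "\<dots> \<le> ennreal (4 * C_rep\<^sup>2) * (4 * ((X1 z)\<^sup>2 + (X2 z)\<^sup>2 + (X3 z)\<^sup>2 + (X4 z)\<^sup>2))"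
      by (intro mult_left_mono ennreal_add4_sq_le) auto
    also have "\<dots> = ennreal (16 * C_rep\<^sup>2) * ((X1 z)\<^sup>2 + (X2 z)\<^sup>2 + (X3 z)\<^sup>2 + (X4 z)\<^sup>2)"
    proof -
      have "ennreal (16 * C_rep\<^sup>2) = ennreal (4 * C_rep\<^sup>2) * 4" using ennreal_mult[of "4 * C_rep\<^sup>2" 4] by simp
      then show ?thesis by (simp only: mult.assoc)
    qed
    finally have sqle: "(ennreal (V t x * sq x))\<^sup>2 \<le> ennreal (16 * C_rep\<^sup>2) * ((X1 z)\<^sup>2 + (X2 z)\<^sup>2 + (X3 z)\<^sup>2 + (X4 z)\<^sup>2)" .
    have "ennreal ((gg t x)\<^sup>2 * (V t x)\<^sup>2 * \<zeta> x) = ennreal (\<theta>\<^sup>2) * ?G z * (ennreal (V t x * sq x))\<^sup>2"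
    proof -
      have "(gg t x)\<^sup>2 * (V t x)\<^sup>2 * \<zeta> x = \<theta>\<^sup>2 * (g1 z)\<^sup>2 * (V t x * sq x)\<^sup>2"
        by (simp add: gz power_mult_distrib sq_sq)
      moreover have "V t x * sq x \<ge> 0" using V_nonneg sq_nonneg by simp
      ultimately show ?thesis by (simp only: ennreal_mult zero_le_power2 mult_nonneg_nonneg ennreal_power)
    qed
    also have "\<dots> \<le> ennreal (\<theta>\<^sup>2) * ?G z * (ennreal (16 * C_rep\<^sup>2) * ((X1 z)\<^sup>2 + (X2 z)\<^sup>2 + (X3 z)\<^sup>2 + (X4 z)\<^sup>2))"
      by (intro mult_left_mono sqle) auto
    also have "\<dots> = ennreal (16 * C_rep\<^sup>2 * \<theta>\<^sup>2) * (?G z * (X1 z)\<^sup>2 + ?G z * (X2 z)\<^sup>2 + ?G z * (X3 z)\<^sup>2 + ?G z * (X4 z)\<^sup>2)"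
    proof -
      have "ennreal (16 * C_rep\<^sup>2 * \<theta>\<^sup>2) = ennreal (16 * C_rep\<^sup>2) * ennreal (\<theta>\<^sup>2)" by (intro ennreal_mult) auto
      then show ?thesis by (simp only: distrib_left distrib_right mult_ac)
    qed
    finally show ?thesis using True z by simp
  qed simp
  have B1: "(\<integral>\<^sup>+z. ?G z * (X1 z)\<^sup>2 \<partial>lborel) \<le> ennreal M.C_schur * (2 * (gradient_integral t0 + drift_integral t0))"
  proof -
    have "(\<integral>\<^sup>+z. ?G z * (X1 z)\<^sup>2 \<partial>lborel) \<le> ennreal (4 * dconst TYPE(real^'d) * M.cB) * (\<integral>\<^sup>+z. (q1 z)\<^sup>2 \<partial>lborel)"
      unfolding X1_def by (rule M.potential1_L2) measurable
    also have "\<dots> \<le> ennreal M.C_schur * (\<integral>\<^sup>+z. 2 * (indicator {t0..T} (fst z) * ennreal ((P (fst z) (snd z))\<^sup>2 * \<zeta> (snd z))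
         + indicator {t0..T} (fst z) * ennreal ((gg (fst z) (snd z))\<^sup>2 * (V (fst z) (snd z))\<^sup>2 * \<zeta> (snd z))) \<partial>lborel)"
    proof (intro mult_mono ennreal_leI C_schur_ge nn_integral_mono)
      fix z
      show "(q1 z)\<^sup>2 \<le> 2 * (indicator {t0..T} (fst z) * ennreal ((P (fst z) (snd z))\<^sup>2 * \<zeta> (snd z))
         + indicator {t0..T} (fst z) * ennreal ((gg (fst z) (snd z))\<^sup>2 * (V (fst z) (snd z))\<^sup>2 * \<zeta> (snd z)))"
      proof (cases "fst z \<in> {t0..T}")
        case True
        define A B where "A = P (fst z) (snd z)" and "B = gg (fst z) (snd z) * V (fst z) (snd z)"
        have AB: "A \<ge> 0" "B \<ge> 0" using P_nonneg gg_nonneg V_nonneg by (auto simp: A_def B_def)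
        have "(q1 z)\<^sup>2 = (ennreal (sq (snd z) * (A + B)))\<^sup>2"
          using True AB sq_nonneg by (simp add: q1_def h1_def A_def B_def ennreal_mult)
        also have "\<dots> = ennreal (\<zeta> (snd z) * (A + B)\<^sup>2)"
          using AB sq_nonneg by (simp add: ennreal_power power_mult_distrib sq_sq)
        also have "\<dots> \<le> ennreal (2 * (A\<^sup>2 * \<zeta> (snd z) + B\<^sup>2 * \<zeta> (snd z)))"
        proof (rule ennreal_leI)
          have "(A + B)\<^sup>2 \<le> 2 * (A\<^sup>2 + B\<^sup>2)" using zero_le_power2[of "A - B"] by (simp add: power2_eq_square algebra_simps)
          then have "\<zeta> (snd z) * (A + B)\<^sup>2 \<le> \<zeta> (snd z) * (2 * (A\<^sup>2 + B\<^sup>2))" using \<zeta>_pos by (intro mult_left_mono) (auto simp: less_imp_le)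
          then show "\<zeta> (snd z) * (A + B)\<^sup>2 \<le> 2 * (A\<^sup>2 * \<zeta> (snd z) + B\<^sup>2 * \<zeta> (snd z))" by (simp add: algebra_simps)
        qed
        also have "\<dots> = 2 * (ennreal (A\<^sup>2 * \<zeta> (snd z)) + ennreal (B\<^sup>2 * \<zeta> (snd z)))"
          using \<zeta>_pos[of "snd z"] by (simp add: ennreal_mult ennreal_plus less_imp_le)
        finally show ?thesis using True by (simp add: A_def B_def power_mult_distrib)
      qed (simp add: q1_def h1_def)
    qed (use C_schur_ge(5) in auto)
    also have "(\<integral>\<^sup>+z. 2 * (indicator {t0..T} (fst z) * ennreal ((P (fst z) (snd z))\<^sup>2 * \<zeta> (snd z))
         + indicator {t0..T} (fst z) * ennreal ((gg (fst z) (snd z))\<^sup>2 * (V (fst z) (snd z))\<^sup>2 * \<zeta> (snd z))) \<partial>lborel) = 2 * (gradient_integral t0 + drift_integral t0)"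
      unfolding gradient_integral_def drift_integral_def by (simp add: nn_integral_cmult nn_integral_add)
    finally show ?thesis .
  qed
  have B2: "(\<integral>\<^sup>+z. ?G z * (X2 z)\<^sup>2 \<partial>lborel) \<le> ennreal M.C_schur * gradient_integral t0"
  proof -
    have "q2 w = ennreal (g1 w) * (ennreal \<theta> * hP w)" for w
    proof (cases "fst w \<in> {t0..T}")
      case True
      have "gg (fst w) (snd w) = \<theta> * g1 w" using True t0 \<theta> by (simp add: gg_def g1_def c_id)
      moreover have "g1 w \<ge> 0" using g_nonneg[of w] \<theta> by (simp add: g1_def)
      ultimately show ?thesis using True \<theta> P_nonneg sq_nonneg by (simp add: q2_def h2_def hP_def ennreal_mult mult_ac)
    qed (simp add: q2_def h2_def hP_def)
    then have "q2 = (\<lambda>w. ennreal (g1 w) * (ennreal \<theta> * hP w))" by auto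
    then have "(\<integral>\<^sup>+z. ?G z * (X2 z)\<^sup>2 \<partial>lborel) \<le> ennreal (M.cB * M.cB) * (\<integral>\<^sup>+z. (ennreal \<theta> * hP z)\<^sup>2 \<partial>lborel)"
      unfolding X2_def by (simp only:) (rule M.potential2_L2, measurable)
    also have "\<dots> \<le> ennreal M.C_schur * gradient_integral t0"
      unfolding gradient_integral_def
    proof (intro mult_mono ennreal_leI C_schur_ge nn_integral_mono)
      fix z
      show "(ennreal \<theta> * hP z)\<^sup>2 \<le> indicator {t0..T} (fst z) * ennreal ((P (fst z) (snd z))\<^sup>2 * \<zeta> (snd z))"
      proof (cases "fst z \<in> {t0..T}")
        case True
        have "ennreal \<theta> * hP z = ennreal (\<theta> * (sq (snd z) * P (fst z) (snd z)))"
          using True \<theta> sq_nonneg P_nonneg by (simp add: hP_def ennreal_mult)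
        then have "(ennreal \<theta> * hP z)\<^sup>2 = ennreal ((\<theta> * (sq (snd z) * P (fst z) (snd z)))\<^sup>2)"
          using \<theta> sq_nonneg P_nonneg by (simp add: ennreal_power)
        also have "(\<theta> * (sq (snd z) * P (fst z) (snd z)))\<^sup>2 = \<theta>\<^sup>2 * ((P (fst z) (snd z))\<^sup>2 * \<zeta> (snd z))"
          by (simp add: power_mult_distrib sq_sq)
        also have "ennreal \<dots> \<le> ennreal (1 * ((P (fst z) (snd z))\<^sup>2 * \<zeta> (snd z)))"
          using \<theta> \<zeta>_pos[of "snd z"] by (intro ennreal_leI mult_right_mono) (auto simp: power_le_one)
        finally show ?thesis using True by simp
      qed (simp add: hP_def)
    qed (use C_schur_ge(5) in auto)
    finally show ?thesis .
  qed
  have B3: "(\<integral>\<^sup>+z. ?G z * (X3 z)\<^sup>2 \<partial>lborel) \<le> ennreal M.C_schur * final_integral"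
  proof -
    have "(\<integral>\<^sup>+z. ?G z * (X3 z)\<^sup>2 \<partial>lborel) \<le> ennreal ((1 + M.cA) * (1 + vol TYPE(real^'d)) * M.cB) * (\<integral>\<^sup>+y. (qT y)\<^sup>2 \<partial>lborel)"
      unfolding X3_def by (rule M.trace_potential_L2) measurable
    also have "(\<integral>\<^sup>+y. (qT y)\<^sup>2 \<partial>lborel) = final_integral"
      unfolding final_integral_def
    proof (intro nn_integral_cong)
      fix y
      have "qT y = ennreal (sq y * V T y)" using sq_nonneg V_nonneg by (simp add: qT_def ennreal_mult)
      then show "(qT y)\<^sup>2 = ennreal ((V T y)\<^sup>2 * \<zeta> y)"
        using sq_nonneg[of y] V_nonneg[of T y] by (simp add: ennreal_power power_mult_distrib sq_sq mult.commute)
    qed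
    also have "ennreal ((1 + M.cA) * (1 + vol TYPE(real^'d)) * M.cB) * final_integral \<le> ennreal M.C_schur * final_integral"
      by (intro mult_right_mono ennreal_leI C_schur_ge) auto
    finally show ?thesis .
  qed
  have B4: "(\<integral>\<^sup>+z. ?G z * (X4 z)\<^sup>2 \<partial>lborel) \<le> ennreal M.C_schur * (ennreal (1 / \<rho>\<^sup>2) * mass_integral t0)"
  proof -
    have "(\<integral>\<^sup>+z. ?G z * (X4 z)\<^sup>2 \<partial>lborel) \<le> ennreal (2 * vol TYPE(real^'d) * ((1 + 2 * vol TYPE(real^'d)) / (r 2)\<^sup>2)) * (\<integral>\<^sup>+z. (qV z)\<^sup>2 \<partial>lborel)"
      unfolding X4_def by (rule M.cavg_L2) measurable
    also have "(\<integral>\<^sup>+z. (qV z)\<^sup>2 \<partial>lborel) = mass_integral t0"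
      unfolding mass_integral_def
    proof (intro nn_integral_cong)
      fix z
      have "qV z = indicator {t0..T} (fst z) * ennreal (sq (snd z) * V (fst z) (snd z))"
        using sq_nonneg V_nonneg by (simp add: qV_def hV_def ennreal_mult mult_ac)
      then show "(qV z)\<^sup>2 = indicator {t0..T} (fst z) * ennreal ((V (fst z) (snd z))\<^sup>2 * \<zeta> (snd z))"
        using sq_nonneg[of "snd z"] V_nonneg[of "fst z" "snd z"]
        by (simp add: ennreal_power power_mult_distrib sq_sq mult.commute indicator_def)
    qed
    also have "2 * vol TYPE(real^'d) * ((1 + 2 * vol TYPE(real^'d)) / (r 2)\<^sup>2) = (2 * vol TYPE(real^'d) * (1 + 2 * vol TYPE(real^'d)) * 16) * (1 / \<rho>\<^sup>2)"
      by (simp add: r_def power_divide)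
    also have "ennreal \<dots> * mass_integral t0 \<le> ennreal (M.C_schur * (1 / \<rho>\<^sup>2)) * mass_integral t0"
      by (intro mult_right_mono ennreal_leI C_schur_ge) auto
    also have "\<dots> = ennreal M.C_schur * (ennreal (1 / \<rho>\<^sup>2) * mass_integral t0)"
    proof -
      have "ennreal (M.C_schur * (1 / \<rho>\<^sup>2)) = ennreal M.C_schur * ennreal (1 / \<rho>\<^sup>2)" using C_schur_ge(5) by (intro ennreal_mult) auto
      then show ?thesis by (simp only: mult.assoc)
    qed
    finally show ?thesis .
  qed
  have "drift_integral t0 \<le> (\<integral>\<^sup>+z. ennreal (16 * C_rep\<^sup>2 * \<theta>\<^sup>2) * (?G z * (X1 z)\<^sup>2 + ?G z * (X2 z)\<^sup>2 + ?G z * (X3 z)\<^sup>2 + ?G z * (X4 z)\<^sup>2) \<partial>lborel)"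
    unfolding drift_integral_def using AE_fst_neq by (intro nn_integral_mono_AE) (auto elim!: eventually_mono intro: pt)
  also have "\<dots> = ennreal (16 * C_rep\<^sup>2 * \<theta>\<^sup>2) * ((\<integral>\<^sup>+z. ?G z * (X1 z)\<^sup>2 \<partial>lborel) + (\<integral>\<^sup>+z. ?G z * (X2 z)\<^sup>2 \<partial>lborel) + (\<integral>\<^sup>+z. ?G z * (X3 z)\<^sup>2 \<partial>lborel) + (\<integral>\<^sup>+z. ?G z * (X4 z)\<^sup>2 \<partial>lborel))"
  proof -
    have [measurable]: "g1 \<in> borel_measurable borel" by (rule M.g_meas)
    show ?thesis by (simp add: nn_integral_cmult nn_integral_add)
  qed
  also have "\<dots> \<le> ennreal (16 * C_rep\<^sup>2 * \<theta>\<^sup>2) * (ennreal M.C_schur * (2 * (gradient_integral t0 + drift_integral t0)) + ennreal M.C_schur * gradient_integral t0 + ennreal M.C_schur * final_integral + ennreal M.C_schur * (ennreal (1 / \<rho>\<^sup>2) * mass_integral t0))"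
    by (intro mult_left_mono add_mono B1 B2 B3 B4) auto
  also have "\<dots> = (ennreal (16 * C_rep\<^sup>2 * \<theta>\<^sup>2) * ennreal M.C_schur) * (2 * (gradient_integral t0 + drift_integral t0) + gradient_integral t0 + final_integral + ennreal (1 / \<rho>\<^sup>2) * mass_integral t0)"
    by (simp only: distrib_left mult.assoc)
  also have "\<dots> \<le> (ennreal (16 * C_rep\<^sup>2 * \<theta>\<^sup>2) * ennreal M.C_schur) * (3 * (gradient_integral t0 + drift_integral t0 + final_integral + ennreal (1 / \<rho>\<^sup>2) * mass_integral t0))"
  proof (intro mult_left_mono)
    have 3: "3 * y = 2 * y + y" for y :: ennreal
      using distrib_right[of 2 1 y] by simp
    have "2 * (gradient_integral t0 + drift_integral t0) + gradient_integral t0 + final_integral + ennreal (1 / \<rho>\<^sup>2) * mass_integral t0 = 2 * (gradient_integral t0 + drift_integral t0) + (gradient_integral t0 + (final_integral + ennreal (1 / \<rho>\<^sup>2) * mass_integral t0))"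
      by (simp only: add.assoc)
    also have "\<dots> \<le> 2 * (gradient_integral t0 + drift_integral t0 + final_integral + ennreal (1 / \<rho>\<^sup>2) * mass_integral t0) + (gradient_integral t0 + drift_integral t0 + final_integral + ennreal (1 / \<rho>\<^sup>2) * mass_integral t0)"
    proof (rule add_mono, rule mult_left_mono)
      let ?X = "ennreal (1 / \<rho>\<^sup>2) * mass_integral t0"
      have "gradient_integral t0 + drift_integral t0 + final_integral + ?X = (gradient_integral t0 + drift_integral t0) + (final_integral + ?X)" by (simp only: add.assoc)
      then show "gradient_integral t0 + drift_integral t0 \<le> gradient_integral t0 + drift_integral t0 + final_integral + ?X" by (metis le_iff_add)
      have "gradient_integral t0 + drift_integral t0 + final_integral + ?X = (gradient_integral t0 + (final_integral + ?X)) + drift_integral t0" by (simp only: ac_simps)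
      then show "gradient_integral t0 + (final_integral + ?X) \<le> gradient_integral t0 + drift_integral t0 + final_integral + ?X" by (metis le_iff_add)
    qed simp
    finally show "2 * (gradient_integral t0 + drift_integral t0) + gradient_integral t0 + final_integral + ennreal (1 / \<rho>\<^sup>2) * mass_integral t0 \<le> 3 * (gradient_integral t0 + drift_integral t0 + final_integral + ennreal (1 / \<rho>\<^sup>2) * mass_integral t0)"
      unfolding 3 .
  qed auto
  also have "\<dots> = ennreal (C_trace * \<theta>\<^sup>2) * (gradient_integral t0 + drift_integral t0 + final_integral + ennreal (1 / \<rho>\<^sup>2) * mass_integral t0)"
  proof -
    have c: "C_trace * \<theta>\<^sup>2 = (16 * C_rep\<^sup>2 * \<theta>\<^sup>2 * M.C_schur) * 3" by (simp add: C_trace_def mult_ac)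
    have "ennreal ((16 * C_rep\<^sup>2 * \<theta>\<^sup>2 * M.C_schur) * 3) = ennreal (16 * C_rep\<^sup>2 * \<theta>\<^sup>2 * M.C_schur) * ennreal 3"
      using C_schur_ge(5) by (intro ennreal_mult) auto
    moreover have "ennreal (16 * C_rep\<^sup>2 * \<theta>\<^sup>2 * M.C_schur) = ennreal (16 * C_rep\<^sup>2 * \<theta>\<^sup>2) * ennreal M.C_schur"
      using C_schur_ge(5) by (intro ennreal_mult) auto
    ultimately have "ennreal (C_trace * \<theta>\<^sup>2) = ennreal (16 * C_rep\<^sup>2 * \<theta>\<^sup>2) * ennreal M.C_schur * 3"
      unfolding c by simp
    then show ?thesis by (simp only: mult.assoc)
  qed
  finally show ?thesis .
qed

end

context energy begin

lemma \<zeta>_integrable: "integrable lborel \<zeta>"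
  using exp_decay_integrable(1)[OF \<zeta>_exp_decay bdd_diff_const[of 1]] by simp

text \<open>Translates between space-time integrals in the extended reals, in which the trace inequality is proved, and iterated
  real integrals, in which terms can be subtracted and absorbed.\<close>

lemma weighted_slice:
  fixes W :: "real \<Rightarrow> real ^ 'd \<Rightarrow> real"
  assumes W[measurable]: "case_prod W \<in> borel_measurable (borel \<Otimes>\<^sub>M borel)"
    and W0: "\<And>t x. 0 \<le> W t x" and WB: "\<And>t x. W t x \<le> B"
  shows "integrable lborel (\<lambda>x. W t x * \<zeta> x)"
    and "0 \<le> (\<integral>x. W t x * \<zeta> x \<partial>lborel)" and "(\<integral>x. W t x * \<zeta> x \<partial>lborel) \<le> B * (\<integral>x. \<zeta> x \<partial>lborel)"
    and "set_integrable lborel {t0..T} (\<lambda>t. \<integral>x. W t x * \<zeta> x \<partial>lborel)"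
    and "(\<integral>\<^sup>+z. indicator {t0..T} (fst z) * ennreal (W (fst z) (snd z) * \<zeta> (snd z)) \<partial>lborel)
      = ennreal (LINT t:{t0..T}|lborel. \<integral>x. W t x * \<zeta> x \<partial>lborel)"
proof -
  define w where "w t = (\<integral>x. W t x * \<zeta> x \<partial>lborel)" for t
  have [measurable]: "W t \<in> borel_measurable borel" for t by measurable
  show I: "integrable lborel (\<lambda>x. W t x * \<zeta> x)" for t
    by (rule exp_decay_integrable_mult(1)[OF \<zeta>_exp_decay, of _ B]) (use W0 WB in \<open>auto simp: abs_of_nonneg\<close>)
  have W\<zeta>: "0 \<le> W t x * \<zeta> x" for t x using W0 \<zeta>_pos[of x] by (simp add: less_imp_le)
  show w0: "0 \<le> (\<integral>x. W t x * \<zeta> x \<partial>lborel)" for t by (intro integral_nonneg_AE AE_I2 W\<zeta>)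
  show wB: "(\<integral>x. W t x * \<zeta> x \<partial>lborel) \<le> B * (\<integral>x. \<zeta> x \<partial>lborel)" for t
  proof -
    have "(\<integral>x. W t x * \<zeta> x \<partial>lborel) \<le> (\<integral>x. B * \<zeta> x \<partial>lborel)"
      using \<zeta>_pos WB by (intro integral_mono I integrable_mult_right \<zeta>_integrable mult_right_mono) (auto simp: less_imp_le)
    then show ?thesis by simp
  qed
  have [measurable]: "w \<in> borel_measurable borel" unfolding w_def by measurable
  have S: "set_integrable lborel {t0..T} w" unfolding set_integrable_def
  proof (rule Bochner_Integration.integrable_bound)
    show "integrable lborel (\<lambda>t. (B * (\<integral>x. \<zeta> x \<partial>lborel)) * indicator {t0..T} t :: real)"
      by (intro integrable_mult_right integrable_real_indicator) (auto simp: emeasure_lborel_Icc_eq)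
    show "AE t in lborel. norm (indicator {t0..T} t *\<^sub>R w t) \<le> norm ((B * (\<integral>x. \<zeta> x \<partial>lborel)) * indicator {t0..T} t :: real)"
    proof (rule AE_I2)
      fix t
      show "norm (indicator {t0..T} t *\<^sub>R w t) \<le> norm ((B * (\<integral>x. \<zeta> x \<partial>lborel)) * indicator {t0..T} t :: real)"
        using w0[of t] wB[of t] by (simp add: w_def indicator_def)
    qed
  qed measurable
  then show "set_integrable lborel {t0..T} (\<lambda>t. \<integral>x. W t x * \<zeta> x \<partial>lborel)" by (simp add: w_def[abs_def])
  note fst_snd_meas[measurable]
  have "(\<integral>\<^sup>+z. indicator {t0..T} (fst z) * ennreal (W (fst z) (snd z) * \<zeta> (snd z)) \<partial>lborel)
     = (\<integral>\<^sup>+t. (\<integral>\<^sup>+x. indicator {t0..T} (fst (t, x)) * ennreal (W (fst (t, x)) (snd (t, x)) * \<zeta> (snd (t, x))) \<partial>lborel) \<partial>lborel)"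
    by (rule nn_integral_pair[symmetric, of "\<lambda>z. indicator {t0..T} (fst z) * ennreal (W (fst z) (snd z) * \<zeta> (snd z))"]) measurable
  also have "\<dots> = (\<integral>\<^sup>+t. ennreal (indicator {t0..T} t *\<^sub>R w t) \<partial>lborel)"
  proof (intro nn_integral_cong)
    fix t
    have "(\<integral>\<^sup>+x. ennreal (W t x * \<zeta> x) \<partial>lborel) = ennreal (w t)" unfolding w_def
      by (rule nn_integral_eq_integral[OF I]) (use W\<zeta> in auto)
    then show "(\<integral>\<^sup>+x. indicator {t0..T} (fst (t, x)) * ennreal (W (fst (t, x)) (snd (t, x)) * \<zeta> (snd (t, x))) \<partial>lborel) = ennreal (indicator {t0..T} t *\<^sub>R w t)"
      by (simp add: nn_integral_cmult indicator_def)
  qed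
  also have "\<dots> = ennreal (LINT t:{t0..T}|lborel. w t)"
    unfolding set_lebesgue_integral_def
    by (rule nn_integral_eq_integral) (use S w0 in \<open>auto simp: set_integrable_def indicator_def w_def\<close>)
  finally show "(\<integral>\<^sup>+z. indicator {t0..T} (fst z) * ennreal (W (fst z) (snd z) * \<zeta> (snd z)) \<partial>lborel)
      = ennreal (LINT t:{t0..T}|lborel. \<integral>x. W t x * \<zeta> x \<partial>lborel)" by (simp add: w_def)
qed

definition wP :: "real \<Rightarrow> real" where "wP t = (\<integral>x. (P t x)\<^sup>2 * \<zeta> x \<partial>lborel)"
definition wK :: "real \<Rightarrow> real" where "wK t = (\<integral>x. ((gg t x)\<^sup>2 * (V t x)\<^sup>2) * \<zeta> x \<partial>lborel)"
definition wV :: "real \<Rightarrow> real" where "wV t = (\<integral>x. (V t x)\<^sup>2 * \<zeta> x \<partial>lborel)"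

lemma wP_window:
  "case_prod (\<lambda>t x. (P t x)\<^sup>2) \<in> borel_measurable (borel \<Otimes>\<^sub>M borel)" "(P t x)\<^sup>2 \<ge> 0" "(P t x)\<^sup>2 \<le> (Mu ^ (n - 1) * Mu)\<^sup>2"
  subgoal by measurable
  subgoal by simp
  subgoal by (intro power_mono P_le P_nonneg)
  done

lemma wV_window:
  "case_prod (\<lambda>t x. (V t x)\<^sup>2) \<in> borel_measurable (borel \<Otimes>\<^sub>M borel)" "(V t x)\<^sup>2 \<ge> 0" "(V t x)\<^sup>2 \<le> (Mu ^ n)\<^sup>2"
  subgoal by measurable
  subgoal by simp
  subgoal by (intro power_mono V_le V_nonneg)
  done

lemma wK_window:
  "case_prod (\<lambda>t x. (gg t x)\<^sup>2 * (V t x)\<^sup>2) \<in> borel_measurable (borel \<Otimes>\<^sub>M borel)" "(gg t x)\<^sup>2 * (V t x)\<^sup>2 \<ge> 0"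
  "(gg t x)\<^sup>2 * (V t x)\<^sup>2 \<le> Mg\<^sup>2 * (Mu ^ n)\<^sup>2"
  subgoal by measurable
  subgoal by simp
  subgoal by (intro mult_mono power_mono V_le V_nonneg gg_le gg_nonneg) auto
  done

lemmas wPw = weighted_slice[of "\<lambda>t x. (P t x)\<^sup>2", OF wP_window, folded wP_def]
lemmas wVw = weighted_slice[of "\<lambda>t x. (V t x)\<^sup>2", OF wV_window, folded wV_def]
lemmas wKw = weighted_slice[of "\<lambda>t x. (gg t x)\<^sup>2 * (V t x)\<^sup>2", OF wK_window, folded wK_def]

lemma wV_eq: "wV t = m (2 * n) \<zeta> t"
proof -
  have "(V t x)\<^sup>2 = U t x ^ (2 * n)" for x
  proof -
    have "(V t x)\<^sup>2 = (\<bar>U t x\<bar>\<^sup>2) ^ n" unfolding V_def by (simp only: power_mult[symmetric] mult.commute)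
    then show ?thesis by (simp add: power_mult)
  qed
  then show ?thesis by (simp add: wV_def m_def)
qed

text \<open>The lower bound of the density for the power \<open>2 n\<close>, integrated in space and then in time.\<close>

lemma energy_inequality:
  assumes t0: "t0 \<in> {0..T}"
  shows "wV t0 + real n * \<delta> / 2 * (LINT t:{t0..T}|lborel. wP t)
    \<le> wV T + C_energy * ((LINT t:{t0..T}|lborel. wK t) + \<mu>0\<^sup>2 * (LINT t:{t0..T}|lborel. wV t))"
proof -
  define Z where "Z t = real n * \<delta> / 2 * wP t - (C_energy * wK t + C_energy * \<mu>0\<^sup>2 * wV t)" for t
  note SI = wPw(4)[of t0] wKw(4)[of t0] wVw(4)[of t0]
  have ZI: "set_integrable lborel {t0..T} Z" unfolding Z_def
    by (intro set_integral_diff(1) set_integral_add(1) set_integrable_mult_right SI)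
  have "(LINT t:{t0..T}|lborel. Z t) \<le> 1 * m (2 * n) \<zeta> T - 1 * m (2 * n) \<zeta> t0"
  proof (rule m_increment_ge[OF \<zeta>_exp_decay _ _ _ ZI])
    show "0 \<le> t0" "t0 \<le> T" "T \<le> T" using t0 by auto
    fix t
    have "Z t = (\<integral>x. (real n * \<delta> / 2) * ((P t x)\<^sup>2 * \<zeta> x) - (C_energy * (((gg t x)\<^sup>2 * (V t x)\<^sup>2) * \<zeta> x) + C_energy * \<mu>0\<^sup>2 * ((V t x)\<^sup>2 * \<zeta> x)) \<partial>lborel)"
      unfolding Z_def wP_def wK_def wV_def
      by (subst Bochner_Integration.integral_diff, intro integrable_mult_right wPw(1), intro Bochner_Integration.integrable_add integrable_mult_right wKw(1) wVw(1),
          subst Bochner_Integration.integral_add, intro integrable_mult_right wKw(1), intro integrable_mult_right wVw(1)) simp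
    also have "\<dots> \<le> (\<integral>x. energy_density (2 * n) \<zeta> t x \<partial>lborel)"
    proof (rule integral_mono)
      show "integrable lborel (\<lambda>x. (real n * \<delta> / 2) * ((P t x)\<^sup>2 * \<zeta> x) - (C_energy * (((gg t x)\<^sup>2 * (V t x)\<^sup>2) * \<zeta> x) + C_energy * \<mu>0\<^sup>2 * ((V t x)\<^sup>2 * \<zeta> x)))"
        by (intro Bochner_Integration.integrable_diff Bochner_Integration.integrable_add integrable_mult_right wPw(1) wKw(1) wVw(1))
      show "integrable lborel (energy_density (2 * n) \<zeta> t)" by (rule energy_density_integrable[OF \<zeta>_exp_decay])
      fix x
      have "(real n * \<delta> / 2 * (P t x)\<^sup>2 - C_energy * ((gg t x)\<^sup>2 + \<mu>0\<^sup>2) * (V t x)\<^sup>2) * \<zeta> x \<le> energy_density (2 * n) \<zeta> t x"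
        using \<zeta>_pos[of x] by (intro energy_density_ge_2n \<zeta>_grad \<mu>0) simp
      then show "(real n * \<delta> / 2) * ((P t x)\<^sup>2 * \<zeta> x) - (C_energy * (((gg t x)\<^sup>2 * (V t x)\<^sup>2) * \<zeta> x) + C_energy * \<mu>0\<^sup>2 * ((V t x)\<^sup>2 * \<zeta> x)) \<le> energy_density (2 * n) \<zeta> t x"
        by (simp add: algebra_simps)
    qed
    finally show "Z t \<le> 1 * (\<integral>x. energy_density (2 * n) \<zeta> t x \<partial>lborel)" by simp
  qed
  moreover have "(LINT t:{t0..T}|lborel. Z t) = real n * \<delta> / 2 * (LINT t:{t0..T}|lborel. wP t) - (C_energy * (LINT t:{t0..T}|lborel. wK t) + C_energy * \<mu>0\<^sup>2 * (LINT t:{t0..T}|lborel. wV t))"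
    unfolding Z_def
    by (subst set_integral_diff(2), intro set_integrable_mult_right SI, intro set_integral_add(1) set_integrable_mult_right SI,
        subst set_integral_add(2), intro set_integrable_mult_right SI, intro set_integrable_mult_right SI) simp
  ultimately show ?thesis unfolding wV_eq[symmetric] by (simp add: algebra_simps)
qed

lemma trace_real:
  assumes t0: "t0 \<in> {0..T}"
  shows "(LINT t:{t0..T}|lborel. wK t) \<le> C_trace * \<theta>\<^sup>2 * ((LINT t:{t0..T}|lborel. wP t) + (LINT t:{t0..T}|lborel. wK t) + wV T + 1 / \<rho>\<^sup>2 * (LINT t:{t0..T}|lborel. wV t))"
proof -
  let ?D = "LINT t:{t0..T}|lborel. wP t" and ?K = "LINT t:{t0..T}|lborel. wK t" and ?M = "LINT t:{t0..T}|lborel. wV t"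
  have nn: "?D \<ge> 0" "?K \<ge> 0" "?M \<ge> 0" "wV T \<ge> 0"
    unfolding set_lebesgue_integral_def
    by (auto intro!: integral_nonneg_AE AE_I2 wPw(2) wKw(2) wVw(2) simp: indicator_def)
  have C_trace: "C_trace \<ge> 0" unfolding C_trace_def using C_schur_ge(5) by simp
  have "drift_integral t0 = ennreal ?K" "gradient_integral t0 = ennreal ?D" "mass_integral t0 = ennreal ?M"
    unfolding drift_integral_def gradient_integral_def mass_integral_def by (rule wKw(5), rule wPw(5), rule wVw(5))
  moreover have "final_integral = ennreal (wV T)" unfolding final_integral_def wV_def
    by (rule nn_integral_eq_integral[OF wVw(1)]) (use \<zeta>_pos in \<open>auto simp: less_imp_le\<close>)
  ultimately have "ennreal ?K \<le> ennreal (C_trace * \<theta>\<^sup>2) * (ennreal ?D + ennreal ?K + ennreal (wV T) + ennreal (1 / \<rho>\<^sup>2) * ennreal ?M)"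
    using trace_estimate[of t0] t0 by simp
  also have "\<dots> = ennreal (C_trace * \<theta>\<^sup>2 * (?D + ?K + wV T + 1 / \<rho>\<^sup>2 * ?M))"
  proof -
    have "ennreal (?D + ?K + wV T + 1 / \<rho>\<^sup>2 * ?M) = ennreal ?D + ennreal ?K + ennreal (wV T) + ennreal (1 / \<rho>\<^sup>2 * ?M)"
      using nn by (simp only: ennreal_plus add_nonneg_nonneg mult_nonneg_nonneg zero_le_divide_1_iff zero_le_power2)
    moreover have "ennreal (1 / \<rho>\<^sup>2 * ?M) = ennreal (1 / \<rho>\<^sup>2) * ennreal ?M" by (intro ennreal_mult nn) simp
    moreover have "ennreal (C_trace * \<theta>\<^sup>2 * (?D + ?K + wV T + 1 / \<rho>\<^sup>2 * ?M)) = ennreal (C_trace * \<theta>\<^sup>2) * ennreal (?D + ?K + wV T + 1 / \<rho>\<^sup>2 * ?M)"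
      using C_trace nn by (intro ennreal_mult mult_nonneg_nonneg add_nonneg_nonneg) auto
    ultimately show ?thesis by (simp only:)
  qed
  finally show ?thesis
    using C_trace nn by (subst (asm) ennreal_le_iff) (auto intro!: mult_nonneg_nonneg add_nonneg_nonneg)
qed

text \<open>The trace inequality is first solved for the drift integral, which occurs on both of its sides, and then inserted into
  the energy inequality, where half of the gradient term absorbs it.\<close>

lemma weighted_bounds:
  assumes small: "C_trace * \<theta>\<^sup>2 \<le> 1 / 2" "2 * C_energy * (C_trace * \<theta>\<^sup>2) \<le> real n * \<delta> / 4"
  defines "\<beta> \<equiv> (real n + C_energy) / \<rho>\<^sup>2"
  shows "wV 0 \<le> 2 * (1 + real n) * exp (2 * \<beta> * T) * wV T"
    and "(LINT t:{0..T}|lborel. wP t) \<le> 8 * (1 + real n) / (real n * \<delta>) * exp (2 * \<beta> * T) * wV T"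
proof -
  let ?D = "\<lambda>t0. LINT t:{t0..T}|lborel. wP t" and ?K = "\<lambda>t0. LINT t:{t0..T}|lborel. wK t" and ?M = "\<lambda>t0. LINT t:{t0..T}|lborel. wV t"
  have nn: "?D t \<ge> 0" "?K t \<ge> 0" "?M t \<ge> 0" "wV t \<ge> 0" for t
    unfolding set_lebesgue_integral_def
    by (auto intro!: integral_nonneg_AE AE_I2 wPw(2) wKw(2) wVw(2) simp: indicator_def)
  have \<beta>: "\<beta> > 0" unfolding \<beta>_def using C_energy_pos n1 \<rho> by (intro divide_pos_pos) auto
  define N where "N = real n"
  have N: "N \<ge> 1" using n1 by (simp add: N_def)
  have main: "wV t0 + N * \<delta> / 4 * ?D t0 \<le> (1 + N) * wV T + \<beta> * ?M t0" if t0: "t0 \<in> {0..T}" for t0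
  proof -
    define e where "e = C_trace * \<theta>\<^sup>2"
    \<comment> \<open>The drift integral occurs on both sides of the trace inequality; it is solved for here.\<close>
    define X where "X = ?D t0 + wV T + 1 / \<rho>\<^sup>2 * ?M t0"
    have X0: "X \<ge> 0" unfolding X_def using nn by (intro add_nonneg_nonneg mult_nonneg_nonneg) auto
    have e: "e \<ge> 0" "e \<le> 1 / 2" "2 * C_energy * e \<le> N * \<delta> / 4"
      using small C_schur_ge(5) by (auto simp: e_def C_trace_def N_def)
    have "?K t0 \<le> e * (X + ?K t0)" using trace_real[OF t0] by (simp add: e_def X_def algebra_simps)
    moreover have "e * ?K t0 \<le> 1 / 2 * ?K t0" by (intro mult_right_mono e nn)
    ultimately have K: "?K t0 \<le> 2 * e * X" by (simp add: distrib_left)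
    have "C_energy * ?K t0 \<le> C_energy * (2 * e * X)" using C_energy_pos K by (intro mult_left_mono) auto
    also have "\<dots> = (2 * C_energy * e) * X" by simp
    also have "\<dots> \<le> N * \<delta> / 4 * X" by (intro mult_right_mono e X0)
    finally have CK: "C_energy * ?K t0 \<le> N * \<delta> / 4 * ?D t0 + N * \<delta> / 4 * wV T + N * \<delta> / 4 * (1 / \<rho>\<^sup>2 * ?M t0)"
      unfolding X_def by (simp only: distrib_left)
    have Nd: "N * \<delta> / 4 \<le> N" using N \<delta> mult_left_le[of \<delta> N] by simp
    have b1: "N * \<delta> / 4 * wV T \<le> N * wV T" by (intro mult_right_mono Nd nn)
    have b2: "N * \<delta> / 4 * (1 / \<rho>\<^sup>2 * ?M t0) \<le> N * (1 / \<rho>\<^sup>2 * ?M t0)" using nn[of t0] by (intro mult_right_mono Nd) auto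
    have b3: "C_energy * (\<mu>0\<^sup>2 * ?M t0) \<le> C_energy * (1 / \<rho>\<^sup>2 * ?M t0)"
    proof -
      have "\<mu>0 \<le> 1 / \<rho>" using \<mu>0 \<rho> by (simp add: pos_le_divide_eq)
      then have "\<mu>0\<^sup>2 \<le> (1 / \<rho>)\<^sup>2" using \<mu>0 by (intro power_mono) auto
      then have "\<mu>0\<^sup>2 * ?M t0 \<le> 1 / \<rho>\<^sup>2 * ?M t0" using nn by (intro mult_right_mono) (auto simp: power_divide)
      then show ?thesis using C_energy_pos by (intro mult_left_mono) auto
    qed
    have bt: "\<beta> * ?M t0 = N * (1 / \<rho>\<^sup>2 * ?M t0) + C_energy * (1 / \<rho>\<^sup>2 * ?M t0)"
      by (simp add: \<beta>_def N_def add_divide_distrib distrib_right)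
    have en: "wV t0 + N * \<delta> / 2 * ?D t0 \<le> wV T + (C_energy * ?K t0 + C_energy * (\<mu>0\<^sup>2 * ?M t0))"
      using energy_inequality[OF t0] by (simp only: N_def distrib_left)
    have half: "N * \<delta> / 2 * ?D t0 = N * \<delta> / 4 * ?D t0 + N * \<delta> / 4 * ?D t0" by simp
    \<comment> \<open>The products are generalised to variables, and only linear arithmetic remains.\<close>
    have lin: "v0 + d \<le> vT + nv + bm"
      if "v0 + dd \<le> vT + (ck + c2)" "dd = d + d" "ck \<le> d + x1 + x2" "x1 \<le> nv" "x2 \<le> y2" "c2 \<le> y3" "bm = y2 + y3"
      for v0 d dd vT nv bm ck c2 x1 x2 y2 y3 :: real using that by linarith
    have "wV t0 + N * \<delta> / 4 * ?D t0 \<le> wV T + N * wV T + \<beta> * ?M t0"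
      by (rule lin[OF en half CK b1 b2 b3 bt])
    then show ?thesis by (simp add: distrib_right)
  qed
  have A0: "(1 + N) * wV T \<ge> 0" using N nn[of T] by simp
  have mB: "wV t \<le> (Mu ^ n)\<^sup>2 * (\<integral>x. \<zeta> x \<partial>lborel)" for t by (rule wVw(3))
  have ineq: "wV t \<le> (1 + N) * wV T + \<beta> * ?M t" if t: "t \<in> {0..T}" for t
  proof -
    have "N * \<delta> / 4 * ?D t \<ge> 0" using N \<delta> nn(1)[of t] by simp
    then show ?thesis using main[OF t] by linarith
  qed
  have z: "0 \<in> {0..T}" using T by simp
  have gr: "wV 0 \<le> 2 * ((1 + N) * wV T) * exp (2 * \<beta> * (T - 0))"
    "\<beta> * ?M 0 \<le> (1 + N) * wV T * exp (2 * \<beta> * (T - 0))"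
    by (rule gronwall_backward[OF A0 \<beta> T _ mB wVw(4) ineq z], rule nn(4), assumption)+
  show "wV 0 \<le> 2 * (1 + real n) * exp (2 * \<beta> * T) * wV T"
    using gr(1) by (simp only: N_def diff_0_right mult.assoc mult.commute mult.left_commute)
  have "N * \<delta> / 4 * ?D 0 \<le> (1 + N) * wV T + (1 + N) * wV T * exp (2 * \<beta> * T)"
    using main[OF z] gr(2) nn(4)[of 0] by simp
  also have "\<dots> \<le> 2 * ((1 + N) * wV T * exp (2 * \<beta> * T))"
  proof -
    have "(1 + N) * wV T * 1 \<le> (1 + N) * wV T * exp (2 * \<beta> * T)" using A0 \<beta> T by (intro mult_left_mono) auto
    then show ?thesis by simp
  qed
  finally have fin: "N * \<delta> / 4 * ?D 0 \<le> 2 * ((1 + N) * wV T * exp (2 * \<beta> * T))" .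
  have Nd: "N * \<delta> / 4 > 0" using N \<delta> by simp
  have "?D 0 \<le> 2 * ((1 + N) * wV T * exp (2 * \<beta> * T)) / (N * \<delta> / 4)"
    using fin Nd by (subst pos_le_divide_eq) (auto simp: mult.commute)
  also have "\<dots> = 8 * (1 + N) / (N * \<delta>) * exp (2 * \<beta> * T) * wV T"
    using N \<delta> by (simp add: field_simps)
  finally show "?D 0 \<le> 8 * (1 + real n) / (real n * \<delta>) * exp (2 * \<beta> * T) * wV T"
    by (simp only: N_def)
qed

lemma weighted_bounds_nn:
  assumes small: "C_trace * \<theta>\<^sup>2 \<le> 1 / 2" "2 * C_energy * (C_trace * \<theta>\<^sup>2) \<le> real n * \<delta> / 4"
  defines "\<beta> \<equiv> (real n + C_energy) / \<rho>\<^sup>2"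
  shows "(\<integral>\<^sup>+x. ennreal ((V 0 x)\<^sup>2 * \<zeta> x) \<partial>lborel) \<le> ennreal (2 * (1 + real n) * exp (2 * \<beta> * T)) * final_integral"
    and "gradient_integral 0 \<le> ennreal (8 * (1 + real n) / (real n * \<delta>) * exp (2 * \<beta> * T)) * final_integral"
proof -
  have J: "final_integral = ennreal (wV T)" unfolding final_integral_def wV_def
    by (rule nn_integral_eq_integral[OF wVw(1)]) (use \<zeta>_pos in \<open>auto simp: less_imp_le\<close>)
  have 0: "(\<integral>\<^sup>+x. ennreal ((V 0 x)\<^sup>2 * \<zeta> x) \<partial>lborel) = ennreal (wV 0)" unfolding wV_def
    by (rule nn_integral_eq_integral[OF wVw(1)]) (use \<zeta>_pos in \<open>auto simp: less_imp_le\<close>)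
  have D: "gradient_integral 0 = ennreal (LINT t:{0..T}|lborel. wP t)" unfolding gradient_integral_def by (rule wPw(5))
  have n0: "real n > 0" using n1 by simp
  show "(\<integral>\<^sup>+x. ennreal ((V 0 x)\<^sup>2 * \<zeta> x) \<partial>lborel) \<le> ennreal (2 * (1 + real n) * exp (2 * \<beta> * T)) * final_integral"
    unfolding 0 J using weighted_bounds(1)[OF small] wVw(2)[of T] by (simp add: ennreal_mult[symmetric] ennreal_leI \<beta>_def)
  show "gradient_integral 0 \<le> ennreal (8 * (1 + real n) / (real n * \<delta>) * exp (2 * \<beta> * T)) * final_integral"
    unfolding D J using weighted_bounds(2)[OF small] wVw(2)[of T] n0 \<delta> by (simp add: ennreal_mult[symmetric] ennreal_leI \<beta>_def)
qed

end

section \<open>Exponential weights\<close>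

text \<open>A smooth substitute for \<open>exp (- \<mu> \<bar>x\<bar>)\<close>, with the same decay and the same bound for the logarithmic gradient.\<close>

definition expw :: "real \<Rightarrow> real \<Rightarrow> real ^ 'd::finite \<Rightarrow> real" where
  "expw \<epsilon> \<mu> x = exp (- \<mu> * sqrt (\<epsilon>\<^sup>2 + (norm x)\<^sup>2))"

lemma expw_has_derivative:
  fixes x :: "real ^ 'd::finite"
  assumes "\<epsilon> > 0"
  shows "(expw \<epsilon> \<mu> has_derivative (\<lambda>h. (- (\<mu> * expw \<epsilon> \<mu> x / sqrt (\<epsilon>\<^sup>2 + (norm x)\<^sup>2)) *\<^sub>R x) \<bullet> h)) (at x)"
proof -
  have pos: "\<epsilon>\<^sup>2 + x \<bullet> x > 0" using assms by (intro add_pos_nonneg) auto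
  show ?thesis
    unfolding expw_def[abs_def] power2_norm_eq_inner
    apply (rule has_derivative_eq_rhs)
     apply (rule derivative_eq_intros | rule pos | simp)+
    using pos by (auto simp: fun_eq_iff field_simps inner_commute)
qed

lemma expw_pos: "expw \<epsilon> \<mu> x > 0" by (simp add: expw_def)

lemma norm_le_sqrt_add: "norm x \<le> sqrt (\<epsilon>\<^sup>2 + (norm x)\<^sup>2)"
  by (rule real_le_rsqrt) simp

lemma expw_le: "\<mu> \<ge> 0 \<Longrightarrow> expw \<epsilon> \<mu> x \<le> exp (- \<mu> * norm x)"
  unfolding expw_def using mult_left_mono[OF norm_le_sqrt_add[of x \<epsilon>], of \<mu>] by simp

lemma expw_gradient:
  fixes x :: "real ^ 'd::finite"
  assumes "\<epsilon> > 0" "\<mu> \<ge> 0"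
  shows "norm (gradient (expw \<epsilon> \<mu>) x) \<le> \<mu> * expw \<epsilon> \<mu> x"
proof -
  let ?s = "sqrt (\<epsilon>\<^sup>2 + (norm x)\<^sup>2)"
  have s: "?s > 0" using assms by (simp add: add_pos_nonneg)
  have "norm (gradient (expw \<epsilon> \<mu>) x) = \<mu> * expw \<epsilon> \<mu> x * (norm x / ?s)"
    unfolding gradient_eqI[OF expw_has_derivative[OF assms(1)]]
    using assms expw_pos[of \<epsilon> \<mu> x] s by (simp add: abs_mult abs_of_nonneg less_imp_le)
  also have "\<dots> \<le> \<mu> * expw \<epsilon> \<mu> x * 1"
    using assms expw_pos[of \<epsilon> \<mu> x] s norm_le_sqrt_add[of x \<epsilon>]
    by (intro mult_left_mono mult_nonneg_nonneg) (auto simp: less_imp_le divide_le_eq_1)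
  finally show ?thesis by simp
qed

lemma expw_exp_decay:
  assumes "\<epsilon> > 0" "\<mu> > 0"
  shows "exp_decay (expw \<epsilon> \<mu> :: real ^ 'd::finite \<Rightarrow> real)"
  unfolding exp_decay_def
proof (intro conjI allI exI)
  show "expw \<epsilon> \<mu> differentiable (at x)" for x :: "real ^ 'd"
    using expw_has_derivative[OF assms(1)] by (rule differentiableI)
  show "\<mu> > 0" by fact
  fix x :: "real ^ 'd" and i
  have e: "expw \<epsilon> \<mu> x \<le> exp (- \<mu> * norm x)" using assms by (intro expw_le) simp
  have "1 * exp (- \<mu> * norm x) \<le> (1 + \<mu>) * exp (- \<mu> * norm x)" using assms by (intro mult_right_mono) auto
  then show "\<bar>expw \<epsilon> \<mu> x\<bar> \<le> (1 + \<mu>) * exp (- \<mu> * norm x)" using e expw_pos[of \<epsilon> \<mu> x] by (simp only: abs_of_pos mult_1_left)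
  have "\<bar>partial_deriv i (expw \<epsilon> \<mu>) x\<bar> \<le> norm (gradient (expw \<epsilon> \<mu>) x)" by (rule abs_partial_le_gradient)
  also have "\<dots> \<le> \<mu> * expw \<epsilon> \<mu> x" using assms by (intro expw_gradient) auto
  also have "\<dots> \<le> (1 + \<mu>) * exp (- \<mu> * norm x)" using assms expw_pos[of \<epsilon> \<mu> x] by (intro mult_mono e) auto
  finally show "\<bar>partial_deriv i (expw \<epsilon> \<mu>) x\<bar> \<le> (1 + \<mu>) * exp (- \<mu> * norm x)" .
qed

text \<open>The square root is the norm of the pair \<open>(\<epsilon>, x)\<close> and so changes by at most \<open>\<bar>x - y\<bar>\<close>; the factor is \<open>exp 1 < 4\<close>.\<close>

lemma expw_ratio:
  assumes "\<mu> \<ge> 0" "\<mu> * norm (x - y) \<le> 1"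
  shows "expw \<epsilon> \<mu> x \<le> 4 * expw \<epsilon> \<mu> y"
proof -
  have n: "norm (\<epsilon>, x) = sqrt (\<epsilon>\<^sup>2 + (norm x)\<^sup>2)" for x :: "real ^ 'a" by (simp add: norm_Pair)
  have "norm (\<epsilon>, y) \<le> norm (\<epsilon>, x) + norm ((\<epsilon>, y) - (\<epsilon>, x))" by (rule norm_triangle_sub)
  also have "norm ((\<epsilon>, y) - (\<epsilon>, x)) = norm (x - y)" by (simp add: norm_Pair norm_minus_commute)
  finally have "\<mu> * norm (\<epsilon>, y) \<le> \<mu> * (norm (\<epsilon>, x) + norm (x - y))" using assms by (intro mult_left_mono)
  then have "- \<mu> * norm (\<epsilon>, x) \<le> 1 + - \<mu> * norm (\<epsilon>, y)" using assms(2) by (simp add: distrib_left)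
  then have "exp (- \<mu> * norm (\<epsilon>, x)) \<le> exp (1 + - \<mu> * norm (\<epsilon>, y))" by simp
  also have "\<dots> = exp 1 * exp (- \<mu> * norm (\<epsilon>, y))" by (rule exp_add)
  also have "\<dots> \<le> 4 * exp (- \<mu> * norm (\<epsilon>, y))" using exp_le by (intro mult_right_mono) auto
  finally show ?thesis by (simp add: expw_def n)
qed

section \<open>From the Morrey seminorm to averages over cylinders\<close>

lemma emeasure_parabolic_cylinder:
  fixes z :: "real \<times> (real ^ 'd::finite)"
  assumes "r > 0"
  shows "emeasure lborel (parabolic_cylinder r z) = ennreal (vol TYPE(real ^ 'd) * r ^ (CARD('d) + 2))"
proof -
  have "emeasure lborel (parabolic_cylinder r z) = emeasure (lborel \<Otimes>\<^sub>M lborel) ({fst z ..< fst z + r\<^sup>2} \<times> ball (snd z) r)"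
    by (simp add: parabolic_cylinder_def lborel_prod)
  also have "\<dots> = emeasure lborel {fst z ..< fst z + r\<^sup>2} * emeasure lborel (ball (snd z) r)"
    by (rule lborel.emeasure_pair_measure_Times) auto
  also have "\<dots> = ennreal (r\<^sup>2) * ennreal (vol TYPE(real ^ 'd) * r ^ CARD('d))"
    using assms by (simp add: emeasure_ball)
  also have "\<dots> = ennreal (vol TYPE(real ^ 'd) * r ^ (CARD('d) + 2))"
    using assms by (subst ennreal_mult[symmetric]) (auto simp: power_add power2_eq_square mult_ac)
  finally show ?thesis .
qed

lemma parabolic_cylinder_sets[measurable]: "parabolic_cylinder r z \<in> sets borel"
  unfolding parabolic_cylinder_def by (rule borel_Times) auto

lemma morrey_hat_cylinder:
  fixes w :: "real \<times> (real ^ 'd::finite) \<Rightarrow> real ^ 'd"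
  assumes w: "w \<in> B0_infinity_vec" and p: "p > 0" and h: "h \<ge> 0"
    and M: "morrey_hat p R w \<le> ennreal h" and r: "0 < r" "r \<le> R"
  shows "(\<integral>\<^sup>+z\<in>parabolic_cylinder r z0. ennreal (norm (w z) powr p) \<partial>lborel)
    \<le> ennreal (vol TYPE(real ^ 'd) * r ^ (CARD('d) + 2) * (h / r) powr p)"
proof -
  let ?C = "parabolic_cylinder r z0"
  define m where "m = vol TYPE(real ^ 'd) * r ^ (CARD('d) + 2)"
  define I where "I = (LINT z:?C|lborel. norm (w z) powr p)"
  have [measurable]: "w \<in> borel_measurable borel" by (rule B0_vec_measurable[OF w])
  obtain B where B: "\<And>z. norm (w z) \<le> B" by (rule B0_vec_bounded[OF w]) blast
  have m: "m > 0" unfolding m_def using r by simp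
  have mC: "measure lborel ?C = m" using emeasure_parabolic_cylinder[OF r(1), of z0] m by (simp add: measure_def m_def)
  have fin: "emeasure lborel ?C < \<infinity>" by (simp add: emeasure_parabolic_cylinder[OF r(1)])
  have int: "set_integrable lborel ?C (\<lambda>z. norm (w z) powr p)"
    unfolding set_integrable_def
  proof (rule Bochner_Integration.integrable_bound)
    show "integrable lborel (\<lambda>z. B powr p * indicator ?C z :: real)"
      using fin by (intro integrable_mult_right integrable_real_indicator) auto
    show "AE z in lborel. norm (indicator ?C z *\<^sub>R (norm (w z) powr p)) \<le> norm (B powr p * indicator ?C z :: real)"
      using B p by (intro AE_I2) (auto simp: indicator_def intro!: powr_mono2)
  qed measurable
  have I0: "I \<ge> 0" unfolding I_def set_lebesgue_integral_def by (intro integral_nonneg_AE AE_I2) (auto simp: indicator_def)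
  have "ennreal r * ennreal ((1 / m * I) powr (1 / p)) \<le> morrey_hat p R w"
    unfolding morrey_hat_def I_def mC[symmetric]
    by (rule SUP_upper2[of r], use r in simp, rule mult_left_mono, rule SUP_upper) (auto simp: parabolic_cylinders_def)
  then have "ennreal (r * (1 / m * I) powr (1 / p)) \<le> ennreal h" using M r by (simp add: ennreal_mult)
  then have "r * (1 / m * I) powr (1 / p) \<le> h" using h by (simp add: ennreal_le_iff)
  then have "(1 / m * I) powr (1 / p) \<le> h / r" using r by (simp add: pos_le_divide_eq mult.commute)
  then have "((1 / m * I) powr (1 / p)) powr p \<le> (h / r) powr p" using p by (intro powr_mono2) auto
  moreover have "((1 / m * I) powr (1 / p)) powr p = 1 / m * I" using p I0 m by (simp add: powr_powr)
  ultimately have "1 / m * I \<le> (h / r) powr p" by simp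
  then have I: "I \<le> m * (h / r) powr p" using m by (simp add: pos_divide_le_eq mult.commute)
  have "(\<integral>\<^sup>+z\<in>?C. ennreal (norm (w z) powr p) \<partial>lborel) = (\<integral>\<^sup>+z. ennreal (indicator ?C z *\<^sub>R (norm (w z) powr p)) \<partial>lborel)"
    by (intro nn_integral_cong) (simp add: indicator_def)
  also have "\<dots> = ennreal I" unfolding I_def set_lebesgue_integral_def
    by (rule nn_integral_eq_integral) (use int in \<open>auto simp: set_integrable_def indicator_def\<close>)
  also have "\<dots> \<le> ennreal (m * (h / r) powr p)" by (rule ennreal_leI[OF I])
  finally show ?thesis by (simp add: m_def)
qed

lemma cyl_covered:
  assumes "r > 0"
  shows "cyl r z \<subseteq> parabolic_cylinder r (fst z - r\<^sup>2, snd z) \<union> parabolic_cylinder r z"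
  by (auto simp: cyl_def parabolic_cylinder_def)

text \<open>A symmetric cylinder is covered by two forward ones.\<close>

lemma cavg_morrey:
  fixes w :: "real \<times> (real ^ 'd::finite) \<Rightarrow> real ^ 'd"
  assumes w: "w \<in> B0_infinity_vec" and p: "p > 0" and h: "h \<ge> 0"
    and M: "morrey_hat p R w \<le> ennreal h" and r: "0 < r" "r \<le> R"
  shows "cavg r (\<lambda>z. ennreal (norm (w z) powr p)) z0 \<le> ennreal (2 * vol TYPE(real ^ 'd) * (h / r) powr p)"
proof -
  have [measurable]: "w \<in> borel_measurable borel" by (rule B0_vec_measurable[OF w])
  let ?F = "\<lambda>z. ennreal (norm (w z) powr p)"
  let ?z1 = "(fst z0 - r\<^sup>2, snd z0)"
  define X where "X = vol TYPE(real ^ 'd) * r ^ (CARD('d) + 2) * (h / r) powr p"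
  have X: "X \<ge> 0" unfolding X_def using r by simp
  have "cavg r ?F z0 = (\<integral>\<^sup>+z. ennreal (1 / r ^ (CARD('d) + 2)) * (?F z * indicator (cyl r z0) z) \<partial>lborel)"
    unfolding cavg_def kcyl_def by (simp add: mult_ac)
  also have "\<dots> \<le> (\<integral>\<^sup>+z. ennreal (1 / r ^ (CARD('d) + 2)) * (?F z * indicator (parabolic_cylinder r ?z1) z + ?F z * indicator (parabolic_cylinder r z0) z) \<partial>lborel)"
    using cyl_covered[OF r(1), of z0] by (intro nn_integral_mono mult_left_mono) (auto simp: indicator_def)
  also have "\<dots> = ennreal (1 / r ^ (CARD('d) + 2)) * ((\<integral>\<^sup>+z\<in>parabolic_cylinder r ?z1. ?F z \<partial>lborel) + (\<integral>\<^sup>+z\<in>parabolic_cylinder r z0. ?F z \<partial>lborel))"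
    by (subst nn_integral_cmult, measurable, subst nn_integral_add) auto
  also have "\<dots> \<le> ennreal (1 / r ^ (CARD('d) + 2)) * (ennreal X + ennreal X)"
    unfolding X_def by (intro mult_left_mono add_mono morrey_hat_cylinder[OF w p h M r]) auto
  also have "\<dots> = ennreal (1 / r ^ (CARD('d) + 2) * (2 * X))"
    using X r by (subst ennreal_plus[symmetric], simp, simp, subst ennreal_mult[symmetric], auto)
  also have "1 / r ^ (CARD('d) + 2) * (2 * X) = 2 * vol TYPE(real ^ 'd) * (h / r) powr p"
    unfolding X_def using r by simp
  finally show ?thesis .
qed

text \<open>The constant in \<open>h\<close> compensates the four cylinders involved, two for each of the coefficients, and makes \<open>h < 1\<close> if
  \<open>\<theta> \<le> 1\<close>; the denominator \<open>C > 1\<close> of \<open>h\<close> becomes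
  \<open>C powr p \<ge> C\<close> after taking powers.\<close>

lemma (in power_solution) cavg_g_morrey:
  assumes p: "p > 1" and \<theta>: "\<theta> > 0"
  defines "h \<equiv> \<theta> / (4 * vol TYPE(real ^ 'd) + 2)"
  assumes M: "morrey_hat p R aa \<le> ennreal h" "morrey_hat p R b \<le> ennreal h" and r: "0 < r" "r \<le> R"
  shows "cavg r (\<lambda>z. ennreal (g z powr p)) z0 \<le> ennreal ((\<theta> / r) powr p)"
proof -
  define \<omega> where "\<omega> = vol TYPE(real ^ 'd)"
  have \<omega>: "\<omega> \<ge> 0" by (simp add: \<omega>_def)
  have h: "h \<ge> 0" using \<theta> \<omega> by (simp add: h_def \<omega>_def)
  have p0: "p > 0" using p by simp
  have [measurable]: "aa \<in> borel_measurable borel" "b \<in> borel_measurable borel" by (intro B0_vec_measurable aa b)+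
  have "cavg r (\<lambda>z. ennreal (g z powr p)) z0
     \<le> (\<integral>\<^sup>+z. kcyl r z0 z * ennreal (norm (aa z) powr p) + kcyl r z0 z * ennreal (norm (b z) powr p) \<partial>lborel)"
    unfolding cavg_def
  proof (intro nn_integral_mono)
    fix z
    have "g z powr p \<le> norm (aa z) powr p + norm (b z) powr p" by (simp add: g_def max_def)
    then have "ennreal (g z powr p) \<le> ennreal (norm (aa z) powr p) + ennreal (norm (b z) powr p)"
      by (subst ennreal_plus[symmetric]) (simp_all only: ennreal_leI powr_ge_zero)
    then show "kcyl r z0 z * ennreal (g z powr p) \<le> kcyl r z0 z * ennreal (norm (aa z) powr p) + kcyl r z0 z * ennreal (norm (b z) powr p)"
      unfolding distrib_left[symmetric] by (rule mult_left_mono) simp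
  qed
  also have "\<dots> = cavg r (\<lambda>z. ennreal (norm (aa z) powr p)) z0 + cavg r (\<lambda>z. ennreal (norm (b z) powr p)) z0"
    unfolding cavg_def by (rule nn_integral_add) measurable
  also have "\<dots> \<le> ennreal (2 * \<omega> * (h / r) powr p) + ennreal (2 * \<omega> * (h / r) powr p)"
    unfolding \<omega>_def by (intro add_mono cavg_morrey[OF aa p0 h M(1) r] cavg_morrey[OF b p0 h M(2) r])
  also have "\<dots> = ennreal (4 * \<omega> * (h / r) powr p)"
    using \<omega> by (subst ennreal_plus[symmetric]) auto
  also have "4 * \<omega> * (h / r) powr p \<le> (\<theta> / r) powr p"
  proof -
    have "4 * \<omega> * (h / r) powr p \<le> (4 * \<omega> + 2) powr 1 * (h / r) powr p" using \<omega> by (intro mult_right_mono) auto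
    also have "\<dots> \<le> (4 * \<omega> + 2) powr p * (h / r) powr p" using \<omega> p by (intro mult_right_mono powr_mono) auto
    also have "\<dots> = ((4 * \<omega> + 2) * (h / r)) powr p" by (rule powr_mult[symmetric])
    also have "(4 * \<omega> + 2) * (h / r) = \<theta> / r" using \<omega> by (simp add: h_def \<omega>_def add_nonneg_eq_0_iff)
    finally show ?thesis .
  qed
  finally show ?thesis by (simp add: ennreal_leI)
qed

section \<open>Choice of the constants and of the weights\<close>

lemma small_square:
  fixes c e :: real
  assumes "e > 0"
  obtains \<theta> where "0 < \<theta>" "\<theta> \<le> 1" "\<bar>c\<bar> * \<theta>\<^sup>2 \<le> e"
proof
  define \<theta> where "\<theta> = min 1 (e / (1 + \<bar>c\<bar>))"
  show t: "0 < min 1 (e / (1 + \<bar>c\<bar>))" "min 1 (e / (1 + \<bar>c\<bar>)) \<le> 1" using assms by (auto intro!: divide_pos_pos)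
  have "\<theta>\<^sup>2 \<le> \<theta>" using t mult_left_le[of \<theta> \<theta>] by (simp add: power2_eq_square \<theta>_def)
  then have "\<bar>c\<bar> * \<theta>\<^sup>2 \<le> (1 + \<bar>c\<bar>) * \<theta>" using t by (intro mult_mono) (auto simp: \<theta>_def)
  also have "\<dots> \<le> (1 + \<bar>c\<bar>) * (e / (1 + \<bar>c\<bar>))" unfolding \<theta>_def by (intro mult_left_mono) auto
  also have "\<dots> = e" by (simp add: add_nonneg_eq_0_iff)
  finally show "\<bar>c\<bar> * (min 1 (e / (1 + \<bar>c\<bar>)))\<^sup>2 \<le> e" unfolding \<theta>_def .
qed

lemma one_plus_sq_le_exp: "(y::real) \<ge> 0 \<Longrightarrow> (1 + y)\<^sup>2 \<le> 4 * exp y"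
proof -
  assume y: "y \<ge> 0"
  have "1 + y / 2 \<le> exp (y / 2)" by (rule exp_ge_add_one_self)
  then have "1 + y \<le> 2 * exp (y / 2)" using y by linarith
  then have "(1 + y)\<^sup>2 \<le> (2 * exp (y / 2))\<^sup>2" using y by (intro power_mono) auto
  also have "\<dots> = 4 * exp y" by (simp add: power_mult_distrib exp_double[symmetric])
  finally show ?thesis .
qed

lemma weight_limit:
  fixes x :: "real ^ 'd::finite"
  assumes R: "R > 0"
  shows "(\<lambda>k. expw (1 / real (Suc k)) (lam + 1 / (R * real (Suc k))) x) \<longlonglongrightarrow> exp (- lam * norm x)"
proof -
  have 1: "(\<lambda>k. 1 / real (Suc k)) \<longlonglongrightarrow> 0" using LIMSEQ_inverse_real_of_nat by (simp add: inverse_eq_divide)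
  have "(\<lambda>k. lam + 1 / R * (1 / real (Suc k))) \<longlonglongrightarrow> lam + 1 / R * 0" by (intro tendsto_intros 1)
  then have 2: "(\<lambda>k. lam + 1 / (R * real (Suc k))) \<longlonglongrightarrow> lam" by simp
  have "(\<lambda>k. exp (- (lam + 1 / (R * real (Suc k))) * sqrt ((1 / real (Suc k))\<^sup>2 + (norm x)\<^sup>2))) \<longlonglongrightarrow> exp (- lam * sqrt (0\<^sup>2 + (norm x)\<^sup>2))"
    by (intro tendsto_intros 1 2)
  then show ?thesis by (simp add: expw_def)
qed

lemma nn_integral_weight_le:
  fixes F :: "'a \<Rightarrow> real" and w :: "nat \<Rightarrow> 'a \<Rightarrow> real"
  assumes [measurable]: "F \<in> borel_measurable M" "\<And>k. w k \<in> borel_measurable M"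
    and lim: "\<And>x. (\<lambda>k. w k x) \<longlonglongrightarrow> W x"
    and le: "\<And>k. (\<integral>\<^sup>+x. ennreal (F x * w k x) \<partial>M) \<le> B"
  shows "(\<integral>\<^sup>+x. ennreal (F x * W x) \<partial>M) \<le> B"
proof -
  have "(\<lambda>k. ennreal (F x * w k x)) \<longlonglongrightarrow> ennreal (F x * W x)" for x
    by (intro tendsto_ennrealI tendsto_mult tendsto_const lim)
  then have "(\<integral>\<^sup>+x. ennreal (F x * W x) \<partial>M) = (\<integral>\<^sup>+x. liminf (\<lambda>k. ennreal (F x * w k x)) \<partial>M)"
    by (intro nn_integral_cong lim_imp_Liminf[symmetric]) simp_all
  also have "\<dots> \<le> liminf (\<lambda>k. \<integral>\<^sup>+x. ennreal (F x * w k x) \<partial>M)" by (rule nn_integral_liminf) measurable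
  also have "\<dots> \<le> liminf (\<lambda>k. B)" by (intro Liminf_mono always_eventually allI le)
  also have "\<dots> = B" by (simp add: Liminf_const)
  finally show ?thesis .
qed

context power_solution begin

lemma V_sq: "(V t x)\<^sup>2 = \<bar>u (c t, x)\<bar> ^ (2 * n)"
  unfolding V_def U_def by (simp only: power_mult[symmetric] mult.commute)

lemma P_sq: "(P t x)\<^sup>2 = u (c t, x) ^ (2 * n - 2) * (norm (gradient (\<lambda>y. u (c t, y)) x))\<^sup>2"
proof -
  have e: "even ((n - 1) * 2)" by simp
  have "(\<bar>u (c t, x)\<bar> ^ (n - 1))\<^sup>2 = u (c t, x) ^ ((n - 1) * 2)"
    unfolding power_mult[symmetric] by (rule power_even_abs[OF e])
  moreover have "(n - 1) * 2 = 2 * n - 2" by simp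
  ultimately show ?thesis unfolding P_def Du_def U_def by (simp add: power_mult_distrib)
qed

end

context solution_at_scales begin

text \<open>The rate of decay \<open>lam + 1 / (R (k + 1))\<close> is positive even for \<open>lam = 0\<close>, so the weights are integrable, and it is at most
  \<open>lam + 1 / R = 1 / \<rho>\<close>, which is the admissible rate on the scale \<open>\<rho>\<close>.\<close>

lemma limit_bounds:
  assumes lam: "lam \<ge> 0" and R: "R > 0" "\<rho> = R / (1 + lam * R)"
    and \<theta>: "0 < \<theta>" "\<theta> \<le> 1"
    and small: "48 * C_rep\<^sup>2 * morrey.C_schur TYPE(real ^ 'd) p * \<theta>\<^sup>2 \<le> 1 / 2"
      "2 * C_energy * (48 * C_rep\<^sup>2 * morrey.C_schur TYPE(real ^ 'd) p * \<theta>\<^sup>2) \<le> real n * \<delta> / 4"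
    and morrey_small: "\<And>k z. cavg (r k) (\<lambda>w. ennreal (g w powr p)) z \<le> ennreal ((\<theta> / r k) powr p)"
  defines "E \<equiv> exp (8 * (real n + C_energy) / R\<^sup>2 * exp (lam * R) * T)"
    and "J \<equiv> (\<integral>\<^sup>+x. ennreal (\<bar>f x\<bar> ^ (2 * n) * exp (- lam * norm x)) \<partial>lborel)"
  shows "(\<integral>\<^sup>+x. ennreal ((V 0 x)\<^sup>2 * exp (- lam * norm x)) \<partial>lborel) \<le> ennreal (2 * (1 + real n) * E) * J"
    and "(\<integral>\<^sup>+z. ennreal ((indicator {0..T} (fst z) * (P (fst z) (snd z))\<^sup>2) * exp (- lam * norm (snd z))) \<partial>lborel)
      \<le> ennreal (8 * (1 + real n) / (real n * \<delta>) * E) * J"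
proof -
  define w :: "nat \<Rightarrow> real ^ 'd \<Rightarrow> real" where "w k = expw (1 / real (Suc k)) (lam + 1 / (R * real (Suc k)))" for k
  define \<mu> where "\<mu> k = lam + 1 / (R * real (Suc k))" for k
  have \<mu>: "\<mu> k > 0" "\<mu> k \<ge> lam" for k using lam R(1) by (auto simp: \<mu>_def intro!: add_nonneg_pos divide_pos_pos)
  have lR: "1 + lam * R > 0" using lam R(1) by (intro add_pos_nonneg) auto
  have \<mu>\<rho>: "\<mu> k * \<rho> \<le> 1" for k
  proof -
    have "R \<le> R * real (Suc k)" using R(1) by simp
    then have "1 / (R * real (Suc k)) \<le> 1 / R" using R(1) by (intro divide_left_mono) auto
    then have "\<mu> k * R \<le> (lam + 1 / R) * R" unfolding \<mu>_def using R(1) by (intro mult_right_mono) auto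
    also have "\<dots> = 1 + lam * R" using R(1) by (simp add: distrib_right)
    finally show ?thesis unfolding R(2) using lR by (simp add: pos_divide_le_eq)
  qed
  have en: "energy \<delta> T a aa b f u n \<rho> p (w k) (\<mu> k) \<theta>" for k
  proof (intro energy.intro energy_axioms.intro)
    show "solution_at_scales \<delta> T a aa b f u n \<rho> p" by (rule solution_at_scales_axioms)
    show "exp_decay (w k)" unfolding w_def \<mu>_def[symmetric] by (rule expw_exp_decay) (auto simp: \<mu>)
    show "0 < w k x" for x unfolding w_def by (rule expw_pos)
    show "norm (gradient (w k) x) \<le> \<mu> k * w k x" for x
      unfolding w_def \<mu>_def[symmetric] by (rule expw_gradient) (auto simp: \<mu> less_imp_le)
    show "0 \<le> \<mu> k" using \<mu>(1)[of k] by simp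
    show "\<mu> k * \<rho> \<le> 1" by (rule \<mu>\<rho>)
    show "w k x \<le> 4 * w k y" if "norm (x - y) \<le> \<rho>" for x y
      unfolding w_def \<mu>_def[symmetric]
    proof (rule expw_ratio)
      show "0 \<le> \<mu> k" using \<mu>(1)[of k] by simp
      then have "\<mu> k * norm (x - y) \<le> \<mu> k * \<rho>" by (intro mult_left_mono that)
      then show "\<mu> k * norm (x - y) \<le> 1" using \<mu>\<rho>[of k] by simp
    qed
    show "0 < \<theta>" "\<theta> \<le> 1" by fact+
    show "cavg (r k) (\<lambda>w. ennreal (g w powr p)) z \<le> ennreal ((\<theta> / r k) powr p)" for k z by (rule morrey_small)
  qed
  have w_le: "w k x \<le> exp (- lam * norm x)" for k x
  proof -
    have "w k x \<le> exp (- \<mu> k * norm x)" unfolding w_def \<mu>_def[symmetric] using \<mu>(1)[of k] by (intro expw_le) simp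
    also have "\<dots> \<le> exp (- lam * norm x)" using mult_right_mono[OF \<mu>(2)[of k], of "norm x"] by simp
    finally show ?thesis .
  qed
  have [measurable]: "w k \<in> borel_measurable borel" for k
    by (rule energy.\<zeta>_meas[OF en])
  note fst_snd_meas[measurable]
  have wlim: "(\<lambda>k. w k x) \<longlonglongrightarrow> exp (- lam * norm x)" for x
    unfolding w_def by (rule weight_limit[OF R(1)])
  define \<beta> where "\<beta> = (real n + C_energy) / \<rho>\<^sup>2"
  have ex: "exp (2 * \<beta> * T) \<le> E"
  proof -
    have "1 / \<rho>\<^sup>2 = (1 + lam * R)\<^sup>2 / R\<^sup>2" by (simp add: R(2) power_divide)
    also have "\<dots> \<le> 4 * exp (lam * R) / R\<^sup>2" using lam R(1) by (intro divide_right_mono one_plus_sq_le_exp) auto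
    finally have "1 / \<rho>\<^sup>2 \<le> 4 * exp (lam * R) / R\<^sup>2" .
    then have "(2 * (real n + C_energy) * T) * (1 / \<rho>\<^sup>2) \<le> (2 * (real n + C_energy) * T) * (4 * exp (lam * R) / R\<^sup>2)"
      using C_energy_pos T by (intro mult_left_mono) auto
    also have "\<dots> = 8 * (real n + C_energy) / R\<^sup>2 * exp (lam * R) * T" by simp
    also have "(2 * (real n + C_energy) * T) * (1 / \<rho>\<^sup>2) = 2 * \<beta> * T" by (simp add: \<beta>_def)
    finally have "2 * \<beta> * T \<le> 8 * (real n + C_energy) / R\<^sup>2 * exp (lam * R) * T" .
    then show ?thesis by (simp add: E_def)
  qed
  have final_integral_le: "energy.final_integral T u n (w k) \<le> J" for k
    unfolding energy.final_integral_def[OF en] J_def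
  proof (intro nn_integral_mono ennreal_leI)
    fix x
    have "(V T x)\<^sup>2 = \<bar>f x\<bar> ^ (2 * n)" unfolding V_T by (simp only: power_mult[symmetric] mult.commute)
    then show "(V T x)\<^sup>2 * w k x \<le> \<bar>f x\<bar> ^ (2 * n) * exp (- lam * norm x)"
      using w_le[of k x] by (simp add: mult_left_mono)
  qed
  show "(\<integral>\<^sup>+x. ennreal ((V 0 x)\<^sup>2 * exp (- lam * norm x)) \<partial>lborel) \<le> ennreal (2 * (1 + real n) * E) * J"
  proof (rule nn_integral_weight_le[where w = w])
    have [measurable]: "V 0 \<in> borel_measurable borel" by measurable
    show "(\<lambda>x. (V 0 x)\<^sup>2) \<in> borel_measurable lborel" by measurable
    show "w k \<in> borel_measurable lborel" for k by measurable
    show "(\<lambda>k. w k x) \<longlonglongrightarrow> exp (- lam * norm x)" for x by (rule wlim)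
    fix k
    interpret X: energy \<delta> T a aa b f u n \<rho> p "w k" "\<mu> k" \<theta> by (rule en)
    have "(\<integral>\<^sup>+x. ennreal ((V 0 x)\<^sup>2 * w k x) \<partial>lborel) \<le> ennreal (2 * (1 + real n) * exp (2 * \<beta> * T)) * X.final_integral"
      unfolding \<beta>_def by (rule X.weighted_bounds_nn(1)) (use small in \<open>simp_all add: X.C_trace_def\<close>)
    also have "\<dots> \<le> ennreal (2 * (1 + real n) * E) * J"
      by (intro mult_mono ennreal_leI mult_left_mono ex final_integral_le) auto
    finally show "(\<integral>\<^sup>+x. ennreal ((V 0 x)\<^sup>2 * w k x) \<partial>lborel) \<le> ennreal (2 * (1 + real n) * E) * J" .
  qed
  show "(\<integral>\<^sup>+z. ennreal ((indicator {0..T} (fst z) * (P (fst z) (snd z))\<^sup>2) * exp (- lam * norm (snd z))) \<partial>lborel)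
      \<le> ennreal (8 * (1 + real n) / (real n * \<delta>) * E) * J"
  proof (rule nn_integral_weight_le[where w = "\<lambda>k z. w k (snd z)"])
    have "case_prod (\<lambda>t x. indicator {0..T} t * (P t x)\<^sup>2) \<in> borel_measurable (borel \<Otimes>\<^sub>M borel)" by measurable
    then have "(\<lambda>z. indicator {0..T} (fst z) * (P (fst z) (snd z))\<^sup>2) \<in> borel_measurable borel"
      unfolding pair_borel case_prod_unfold .
    then show "(\<lambda>z. indicator {0..T} (fst z) * (P (fst z) (snd z))\<^sup>2) \<in> borel_measurable lborel"
      by simp
    show "(\<lambda>z :: real \<times> (real ^ 'd). w k (snd z)) \<in> borel_measurable lborel" for k by measurable
    show "(\<lambda>k. w k (snd z)) \<longlonglongrightarrow> exp (- lam * norm (snd z))" for z by (rule wlim)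
    fix k
    interpret X: energy \<delta> T a aa b f u n \<rho> p "w k" "\<mu> k" \<theta> by (rule en)
    have "(\<integral>\<^sup>+z. ennreal ((indicator {0..T} (fst z) * (P (fst z) (snd z))\<^sup>2) * w k (snd z)) \<partial>lborel) = X.gradient_integral 0"
      unfolding X.gradient_integral_def by (intro nn_integral_cong) (simp add: indicator_def)
    also have "\<dots> \<le> ennreal (8 * (1 + real n) / (real n * \<delta>) * exp (2 * \<beta> * T)) * X.final_integral"
      unfolding \<beta>_def by (rule X.weighted_bounds_nn(2)) (use small in \<open>simp_all add: X.C_trace_def\<close>)
    also have "\<dots> \<le> ennreal (8 * (1 + real n) / (real n * \<delta>) * E) * J"
      using \<delta> by (intro mult_mono ennreal_leI mult_left_mono ex final_integral_le) auto
    finally show "(\<integral>\<^sup>+z. ennreal ((indicator {0..T} (fst z) * (P (fst z) (snd z))\<^sup>2) * w k (snd z)) \<partial>lborel)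
       \<le> ennreal (8 * (1 + real n) / (real n * \<delta>) * E) * J" .
  qed
qed

end

theorem theorem2p1:
  fixes \<delta> p\<^sub>0 :: real and n :: nat
  assumes "CARD('d::finite) \<ge> 2"
    and "\<delta> \<in> {0<..1}"
    and "p\<^sub>0 \<in> {2<..2 + real CARD('d)}"
    and "n \<in> {1} \<union> {2 * i | i. i \<ge> 2}"
  shows "\<exists>a_hat\<in>{0<..<1}. \<exists>b_hat\<in>{0<..<1}. \<exists>N\<^sub>0>0. \<exists>N\<^sub>1>0. \<exists>N\<^sub>2>0.
    \<forall>\<rho>\<^sub>0>0. \<forall>lam\<ge>0.
    \<forall>a\<in>(B0_infinity_mat :: (real \<times> (real ^ 'd) \<Rightarrow> real ^ 'd ^ 'd) set).
    \<forall>aa\<in>B0_infinity_vec. \<forall>b\<in>B0_infinity_vec. \<forall>f\<in>C0_infinity. \<forall>T>0. \<forall>u.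
      range a \<subseteq> S_delta \<delta> \<longrightarrow>
      classical_solution a aa b f T u \<longrightarrow>
      morrey_hat p\<^sub>0 \<rho>\<^sub>0 aa \<le> ennreal (exp (- lam * \<rho>\<^sub>0) * a_hat) \<longrightarrow>
      morrey_hat p\<^sub>0 \<rho>\<^sub>0 b \<le> ennreal (exp (- lam * \<rho>\<^sub>0) * b_hat) \<longrightarrow>
      (let \<alpha> = N\<^sub>0 / \<rho>\<^sub>0\<^sup>2 * exp (lam * \<rho>\<^sub>0);
           J = (\<integral>\<^sup>+x. ennreal (\<bar>f x\<bar> ^ (2 * n) * exp (- lam * norm x)) \<partial>lborel)
       in (\<integral>\<^sup>+x. ennreal (\<bar>u (0, x)\<bar> ^ (2 * n) * exp (- lam * norm x)) \<partial>lborel)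
            \<le> ennreal (N\<^sub>1 * exp (\<alpha> * T)) * J
        \<and> (\<integral>\<^sup>+(t, x)\<in>{0..T} \<times> UNIV.
              ennreal (u (t, x) ^ (2 * n - 2) * (norm (gradient (\<lambda>y. u (t, y)) x))\<^sup>2
                       * exp (- lam * norm x)) \<partial>lborel)
            \<le> ennreal (N\<^sub>2 * exp (lam * \<rho>\<^sub>0 + \<alpha> * T)) * J)"
proof -
  \<comment> \<open>The constants of the locales depend on d, delta, p and n only, so they can be named before
    the coefficients are given. The absolute value makes nonnegativity available at this point.\<close>
  define C_energy_val where "C_energy_val = \<bar>power_solution.C_energy \<delta> n\<bar>"
  define C_trace_val where "C_trace_val = 48 * (solution_at_scales.C_rep TYPE('d) \<delta> n)\<^sup>2 * morrey.C_schur TYPE(real ^ 'd) p\<^sub>0"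
  define \<omega> where "\<omega> = vol TYPE(real ^ 'd)"
  have \<omega>: "\<omega> \<ge> 0" by (simp add: \<omega>_def)
  have \<delta>: "0 < \<delta>" "\<delta> \<le> 1" and p: "2 < p\<^sub>0" using assms by auto
  have n: "n = 1 \<or> (even n \<and> n \<ge> 2)" using assms(4) by auto
  then have n1: "n \<ge> 1" by auto
  have "min (1 / 2) (real n * \<delta> / 4) > 0" using n1 \<delta> by simp
  then obtain \<theta> where \<theta>: "0 < \<theta>" "\<theta> \<le> 1" and th: "\<bar>\<bar>C_trace_val\<bar> + \<bar>2 * C_energy_val * C_trace_val\<bar>\<bar> * \<theta>\<^sup>2 \<le> min (1 / 2) (real n * \<delta> / 4)"
    by (rule small_square)
  have small: "C_trace_val * \<theta>\<^sup>2 \<le> 1 / 2" "2 * C_energy_val * (C_trace_val * \<theta>\<^sup>2) \<le> real n * \<delta> / 4"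
  proof -
    have "C_trace_val * \<theta>\<^sup>2 \<le> (\<bar>C_trace_val\<bar> + \<bar>2 * C_energy_val * C_trace_val\<bar>) * \<theta>\<^sup>2" by (intro mult_right_mono) auto
    then show "C_trace_val * \<theta>\<^sup>2 \<le> 1 / 2" using th by simp
    have "(2 * C_energy_val * C_trace_val) * \<theta>\<^sup>2 \<le> (\<bar>C_trace_val\<bar> + \<bar>2 * C_energy_val * C_trace_val\<bar>) * \<theta>\<^sup>2" by (intro mult_right_mono) auto
    then show "2 * C_energy_val * (C_trace_val * \<theta>\<^sup>2) \<le> real n * \<delta> / 4" using th by (simp add: mult.assoc)
  qed
  define h where "h = \<theta> / (4 * \<omega> + 2)"
  have h: "h \<in> {0<..<1}" using \<theta> \<omega> by (simp add: h_def)
  have C_energy_val: "C_energy_val \<ge> 0" by (simp add: C_energy_val_def)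
  have main: "(\<integral>\<^sup>+x. ennreal (\<bar>u (0, x)\<bar> ^ (2 * n) * exp (- lam * norm x)) \<partial>lborel)
      \<le> ennreal (2 * (1 + real n) * exp (8 * (real n + C_energy_val) / R\<^sup>2 * exp (lam * R) * T)) * J"
     "(\<integral>\<^sup>+(t, x)\<in>{0..T} \<times> UNIV. ennreal (u (t, x) ^ (2 * n - 2) * (norm (gradient (\<lambda>y. u (t, y)) x))\<^sup>2 * exp (- lam * norm x)) \<partial>lborel)
      \<le> ennreal (8 * (1 + real n) / (real n * \<delta>) * exp (lam * R + 8 * (real n + C_energy_val) / R\<^sup>2 * exp (lam * R) * T)) * J"
    if R: "R > 0" and lam: "lam \<ge> 0" and a: "a \<in> (B0_infinity_mat :: (real \<times> (real ^ 'd) \<Rightarrow> real ^ 'd ^ 'd) set)"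
      and aa: "aa \<in> B0_infinity_vec" and b: "b \<in> B0_infinity_vec" and T: "T > 0"
      and aS: "range a \<subseteq> S_delta \<delta>" and sol: "classical_solution a aa b f T u"
      and Ma: "morrey_hat p\<^sub>0 R aa \<le> ennreal (exp (- lam * R) * h)" and Mb: "morrey_hat p\<^sub>0 R b \<le> ennreal (exp (- lam * R) * h)"
      and J: "J = (\<integral>\<^sup>+x. ennreal (\<bar>f x\<bar> ^ (2 * n) * exp (- lam * norm x)) \<partial>lborel)"
    for R lam a aa b f T u J
  proof -
    define \<rho> where "\<rho> = R / (1 + lam * R)"
    have lR: "1 + lam * R \<ge> 1" using lam R by simp
    have \<rho>_pos: "0 < \<rho>" and \<rho>_le: "\<rho> \<le> R" using R lR mult_left_mono[OF lR, of R] by (auto simp: \<rho>_def pos_divide_le_eq)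
    interpret solution_at_scales \<delta> T a aa b f u n \<rho> p\<^sub>0
      by unfold_locales (use \<delta> T a aa b aS sol n \<rho>_pos p in auto)
    have C_energy_val_eq: "C_energy = C_energy_val" using C_energy_pos by (simp add: C_energy_val_def)
    have C_trace_val_eq: "48 * C_rep\<^sup>2 * morrey.C_schur TYPE(real ^ 'd) p\<^sub>0 = C_trace_val" by (simp add: C_trace_val_def)
    have "exp (- lam * R) * h \<le> 1 * h" using lam R h by (intro mult_right_mono) auto
    then have eh: "ennreal (exp (- lam * R) * h) \<le> ennreal h" by (intro ennreal_leI) simp
    have morrey_small: "cavg (r k) (\<lambda>w. ennreal (g w powr p\<^sub>0)) z \<le> ennreal ((\<theta> / r k) powr p\<^sub>0)" for k z
    proof (rule cavg_g_morrey[OF _ \<theta>(1)])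
      show "1 < p\<^sub>0" using p by simp
      show "morrey_hat p\<^sub>0 R aa \<le> ennreal (\<theta> / (4 * vol TYPE(real ^ 'd) + 2))"
        using order_trans[OF Ma eh] by (simp add: h_def \<omega>_def)
      show "morrey_hat p\<^sub>0 R b \<le> ennreal (\<theta> / (4 * vol TYPE(real ^ 'd) + 2))"
        using order_trans[OF Mb eh] by (simp add: h_def \<omega>_def)
      show "0 < r k" by simp
      have "r k \<le> \<rho>" using \<rho>_pos by (simp add: r_def divide_le_eq mult_le_cancel_left1)
      then show "r k \<le> R" using \<rho>_le by simp
    qed
    note lb = limit_bounds[OF lam R \<rho>_def \<theta> _ _ morrey_small, unfolded C_trace_val_eq C_energy_val_eq, OF small, folded J]
    have c0: "c 0 = 0" using T by (intro c_id) auto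
    show "(\<integral>\<^sup>+x. ennreal (\<bar>u (0, x)\<bar> ^ (2 * n) * exp (- lam * norm x)) \<partial>lborel)
      \<le> ennreal (2 * (1 + real n) * exp (8 * (real n + C_energy_val) / R\<^sup>2 * exp (lam * R) * T)) * J"
      using lb(1) unfolding V_sq c0 .
    let ?B = "8 * (real n + C_energy_val) / R\<^sup>2 * exp (lam * R) * T"
    have "(\<integral>\<^sup>+(t, x)\<in>{0..T} \<times> UNIV. ennreal (u (t, x) ^ (2 * n - 2) * (norm (gradient (\<lambda>y. u (t, y)) x))\<^sup>2 * exp (- lam * norm x)) \<partial>lborel)
      = (\<integral>\<^sup>+z. ennreal ((indicator {0..T} (fst z) * (P (fst z) (snd z))\<^sup>2) * exp (- lam * norm (snd z))) \<partial>lborel)"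
    proof (intro nn_integral_cong)
      fix z :: "real \<times> (real ^ 'd)"
      show "(case z of (t, x) \<Rightarrow> ennreal (u (t, x) ^ (2 * n - 2) * (norm (gradient (\<lambda>y. u (t, y)) x))\<^sup>2 * exp (- lam * norm x))) * indicator ({0..T} \<times> UNIV) z
        = ennreal ((indicator {0..T} (fst z) * (P (fst z) (snd z))\<^sup>2) * exp (- lam * norm (snd z)))"
      proof (cases "fst z \<in> {0..T}")
        case True
        then have "c (fst z) = fst z" by (rule c_id)
        then show ?thesis using True by (simp add: P_sq split_beta indicator_def mem_Times_iff)
      next
        case False
        then have "z \<notin> {0..T} \<times> UNIV" by (simp only: mem_Times_iff) simp
        with False show ?thesis by simp
      qed
    qed
    also have "\<dots> \<le> ennreal (8 * (1 + real n) / (real n * \<delta>) * exp ?B) * J" by (rule lb(2))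
    also have "\<dots> \<le> ennreal (8 * (1 + real n) / (real n * \<delta>) * exp (lam * R + ?B)) * J"
      using lam R \<delta> by (intro mult_right_mono ennreal_leI mult_left_mono) auto
    finally show "(\<integral>\<^sup>+(t, x)\<in>{0..T} \<times> UNIV. ennreal (u (t, x) ^ (2 * n - 2) * (norm (gradient (\<lambda>y. u (t, y)) x))\<^sup>2 * exp (- lam * norm x)) \<partial>lborel)
      \<le> ennreal (8 * (1 + real n) / (real n * \<delta>) * exp (lam * R + ?B)) * J" .
  qed
  show ?thesis
    unfolding Let_def
    by (rule bexI[OF _ h], rule bexI[OF _ h], rule exI[of _ "8 * (real n + C_energy_val)"], rule conjI, use C_energy_val n1 in simp,
        rule exI[of _ "2 * (1 + real n)"], rule conjI, simp, rule exI[of _ "8 * (1 + real n) / (real n * \<delta>)"], rule conjI,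
        use n1 \<delta> in simp, intro allI ballI impI conjI main) (assumption | rule refl)+
qed

end
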